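(* Let $P$ be a submonoid of a group $G$, with group of units $P^*=P\cap P^{-1}$. Suppose that any one of the following equivalent conditions holds: (i) the partial action of $G$ on $\Omega_P$ is topologically free; (ii) the action of $P^*$ on $\Omega_P$ is topologically free; (iii) if $u\in P^*\setminus\{e\}$ and $\mathcal C$ is a finite collection of proper constructible right ideals of $P$, then there exists $t\in P\setminus\bigcup_{R\in\mathcal C}R$ such that $utP\neq tP$; (iv) every ideal of $\mathcal T_u(P)$ that has trivial intersection with $D_u$ is contained in the kernel of $\lambda^+\colon\mathcal T_u(P)\to\mathcal T_\lambda(P)$. Suppose moreover that the conditional expectation $E_u\colon\mathcal T_u(P)\to D_u$ is faithful. Let $\{W_p:p\in P\}$ be a family of elements of a $\mathrm C^*$-algebra satisfying the relations (T1)--(T4), and let $\mathrm C^*(W)$ be the $\mathrm C^*$-algebra it generates. Then there is a homomorphism $\pi_W\colon\mathcal T_\lambda(P)\to\mathrm C^*(W)$ such that $\pi_W(L_p)=W_p$ for all $p\in P$, and $\pi_W$ is an isomorphism if and only if $W$ is jointly proper.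
   Context: $P$ is a submonoid of a group $G$ with identity $e$. Ideals of $\mathrm C^*$-algebras are closed and two-sided. A word is a finite sequence $\alpha=(p_1,p_2,\ldots,p_{2k-1},p_{2k})$ of even length $2k\ge 0$ with entries in $P$; $\mathcal W$ is the set of all words (including the empty word). Put $\dot\alpha:=p_1^{-1}p_2\cdots p_{2k-1}^{-1}p_{2k}\in G$ (equal to $e$ for the empty word); $\alpha$ is neutral if $\dot\alpha=e$. Put $\tilde\alpha:=(p_{2k},p_{2k-1},\ldots,p_2,p_1)$ and $K(\alpha):=P\cap p_{2k}^{-1}p_{2k-1}P\cap p_{2k}^{-1}p_{2k-1}p_{2k-2}^{-1}p_{2k-3}P\cap\cdots\cap p_{2k}^{-1}p_{2k-1}\cdots p_2^{-1}p_1P$ (equal to $P$ for the empty word). The constructible right ideals of $P$ are the members of $\mathfrak J:=\{K(\alpha):\alpha\in\mathcal W\}$. For a map $w\colon P\to B$ into a unital $\mathrm C^*$-algebra, $\dot w_\alpha:=w_{p_1}^*w_{p_2}\cdots w_{p_{2k-1}}^*w_{p_{2k}}$ ($=1$ for the empty word). A map $w\colon P\to B$ satisfies (T1)--(T4) if: (T1) $w_e=1$; (T2) $\dot w_\alpha=0$ if $\alpha$ is neutral and $K(\alpha)=\emptyset$; (T3) $\dot w_\alpha=\dot w_\beta$ if $\alpha,\beta$ are neutral and $K(\alpha)=K(\beta)$; (T4) $\prod_{\beta\in F}(\dot w_\alpha-\dot w_\beta)=0$ if $\alpha$ is neutral and $F$ is a finite set of neutral words with $K(\alpha)=\bigcup_{\beta\in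 F}K(\beta)$. Such a $w$ is jointly proper if $\prod_{\alpha\in F}(1-\dot w_\alpha)\neq0$ for every finite collection $F$ of neutral words such that $K(\alpha)$ is a proper constructible right ideal (i.e. $K(\alpha)\neq P$) for each $\alpha\in F$. $\mathcal T_u(P)$ is the universal $\mathrm C^*$-algebra with generators $\{t_p:p\in P\}$ subject to (T1)--(T4), and $D_u:=\overline{\mathrm{span}}\{\dot t_\alpha:\dot\alpha=e\}$. $\mathcal T_\lambda(P)$ is the $\mathrm C^*$-algebra generated by the isometries $L_p\delta_q=\delta_{pq}$ on $\ell^2(P)$; $D_r:=\overline{\mathrm{span}}\{\mathbb 1_S:S\in\mathfrak J\}\subseteq\ell^\infty(P)$ is a subalgebra of it; $\lambda^+\colon\mathcal T_u(P)\to\mathcal T_\lambda(P)$ is the canonical surjection $t_p\mapsto L_p$, which restricts to an isomorphism $D_u\cong D_r$. $E_r\colon\mathcal T_\lambda(P)\to D_r$ is the restriction of the canonical diagonal conditional expectation $\mathcal B(\ell^2(P))\to\ell^\infty(P)$, and $E_u:=(\lambda^+|_{D_u})^{-1}\circ E_r\circ\lambda^+$, a conditional expectation of $\mathcal T_u(P)$ onto $D_u$. $\Omega_P$ is the compact space (topology of pointwise convergence) of all nonzero functions $\chi\colon\mathfrak J\to\{0,1\}$ with $\chi(R\cap S)=\chi(R)\chi(S)$, $\chi(\emptyset)=0$ if $\emptyset\in\mathfrak J$, and such that whenever $S=\bigcup_{i=1}^nS_i$ with $S,S_i\in\mathfrak J$ and $\chi(S)=1$, then $\chi(S_i)=1$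 for some $i$. The partial action of $G$ on $\Omega_P$ is given by $U_{g^{-1}}:=\{\chi\in\Omega_P:\chi(K(\alpha))=1\text{ for some }\alpha\text{ with }\dot\alpha=g\}$ and homeomorphisms $\hat\gamma_g\colon U_{g^{-1}}\to U_g$ determined by $\hat\gamma_g(\chi)(K(\beta))=\chi(g^{-1}K(\beta))=\chi(K(\tilde\beta))$ for $\dot\beta=g^{-1}$; it restricts to an action of the group $P^*$. A partial action $\theta$ of a discrete group on a space is topologically free if for every $h\neq e$ the set of points in the domain of $\theta_h$ fixed by $\theta_h$ has empty interior. *)

theory Defs
  imports
    "HOL-Analysis.Analysis"
    "HOL-Algebra.Ideal"
    "HOL-Algebra.Module"
    "HOL-Library.Poly_Mapping"
begin

section \<open>Unital C*-algebras\<close>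

text \<open>
  The algebras of the theorem depend on the semigroup, so C*-algebras are records with an
  explicit carrier. All of them are unital, and the zero algebra is allowed.
\<close>

record 'a star_algebra = "(complex, 'a) module" +
  adj :: "'a \<Rightarrow> 'a"

record 'a cstar = "'a star_algebra" +
  cnorm :: "'a \<Rightarrow> real"

locale cstar_algebra = ring A for A :: "('a, 'm) cstar_scheme" (structure) +
  assumes scale_closed: "x \<in> carrier A \<Longrightarrow> c \<odot> x \<in> carrier A"
    and scale_add_left: "x \<in> carrier A \<Longrightarrow> (c + d) \<odot> x = c \<odot> x \<oplus> d \<odot> x"
    and scale_add_right: "\<lbrakk>x \<in> carrier A; y \<in> carrier A\<rbrakk> \<Longrightarrow> c \<odot> (x \<oplus> y) = c \<odot> x \<oplus> c \<odot> y"
    and scale_scale: "x \<in> carrier A \<Longrightarrow> (c * d) \<odot> x = c \<odot> (d \<odot> x)"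
    and scale_one: "x \<in> carrier A \<Longrightarrow> 1 \<odot> x = x"
    and scale_mult_left: "\<lbrakk>x \<in> carrier A; y \<in> carrier A\<rbrakk> \<Longrightarrow> (c \<odot> x) \<otimes> y = c \<odot> (x \<otimes> y)"
    and scale_mult_right: "\<lbrakk>x \<in> carrier A; y \<in> carrier A\<rbrakk> \<Longrightarrow> x \<otimes> (c \<odot> y) = c \<odot> (x \<otimes> y)"
    and adj_closed: "x \<in> carrier A \<Longrightarrow> adj A x \<in> carrier A"
    and adj_adj: "x \<in> carrier A \<Longrightarrow> adj A (adj A x) = x"
    and adj_add: "\<lbrakk>x \<in> carrier A; y \<in> carrier A\<rbrakk> \<Longrightarrow> adj A (x \<oplus> y) = adj A x \<oplus> adj A y"
    and adj_scale: "x \<in> carrier A \<Longrightarrow> adj A (c \<odot> x) = cnj c \<odot> adj A x"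
    and adj_mult: "\<lbrakk>x \<in> carrier A; y \<in> carrier A\<rbrakk> \<Longrightarrow> adj A (x \<otimes> y) = adj A y \<otimes> adj A x"
    and norm_nonneg: "x \<in> carrier A \<Longrightarrow> 0 \<le> cnorm A x"
    and norm_eq_zero: "x \<in> carrier A \<Longrightarrow> cnorm A x = 0 \<longleftrightarrow> x = \<zero>"
    and norm_triangle: "\<lbrakk>x \<in> carrier A; y \<in> carrier A\<rbrakk> \<Longrightarrow> cnorm A (x \<oplus> y) \<le> cnorm A x + cnorm A y"
    and norm_scale: "x \<in> carrier A \<Longrightarrow> cnorm A (c \<odot> x) = cmod c * cnorm A x"
    and norm_mult: "\<lbrakk>x \<in> carrier A; y \<in> carrier A\<rbrakk> \<Longrightarrow> cnorm A (x \<otimes> y) \<le> cnorm A x * cnorm A y"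
    and norm_cstar: "x \<in> carrier A \<Longrightarrow> cnorm A (adj A x \<otimes> x) = (cnorm A x)\<^sup>2"
    and complete: "\<lbrakk>\<And>n. s n \<in> carrier A;
        \<forall>\<epsilon>>0. \<exists>N::nat. \<forall>m\<ge>N. \<forall>n\<ge>N. cnorm A (s m \<ominus> s n) < \<epsilon>\<rbrakk>
      \<Longrightarrow> \<exists>x\<in>carrier A. (\<lambda>n. cnorm A (s n \<ominus> x)) \<longlonglongrightarrow> 0"

definition star_hom :: "('a, 'm) star_algebra_scheme \<Rightarrow> ('b, 'n) star_algebra_scheme \<Rightarrow> ('a \<Rightarrow> 'b) set" where
  "star_hom A B = {h \<in> ring_hom A B.
     (\<forall>c. \<forall>x\<in>carrier A. h (c \<odot>\<^bsub>A\<^esub> x) = c \<odot>\<^bsub>B\<^esub> h x) \<and>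
     (\<forall>x\<in>carrier A. h (adj A x) = adj B (h x))}"

definition norm_closure :: "('a, 'm) cstar_scheme \<Rightarrow> 'a set \<Rightarrow> 'a set" where
  "norm_closure A S = {x \<in> carrier A.
     \<exists>s. (\<forall>n::nat. s n \<in> S) \<and> (\<lambda>n. cnorm A (s n \<ominus>\<^bsub>A\<^esub> x)) \<longlonglongrightarrow> 0}"

definition linear_subspace :: "('a, 'm) star_algebra_scheme \<Rightarrow> 'a set \<Rightarrow> bool" where
  "linear_subspace A V \<longleftrightarrow> V \<subseteq> carrier A \<and> \<zero>\<^bsub>A\<^esub> \<in> V \<and>
     (\<forall>x\<in>V. \<forall>y\<in>V. x \<oplus>\<^bsub>A\<^esub> y \<in> V) \<and> (\<forall>c. \<forall>x\<in>V. c \<odot>\<^bsub>A\<^esub> x \<in> V)"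

definition linear_span :: "('a, 'm) star_algebra_scheme \<Rightarrow> 'a set \<Rightarrow> 'a set" where
  "linear_span A S = \<Inter>{V. linear_subspace A V \<and> S \<subseteq> V}"

definition cstar_subalgebra :: "('a, 'm) cstar_scheme \<Rightarrow> 'a set \<Rightarrow> bool" where
  "cstar_subalgebra A C \<longleftrightarrow> linear_subspace A C \<and>
     (\<forall>x\<in>C. \<forall>y\<in>C. x \<otimes>\<^bsub>A\<^esub> y \<in> C) \<and> (\<forall>x\<in>C. adj A x \<in> C) \<and> norm_closure A C \<subseteq> C"

definition cstar_generated :: "('a, 'm) cstar_scheme \<Rightarrow> 'a set \<Rightarrow> ('a, 'm) cstar_scheme" where
  "cstar_generated A S = A\<lparr>carrier := \<Inter>{C. cstar_subalgebra A C \<and> S \<subseteq> C}\<rparr>"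

definition closed_ideal :: "'a set \<Rightarrow> ('a, 'm) cstar_scheme \<Rightarrow> bool" where
  "closed_ideal J A \<longleftrightarrow> ideal J A \<and> norm_closure A J \<subseteq> J"

definition mult_list :: "('a, 'm) monoid_scheme \<Rightarrow> 'a list \<Rightarrow> 'a" where
  "mult_list A xs = foldr (\<otimes>\<^bsub>A\<^esub>) xs \<one>\<^bsub>A\<^esub>"


section \<open>Words, constructible right ideals and the Toeplitz relations\<close>

definition words :: "'g set \<Rightarrow> 'g list set" where
  "words P = {\<alpha>. set \<alpha> \<subseteq> P \<and> even (length \<alpha>)}"

text \<open>Only words of even length are used; the clause for singletons is a dummy.\<close>

fun dot :: "('g, 'm) monoid_scheme \<Rightarrow> 'g list \<Rightarrow> 'g" where
  "dot G [] = \<one>\<^bsub>G\<^esub>"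
| "dot G [p] = \<one>\<^bsub>G\<^esub>"
| "dot G (p # q # \<alpha>) = inv\<^bsub>G\<^esub> p \<otimes>\<^bsub>G\<^esub> q \<otimes>\<^bsub>G\<^esub> dot G \<alpha>"

fun wdot :: "('a, 'm) star_algebra_scheme \<Rightarrow> ('g \<Rightarrow> 'a) \<Rightarrow> 'g list \<Rightarrow> 'a" where
  "wdot A w [] = \<one>\<^bsub>A\<^esub>"
| "wdot A w [p] = \<one>\<^bsub>A\<^esub>"
| "wdot A w (p # q # \<alpha>) = adj A (w p) \<otimes>\<^bsub>A\<^esub> w q \<otimes>\<^bsub>A\<^esub> wdot A w \<alpha>"

definition neutral_words :: "('g, 'm) monoid_scheme \<Rightarrow> 'g set \<Rightarrow> 'g list set" where
  "neutral_words G P = {\<alpha> \<in> words P. dot G \<alpha> = \<one>\<^bsub>G\<^esub>}"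

text \<open>
  The sets intersected in \<open>K(\<alpha>)\<close> are \<open>gP\<close> where \<open>g\<close> is the dot of an initial segment of even
  length of the reversed word \<open>(p\<^sub>2\<^sub>k, \<dots>, p\<^sub>1)\<close>; the empty segment gives \<open>P\<close>.
\<close>

definition constr :: "('g, 'm) monoid_scheme \<Rightarrow> 'g set \<Rightarrow> 'g list \<Rightarrow> 'g set" where
  "constr G P \<alpha> = (\<Inter>j\<in>{0..length \<alpha> div 2}. dot G (take (2 * j) (rev \<alpha>)) <#\<^bsub>G\<^esub> P)"

definition constructible :: "('g, 'm) monoid_scheme \<Rightarrow> 'g set \<Rightarrow> 'g set set" where
  "constructible G P = constr G P ` words P"

text \<open>
  The elements that (T1)--(T4) require to vanish. The finite set \<open>F\<close> in (T4) is given by an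
  enumeration: (T3) makes the elements \<open>wdot A w \<alpha>\<close> with \<open>\<alpha>\<close> neutral commute, so the order of
  the factors is immaterial. In (T4), \<open>F\<close> has to be nonempty, since the empty product is \<open>1\<close> and
  the case \<open>K(\<alpha>) = \<emptyset>\<close> would otherwise give \<open>1 = 0\<close>; that case is covered by (T2).
\<close>

definition toeplitz_relators ::
    "('g, 'm) monoid_scheme \<Rightarrow> 'g set \<Rightarrow> ('a, 'n) star_algebra_scheme \<Rightarrow> ('g \<Rightarrow> 'a) \<Rightarrow> 'a set" where
  "toeplitz_relators G P A w =
     {w \<one>\<^bsub>G\<^esub> \<ominus>\<^bsub>A\<^esub> \<one>\<^bsub>A\<^esub>}
   \<union> {wdot A w \<alpha> | \<alpha>. \<alpha> \<in> neutral_words G P \<and> constr G P \<alpha> = {}}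
   \<union> {wdot A w \<alpha> \<ominus>\<^bsub>A\<^esub> wdot A w \<beta> | \<alpha> \<beta>.
        \<alpha> \<in> neutral_words G P \<and> \<beta> \<in> neutral_words G P \<and> constr G P \<alpha> = constr G P \<beta>}
   \<union> {mult_list A (map (\<lambda>\<beta>. wdot A w \<alpha> \<ominus>\<^bsub>A\<^esub> wdot A w \<beta>) F) | \<alpha> F.
        \<alpha> \<in> neutral_words G P \<and> F \<noteq> [] \<and> distinct F \<and> set F \<subseteq> neutral_words G P \<and>
        constr G P \<alpha> = (\<Union>\<beta>\<in>set F. constr G P \<beta>)}"

definition toeplitz_family ::
    "('g, 'm) monoid_scheme \<Rightarrow> 'g set \<Rightarrow> ('a, 'n) star_algebra_scheme \<Rightarrow> ('g \<Rightarrow> 'a) \<Rightarrow> bool" where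
  "toeplitz_family G P A w \<longleftrightarrow>
     w \<in> P \<rightarrow> carrier A \<and> (\<forall>r\<in>toeplitz_relators G P A w. r = \<zero>\<^bsub>A\<^esub>)"

text \<open>
  Here \<open>F\<close> may be empty, so joint properness includes \<open>1 \<noteq> 0\<close>.
\<close>

definition jointly_proper ::
    "('g, 'm) monoid_scheme \<Rightarrow> 'g set \<Rightarrow> ('a, 'n) star_algebra_scheme \<Rightarrow> ('g \<Rightarrow> 'a) \<Rightarrow> bool" where
  "jointly_proper G P A w \<longleftrightarrow>
     (\<forall>F. distinct F \<and> set F \<subseteq> neutral_words G P \<and> (\<forall>\<alpha>\<in>set F. constr G P \<alpha> \<noteq> P) \<longrightarrow>
        mult_list A (map (\<lambda>\<alpha>. \<one>\<^bsub>A\<^esub> \<ominus>\<^bsub>A\<^esub> wdot A w \<alpha>) F) \<noteq> \<zero>\<^bsub>A\<^esub>)"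


section \<open>Universal C*-algebras given by generators and relations\<close>

text \<open>
  With concatenation as addition of lists, finitely supported functions on lists form the free
  unital algebra. A letter \<open>(x, False)\<close> stands for the generator \<open>x\<close> and \<open>(x, True)\<close> for its adjoint.
\<close>

instantiation list :: (type) monoid_add
begin
definition zero_list :: "'a list" where "zero_list = []"
definition plus_list :: "'a list \<Rightarrow> 'a list \<Rightarrow> 'a list" where "plus_list = (@)"
instance by standard (simp_all add: zero_list_def plus_list_def)
end

type_synonym 'x star_poly = "('x \<times> bool) list \<Rightarrow>\<^sub>0 complex"

definition adj_word :: "('x \<times> bool) list \<Rightarrow> ('x \<times> bool) list" where
  "adj_word u = rev (map (\<lambda>(x, b). (x, \<not> b)) u)"

definition adj_poly :: "'x star_poly \<Rightarrow> 'x star_poly" where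
  "adj_poly f = (\<Sum>u\<in>Poly_Mapping.keys f.
     Poly_Mapping.single (adj_word u) (cnj (Poly_Mapping.lookup f u)))"

definition free_star_algebra :: "'x set \<Rightarrow> 'x star_poly star_algebra" where
  "free_star_algebra X =
     \<lparr>carrier = {f. \<forall>u\<in>Poly_Mapping.keys f. fst ` set u \<subseteq> X},
      mult = (*), one = 1, zero = 0, add = (+),
      smult = (\<lambda>c. Poly_Mapping.map ((*) c)), adj = adj_poly\<rparr>"

definition free_gen :: "'x \<Rightarrow> 'x star_poly" where
  "free_gen x = Poly_Mapping.single [(x, False)] 1"

definition cstar_seminorm :: "('a, 'm) star_algebra_scheme \<Rightarrow> ('a \<Rightarrow> real) \<Rightarrow> bool" where
  "cstar_seminorm A \<nu> \<longleftrightarrow>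
     (\<forall>x\<in>carrier A. 0 \<le> \<nu> x \<and> \<nu> (adj A x \<otimes>\<^bsub>A\<^esub> x) = (\<nu> x)\<^sup>2 \<and> (\<forall>c. \<nu> (c \<odot>\<^bsub>A\<^esub> x) = cmod c * \<nu> x)) \<and>
     (\<forall>x\<in>carrier A. \<forall>y\<in>carrier A. \<nu> (x \<oplus>\<^bsub>A\<^esub> y) \<le> \<nu> x + \<nu> y \<and> \<nu> (x \<otimes>\<^bsub>A\<^esub> y) \<le> \<nu> x * \<nu> y)"

text \<open>
  The C*-seminorms vanishing on \<open>R\<close> are the functions \<open>x \<mapsto> \<parallel>\<rho> x\<parallel>\<close> where \<open>\<rho>\<close> is a
  *-homomorphism to a C*-algebra that maps \<open>R\<close> to \<open>0\<close>. The supremum is meant for relations that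
  bound the generators, as the Toeplitz relations do: they force the generators to be isometries.
\<close>

definition universal_seminorm :: "('a, 'm) star_algebra_scheme \<Rightarrow> 'a set \<Rightarrow> 'a \<Rightarrow> real" where
  "universal_seminorm A R x = Sup {\<nu> x | \<nu>. cstar_seminorm A \<nu> \<and> (\<forall>r\<in>R. \<nu> r = 0)}"

text \<open>
  Hausdorff completion of a *-algebra with respect to a C*-seminorm: Cauchy sequences modulo
  null sequences.
\<close>

definition cauchy_seqs :: "('a, 'm) star_algebra_scheme \<Rightarrow> ('a \<Rightarrow> real) \<Rightarrow> (nat \<Rightarrow> 'a) set" where
  "cauchy_seqs A \<nu> = {s. (\<forall>n. s n \<in> carrier A) \<and>
     (\<forall>\<epsilon>>0. \<exists>N. \<forall>m\<ge>N. \<forall>n\<ge>N. \<nu> (s m \<ominus>\<^bsub>A\<^esub> s n) < \<epsilon>)}"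

definition cauchy_class ::
    "('a, 'm) star_algebra_scheme \<Rightarrow> ('a \<Rightarrow> real) \<Rightarrow> (nat \<Rightarrow> 'a) \<Rightarrow> (nat \<Rightarrow> 'a) set" where
  "cauchy_class A \<nu> s = {s' \<in> cauchy_seqs A \<nu>. (\<lambda>n. \<nu> (s' n \<ominus>\<^bsub>A\<^esub> s n)) \<longlonglongrightarrow> 0}"

definition cstar_completion ::
    "('a, 'm) star_algebra_scheme \<Rightarrow> ('a \<Rightarrow> real) \<Rightarrow> (nat \<Rightarrow> 'a) set cstar" where
  "cstar_completion A \<nu> =
     \<lparr>carrier = cauchy_class A \<nu> ` cauchy_seqs A \<nu>,
      mult = (\<lambda>X Y. \<Union>s\<in>X. \<Union>s'\<in>Y. cauchy_class A \<nu> (\<lambda>n. s n \<otimes>\<^bsub>A\<^esub> s' n)),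
      one = cauchy_class A \<nu> (\<lambda>n. \<one>\<^bsub>A\<^esub>),
      zero = cauchy_class A \<nu> (\<lambda>n. \<zero>\<^bsub>A\<^esub>),
      add = (\<lambda>X Y. \<Union>s\<in>X. \<Union>s'\<in>Y. cauchy_class A \<nu> (\<lambda>n. s n \<oplus>\<^bsub>A\<^esub> s' n)),
      smult = (\<lambda>c X. \<Union>s\<in>X. cauchy_class A \<nu> (\<lambda>n. c \<odot>\<^bsub>A\<^esub> s n)),
      adj = (\<lambda>X. \<Union>s\<in>X. cauchy_class A \<nu> (\<lambda>n. adj A (s n))),
      cnorm = (\<lambda>X. THE r. \<forall>s\<in>X. (\<lambda>n. \<nu> (s n)) \<longlonglongrightarrow> r)\<rparr>"

definition toeplitz_seminorm :: "('g, 'm) monoid_scheme \<Rightarrow> 'g set \<Rightarrow> 'g star_poly \<Rightarrow> real" where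
  "toeplitz_seminorm G P = universal_seminorm (free_star_algebra P)
     (toeplitz_relators G P (free_star_algebra P) free_gen)"

definition T_univ :: "('g, 'm) monoid_scheme \<Rightarrow> 'g set \<Rightarrow> (nat \<Rightarrow> 'g star_poly) set cstar" where
  "T_univ G P = cstar_completion (free_star_algebra P) (toeplitz_seminorm G P)"

definition t_gen :: "('g, 'm) monoid_scheme \<Rightarrow> 'g set \<Rightarrow> 'g \<Rightarrow> (nat \<Rightarrow> 'g star_poly) set" where
  "t_gen G P p = cauchy_class (free_star_algebra P) (toeplitz_seminorm G P) (\<lambda>n. free_gen p)"

definition D_univ :: "('g, 'm) monoid_scheme \<Rightarrow> 'g set \<Rightarrow> (nat \<Rightarrow> 'g star_poly) set set" where
  "D_univ G P = norm_closure (T_univ G P)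
     (linear_span (T_univ G P) (wdot (T_univ G P) (t_gen G P) ` neutral_words G P))"


section \<open>The reduced Toeplitz algebra\<close>

text \<open>
  Vectors of \<open>\<ell>\<^sup>2(X)\<close> are functions on the whole type that vanish outside \<open>X\<close>, and operators on
  \<open>\<ell>\<^sup>2(X)\<close> are extended by \<open>0\<close> to functions that are not in \<open>\<ell>\<^sup>2(X)\<close>.
\<close>

definition ell2 :: "'x set \<Rightarrow> ('x \<Rightarrow> complex) set" where
  "ell2 X = {f. (\<forall>x. x \<notin> X \<longrightarrow> f x = 0) \<and> (\<lambda>x. (cmod (f x))\<^sup>2) summable_on X}"

definition ell2_inner :: "'x set \<Rightarrow> ('x \<Rightarrow> complex) \<Rightarrow> ('x \<Rightarrow> complex) \<Rightarrow> complex" where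
  "ell2_inner X f g = infsum (\<lambda>x. f x * cnj (g x)) X"

definition ell2_norm :: "'x set \<Rightarrow> ('x \<Rightarrow> complex) \<Rightarrow> real" where
  "ell2_norm X f = sqrt (infsum (\<lambda>x. (cmod (f x))\<^sup>2) X)"

definition delta :: "'x \<Rightarrow> 'x \<Rightarrow> complex" where
  "delta q = (\<lambda>x. if x = q then 1 else 0)"

definition bounded_ops :: "'x set \<Rightarrow> (('x \<Rightarrow> complex) \<Rightarrow> ('x \<Rightarrow> complex)) set" where
  "bounded_ops X = {T.
     (\<forall>f\<in>ell2 X. T f \<in> ell2 X) \<and> (\<forall>f. f \<notin> ell2 X \<longrightarrow> T f = (\<lambda>x. 0)) \<and>
     (\<forall>f\<in>ell2 X. \<forall>g\<in>ell2 X. T (\<lambda>x. f x + g x) = (\<lambda>x. T f x + T g x)) \<and>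
     (\<forall>c. \<forall>f\<in>ell2 X. T (\<lambda>x. c * f x) = (\<lambda>x. c * T f x)) \<and>
     (\<exists>C. \<forall>f\<in>ell2 X. ell2_norm X (T f) \<le> C * ell2_norm X f)}"

definition B_ell2 :: "'x set \<Rightarrow> (('x \<Rightarrow> complex) \<Rightarrow> ('x \<Rightarrow> complex)) cstar" where
  "B_ell2 X =
     \<lparr>carrier = bounded_ops X,
      mult = (\<circ>),
      one = (\<lambda>f. if f \<in> ell2 X then f else (\<lambda>x. 0)),
      zero = (\<lambda>f x. 0),
      add = (\<lambda>S T f x. S f x + T f x),
      smult = (\<lambda>c T f x. c * T f x),
      adj = (\<lambda>T. THE S. S \<in> bounded_ops X \<and>
               (\<forall>f\<in>ell2 X. \<forall>g\<in>ell2 X. ell2_inner X (T f) g = ell2_inner X f (S g))),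
      cnorm = (\<lambda>T. Sup {ell2_norm X (T f) | f. f \<in> ell2 X \<and> ell2_norm X f \<le> 1})\<rparr>"

text \<open>The isometry with \<open>L\<^sub>p \<delta>\<^sub>q = \<delta>\<^sub>p\<^sub>q\<close> for \<open>q \<in> P\<close>.\<close>

definition L_op :: "('g, 'm) monoid_scheme \<Rightarrow> 'g set \<Rightarrow> 'g \<Rightarrow> ('g \<Rightarrow> complex) \<Rightarrow> ('g \<Rightarrow> complex)" where
  "L_op G P p = (\<lambda>f. if f \<in> ell2 P
     then (\<lambda>x. if x \<in> p <#\<^bsub>G\<^esub> P then f (inv\<^bsub>G\<^esub> p \<otimes>\<^bsub>G\<^esub> x) else 0)
     else (\<lambda>x. 0))"

definition T_red :: "('g, 'm) monoid_scheme \<Rightarrow> 'g set \<Rightarrow> (('g \<Rightarrow> complex) \<Rightarrow> ('g \<Rightarrow> complex)) cstar" where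
  "T_red G P = cstar_generated (B_ell2 P) (L_op G P ` P)"

text \<open>Functions in \<open>\<ell>\<^sup>\<infinity>(P)\<close> are identified with the multiplication operators they define.\<close>

definition E_red :: "'g set \<Rightarrow> (('g \<Rightarrow> complex) \<Rightarrow> ('g \<Rightarrow> complex)) \<Rightarrow> ('g \<Rightarrow> complex) \<Rightarrow> ('g \<Rightarrow> complex)" where
  "E_red P T = (\<lambda>f. if f \<in> ell2 P
     then (\<lambda>x. ell2_inner P (T (delta x)) (delta x) * f x) else (\<lambda>x. 0))"

definition lambda_plus ::
    "('g, 'm) monoid_scheme \<Rightarrow> 'g set \<Rightarrow> (nat \<Rightarrow> 'g star_poly) set \<Rightarrow> ('g \<Rightarrow> complex) \<Rightarrow> ('g \<Rightarrow> complex)" where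
  "lambda_plus G P = (THE h. h \<in> star_hom (T_univ G P) (T_red G P) \<and>
     h \<in> extensional (carrier (T_univ G P)) \<and> (\<forall>p\<in>P. h (t_gen G P p) = L_op G P p))"

definition E_univ ::
    "('g, 'm) monoid_scheme \<Rightarrow> 'g set \<Rightarrow> (nat \<Rightarrow> 'g star_poly) set \<Rightarrow> (nat \<Rightarrow> 'g star_poly) set" where
  "E_univ G P a = inv_into (D_univ G P) (lambda_plus G P) (E_red P (lambda_plus G P a))"

definition E_univ_faithful :: "('g, 'm) monoid_scheme \<Rightarrow> 'g set \<Rightarrow> bool" where
  "E_univ_faithful G P \<longleftrightarrow>
     (\<forall>a\<in>carrier (T_univ G P).
        E_univ G P (adj (T_univ G P) a \<otimes>\<^bsub>T_univ G P\<^esub> a) = \<zero>\<^bsub>T_univ G P\<^esub> \<longrightarrow> a = \<zero>\<^bsub>T_univ G P\<^esub>)"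


section \<open>The space \<open>\<Omega>\<^sub>P\<close> and the partial action\<close>

definition Omega :: "('g, 'm) monoid_scheme \<Rightarrow> 'g set \<Rightarrow> ('g set \<Rightarrow> nat) set" where
  "Omega G P = {\<xi> \<in> constructible G P \<rightarrow>\<^sub>E {0, 1}.
     (\<exists>S\<in>constructible G P. \<xi> S \<noteq> 0) \<and>
     (\<forall>R\<in>constructible G P. \<forall>S\<in>constructible G P. \<xi> (R \<inter> S) = \<xi> R * \<xi> S) \<and>
     ({} \<in> constructible G P \<longrightarrow> \<xi> {} = 0) \<and>
     (\<forall>S\<in>constructible G P. \<forall>\<C>. finite \<C> \<and> \<C> \<subseteq> constructible G P \<and> S = \<Union>\<C> \<and> \<xi> S = 1
        \<longrightarrow> (\<exists>R\<in>\<C>. \<xi> R = 1))}"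

definition Omega_top :: "('g, 'm) monoid_scheme \<Rightarrow> 'g set \<Rightarrow> ('g set \<Rightarrow> nat) topology" where
  "Omega_top G P = subtopology
     (product_topology (\<lambda>_. discrete_topology {0, 1}) (constructible G P)) (Omega G P)"

text \<open>\<open>Omega_dom G P g\<close> is \<open>U\<^bsub>g\<inverse>\<^esub>\<close>, the domain of \<open>\<gamma>\<^sub>g\<close>.\<close>

definition Omega_dom :: "('g, 'm) monoid_scheme \<Rightarrow> 'g set \<Rightarrow> 'g \<Rightarrow> ('g set \<Rightarrow> nat) set" where
  "Omega_dom G P g = {\<xi> \<in> Omega G P. \<exists>\<alpha>\<in>words P. dot G \<alpha> = g \<and> \<xi> (constr G P \<alpha>) = 1}"

definition Omega_act ::
    "('g, 'm) monoid_scheme \<Rightarrow> 'g set \<Rightarrow> 'g \<Rightarrow> ('g set \<Rightarrow> nat) \<Rightarrow> ('g set \<Rightarrow> nat)" where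
  "Omega_act G P g \<xi> = (THE \<psi>. \<psi> \<in> Omega_dom G P (inv\<^bsub>G\<^esub> g) \<and>
     (\<forall>\<beta>\<in>words P. dot G \<beta> = inv\<^bsub>G\<^esub> g \<longrightarrow>
        \<psi> (constr G P \<beta>) = \<xi> (inv\<^bsub>G\<^esub> g <#\<^bsub>G\<^esub> constr G P \<beta>)))"

definition topologically_free ::
    "('g, 'm) monoid_scheme \<Rightarrow> 'g set \<Rightarrow> 'x topology \<Rightarrow> ('g \<Rightarrow> 'x set) \<Rightarrow> ('g \<Rightarrow> 'x \<Rightarrow> 'x) \<Rightarrow> bool" where
  "topologically_free G H X U \<theta> \<longleftrightarrow>
     (\<forall>h\<in>H. h \<noteq> \<one>\<^bsub>G\<^esub> \<longrightarrow> X interior_of {x \<in> U h. \<theta> h x = x} = {})"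

definition unit_group :: "('g, 'm) monoid_scheme \<Rightarrow> 'g set \<Rightarrow> 'g set" where
  "unit_group G P = {u \<in> P. inv\<^bsub>G\<^esub> u \<in> P}"


section \<open>The four conditions\<close>

definition partial_action_top_free :: "('g, 'm) monoid_scheme \<Rightarrow> 'g set \<Rightarrow> bool" where
  "partial_action_top_free G P \<longleftrightarrow>
     topologically_free G (carrier G) (Omega_top G P) (Omega_dom G P) (Omega_act G P)"

definition unit_action_top_free :: "('g, 'm) monoid_scheme \<Rightarrow> 'g set \<Rightarrow> bool" where
  "unit_action_top_free G P \<longleftrightarrow>
     topologically_free G (unit_group G P) (Omega_top G P) (Omega_dom G P) (Omega_act G P)"

definition units_move_ideals :: "('g, 'm) monoid_scheme \<Rightarrow> 'g set \<Rightarrow> bool" where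
  "units_move_ideals G P \<longleftrightarrow>
     (\<forall>u \<in> unit_group G P - {\<one>\<^bsub>G\<^esub>}. \<forall>\<C>. finite \<C> \<and> \<C> \<subseteq> constructible G P - {P} \<longrightarrow>
        (\<exists>t \<in> P - \<Union>\<C>. (u \<otimes>\<^bsub>G\<^esub> t) <#\<^bsub>G\<^esub> P \<noteq> t <#\<^bsub>G\<^esub> P))"

definition diagonal_detects_ideals :: "('g, 'm) monoid_scheme \<Rightarrow> 'g set \<Rightarrow> bool" where
  "diagonal_detects_ideals G P \<longleftrightarrow>
     (\<forall>J. closed_ideal J (T_univ G P) \<and> J \<inter> D_univ G P = {\<zero>\<^bsub>T_univ G P\<^esub>} \<longrightarrow>
        J \<subseteq> {a \<in> carrier (T_univ G P). lambda_plus G P a = \<zero>\<^bsub>T_red G P\<^esub>})"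

end

theory Submission
  imports Defs "HOL-Algebra.RingHom"
begin

text \<open>
  The character of \<open>\<Omega>\<^sub>P\<close> given by a point \<open>p\<close> is fixed by \<open>g\<close> only if \<open>gpP = pP\<close>, that is, if \<open>gp = pv\<close> with
  a unit \<open>v\<close>. Since these characters are dense, failures of topological freeness come from units, and
  on neighbourhoods they are described by finitely many constructible ideals; this gives (i)--(iii).

  For (iv), a nonzero \<open>\<lambda>\<^sup>+(a)\<close> with \<open>a\<close> in an ideal \<open>J\<close> has a nonzero diagonal entry for some \<open>a\<^sup>*a\<close>. By (iii) a
  projection of the diagonal compresses the finitely many off-diagonal terms of an approximation of
  \<open>a\<^sup>*a\<close> to \<open>0\<close>, so it is close to an element of \<open>J\<close> and hence lies in \<open>J\<close>. Conversely, if (iii) fails for \<open>u\<close> and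
  ideals \<open>K(\<alpha>)\<close>, then \<open>(t\<^sub>u - 1) \<Prod> (1 - t\<^sub>\<alpha>)\<close> is killed by the representation on \<open>\<ell>\<^sup>2\<close> of the set of principal right
  ideals \<open>tP\<close>, which is faithful on the diagonal, but not by \<open>\<lambda>\<^sup>+\<close>.

  If \<open>E\<^sub>u\<close> is faithful then \<open>\<lambda>\<^sup>+\<close> is injective, hence isometric and onto, and \<open>\<pi>\<^sub>W\<close> is the universal
  representation composed with its inverse. Conjugating by \<open>t\<^sub>p\<close> moves a nonzero product of diagonal
  projections to one that is nonzero at the identity, so joint properness makes it nonzero
  in \<open>C\<^sup>*(W)\<close>. Thus the kernel meets the diagonal trivially and (iv) applies.
\<close>

section \<open>C*-algebras with explicit carrier\<close>

text \<open>Three facts about C*-algebras carry the argument: homomorphisms are contractive,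
  injective ones are isometric, and the norm of a diagonal element is governed by its values at
  points of P. All three are proved without spectra or positivity, from an iterative square root of
  1 - x, repeated squaring and the C*-identity. Isometry is needed because the image of T_u has to
  be closed before it can be identified with the C*-algebra generated by the family.

  The diagonal is never identified with functions on Omega_P. A finite combination f of projections
  is evaluated at points p of P: for every Toeplitz family its norm is zero or at most some |f(p)|,
  and for a nondegenerate family it is at least every |f(p)|. This comparison shows that the kernel
  of a nondegenerate representation meets D_u trivially.

  Products of projections and complements (\<open>lits\<close>) are the cells of this computation
  and also the compressing projections for (iv). Compressing several words is delicate because each
  word may require another point; (iii) supplies the new point inside the old cell, so earlier
  compressions survive.\<close>

locale star_alg = ring A for A :: "('a, 'm) star_algebra_scheme" (structure) +
  assumes scale_closed [simp]: "x \<in> carrier A \<Longrightarrow> c \<odot> x \<in> carrier A"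
    and scale_add_left: "x \<in> carrier A \<Longrightarrow> (c + d) \<odot> x = c \<odot> x \<oplus> d \<odot> x"
    and scale_add_right: "\<lbrakk>x \<in> carrier A; y \<in> carrier A\<rbrakk> \<Longrightarrow> c \<odot> (x \<oplus> y) = c \<odot> x \<oplus> c \<odot> y"
    and scale_scale: "x \<in> carrier A \<Longrightarrow> (c * d) \<odot> x = c \<odot> (d \<odot> x)"
    and scale_one [simp]: "x \<in> carrier A \<Longrightarrow> 1 \<odot> x = x"
    and scale_mult_left: "\<lbrakk>x \<in> carrier A; y \<in> carrier A\<rbrakk> \<Longrightarrow> (c \<odot> x) \<otimes> y = c \<odot> (x \<otimes> y)"
    and scale_mult_right: "\<lbrakk>x \<in> carrier A; y \<in> carrier A\<rbrakk> \<Longrightarrow> x \<otimes> (c \<odot> y) = c \<odot> (x \<otimes> y)"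
    and adj_closed [simp]: "x \<in> carrier A \<Longrightarrow> adj A x \<in> carrier A"
    and adj_adj [simp]: "x \<in> carrier A \<Longrightarrow> adj A (adj A x) = x"
    and adj_add: "\<lbrakk>x \<in> carrier A; y \<in> carrier A\<rbrakk> \<Longrightarrow> adj A (x \<oplus> y) = adj A x \<oplus> adj A y"
    and adj_scale: "x \<in> carrier A \<Longrightarrow> adj A (c \<odot> x) = cnj c \<odot> adj A x"
    and adj_mult: "\<lbrakk>x \<in> carrier A; y \<in> carrier A\<rbrakk> \<Longrightarrow> adj A (x \<otimes> y) = adj A y \<otimes> adj A x"
begin

lemma scale_zero_left [simp]: "x \<in> carrier A \<Longrightarrow> 0 \<odot> x = \<zero>"
  using scale_add_left[of x 0 0] by (simp add: local.add.r_cancel_one)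

lemma scale_zero_right [simp]: "c \<odot> \<zero> = \<zero>"
  using scale_add_right[of \<zero> \<zero> c] by (simp add: local.add.r_cancel_one)

lemma scale_uminus_left: "x \<in> carrier A \<Longrightarrow> (- c) \<odot> x = \<ominus> (c \<odot> x)"
  using scale_add_left[of x "- c" c] by (simp add: minus_equality)

lemma uminus_conv_scale: "x \<in> carrier A \<Longrightarrow> \<ominus> x = (- 1) \<odot> x"
  by (simp add: scale_uminus_left)

lemma scale_uminus_right: "x \<in> carrier A \<Longrightarrow> c \<odot> (\<ominus> x) = \<ominus> (c \<odot> x)"
  by (simp add: uminus_conv_scale flip: scale_scale)

lemma scale_diff_right:
  "\<lbrakk>x \<in> carrier A; y \<in> carrier A\<rbrakk> \<Longrightarrow> c \<odot> (x \<ominus> y) = c \<odot> x \<ominus> c \<odot> y"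
  by (simp add: minus_eq scale_add_right scale_uminus_right)

lemma adj_zero [simp]: "adj A \<zero> = \<zero>"
  using adj_scale[of \<zero> 0] by simp

lemma adj_one [simp]: "adj A \<one> = \<one>"
  using adj_mult[of "adj A \<one>" \<one>] by simp

lemma adj_uminus: "x \<in> carrier A \<Longrightarrow> adj A (\<ominus> x) = \<ominus> adj A x"
  by (simp add: uminus_conv_scale adj_scale)

lemma adj_diff: "\<lbrakk>x \<in> carrier A; y \<in> carrier A\<rbrakk> \<Longrightarrow> adj A (x \<ominus> y) = adj A x \<ominus> adj A y"
  by (simp add: minus_eq adj_add adj_uminus)

lemma diff_eq_zero_iff: "\<lbrakk>x \<in> carrier A; y \<in> carrier A\<rbrakk> \<Longrightarrow> x \<ominus> y = \<zero> \<longleftrightarrow> x = y"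
  by (metis minus_equality minus_eq minus_minus r_neg add.inv_closed)

end

text \<open>A seminorm rather than a norm, so that the same estimates serve the norm of a C*-algebra
  and the universal seminorm on the free *-algebra.\<close>

locale cstar_semi = star_alg A for A :: "('a, 'm) star_algebra_scheme" (structure) +
  fixes \<nu> :: "'a \<Rightarrow> real"
  assumes seminorm: "cstar_seminorm A \<nu>"
begin

lemma nu_nonneg [simp]: "x \<in> carrier A \<Longrightarrow> 0 \<le> \<nu> x"
  and nu_cstar: "x \<in> carrier A \<Longrightarrow> \<nu> (adj A x \<otimes> x) = (\<nu> x)\<^sup>2"
  and nu_scale: "x \<in> carrier A \<Longrightarrow> \<nu> (c \<odot> x) = cmod c * \<nu> x"
  and nu_triangle: "\<lbrakk>x \<in> carrier A; y \<in> carrier A\<rbrakk> \<Longrightarrow> \<nu> (x \<oplus> y) \<le> \<nu> x + \<nu> y"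
  and nu_mult: "\<lbrakk>x \<in> carrier A; y \<in> carrier A\<rbrakk> \<Longrightarrow> \<nu> (x \<otimes> y) \<le> \<nu> x * \<nu> y"
  using seminorm by (auto simp: cstar_seminorm_def)

lemma nu_zero [simp]: "\<nu> \<zero> = 0"
  using nu_scale[of \<zero> 0] by simp

lemma nu_uminus: "x \<in> carrier A \<Longrightarrow> \<nu> (\<ominus> x) = \<nu> x"
  by (simp add: uminus_conv_scale nu_scale)

lemma nu_diff_le: "\<lbrakk>x \<in> carrier A; y \<in> carrier A\<rbrakk> \<Longrightarrow> \<nu> (x \<ominus> y) \<le> \<nu> x + \<nu> y"
  using nu_triangle[of x "\<ominus> y"] by (simp add: minus_eq nu_uminus)

lemma nu_diff_commute: "\<lbrakk>x \<in> carrier A; y \<in> carrier A\<rbrakk> \<Longrightarrow> \<nu> (x \<ominus> y) = \<nu> (y \<ominus> x)"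
  using nu_uminus[of "x \<ominus> y"] by (simp add: minus_eq minus_add add.m_comm)

lemma nu_diff_triangle:
  assumes "x \<in> carrier A" "y \<in> carrier A" "z \<in> carrier A"
  shows "\<nu> (x \<ominus> z) \<le> \<nu> (x \<ominus> y) + \<nu> (y \<ominus> z)"
proof -
  have "x \<ominus> z = (x \<ominus> y) \<oplus> (y \<ominus> z)"
    using assms by algebra
  then show ?thesis
    using nu_triangle[of "x \<ominus> y" "y \<ominus> z"] assms by simp
qed

lemma nu_le_diff_add: "\<lbrakk>x \<in> carrier A; y \<in> carrier A\<rbrakk> \<Longrightarrow> \<nu> x \<le> \<nu> (x \<ominus> y) + \<nu> y"
  using nu_diff_triangle[of x y \<zero>] by (simp add: minus_eq)

lemma nu_abs_diff: "\<lbrakk>x \<in> carrier A; y \<in> carrier A\<rbrakk> \<Longrightarrow> \<bar>\<nu> x - \<nu> y\<bar> \<le> \<nu> (x \<ominus> y)"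
  using nu_le_diff_add[of x y] nu_le_diff_add[of y x] nu_diff_commute[of x y] by simp

text \<open>Cancel \<open>\<nu> y\<close> in \<open>(\<nu> y)\<^sup>2 = \<nu> (adj A y \<otimes> y)
  \<le> \<nu> (adj A y) * \<nu> y\<close>, then exchange the roles of y and its adjoint.\<close>

lemma nu_adj [simp]:
  assumes "x \<in> carrier A" shows "\<nu> (adj A x) = \<nu> x"
proof -
  have le: "\<nu> y \<le> \<nu> (adj A y)" if "y \<in> carrier A" for y
  proof (cases "\<nu> y = 0")
    case False
    then have "0 < \<nu> y" using that nu_nonneg[of y] by linarith
    moreover have "\<nu> y * \<nu> y \<le> \<nu> (adj A y) * \<nu> y"
      using nu_cstar[of y] nu_mult[of "adj A y" y] that by (simp add: power2_eq_square)
    ultimately show ?thesis by simp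
  qed (use that in simp)
  show ?thesis using le[of x] le[of "adj A x"] assms by simp
qed

text \<open>By the C*-identity \<open>\<nu> \<one>\<close> equals its own square, so it is 0 or 1;
  the value 0 occurs in the zero algebra.\<close>

lemma nu_one_le: "\<nu> \<one> \<le> 1"
proof -
  have "\<nu> \<one> = (\<nu> \<one>)\<^sup>2" using nu_cstar[of \<one>] by simp
  then show ?thesis by (metis nu_nonneg one_closed power2_eq_square mult_cancel_right1 order_refl zero_le_one)
qed

definition conv :: "(nat \<Rightarrow> 'a) \<Rightarrow> 'a \<Rightarrow> bool" where
  "conv s x \<longleftrightarrow> (\<forall>n. s n \<in> carrier A) \<and> x \<in> carrier A \<and> (\<lambda>n. \<nu> (s n \<ominus> x)) \<longlonglongrightarrow> 0"

lemma convI_bound: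
  assumes "\<And>n. s n \<in> carrier A" "x \<in> carrier A" "\<And>n. \<nu> (s n \<ominus> x) \<le> b n" "b \<longlonglongrightarrow> 0"
  shows "conv s x"
  unfolding conv_def
proof (intro conjI allI)
  show "(\<lambda>n. \<nu> (s n \<ominus> x)) \<longlonglongrightarrow> 0"
    by (rule tendsto_sandwich[OF _ _ tendsto_const \<open>b \<longlonglongrightarrow> 0\<close>]) (use assms in auto)
qed (use assms in auto)

lemma conv_const: "x \<in> carrier A \<Longrightarrow> conv (\<lambda>n. x) x"
  by (simp add: conv_def minus_eq r_neg)

lemma conv_nu: assumes "conv s x" shows "(\<lambda>n. \<nu> (s n)) \<longlonglongrightarrow> \<nu> x"
proof -
  have "(\<lambda>n. \<nu> (s n) - \<nu> x) \<longlonglongrightarrow> 0"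
    by (rule tendsto_rabs_zero_cancel, rule tendsto_sandwich[OF _ _ tendsto_const, where h="\<lambda>n. \<nu> (s n \<ominus> x)"])
      (use assms nu_abs_diff in \<open>auto simp: conv_def\<close>)
  then show ?thesis by (simp add: LIM_zero_iff)
qed

lemma conv_add:
  assumes "conv s x" "conv s' x'" shows "conv (\<lambda>n. s n \<oplus> s' n) (x \<oplus> x')"
proof (rule convI_bound)
  fix n
  have c: "s n \<in> carrier A" "s' n \<in> carrier A" "x \<in> carrier A" "x' \<in> carrier A"
    using assms by (auto simp: conv_def)
  then show "s n \<oplus> s' n \<in> carrier A" by simp
  have "(s n \<oplus> s' n) \<ominus> (x \<oplus> x') = (s n \<ominus> x) \<oplus> (s' n \<ominus> x')"
    using c by algebra
  then show "\<nu> ((s n \<oplus> s' n) \<ominus> (x \<oplus> x')) \<le> \<nu> (s n \<ominus> x) + \<nu> (s' n \<ominus> x')"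
    using c nu_triangle by simp
next
  show "(\<lambda>n. \<nu> (s n \<ominus> x) + \<nu> (s' n \<ominus> x')) \<longlonglongrightarrow> 0"
    using assms by (intro tendsto_add_zero) (auto simp: conv_def)
qed (use assms in \<open>auto simp: conv_def\<close>)

lemma conv_scale:
  assumes "conv s x" shows "conv (\<lambda>n. c \<odot> s n) (c \<odot> x)"
proof (rule convI_bound)
  fix n
  have c: "s n \<in> carrier A" "x \<in> carrier A"
    using assms by (auto simp: conv_def)
  then show "\<nu> (c \<odot> s n \<ominus> c \<odot> x) \<le> cmod c * \<nu> (s n \<ominus> x)"
    by (simp add: nu_scale flip: scale_diff_right)
next
  show "(\<lambda>n. cmod c * \<nu> (s n \<ominus> x)) \<longlonglongrightarrow> 0"
    using assms by (intro tendsto_mult_right_zero) (auto simp: conv_def)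
qed (use assms in \<open>auto simp: conv_def\<close>)

lemma conv_adj:
  assumes "conv s x" shows "conv (\<lambda>n. adj A (s n)) (adj A x)"
proof (rule convI_bound)
  fix n
  have c: "s n \<in> carrier A" "x \<in> carrier A"
    using assms by (auto simp: conv_def)
  then show "\<nu> (adj A (s n) \<ominus> adj A x) \<le> \<nu> (s n \<ominus> x)"
    by (simp flip: adj_diff)
qed (use assms in \<open>auto simp: conv_def\<close>)

lemma nu_mult_diff_le:
  assumes "x \<in> carrier A" "x' \<in> carrier A" "y \<in> carrier A" "y' \<in> carrier A"
  shows "\<nu> (x \<otimes> y \<ominus> x' \<otimes> y') \<le> \<nu> x * \<nu> (y \<ominus> y') + \<nu> (x \<ominus> x') * \<nu> y'"
proof -
  have "x \<otimes> y \<ominus> x' \<otimes> y' = x \<otimes> (y \<ominus> y') \<oplus> (x \<ominus> x') \<otimes> y'"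
    using assms by algebra
  then show ?thesis
    using nu_triangle[of "x \<otimes> (y \<ominus> y')" "(x \<ominus> x') \<otimes> y'"]
      nu_mult[of x "y \<ominus> y'"] nu_mult[of "x \<ominus> x'" y'] assms by simp
qed

lemma conv_mult:
  assumes "conv s x" "conv s' x'" shows "conv (\<lambda>n. s n \<otimes> s' n) (x \<otimes> x')"
proof (rule convI_bound)
  fix n
  show "\<nu> (s n \<otimes> s' n \<ominus> x \<otimes> x') \<le> \<nu> (s n) * \<nu> (s' n \<ominus> x') + \<nu> (s n \<ominus> x) * \<nu> x'"
    using assms by (intro nu_mult_diff_le) (auto simp: conv_def)
next
  have "(\<lambda>n. \<nu> (s n) * \<nu> (s' n \<ominus> x') + \<nu> (s n \<ominus> x) * \<nu> x') \<longlonglongrightarrow> \<nu> x * 0 + 0 * \<nu> x'"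
    using conv_nu[OF assms(1)] assms by (intro tendsto_intros) (auto simp: conv_def)
  then show "(\<lambda>n. \<nu> (s n) * \<nu> (s' n \<ominus> x') + \<nu> (s n \<ominus> x) * \<nu> x') \<longlonglongrightarrow> 0" by simp
qed (use assms in \<open>auto simp: conv_def\<close>)

lemma conv_diff:
  assumes "conv s x" "conv s' x'" shows "conv (\<lambda>n. s n \<ominus> s' n) (x \<ominus> x')"
proof -
  have "conv (\<lambda>n. s n \<oplus> (- 1) \<odot> s' n) (x \<oplus> (- 1) \<odot> x')"
    by (intro conv_add conv_scale assms)
  then show ?thesis using assms by (simp add: minus_eq uminus_conv_scale conv_def)
qed

lemma conv_limit_nu_zero:
  assumes "conv s x" "conv s y" shows "\<nu> (x \<ominus> y) = 0"
proof -
  have "conv (\<lambda>n. s n \<ominus> s n) (x \<ominus> y)" using assms by (rule conv_diff)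
  then have "(\<lambda>n. \<nu> (s n \<ominus> s n)) \<longlonglongrightarrow> \<nu> (x \<ominus> y)" by (rule conv_nu)
  moreover have "\<nu> (s n \<ominus> s n) = 0" for n using assms by (simp add: conv_def minus_eq r_neg)
  ultimately show ?thesis by (simp add: LIMSEQ_const_iff)
qed

end

context cstar_algebra begin

lemma star_alg: "star_alg A"
  by unfold_locales
    (simp_all add: scale_closed scale_add_left scale_add_right scale_scale scale_one
      scale_mult_left scale_mult_right adj_closed adj_adj adj_add adj_scale adj_mult)

lemma cstar_semi: "cstar_semi A (cnorm A)"
  unfolding cstar_semi_def cstar_semi_axioms_def
  by (simp add: star_alg cstar_seminorm_def norm_nonneg norm_cstar norm_scale norm_triangle norm_mult)

end

sublocale cstar_algebra \<subseteq> cstar_semi A "cnorm A"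
  by (rule cstar_semi)

lemma cstar_algebraI:
  fixes A :: "('a, 'm) cstar_scheme" (structure)
  assumes "star_alg A" "cstar_seminorm A (cnorm A)"
    and "\<And>x. x \<in> carrier A \<Longrightarrow> cnorm A x = 0 \<Longrightarrow> x = \<zero>"
    and "\<And>s. \<lbrakk>\<And>n. s n \<in> carrier A;
        \<forall>\<epsilon>>0. \<exists>N::nat. \<forall>m\<ge>N. \<forall>n\<ge>N. cnorm A (s m \<ominus> s n) < \<epsilon>\<rbrakk>
      \<Longrightarrow> \<exists>x\<in>carrier A. (\<lambda>n. cnorm A (s n \<ominus> x)) \<longlonglongrightarrow> 0"
  shows "cstar_algebra A"
proof -
  interpret cstar_semi A "cnorm A"
    using assms by (simp add: cstar_semi_def cstar_semi_axioms_def)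
  show ?thesis
    by unfold_locales
      (use assms nu_zero in \<open>auto simp: scale_add_left scale_add_right scale_scale
        scale_mult_left scale_mult_right adj_add adj_scale adj_mult nu_scale nu_cstar nu_triangle nu_mult\<close>)
qed

section \<open>Square roots and norm estimates in a C*-algebra\<close>

context cstar_algebra begin

lemma cauchy_conv:
  assumes "\<And>n. s n \<in> carrier A"
    "\<forall>\<epsilon>>0. \<exists>N::nat. \<forall>m\<ge>N. \<forall>n\<ge>N. cnorm A (s m \<ominus> s n) < \<epsilon>"
  obtains x where "conv s x"
  using complete[OF assms] assms(1) by (auto simp: conv_def)

lemma conv_unique: "conv s x \<Longrightarrow> conv s y \<Longrightarrow> x = y"
  using conv_limit_nu_zero[of s x y] norm_eq_zero[of "x \<ominus> y"]
  by (auto simp: conv_def diff_eq_zero_iff)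

lemma conv_commute:
  assumes "conv s x" "y \<in> carrier A" "\<And>n. y \<otimes> s n = s n \<otimes> y"
  shows "y \<otimes> x = x \<otimes> y"
  using conv_unique[OF conv_mult[OF conv_const[of y] assms(1)]]
    conv_mult[OF assms(1) conv_const[of y]] assms by simp

text \<open>
  The fixed point \<open>z\<close> of \<open>z = (x + z\<^sup>2) / 2\<close>, so that \<open>1 - z\<close> is a square root of \<open>1 - x\<close>. The
  iteration is dominated by the corresponding real iteration for \<open>x = 1\<close>.
\<close>

lemma sqrt_exists:
  assumes x: "x \<in> carrier A" "adj A x = x" "cnorm A x \<le> 1"
  obtains z where "z \<in> carrier A" "adj A z = z" "cnorm A z \<le> 1"
    "(\<one> \<ominus> z) \<otimes> (\<one> \<ominus> z) = \<one> \<ominus> x"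
    "\<And>y. \<lbrakk>y \<in> carrier A; y \<otimes> x = x \<otimes> y\<rbrakk> \<Longrightarrow> y \<otimes> z = z \<otimes> y"
proof -
  define f where "f = (\<lambda>z. (1/2) \<odot> (x \<oplus> z \<otimes> z))"
  define g where "g = (\<lambda>r::real. (1 + r\<^sup>2) / 2)"
  define z where "z n = (f ^^ n) \<zero>" for n
  define r where "r n = (g ^^ n) 0" for n
  have z0: "z 0 = \<zero>" and zS: "z (Suc n) = (1/2) \<odot> (x \<oplus> z n \<otimes> z n)" for n
    by (simp_all add: z_def f_def)
  have r0: "r 0 = 0" and rS: "r (Suc n) = (1 + (r n)\<^sup>2) / 2" for n
    by (simp_all add: r_def g_def)
  have zc [simp]: "z n \<in> carrier A" for n
    by (induction n) (simp_all add: z0 zS x)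
  have r_bd: "0 \<le> r n \<and> r n \<le> 1" for n
    by (induction n) (auto simp: r0 rS power2_eq_square intro: mult_le_one)
  have z_bd: "cnorm A (z n) \<le> r n" for n
  proof (induction n)
    case (Suc n)
    have "cnorm A (z (Suc n)) = (1/2) * cnorm A (x \<oplus> z n \<otimes> z n)"
      by (simp add: zS nu_scale x)
    also have "\<dots> \<le> (1/2) * (cnorm A x + cnorm A (z n) * cnorm A (z n))"
      using nu_triangle[of x "z n \<otimes> z n"] nu_mult[of "z n" "z n"] x by simp
    also have "\<dots> \<le> (1/2) * (1 + r n * r n)"
      using Suc x by (intro mult_left_mono add_mono mult_mono) (auto simp: r_bd)
    finally show ?case by (simp add: rS power2_eq_square)
  qed (simp add: z0 r0)
  \<comment> \<open>The iterates are polynomials in x, so they commute with everything that commutes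
    with x. With y an iterate they commute with each other, which is needed to factor a difference
    of squares below.\<close>
  have z_comm: "y \<otimes> z n = z n \<otimes> y" if "y \<in> carrier A" "y \<otimes> x = x \<otimes> y" for y n
  proof (induction n)
    case (Suc n)
    have "y \<otimes> (z n \<otimes> z n) = (z n \<otimes> z n) \<otimes> y"
      using Suc that by (metis m_assoc zc)
    then show ?case using that x
      by (simp add: zS scale_mult_left scale_mult_right r_distr l_distr)
  qed (use that in \<open>simp add: z0\<close>)
  have zz_comm: "z m \<otimes> z n = z n \<otimes> z m" for m n
    by (rule z_comm) (auto intro: z_comm[symmetric] simp: x)
  have z_sa: "adj A (z n) = z n" for n
    by (induction n) (simp_all add: z0 zS adj_scale adj_add adj_mult x)
  \<comment> \<open>The increments of z are dominated by those of the increasing real sequence r,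
    which is bounded by 1. Telescoping then makes z a Cauchy sequence.\<close>
  have step: "cnorm A (z (Suc n) \<ominus> z n) \<le> r (Suc n) - r n" for n
  proof (induction n)
    case 0
    then show ?case using x nu_scale[of "x \<oplus> \<zero>" "1/2"] z0 zS[of 0] r0 rS[of 0]
      by (simp add: minus_eq nu_scale)
  next
    case (Suc n)
    have "z (Suc (Suc n)) \<ominus> z (Suc n) = (1/2) \<odot> ((x \<oplus> z (Suc n) \<otimes> z (Suc n)) \<ominus> (x \<oplus> z n \<otimes> z n))"
      by (simp add: zS scale_diff_right x)
    also have "(x \<oplus> z (Suc n) \<otimes> z (Suc n)) \<ominus> (x \<oplus> z n \<otimes> z n)
       = z (Suc n) \<otimes> z (Suc n) \<ominus> z n \<otimes> z n"
    proof -
      have "(x \<oplus> p) \<ominus> (x \<oplus> q) = p \<ominus> q" if "p \<in> carrier A" "q \<in> carrier A" for p q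
        using x that by algebra
      then show ?thesis by simp
    qed
    also have "\<dots> = (z (Suc n) \<ominus> z n) \<otimes> (z (Suc n) \<oplus> z n)"
    proof -
      have "(p \<ominus> q) \<otimes> (p \<oplus> q) = p \<otimes> p \<ominus> q \<otimes> q"
        if "p \<in> carrier A" "q \<in> carrier A" "q \<otimes> p = p \<otimes> q" for p q
        using that by (simp add: minus_eq ring_simprules)
      then show ?thesis using zz_comm by simp
    qed
    finally have "cnorm A (z (Suc (Suc n)) \<ominus> z (Suc n))
      \<le> (1/2) * (cnorm A (z (Suc n) \<ominus> z n) * cnorm A (z (Suc n) \<oplus> z n))"
      by (simp add: nu_scale nu_mult)
    also have "\<dots> \<le> (1/2) * ((r (Suc n) - r n) * (r (Suc n) + r n))"
      using Suc z_bd[of n] z_bd[of "Suc n"] nu_triangle[of "z (Suc n)" "z n"]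
        order_trans[OF nu_nonneg Suc]
      by (intro mult_left_mono mult_mono) auto
    also have "\<dots> = r (Suc (Suc n)) - r (Suc n)"
      unfolding rS[of "Suc n"] rS[of n] by (simp add: field_simps power2_eq_square)
    finally show ?case .
  qed
  have dist: "cnorm A (z (n + k) \<ominus> z n) \<le> r (n + k) - r n" for n k
  proof (induction k)
    case (Suc k)
    show ?case
      using nu_diff_triangle[of "z (Suc (n + k))" "z (n + k)" "z n"] step[of "n + k"] Suc by simp
  qed (simp add: minus_eq r_neg)
  have "r n \<le> r (Suc n)" for n
    using order_trans[OF nu_nonneg step[of n]] by simp
  then have "incseq r" by (rule incseq_SucI)
  then have "Cauchy r"
    using r_bd incseq_convergent[of r 1] LIMSEQ_imp_Cauchy by metis
  have "\<exists>N. \<forall>m\<ge>N. \<forall>n\<ge>N. cnorm A (z m \<ominus> z n) < \<epsilon>" if eps: "\<epsilon> > 0" for \<epsilon>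
  proof -
    obtain N where N: "\<forall>m\<ge>N. \<forall>n\<ge>N. \<bar>r m - r n\<bar> < \<epsilon>"
      using \<open>Cauchy r\<close> eps unfolding Cauchy_def dist_real_def by blast
    have "cnorm A (z m \<ominus> z n) < \<epsilon>" if "m \<ge> N" "n \<ge> N" for m n
    proof (cases "n \<le> m")
      case True
      then show ?thesis using dist[of n "m - n"] N that by fastforce
    next
      case False
      then show ?thesis using dist[of m "n - m"] N that nu_diff_commute[of "z m" "z n"] by fastforce
    qed
    then show ?thesis by blast
  qed
  then have cau: "\<forall>\<epsilon>>0. \<exists>N. \<forall>m\<ge>N. \<forall>n\<ge>N. cnorm A (z m \<ominus> z n) < \<epsilon>" by blast
  obtain w where w: "conv z w"
    by (rule cauchy_conv[OF zc cau])
  then have wc [simp]: "w \<in> carrier A" by (simp add: conv_def)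
  show ?thesis
  proof
    show "adj A w = w"
      by (rule conv_unique[OF _ w]) (use conv_adj[OF w] in \<open>simp add: z_sa\<close>)
    show "cnorm A w \<le> 1"
      by (rule LIMSEQ_le_const2[OF conv_nu[OF w]]) (meson z_bd r_bd order_trans)
    show "y \<otimes> w = w \<otimes> y" if "y \<in> carrier A" "y \<otimes> x = x \<otimes> y" for y
      by (rule conv_commute[OF w that(1)]) (rule z_comm[OF that])
    have "conv (\<lambda>n. z (Suc n)) w"
      using w by (auto simp: conv_def dest: LIMSEQ_Suc)
    moreover have "conv (\<lambda>n. z (Suc n)) ((1/2) \<odot> (x \<oplus> w \<otimes> w))"
      unfolding zS by (intro conv_scale conv_add conv_mult conv_const w x)
    ultimately have "w = (1/2) \<odot> (x \<oplus> w \<otimes> w)" by (rule conv_unique)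
    then have "2 \<odot> w = x \<oplus> w \<otimes> w" using x scale_scale[of "x \<oplus> w \<otimes> w" 2 "1/2"] by simp
    then have "w \<oplus> w = x \<oplus> w \<otimes> w" using scale_add_left[of w 1 1] by simp
    have "(\<one> \<ominus> w) \<otimes> (\<one> \<ominus> w) = \<one> \<ominus> (w \<oplus> w) \<oplus> w \<otimes> w"
      using wc by (simp add: minus_eq minus_add ring_simprules)
    also have "\<dots> = \<one> \<ominus> x"
      unfolding \<open>w \<oplus> w = x \<oplus> w \<otimes> w\<close> using x wc by algebra
    finally show "(\<one> \<ominus> w) \<otimes> (\<one> \<ominus> w) = \<one> \<ominus> x" .
  qed simp
qed

text \<open>Here \<open>a + ic\<close> is a multiple of a unitary, and \<open>a\<close> is its real part.\<close>

lemma norm_le_of_squares: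
  assumes a: "a \<in> carrier A" "adj A a = a" and c: "c \<in> carrier A" "adj A c = c"
    and comm: "a \<otimes> c = c \<otimes> a" and sum: "a \<otimes> a \<oplus> c \<otimes> c = complex_of_real t \<odot> \<one>" and t: "0 \<le> t"
  shows "(cnorm A a)\<^sup>2 \<le> t"
proof -
  define u where "u = a \<oplus> \<i> \<odot> c"
  have u: "u \<in> carrier A" and adju: "adj A u = a \<oplus> (- \<i>) \<odot> c"
    using a c by (simp_all add: u_def adj_add adj_scale)
  have "adj A u \<otimes> u = a \<otimes> a \<oplus> \<i> \<odot> (a \<otimes> c) \<oplus> ((- \<i>) \<odot> (c \<otimes> a) \<oplus> c \<otimes> c)"
    using a c unfolding adju unfolding u_def
    by (simp add: l_distr r_distr scale_mult_left scale_mult_right scale_add_right a_ac flip: scale_scale)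
  also have "\<dots> = a \<otimes> a \<oplus> c \<otimes> c"
    using a c by (simp add: comm scale_uminus_left ring_simprules)
  finally have "(cnorm A u)\<^sup>2 = t * cnorm A \<one>"
    using nu_cstar[OF u] t by (simp add: sum nu_scale)
  also have "\<dots> \<le> t" using nu_one_le t by (simp add: mult_left_le)
  finally have "(cnorm A u)\<^sup>2 \<le> t" .
  have "u \<oplus> adj A u = a \<oplus> a"
    using a c unfolding adju by (simp add: u_def scale_uminus_left ring_simprules)
  then have "2 \<odot> a = u \<oplus> adj A u"
    using scale_add_left[of a 1 1] a by simp
  then have "2 * cnorm A a \<le> cnorm A u + cnorm A u"
    using nu_scale[of a 2] nu_triangle[of u "adj A u"] u a by simp
  then show ?thesis
    using \<open>(cnorm A u)\<^sup>2 \<le> t\<close> power_mono[of "cnorm A a" "cnorm A u" 2] a by simp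
qed

text \<open>The square root c = 1 - z of 1 - b^2 is self-adjoint and commutes with b, and c^2 + b^2
  = 1. So \<open>norm_le_of_squares\<close> bounds c, and the C*-identity bounds c^2. The lemma
  allows \<open>sqrt_exists\<close> to be applied to 1 - b^2.\<close>

lemma norm_one_minus_square_le:
  assumes b: "b \<in> carrier A" "adj A b = b" "cnorm A b \<le> 1"
  shows "cnorm A (\<one> \<ominus> b \<otimes> b) \<le> 1"
proof -
  have bb: "cnorm A (b \<otimes> b) \<le> 1"
    using nu_mult[of b b] b mult_le_one[of "cnorm A b" "cnorm A b"] by simp
  obtain z where z: "z \<in> carrier A" "adj A z = z" "(\<one> \<ominus> z) \<otimes> (\<one> \<ominus> z) = \<one> \<ominus> b \<otimes> b"
    and comm: "\<And>y. \<lbrakk>y \<in> carrier A; y \<otimes> (b \<otimes> b) = (b \<otimes> b) \<otimes> y\<rbrakk> \<Longrightarrow> y \<otimes> z = z \<otimes> y"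
    using sqrt_exists[of "b \<otimes> b"] b bb by (metis adj_mult m_closed)
  have "b \<otimes> z = z \<otimes> b" using comm[of b] b by (simp add: m_assoc)
  then have "(cnorm A (\<one> \<ominus> z))\<^sup>2 \<le> 1"
    using b z by (intro norm_le_of_squares[where c = b])
      (auto simp: adj_diff adj_add adj_uminus minus_eq ring_simprules)
  moreover have "(cnorm A (\<one> \<ominus> z))\<^sup>2 = cnorm A ((\<one> \<ominus> z) \<otimes> (\<one> \<ominus> z))"
    using nu_cstar[of "\<one> \<ominus> z"] z by (simp add: adj_diff)
  ultimately show ?thesis by (simp add: z(3))
qed

end

section \<open>Homomorphisms: contractivity, and isometry of the injective ones\<close>

locale star_hom_pair = dom: star_alg A + cod: star_alg B
  for A :: "('a, 'm) star_algebra_scheme" and B :: "('b, 'n) star_algebra_scheme" +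
  fixes h :: "'a \<Rightarrow> 'b"
  assumes star_hom: "h \<in> star_hom A B"
begin

sublocale ring_hom_ring A B h
  using star_hom
  by (auto simp: star_hom_def ring_hom_ring_def ring_hom_ring_axioms_def dom.ring_axioms cod.ring_axioms)

lemma hom_scale [simp]: "x \<in> carrier A \<Longrightarrow> h (c \<odot>\<^bsub>A\<^esub> x) = c \<odot>\<^bsub>B\<^esub> h x"
  and hom_adj [simp]: "x \<in> carrier A \<Longrightarrow> h (adj A x) = adj B (h x)"
  using star_hom by (auto simp: star_hom_def)

lemma hom_diff: "\<lbrakk>x \<in> carrier A; y \<in> carrier A\<rbrakk> \<Longrightarrow> h (x \<ominus>\<^bsub>A\<^esub> y) = h x \<ominus>\<^bsub>B\<^esub> h y"
  by (simp add: dom.minus_eq cod.minus_eq)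

end

locale cstar_hom_pair = star_hom_pair A B h + dom: cstar_algebra A + cod: cstar_algebra B
  for A :: "('a, 'm) cstar_scheme" and B :: "('b, 'n) cstar_scheme" and h
begin

text \<open>A self-adjoint a of norm at most 1 has a commuting self-adjoint partner c with a^2 + c^2
  = 1. This relation is purely algebraic, so h preserves it, and \<open>norm_le_of_squares\<close>
  in B bounds \<open>h a\<close>.\<close>

lemma contractive_sa:
  assumes a: "a \<in> carrier A" "adj A a = a" "cnorm A a \<le> 1"
  shows "cnorm B (h a) \<le> 1"
proof -
  have aa: "cnorm A (a \<otimes>\<^bsub>A\<^esub> a) \<le> 1"
    using dom.nu_mult[of a a] a mult_le_one[of "cnorm A a" "cnorm A a"] by simp
  obtain z where z: "z \<in> carrier A" "adj A z = z"
      "(\<one>\<^bsub>A\<^esub> \<ominus>\<^bsub>A\<^esub> z) \<otimes>\<^bsub>A\<^esub> (\<one>\<^bsub>A\<^esub> \<ominus>\<^bsub>A\<^esub> z) = \<one>\<^bsub>A\<^esub> \<ominus>\<^bsub>A\<^esub> a \<otimes>\<^bsub>A\<^esub> a"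
    and comm: "\<And>y. \<lbrakk>y \<in> carrier A; y \<otimes>\<^bsub>A\<^esub> (a \<otimes>\<^bsub>A\<^esub> a) = (a \<otimes>\<^bsub>A\<^esub> a) \<otimes>\<^bsub>A\<^esub> y\<rbrakk> \<Longrightarrow> y \<otimes>\<^bsub>A\<^esub> z = z \<otimes>\<^bsub>A\<^esub> y"
    using dom.sqrt_exists[of "a \<otimes>\<^bsub>A\<^esub> a"] a aa by (metis dom.adj_mult dom.m_closed)
  define c where "c = \<one>\<^bsub>A\<^esub> \<ominus>\<^bsub>A\<^esub> z"
  have c: "c \<in> carrier A" "adj A c = c" using z by (simp_all add: c_def dom.adj_diff)
  have "a \<otimes>\<^bsub>A\<^esub> z = z \<otimes>\<^bsub>A\<^esub> a" using comm[of a] a by (simp add: dom.m_assoc)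
  then have ac: "a \<otimes>\<^bsub>A\<^esub> c = c \<otimes>\<^bsub>A\<^esub> a"
    using a z by (simp add: c_def dom.minus_eq dom.ring_simprules)
  have "a \<otimes>\<^bsub>A\<^esub> a \<oplus>\<^bsub>A\<^esub> c \<otimes>\<^bsub>A\<^esub> c = \<one>\<^bsub>A\<^esub>"
    using a z by (simp add: c_def dom.minus_eq dom.ring_simprules)
  then have "h a \<otimes>\<^bsub>B\<^esub> h a \<oplus>\<^bsub>B\<^esub> h c \<otimes>\<^bsub>B\<^esub> h c = \<one>\<^bsub>B\<^esub>"
    using a c by (metis dom.m_closed hom_add hom_mult hom_one)
  moreover have "h a \<otimes>\<^bsub>B\<^esub> h c = h c \<otimes>\<^bsub>B\<^esub> h a" using ac a c by (metis hom_mult)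
  moreover have "adj B (h a) = h a" "adj B (h c) = h c"
    using a c by (metis hom_adj)+
  ultimately have "(cnorm B (h a))\<^sup>2 \<le> 1"
    using a c by (intro cod.norm_le_of_squares[of "h a" "h c" 1]) auto
  then show ?thesis using abs_le_square_iff[of "cnorm B (h a)" 1] a by simp
qed

lemma contractive:
  assumes "x \<in> carrier A" shows "cnorm B (h x) \<le> cnorm A x"
proof (cases "cnorm A x = 0")
  case True
  then show ?thesis using assms by (simp add: dom.norm_eq_zero)
next
  case False
  then have pos: "cnorm A x > 0" using dom.nu_nonneg[OF assms] by linarith
  define a where "a = complex_of_real (1 / (cnorm A x)\<^sup>2) \<odot>\<^bsub>A\<^esub> (adj A x \<otimes>\<^bsub>A\<^esub> x)"
  have a: "a \<in> carrier A" "adj A a = a" "cnorm A a \<le> 1"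
    using assms pos by (simp_all add: a_def dom.adj_scale dom.adj_mult dom.nu_scale dom.nu_cstar norm_divide norm_power)
  have "(1 / (cnorm A x)\<^sup>2) * (cnorm B (h x))\<^sup>2 \<le> 1"
    using contractive_sa[OF a] assms
    by (simp add: a_def cod.nu_scale cod.nu_cstar norm_divide del: of_real_divide)
  then have "(cnorm B (h x))\<^sup>2 \<le> (cnorm A x)\<^sup>2" using pos by (simp add: field_simps)
  then show ?thesis using assms pos by (simp add: power2_le_iff_abs_le)
qed

text \<open>On self-adjoint elements the C*-identity makes squaring exact for the norm, in A and in
  B alike. Repeated squaring therefore amplifies any gap between the norms of a and
  \<open>h a\<close>.\<close>

lemma norm_square_iterate:
  assumes "a \<in> carrier A" "adj A a = a"
  shows "(((\<lambda>y. y \<otimes>\<^bsub>A\<^esub> y) ^^ k) a) \<in> carrier A \<and> adj A (((\<lambda>y. y \<otimes>\<^bsub>A\<^esub> y) ^^ k) a) = ((\<lambda>y. y \<otimes>\<^bsub>A\<^esub> y) ^^ k) a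
    \<and> cnorm A (((\<lambda>y. y \<otimes>\<^bsub>A\<^esub> y) ^^ k) a) = cnorm A a ^ (2 ^ k)
    \<and> cnorm B (h (((\<lambda>y. y \<otimes>\<^bsub>A\<^esub> y) ^^ k) a)) = cnorm B (h a) ^ (2 ^ k)"
proof (induction k)
  case (Suc k)
  define y where "y = ((\<lambda>y. y \<otimes>\<^bsub>A\<^esub> y) ^^ k) a"
  have y: "y \<in> carrier A" "adj A y = y" "cnorm A y = cnorm A a ^ (2 ^ k)" "cnorm B (h y) = cnorm B (h a) ^ (2 ^ k)"
    using Suc by (simp_all add: y_def)
  have "cnorm A (y \<otimes>\<^bsub>A\<^esub> y) = (cnorm A y)\<^sup>2" "cnorm B (h y \<otimes>\<^bsub>B\<^esub> h y) = (cnorm B (h y))\<^sup>2"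
    using dom.nu_cstar[of y] cod.nu_cstar[of "h y"] hom_adj[of y] y by simp_all
  then show ?case using y
    by (simp add: dom.adj_mult power_mult[symmetric] mult.commute flip: y_def)
qed (use assms in auto)

text \<open>
  For \<open>a\<close> self-adjoint with \<open>\<parallel>a\<parallel> = 1\<close> and \<open>\<parallel>h a\<parallel>\<close> small put \<open>b = (a\<^sup>2 - 1/2) / 2\<close>. The square root
  \<open>w = \<bar>b\<bar>\<close> of \<open>b\<^sup>2\<close> is mapped to \<open>- h b\<close>, so \<open>w = - b\<close> by injectivity, that is, \<open>a\<^sup>2 \<le> 1/2\<close>.
\<close>

lemma injective_sa:
  assumes inj: "\<And>x. x \<in> carrier A \<Longrightarrow> h x = \<zero>\<^bsub>B\<^esub> \<Longrightarrow> x = \<zero>\<^bsub>A\<^esub>"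
    and a: "a \<in> carrier A" "adj A a = a" "cnorm A a = 1"
  shows "cnorm B (h a) > 1/4"
proof (rule ccontr)
  assume "\<not> cnorm B (h a) > 1/4"
  then have ha: "cnorm B (h a) \<le> 1/4" by simp
  define q where "q = a \<otimes>\<^bsub>A\<^esub> a"
  have q: "q \<in> carrier A" "adj A q = q" "cnorm A q = 1"
    using a dom.nu_cstar[of a] by (simp_all add: q_def dom.adj_mult)
  have hq: "cnorm B (h q) \<le> 1/16"
    using cod.nu_mult[of "h a" "h a"] mult_mono[OF ha ha] a by (simp add: q_def)
  define b where "b = (1/2) \<odot>\<^bsub>A\<^esub> q \<ominus>\<^bsub>A\<^esub> (1/4) \<odot>\<^bsub>A\<^esub> \<one>\<^bsub>A\<^esub>"
  have b: "b \<in> carrier A" "adj A b = b"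
    using q by (simp_all add: b_def dom.adj_diff dom.adj_scale)
  have "cnorm A b \<le> 1"
    using dom.nu_diff_le[of "(1/2) \<odot>\<^bsub>A\<^esub> q" "(1/4) \<odot>\<^bsub>A\<^esub> \<one>\<^bsub>A\<^esub>"] q dom.nu_one_le
    by (simp add: b_def dom.nu_scale)
  then have nb: "cnorm A (\<one>\<^bsub>A\<^esub> \<ominus>\<^bsub>A\<^esub> b \<otimes>\<^bsub>A\<^esub> b) \<le> 1" using b by (intro dom.norm_one_minus_square_le)
  have sa1: "adj A (\<one>\<^bsub>A\<^esub> \<ominus>\<^bsub>A\<^esub> b \<otimes>\<^bsub>A\<^esub> b) = \<one>\<^bsub>A\<^esub> \<ominus>\<^bsub>A\<^esub> b \<otimes>\<^bsub>A\<^esub> b"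
    using b by (simp add: dom.adj_diff dom.adj_mult)
  obtain z where z: "z \<in> carrier A" "adj A z = z" "cnorm A z \<le> 1"
      "(\<one>\<^bsub>A\<^esub> \<ominus>\<^bsub>A\<^esub> z) \<otimes>\<^bsub>A\<^esub> (\<one>\<^bsub>A\<^esub> \<ominus>\<^bsub>A\<^esub> z) = \<one>\<^bsub>A\<^esub> \<ominus>\<^bsub>A\<^esub> (\<one>\<^bsub>A\<^esub> \<ominus>\<^bsub>A\<^esub> b \<otimes>\<^bsub>A\<^esub> b)"
    and zcomm: "\<And>y. \<lbrakk>y \<in> carrier A; y \<otimes>\<^bsub>A\<^esub> (\<one>\<^bsub>A\<^esub> \<ominus>\<^bsub>A\<^esub> b \<otimes>\<^bsub>A\<^esub> b) = (\<one>\<^bsub>A\<^esub> \<ominus>\<^bsub>A\<^esub> b \<otimes>\<^bsub>A\<^esub> b) \<otimes>\<^bsub>A\<^esub> y\<rbrakk>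
      \<Longrightarrow> y \<otimes>\<^bsub>A\<^esub> z = z \<otimes>\<^bsub>A\<^esub> y"
    \<comment> \<open>The square root is taken for x = 1 - b^2, so 1 - x = b^2 and the root
      \<open>w = \<one> - z\<close> satisfies w^2 = b^2. It plays the role of the absolute value of
      b.\<close>
    using dom.sqrt_exists[OF _ sa1 nb] b by (metis dom.minus_closed dom.m_closed dom.one_closed)
  define w where "w = \<one>\<^bsub>A\<^esub> \<ominus>\<^bsub>A\<^esub> z"
  have w: "w \<in> carrier A" and ww: "w \<otimes>\<^bsub>A\<^esub> w = b \<otimes>\<^bsub>A\<^esub> b"
    unfolding w_def using z(1) b
    by (simp_all add: z(4)) (simp add: dom.minus_eq dom.minus_add dom.r_neg flip: dom.a_assoc)
  have commz: "y \<otimes>\<^bsub>A\<^esub> z = z \<otimes>\<^bsub>A\<^esub> y" if "y \<in> carrier A" "y \<otimes>\<^bsub>A\<^esub> b = b \<otimes>\<^bsub>A\<^esub> y" for y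
  proof (rule zcomm)
    have "y \<otimes>\<^bsub>A\<^esub> (b \<otimes>\<^bsub>A\<^esub> b) = (b \<otimes>\<^bsub>A\<^esub> b) \<otimes>\<^bsub>A\<^esub> y"
      using that b by (metis dom.m_assoc)
    then show "y \<otimes>\<^bsub>A\<^esub> (\<one>\<^bsub>A\<^esub> \<ominus>\<^bsub>A\<^esub> b \<otimes>\<^bsub>A\<^esub> b) = (\<one>\<^bsub>A\<^esub> \<ominus>\<^bsub>A\<^esub> b \<otimes>\<^bsub>A\<^esub> b) \<otimes>\<^bsub>A\<^esub> y"
      using that b by (simp add: dom.minus_eq dom.r_distr dom.l_distr dom.r_minus dom.l_minus)
  qed (use that in simp)
  have bz: "b \<otimes>\<^bsub>A\<^esub> z = z \<otimes>\<^bsub>A\<^esub> b" using commz b by simp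
  have "a \<otimes>\<^bsub>A\<^esub> b = b \<otimes>\<^bsub>A\<^esub> a"
    using a by (simp add: b_def q_def dom.minus_eq dom.r_distr dom.l_distr dom.r_minus dom.l_minus
        dom.scale_mult_left dom.scale_mult_right dom.m_assoc)
  then have az: "a \<otimes>\<^bsub>A\<^esub> z = z \<otimes>\<^bsub>A\<^esub> a" using commz a by simp
  have "(w \<oplus>\<^bsub>A\<^esub> b) \<otimes>\<^bsub>A\<^esub> (w \<ominus>\<^bsub>A\<^esub> b) = \<zero>\<^bsub>A\<^esub>"
  proof -
    have "w \<otimes>\<^bsub>A\<^esub> b = b \<otimes>\<^bsub>A\<^esub> w"
      using bz z b by (simp add: w_def dom.minus_eq dom.r_distr dom.l_distr dom.r_minus dom.l_minus)
    then show ?thesis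
      using w b ww by (simp add: dom.minus_eq dom.ring_simprules)
  qed
  then have prod0: "h (w \<oplus>\<^bsub>A\<^esub> b) \<otimes>\<^bsub>B\<^esub> h (w \<ominus>\<^bsub>A\<^esub> b) = \<zero>\<^bsub>B\<^esub>"
    using w b by (metis dom.add.m_closed dom.minus_closed hom_mult hom_zero)
  \<comment> \<open>Since w - b = 5/4 - (z + q/2), its image is 5/4 - k with the norm of k at most
    33/32 < 5/4. Right multiplication by it is injective, so h(w + b) h(w - b) = 0 forces h(w + b) =
    0.\<close>
  define k where "k = h z \<oplus>\<^bsub>B\<^esub> (1/2) \<odot>\<^bsub>B\<^esub> h q"
  have k: "k \<in> carrier B" using z q by (simp add: k_def)
  have "cnorm B k \<le> 1 + 1/32"
    using cod.nu_triangle[of "h z" "(1/2) \<odot>\<^bsub>B\<^esub> h q"] contractive[of z] z q hq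
    by (simp add: k_def cod.nu_scale)
  have "w \<ominus>\<^bsub>A\<^esub> b = (5/4) \<odot>\<^bsub>A\<^esub> \<one>\<^bsub>A\<^esub> \<ominus>\<^bsub>A\<^esub> (z \<oplus>\<^bsub>A\<^esub> (1/2) \<odot>\<^bsub>A\<^esub> q)"
    using z q dom.scale_add_left[of "\<one>\<^bsub>A\<^esub>" 1 "1/4"]
    by (simp add: w_def b_def dom.minus_eq dom.minus_add dom.a_ac)
  then have hwb: "h (w \<ominus>\<^bsub>A\<^esub> b) = (5/4) \<odot>\<^bsub>B\<^esub> \<one>\<^bsub>B\<^esub> \<ominus>\<^bsub>B\<^esub> k"
    using z q by (simp add: hom_diff k_def)
  define y where "y = h (w \<oplus>\<^bsub>A\<^esub> b)"
  have y: "y \<in> carrier B" using w b by (simp add: y_def)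
  have "y \<otimes>\<^bsub>B\<^esub> ((5/4) \<odot>\<^bsub>B\<^esub> \<one>\<^bsub>B\<^esub>) \<ominus>\<^bsub>B\<^esub> y \<otimes>\<^bsub>B\<^esub> k = \<zero>\<^bsub>B\<^esub>"
    using prod0 y k unfolding hwb y_def[symmetric] by (simp add: cod.minus_eq cod.r_distr cod.r_minus)
  then have "(5/4) \<odot>\<^bsub>B\<^esub> y = y \<otimes>\<^bsub>B\<^esub> k"
    using y k by (simp add: cod.diff_eq_zero_iff cod.scale_mult_right)
  then have "5/4 * cnorm B y \<le> cnorm B y * cnorm B k"
    using cod.nu_scale[of y "5/4"] cod.nu_mult[of y k] y k by simp
  also have "\<dots> \<le> cnorm B y * (1 + 1/32)"
    using \<open>cnorm B k \<le> 1 + 1/32\<close> y by (intro mult_left_mono) auto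
  finally have "cnorm B y = 0" using cod.nu_nonneg[OF y] by simp
  then have "w \<oplus>\<^bsub>A\<^esub> b = \<zero>\<^bsub>A\<^esub>"
    using inj[of "w \<oplus>\<^bsub>A\<^esub> b"] w b y by (simp add: y_def cod.norm_eq_zero)
  moreover have "(w \<oplus>\<^bsub>A\<^esub> (1/2) \<odot>\<^bsub>A\<^esub> q) \<ominus>\<^bsub>A\<^esub> (1/4) \<odot>\<^bsub>A\<^esub> \<one>\<^bsub>A\<^esub> = w \<oplus>\<^bsub>A\<^esub> b"
    using w q by (simp add: b_def dom.minus_eq dom.a_assoc)
  ultimately have sum: "w \<oplus>\<^bsub>A\<^esub> (1/2) \<odot>\<^bsub>A\<^esub> q = (1/4) \<odot>\<^bsub>A\<^esub> \<one>\<^bsub>A\<^esub>"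
    using dom.diff_eq_zero_iff[of "w \<oplus>\<^bsub>A\<^esub> (1/2) \<odot>\<^bsub>A\<^esub> q" "(1/4) \<odot>\<^bsub>A\<^esub> \<one>\<^bsub>A\<^esub>"] w q by simp
  \<comment> \<open>A second square root writes w as the square of the self-adjoint element 1 - m
    that commutes with a. The identity a^2/2 + w = 1/4 then has the form required by
    \<open>norm_le_of_squares\<close>, once a is scaled by the square root r of 1/2. The outcome 1/2
    <= 1/4 is absurd.\<close>
  obtain m where m: "m \<in> carrier A" "adj A m = m"
      "(\<one>\<^bsub>A\<^esub> \<ominus>\<^bsub>A\<^esub> m) \<otimes>\<^bsub>A\<^esub> (\<one>\<^bsub>A\<^esub> \<ominus>\<^bsub>A\<^esub> m) = w" "a \<otimes>\<^bsub>A\<^esub> m = m \<otimes>\<^bsub>A\<^esub> a"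
    using dom.sqrt_exists[of z] z az a unfolding w_def by metis
  define r where "r = complex_of_real (sqrt (1/2))"
  have rr: "r * r = 1/2" and nr: "cmod r = sqrt (1/2)"
    by (simp_all add: r_def flip: of_real_mult)
  define a' where "a' = r \<odot>\<^bsub>A\<^esub> a"
  have "(cnorm A a')\<^sup>2 \<le> 1/4"
  proof (rule dom.norm_le_of_squares[where c = "\<one>\<^bsub>A\<^esub> \<ominus>\<^bsub>A\<^esub> m"])
    show "a' \<otimes>\<^bsub>A\<^esub> (\<one>\<^bsub>A\<^esub> \<ominus>\<^bsub>A\<^esub> m) = (\<one>\<^bsub>A\<^esub> \<ominus>\<^bsub>A\<^esub> m) \<otimes>\<^bsub>A\<^esub> a'"
      using m a by (simp add: a'_def dom.minus_eq dom.r_distr dom.l_distr dom.r_minus dom.l_minus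
          dom.scale_mult_left dom.scale_mult_right dom.scale_add_right dom.scale_uminus_right)
    have "a' \<otimes>\<^bsub>A\<^esub> a' = (1/2) \<odot>\<^bsub>A\<^esub> q"
      using a by (simp add: a'_def q_def dom.scale_mult_left dom.scale_mult_right rr flip: dom.scale_scale)
    then show "a' \<otimes>\<^bsub>A\<^esub> a' \<oplus>\<^bsub>A\<^esub> (\<one>\<^bsub>A\<^esub> \<ominus>\<^bsub>A\<^esub> m) \<otimes>\<^bsub>A\<^esub> (\<one>\<^bsub>A\<^esub> \<ominus>\<^bsub>A\<^esub> m) = complex_of_real (1/4) \<odot>\<^bsub>A\<^esub> \<one>\<^bsub>A\<^esub>"
      using sum w q m by (simp add: dom.a_comm)
  qed (use a m in \<open>auto simp: a'_def r_def dom.adj_scale dom.adj_diff\<close>)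
  moreover have "cnorm A a' = sqrt (1/2)"
    using a by (simp add: a'_def dom.nu_scale nr)
  ultimately show False by simp
qed

text \<open>If h shrank x, the normalised element of the form x*x would have norm 1 and an image of
  norm below 1. Squaring it often enough keeps the norm 1 and pushes the image below 1/4, against
  \<open>injective_sa\<close>.\<close>

lemma injective_isometric:
  assumes inj: "\<And>x. x \<in> carrier A \<Longrightarrow> h x = \<zero>\<^bsub>B\<^esub> \<Longrightarrow> x = \<zero>\<^bsub>A\<^esub>" and x: "x \<in> carrier A"
  shows "cnorm B (h x) = cnorm A x"
proof (rule ccontr)
  assume "cnorm B (h x) \<noteq> cnorm A x"
  then have less: "cnorm B (h x) < cnorm A x" using contractive[OF x] by simp
  then have pos: "0 < cnorm A x" using order_le_less_trans[OF cod.nu_nonneg less] x by simp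
  define a where "a = complex_of_real (1 / (cnorm A x)\<^sup>2) \<odot>\<^bsub>A\<^esub> (adj A x \<otimes>\<^bsub>A\<^esub> x)"
  have a: "a \<in> carrier A" "adj A a = a" "cnorm A a = 1"
    using x pos by (simp_all add: a_def dom.adj_scale dom.adj_mult dom.nu_scale dom.nu_cstar norm_divide norm_power)
  have "cnorm B (h a) = (cnorm B (h x))\<^sup>2 / (cnorm A x)\<^sup>2"
    using x by (simp add: a_def cod.nu_scale cod.nu_cstar norm_divide norm_power)
  also have "\<dots> < 1" using less pos x by (simp add: power_strict_mono)
  finally have lt1: "cnorm B (h a) < 1" .
  have "strict_mono (\<lambda>k. 2 ^ k :: nat)" by (simp add: strict_mono_def)
  then have "(\<lambda>k. cnorm B (h a) ^ (2 ^ k)) \<longlonglongrightarrow> 0"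
    using LIMSEQ_subseq_LIMSEQ[OF LIMSEQ_realpow_zero[of "cnorm B (h a)"]] lt1 a
    by (simp add: comp_def)
  then have "eventually (\<lambda>k. cnorm B (h a) ^ (2 ^ k) < 1/4) sequentially"
    by (rule order_tendstoD) simp
  then obtain k where k: "cnorm B (h a) ^ (2 ^ k) < 1/4"
    by (auto simp: eventually_sequentially)
  define c where "c = ((\<lambda>y. y \<otimes>\<^bsub>A\<^esub> y) ^^ k) a"
  have "c \<in> carrier A" "adj A c = c" "cnorm A c = 1" "cnorm B (h c) = cnorm B (h a) ^ (2 ^ k)"
    using norm_square_iterate[OF a(1,2), of k] a(3) by (simp_all add: c_def)
  then show False
    using injective_sa[of c] inj k by auto
qed

lemma conv_hom: "dom.conv s x \<Longrightarrow> cod.conv (\<lambda>n. h (s n)) (h x)"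
  by (rule cod.convI_bound[where b = "\<lambda>n. cnorm A (s n \<ominus>\<^bsub>A\<^esub> x)"])
    (auto simp: dom.conv_def contractive simp flip: hom_diff)

end

section \<open>Completion of a *-algebra\<close>

context cstar_semi begin

abbreviation "CS \<equiv> cauchy_seqs A \<nu>"
abbreviation "cls \<equiv> cauchy_class A \<nu>"

definition equiv_seq :: "(nat \<Rightarrow> 'a) \<Rightarrow> (nat \<Rightarrow> 'a) \<Rightarrow> bool" where
  "equiv_seq s s' \<longleftrightarrow> (\<lambda>n. \<nu> (s n \<ominus> s' n)) \<longlonglongrightarrow> 0"

lemma cs_closed: "s \<in> CS \<Longrightarrow> s n \<in> carrier A"
  by (simp add: cauchy_seqs_def)

lemma csD: "s \<in> CS \<Longrightarrow> \<epsilon> > 0 \<Longrightarrow> \<exists>N. \<forall>m\<ge>N. \<forall>n\<ge>N. \<nu> (s m \<ominus> s n) < \<epsilon>"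
  unfolding cauchy_seqs_def by blast

text \<open>One criterion for all the operations: a Lipschitz bound in two Cauchy sequences. The
  constants are required to be positive because the tolerance is divided by them.\<close>

lemma csI_bound:
  assumes s: "s \<in> CS" "s' \<in> CS" and t: "\<And>n. t n \<in> carrier A" and C: "C > 0" "D > 0"
    and bd: "\<And>m n. \<nu> (t m \<ominus> t n) \<le> C * \<nu> (s m \<ominus> s n) + D * \<nu> (s' m \<ominus> s' n)"
  shows "t \<in> CS"
  unfolding cauchy_seqs_def
proof (intro CollectI conjI allI impI t)
  fix \<epsilon> :: real assume e: "\<epsilon> > 0"
  obtain N where N: "\<forall>m\<ge>N. \<forall>n\<ge>N. \<nu> (s m \<ominus> s n) < \<epsilon> / (2 * C)"
    using csD[OF s(1), of "\<epsilon> / (2 * C)"] e C by auto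
  obtain N' where N': "\<forall>m\<ge>N'. \<forall>n\<ge>N'. \<nu> (s' m \<ominus> s' n) < \<epsilon> / (2 * D)"
    using csD[OF s(2), of "\<epsilon> / (2 * D)"] e C by auto
  have "\<nu> (t m \<ominus> t n) < \<epsilon>" if "m \<ge> max N N'" "n \<ge> max N N'" for m n
  proof -
    have "C * \<nu> (s m \<ominus> s n) < \<epsilon> / 2" "D * \<nu> (s' m \<ominus> s' n) < \<epsilon> / 2"
      using N N' that C by (auto simp: field_simps)
    then show ?thesis using bd[of m n] by simp
  qed
  then show "\<exists>N. \<forall>m\<ge>N. \<forall>n\<ge>N. \<nu> (t m \<ominus> t n) < \<epsilon>" by blast
qed

lemma cs_nu_convergent: assumes "s \<in> CS" shows "convergent (\<lambda>n. \<nu> (s n))"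
  unfolding Cauchy_convergent_iff[symmetric] Cauchy_def dist_real_def
proof (intro allI impI)
  fix e :: real assume "e > 0"
  then obtain N where "\<forall>m\<ge>N. \<forall>n\<ge>N. \<nu> (s m \<ominus> s n) < e" using csD[OF assms] by blast
  then show "\<exists>M. \<forall>m\<ge>M. \<forall>n\<ge>M. \<bar>\<nu> (s m) - \<nu> (s n)\<bar> < e"
    using nu_abs_diff assms by (meson cs_closed order_le_less_trans)
qed

lemma cs_bounded: assumes "s \<in> CS" shows "\<exists>C>0. \<forall>n. \<nu> (s n) \<le> C"
proof -
  obtain K where "K > 0" "\<forall>n. norm (\<nu> (s n)) \<le> K"
    using convergent_imp_Bseq[OF cs_nu_convergent[OF assms]] unfolding Bseq_def by blast
  then show ?thesis by (auto simp: abs_le_iff)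
qed

lemma cs_const [simp]: "x \<in> carrier A \<Longrightarrow> (\<lambda>n. x) \<in> CS"
  by (auto simp: cauchy_seqs_def minus_eq r_neg)

lemma cs_add [simp]: assumes "s \<in> CS" "s' \<in> CS" shows "(\<lambda>n. s n \<oplus> s' n) \<in> CS"
proof (rule csI_bound[OF assms, where C = 1 and D = 1])
  note [simp] = assms(1,2)[THEN cs_closed]
  fix m n
  have "(p \<oplus> q) \<ominus> (p' \<oplus> q') = (p \<ominus> p') \<oplus> (q \<ominus> q')"
    if "p \<in> carrier A" "q \<in> carrier A" "p' \<in> carrier A" "q' \<in> carrier A" for p q p' q'
    using that by algebra
  then show "\<nu> ((s m \<oplus> s' m) \<ominus> (s n \<oplus> s' n)) \<le> 1 * \<nu> (s m \<ominus> s n) + 1 * \<nu> (s' m \<ominus> s' n)"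
    using assms nu_triangle by simp
qed (use assms assms[THEN cs_closed] in auto)

lemma cs_scale [simp]: assumes "s \<in> CS" shows "(\<lambda>n. c \<odot> s n) \<in> CS"
proof (rule csI_bound[OF assms assms, where C = "1 + cmod c" and D = 1])
  note [simp] = assms(1)[THEN cs_closed]
  fix m n
  have "cmod c * \<nu> (s m \<ominus> s n) \<le> (1 + cmod c) * \<nu> (s m \<ominus> s n)"
    using assms by (intro mult_right_mono) auto
  moreover have "0 \<le> \<nu> (s m \<ominus> s n)" by simp
  ultimately have "cmod c * \<nu> (s m \<ominus> s n) \<le> (1 + cmod c) * \<nu> (s m \<ominus> s n) + 1 * \<nu> (s m \<ominus> s n)"
    by linarith
  then show "\<nu> (c \<odot> s m \<ominus> c \<odot> s n) \<le> (1 + cmod c) * \<nu> (s m \<ominus> s n) + 1 * \<nu> (s m \<ominus> s n)"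
    using assms by (simp add: nu_scale flip: scale_diff_right)
qed (use assms assms[THEN cs_closed] in \<open>auto intro: add_pos_nonneg\<close>)

lemma cs_uminus [simp]: assumes "s \<in> CS" shows "(\<lambda>n. \<ominus> s n) \<in> CS"
  using cs_scale[OF assms, of "- 1"] cs_closed[OF assms] by (simp add: scale_uminus_left)

lemma cs_adj [simp]: assumes "s \<in> CS" shows "(\<lambda>n. adj A (s n)) \<in> CS"
  by (rule csI_bound[OF assms assms, where C = 1 and D = 1])
    (use assms assms(1)[THEN cs_closed] in \<open>auto simp flip: adj_diff\<close>)

lemma cs_mult [simp]: assumes "s \<in> CS" "s' \<in> CS" shows "(\<lambda>n. s n \<otimes> s' n) \<in> CS"
proof -
  note [simp] = assms(1,2)[THEN cs_closed]
  obtain C where C: "C > 0" "\<And>n. \<nu> (s n) \<le> C" using cs_bounded[OF assms(1)] by blast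
  obtain D where D: "D > 0" "\<And>n. \<nu> (s' n) \<le> D" using cs_bounded[OF assms(2)] by blast
  show ?thesis
  proof (rule csI_bound[OF assms, where C = D and D = C])
    fix m n
    have "\<nu> (s m \<otimes> s' m \<ominus> s n \<otimes> s' n) \<le> \<nu> (s m) * \<nu> (s' m \<ominus> s' n) + \<nu> (s m \<ominus> s n) * \<nu> (s' n)"
      using assms by (intro nu_mult_diff_le) auto
    also have "\<dots> \<le> C * \<nu> (s' m \<ominus> s' n) + \<nu> (s m \<ominus> s n) * D"
      using assms C D by (intro add_mono mult_right_mono mult_left_mono) auto
    finally show "\<nu> (s m \<otimes> s' m \<ominus> s n \<otimes> s' n) \<le> D * \<nu> (s m \<ominus> s n) + C * \<nu> (s' m \<ominus> s' n)"
      by (simp add: mult.commute add.commute)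
  qed (use assms assms[THEN cs_closed] C D in auto)
qed

lemma equiv_refl: assumes "s \<in> CS" shows "equiv_seq s s"
  using cs_closed[OF assms] by (simp add: equiv_seq_def minus_eq r_neg)

lemma equiv_sym:
  assumes "s \<in> CS" "s' \<in> CS" "equiv_seq s s'" shows "equiv_seq s' s"
  using assms(1,2)[THEN cs_closed] assms(3) by (simp add: equiv_seq_def nu_diff_commute)

lemma equivI_bound:
  assumes "\<And>n. \<nu> (s n \<ominus> s' n) \<le> b n" "b \<longlonglongrightarrow> 0" "\<And>n. s n \<in> carrier A" "\<And>n. s' n \<in> carrier A"
  shows "equiv_seq s s'"
  unfolding equiv_seq_def
  by (rule tendsto_sandwich[OF _ _ tendsto_const \<open>b \<longlonglongrightarrow> 0\<close>]) (use assms in auto)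

lemma equiv_trans:
  assumes "s \<in> CS" "s' \<in> CS" "s'' \<in> CS" "equiv_seq s s'" "equiv_seq s' s''"
  shows "equiv_seq s s''"
  by (rule equivI_bound[where b = "\<lambda>n. \<nu> (s n \<ominus> s' n) + \<nu> (s' n \<ominus> s'' n)"])
    (use assms assms(1-3)[THEN cs_closed] in \<open>auto simp: equiv_seq_def intro: nu_diff_triangle tendsto_add_zero\<close>)

lemma cls_def': "cls s = {s' \<in> CS. equiv_seq s' s}"
  by (simp add: cauchy_class_def equiv_seq_def)

lemma cls_self [simp]: "s \<in> CS \<Longrightarrow> s \<in> cls s"
  by (simp add: cls_def' equiv_refl)

lemma cls_eqI: "\<lbrakk>s \<in> CS; s' \<in> CS; equiv_seq s s'\<rbrakk> \<Longrightarrow> cls s = cls s'"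
  unfolding cls_def' using equiv_trans equiv_sym by blast

lemma cls_mem: "s' \<in> cls s \<Longrightarrow> s' \<in> CS \<and> equiv_seq s' s"
  by (simp add: cls_def')

lemma cls_eq_iff: "\<lbrakk>s \<in> CS; s' \<in> CS\<rbrakk> \<Longrightarrow> cls s = cls s' \<longleftrightarrow> equiv_seq s s'"
  using cls_eqI[of s s'] cls_self[of s] cls_mem[of s s'] by metis

lemma equiv_add:
  assumes "s \<in> CS" "s' \<in> CS" "t \<in> CS" "t' \<in> CS" "equiv_seq s t" "equiv_seq s' t'"
  shows "equiv_seq (\<lambda>n. s n \<oplus> s' n) (\<lambda>n. t n \<oplus> t' n)"
proof (rule equivI_bound[where b = "\<lambda>n. \<nu> (s n \<ominus> t n) + \<nu> (s' n \<ominus> t' n)"])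
  note [simp] = assms(1-4)[THEN cs_closed]
  fix n
  have "(p \<oplus> q) \<ominus> (p' \<oplus> q') = (p \<ominus> p') \<oplus> (q \<ominus> q')"
    if "p \<in> carrier A" "q \<in> carrier A" "p' \<in> carrier A" "q' \<in> carrier A" for p q p' q'
    using that by algebra
  then show "\<nu> ((s n \<oplus> s' n) \<ominus> (t n \<oplus> t' n)) \<le> \<nu> (s n \<ominus> t n) + \<nu> (s' n \<ominus> t' n)"
    using assms nu_triangle by simp
qed (use assms assms(1-4)[THEN cs_closed] in \<open>auto simp: equiv_seq_def intro: tendsto_add_zero\<close>)

lemma equiv_mult:
  assumes "s \<in> CS" "s' \<in> CS" "t \<in> CS" "t' \<in> CS" "equiv_seq s t" "equiv_seq s' t'"
  shows "equiv_seq (\<lambda>n. s n \<otimes> s' n) (\<lambda>n. t n \<otimes> t' n)"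
proof (rule equivI_bound)
  note [simp] = assms(1-4)[THEN cs_closed]
  fix n
  show "\<nu> (s n \<otimes> s' n \<ominus> t n \<otimes> t' n) \<le> \<nu> (s n) * \<nu> (s' n \<ominus> t' n) + \<nu> (s n \<ominus> t n) * \<nu> (t' n)"
    using assms by (intro nu_mult_diff_le) auto
next
  obtain a b where ab: "(\<lambda>n. \<nu> (s n)) \<longlonglongrightarrow> a" "(\<lambda>n. \<nu> (t' n)) \<longlonglongrightarrow> b"
    using cs_nu_convergent assms unfolding convergent_def by meson
  have "(\<lambda>n. \<nu> (s n) * \<nu> (s' n \<ominus> t' n) + \<nu> (s n \<ominus> t n) * \<nu> (t' n)) \<longlonglongrightarrow> a * 0 + 0 * b"
    using assms ab by (intro tendsto_intros) (auto simp: equiv_seq_def)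
  then show "(\<lambda>n. \<nu> (s n) * \<nu> (s' n \<ominus> t' n) + \<nu> (s n \<ominus> t n) * \<nu> (t' n)) \<longlonglongrightarrow> 0" by simp
qed (use assms assms(1-4)[THEN cs_closed] in auto)

lemma equiv_scale:
  assumes "s \<in> CS" "t \<in> CS" "equiv_seq s t"
  shows "equiv_seq (\<lambda>n. c \<odot> s n) (\<lambda>n. c \<odot> t n)"
  by (rule equivI_bound[where b = "\<lambda>n. cmod c * \<nu> (s n \<ominus> t n)"])
    (use assms assms(1,2)[THEN cs_closed] in \<open>auto simp: equiv_seq_def nu_scale intro: tendsto_mult_right_zero simp flip: scale_diff_right\<close>)

lemma equiv_adj:
  assumes "s \<in> CS" "t \<in> CS" "equiv_seq s t"
  shows "equiv_seq (\<lambda>n. adj A (s n)) (\<lambda>n. adj A (t n))"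
  by (rule equivI_bound[where b = "\<lambda>n. \<nu> (s n \<ominus> t n)"])
    (use assms assms(1,2)[THEN cs_closed] in \<open>auto simp: equiv_seq_def simp flip: adj_diff\<close>)

abbreviation "Comp \<equiv> cstar_completion A \<nu>"

text \<open>The operations of \<open>cstar_completion\<close> are unions over all pairs of
  representatives. Once every pair gives the same class, the union collapses to that class.\<close>

lemma UN2_const: "x \<in> X \<Longrightarrow> y \<in> Y \<Longrightarrow> (\<And>s s'. s \<in> X \<Longrightarrow> s' \<in> Y \<Longrightarrow> F s s' = c) \<Longrightarrow> (\<Union>s\<in>X. \<Union>s'\<in>Y. F s s') = c"
  by auto

lemma UN1_const: "x \<in> X \<Longrightarrow> (\<And>s. s \<in> X \<Longrightarrow> F s = c) \<Longrightarrow> (\<Union>s\<in>X. F s) = c"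
  by auto

lemma comp_carrier: "carrier Comp = cls ` CS"
  by (simp add: cstar_completion_def)

lemma comp_closed [simp]: "s \<in> CS \<Longrightarrow> cls s \<in> carrier Comp"
  by (simp add: comp_carrier)

lemma compE:
  assumes "X \<in> carrier Comp"
  obtains s where "s \<in> CS" "\<forall>n. s n \<in> carrier A" "X = cls s"
  using assms cs_closed unfolding comp_carrier by blast

lemma comp_mult [simp]:
  assumes "s \<in> CS" "s' \<in> CS" shows "cls s \<otimes>\<^bsub>Comp\<^esub> cls s' = cls (\<lambda>n. s n \<otimes> s' n)"
  unfolding cstar_completion_def monoid.simps
proof (rule UN2_const[OF cls_self[OF assms(1)] cls_self[OF assms(2)]])
  fix t t' assume "t \<in> cls s" "t' \<in> cls s'"
  from this[THEN cls_mem] show "cls (\<lambda>n. t n \<otimes> t' n) = cls (\<lambda>n. s n \<otimes> s' n)"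
    using assms by (simp add: cls_eq_iff equiv_mult)
qed

lemma comp_add [simp]:
  assumes "s \<in> CS" "s' \<in> CS" shows "cls s \<oplus>\<^bsub>Comp\<^esub> cls s' = cls (\<lambda>n. s n \<oplus> s' n)"
  unfolding cstar_completion_def ring.simps
proof (rule UN2_const[OF cls_self[OF assms(1)] cls_self[OF assms(2)]])
  fix t t' assume "t \<in> cls s" "t' \<in> cls s'"
  from this[THEN cls_mem] show "cls (\<lambda>n. t n \<oplus> t' n) = cls (\<lambda>n. s n \<oplus> s' n)"
    using assms by (simp add: cls_eq_iff equiv_add)
qed

lemma comp_scale [simp]:
  assumes "s \<in> CS" shows "c \<odot>\<^bsub>Comp\<^esub> cls s = cls (\<lambda>n. c \<odot> s n)"
  unfolding cstar_completion_def module.simps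
proof (rule UN1_const[OF cls_self[OF assms]])
  fix t assume "t \<in> cls s"
  from this[THEN cls_mem] show "cls (\<lambda>n. c \<odot> t n) = cls (\<lambda>n. c \<odot> s n)"
    using assms by (simp add: cls_eq_iff equiv_scale)
qed

lemma comp_adj [simp]:
  assumes "s \<in> CS" shows "adj Comp (cls s) = cls (\<lambda>n. adj A (s n))"
  unfolding cstar_completion_def star_algebra.simps
proof (rule UN1_const[OF cls_self[OF assms]])
  fix t assume "t \<in> cls s"
  from this[THEN cls_mem] show "cls (\<lambda>n. adj A (t n)) = cls (\<lambda>n. adj A (s n))"
    using assms by (simp add: cls_eq_iff equiv_adj)
qed

lemma comp_one: "\<one>\<^bsub>Comp\<^esub> = cls (\<lambda>n. \<one>)" and comp_zero: "\<zero>\<^bsub>Comp\<^esub> = cls (\<lambda>n. \<zero>)"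
  by (simp_all add: cstar_completion_def)

text \<open>The norm is a definite description of the common limit over all representatives; it
  exists because equivalent sequences have seminorms differing by a null sequence.\<close>

lemma comp_norm:
  assumes s: "s \<in> CS" shows "(\<lambda>n. \<nu> (s n)) \<longlonglongrightarrow> cnorm Comp (cls s)"
proof -
  obtain r where r: "(\<lambda>n. \<nu> (s n)) \<longlonglongrightarrow> r"
    using cs_nu_convergent[OF s] unfolding convergent_def by blast
  have all: "(\<lambda>n. \<nu> (t n)) \<longlonglongrightarrow> r" if "t \<in> cls s" for t
  proof -
    have t: "t \<in> CS" "equiv_seq t s" using cls_mem[OF that] by auto
    have diff: "(\<lambda>n. \<nu> (t n) - \<nu> (s n)) \<longlonglongrightarrow> 0"
      by (rule tendsto_rabs_zero_cancel, rule tendsto_sandwich[OF _ _ tendsto_const, where h="\<lambda>n. \<nu> (t n \<ominus> s n)"])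
        (use s t s[THEN cs_closed] t(1)[THEN cs_closed] nu_abs_diff in \<open>auto simp: equiv_seq_def\<close>)
    then show ?thesis using tendsto_add[OF diff r] by simp
  qed
  have "(THE r. \<forall>t\<in>cls s. (\<lambda>n. \<nu> (t n)) \<longlonglongrightarrow> r) = r"
    by (rule the_equality) (use all r LIMSEQ_unique cls_self[OF s] in blast)+
  then show ?thesis using r by (simp add: cstar_completion_def)
qed

lemma comp_star_alg: "star_alg Comp"
proof -
  have zc: "\<zero>\<^bsub>Comp\<^esub> \<in> carrier Comp" and oc: "\<one>\<^bsub>Comp\<^esub> \<in> carrier Comp"
    by (simp_all add: comp_zero comp_one)
  have "abelian_group Comp"
  proof (rule abelian_groupI)
    fix X assume "X \<in> carrier Comp"
    then obtain s where s: "s \<in> CS" "\<forall>n. s n \<in> carrier A" "X = cls s" by (rule compE)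
    then show "\<exists>Y\<in>carrier Comp. Y \<oplus>\<^bsub>Comp\<^esub> X = \<zero>\<^bsub>Comp\<^esub>"
      by (intro bexI[of _ "cls (\<lambda>n. \<ominus> s n)"])
        (simp_all add: comp_zero l_neg)
  qed (auto simp: zc elim!: compE, auto simp: comp_zero a_ac)
  moreover have "monoid Comp"
    by (rule monoidI) (auto simp: oc elim!: compE, auto simp: comp_one m_assoc)
  ultimately have "ring Comp"
    by (rule ringI) (auto elim!: compE simp: l_distr r_distr)
  then show ?thesis
    unfolding star_alg_def star_alg_axioms_def
    by (auto elim!: compE simp: scale_add_left scale_add_right scale_scale
        scale_mult_left scale_mult_right adj_add adj_scale adj_mult)
qed

lemma comp_cstar_semi: "cstar_semi Comp (cnorm Comp)"
proof -
  have nonneg: "0 \<le> cnorm Comp (cls s)" if "s \<in> CS" for s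
    using LIMSEQ_le_const[OF comp_norm[OF that], of 0] cs_closed[OF that] by auto
  have scale: "cnorm Comp (cls (\<lambda>n. c \<odot> s n)) = cmod c * cnorm Comp (cls s)" if "s \<in> CS" for s c
    using LIMSEQ_unique[OF comp_norm[of "\<lambda>n. c \<odot> s n"] ]
      tendsto_mult_left[OF comp_norm[OF that], of "cmod c"] that cs_closed[OF that] by (simp add: nu_scale)
  have tri: "cnorm Comp (cls (\<lambda>n. s n \<oplus> s' n)) \<le> cnorm Comp (cls s) + cnorm Comp (cls s')"
    if "s \<in> CS" "s' \<in> CS" for s s'
    by (rule LIMSEQ_le[OF comp_norm tendsto_add[OF comp_norm comp_norm]])
      (use that that[THEN cs_closed] nu_triangle in auto)
  have mult: "cnorm Comp (cls (\<lambda>n. s n \<otimes> s' n)) \<le> cnorm Comp (cls s) * cnorm Comp (cls s')"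
    if "s \<in> CS" "s' \<in> CS" for s s'
    by (rule LIMSEQ_le[OF comp_norm tendsto_mult[OF comp_norm comp_norm]])
      (use that that[THEN cs_closed] nu_mult in auto)
  have cst: "cnorm Comp (cls (\<lambda>n. adj A (s n) \<otimes> s n)) = (cnorm Comp (cls s))\<^sup>2" if "s \<in> CS" for s
    using LIMSEQ_unique[OF comp_norm[of "\<lambda>n. adj A (s n) \<otimes> s n"]]
      tendsto_power[OF comp_norm[OF that], of 2] that cs_closed[OF that] by (simp add: nu_cstar)
  show ?thesis
    unfolding cstar_semi_def cstar_semi_axioms_def cstar_seminorm_def
    by (auto simp: comp_star_alg nonneg scale tri mult cst elim!: compE)
qed

definition embed :: "'a \<Rightarrow> (nat \<Rightarrow> 'a) set" where
  "embed a = cls (\<lambda>n. a)"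

lemma embed_star_hom: "embed \<in> star_hom A Comp"
  by (auto simp: star_hom_def ring_hom_def embed_def comp_one)

lemma norm_embed: "a \<in> carrier A \<Longrightarrow> cnorm Comp (embed a) = \<nu> a"
  using comp_norm[of "\<lambda>n. a"] by (simp add: embed_def LIMSEQ_const_iff)

lemma comp_diff:
  assumes "s \<in> CS" "s' \<in> CS" shows "cls s \<ominus>\<^bsub>Comp\<^esub> cls s' = cls (\<lambda>n. s n \<ominus> s' n)"
proof -
  interpret C: star_alg Comp by (rule comp_star_alg)
  show ?thesis
    using assms assms[THEN cs_closed] by (simp add: C.minus_eq C.uminus_conv_scale minus_eq uminus_conv_scale)
qed

lemma embed_conv:
  assumes "s \<in> CS" shows "(\<lambda>k. cnorm Comp (embed (s k) \<ominus>\<^bsub>Comp\<^esub> cls s)) \<longlonglongrightarrow> 0"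
proof (rule LIMSEQ_I)
  note [simp] = assms[THEN cs_closed]
  fix e :: real assume "e > 0"
  then obtain N where N: "\<forall>m\<ge>N. \<forall>n\<ge>N. \<nu> (s m \<ominus> s n) < e / 2"
    using csD[OF assms, of "e / 2"] by auto
  have "norm (cnorm Comp (embed (s k) \<ominus>\<^bsub>Comp\<^esub> cls s) - 0) < e" if "k \<ge> N" for k
  proof -
    have "(\<lambda>n. s k \<ominus> s n) \<in> CS"
      using cs_add[of "\<lambda>n. s k" "\<lambda>n. (- 1) \<odot> s n"] assms
      by (simp add: minus_eq uminus_conv_scale)
    from comp_norm[OF this] have lim: "(\<lambda>n. \<nu> (s k \<ominus> s n)) \<longlonglongrightarrow> cnorm Comp (embed (s k) \<ominus>\<^bsub>Comp\<^esub> cls s)"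
      using assms by (simp add: embed_def comp_diff)
    have "cnorm Comp (embed (s k) \<ominus>\<^bsub>Comp\<^esub> cls s) \<le> e / 2"
      by (rule LIMSEQ_le_const2[OF lim]) (use N that less_imp_le in blast)
    moreover have "0 \<le> cnorm Comp (embed (s k) \<ominus>\<^bsub>Comp\<^esub> cls s)"
      by (rule LIMSEQ_le_const[OF lim]) (use assms in auto)
    ultimately show ?thesis using \<open>e > 0\<close> by simp
  qed
  then show "\<exists>N. \<forall>k\<ge>N. norm (cnorm Comp (embed (s k) \<ominus>\<^bsub>Comp\<^esub> cls s) - 0) < e" by blast
qed

lemma comp_cstar_algebra: "cstar_algebra Comp"
proof -
  interpret C: cstar_semi Comp "cnorm Comp" by (rule comp_cstar_semi)
  have emb [simp]: "embed a \<in> carrier Comp" if "a \<in> carrier A" for a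
    using that by (simp add: embed_def)
  have emb_diff: "embed a \<ominus>\<^bsub>Comp\<^esub> embed b = embed (a \<ominus> b)" if "a \<in> carrier A" "b \<in> carrier A" for a b
    using that by (simp add: embed_def comp_diff)
  show ?thesis
  proof (rule cstar_algebraI[OF comp_star_alg C.seminorm])
    fix X assume X: "X \<in> carrier Comp" "cnorm Comp X = 0"
    then obtain s where s: "s \<in> CS" "\<forall>n. s n \<in> carrier A" "X = cls s" by (auto elim: compE)
    then show "X = \<zero>\<^bsub>Comp\<^esub>"
      using comp_norm[OF s(1)] X by (auto simp: comp_zero minus_eq equiv_seq_def cls_eq_iff)
  next
    fix X :: "nat \<Rightarrow> (nat \<Rightarrow> 'a) set"
    assume X: "\<And>n. X n \<in> carrier Comp"
      and cauchy: "\<forall>\<epsilon>>0. \<exists>N. \<forall>m\<ge>N. \<forall>n\<ge>N. cnorm Comp (X m \<ominus>\<^bsub>Comp\<^esub> X n) < \<epsilon>"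
    \<comment> \<open>By density the k-th class is within 1/(k+1) of a constant sequence. The chosen
      constants form one Cauchy sequence in A, and its class is the limit.\<close>
    have "\<exists>a\<in>carrier A. cnorm Comp (X k \<ominus>\<^bsub>Comp\<^esub> embed a) < 1 / real (Suc k)" for k
    proof -
      obtain s where s: "s \<in> CS" "\<forall>n. s n \<in> carrier A" "X k = cls s" using X[of k] by (auto elim: compE)
      have "eventually (\<lambda>n. cnorm Comp (embed (s n) \<ominus>\<^bsub>Comp\<^esub> cls s) < 1 / real (Suc k)) sequentially"
        by (rule order_tendstoD(2)[OF embed_conv[OF s(1)]]) simp
      then obtain n where "cnorm Comp (embed (s n) \<ominus>\<^bsub>Comp\<^esub> cls s) < 1 / real (Suc k)"
        by (auto simp: eventually_sequentially)
      then show ?thesis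
        using s X[of k] C.nu_diff_commute[of "embed (s n)" "cls s"] by (intro bexI[of _ "s n"]) auto
    qed
    then obtain a where a: "\<And>k. a k \<in> carrier A"
        and ak: "\<And>k. cnorm Comp (X k \<ominus>\<^bsub>Comp\<^esub> embed (a k)) < 1 / real (Suc k)"
      by metis
    have "a \<in> CS"
      unfolding cauchy_seqs_def
    proof (intro CollectI conjI allI impI a)
      fix e :: real assume e: "e > 0"
      then obtain N where N: "\<forall>m\<ge>N. \<forall>n\<ge>N. cnorm Comp (X m \<ominus>\<^bsub>Comp\<^esub> X n) < e / 3"
        using cauchy[rule_format, of "e / 3"] by auto
      obtain M where M: "1 / real (Suc M) < e / 3"
        using reals_Archimedean[of "e / 3"] e by (auto simp: inverse_eq_divide)
      have "\<nu> (a m \<ominus> a n) < e" if mn: "m \<ge> max N M" "n \<ge> max N M" for m n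
      proof -
        have "1 / real (Suc m) \<le> 1 / real (Suc M)" "1 / real (Suc n) \<le> 1 / real (Suc M)"
          using mn by (simp_all add: field_simps)
        then have "cnorm Comp (X m \<ominus>\<^bsub>Comp\<^esub> embed (a m)) < e / 3" "cnorm Comp (X n \<ominus>\<^bsub>Comp\<^esub> embed (a n)) < e / 3"
          using ak[of m] ak[of n] M by linarith+
        moreover have "cnorm Comp (X m \<ominus>\<^bsub>Comp\<^esub> X n) < e / 3" using N mn by simp
        moreover have "\<nu> (a m \<ominus> a n) = cnorm Comp (embed (a m) \<ominus>\<^bsub>Comp\<^esub> embed (a n))"
          using a by (simp add: emb_diff norm_embed)
        moreover have "\<dots> \<le> cnorm Comp (embed (a m) \<ominus>\<^bsub>Comp\<^esub> X m) + cnorm Comp (X m \<ominus>\<^bsub>Comp\<^esub> embed (a n))"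
          "cnorm Comp (X m \<ominus>\<^bsub>Comp\<^esub> embed (a n)) \<le> cnorm Comp (X m \<ominus>\<^bsub>Comp\<^esub> X n) + cnorm Comp (X n \<ominus>\<^bsub>Comp\<^esub> embed (a n))"
          using a X by (auto intro: C.nu_diff_triangle)
        moreover have "cnorm Comp (embed (a m) \<ominus>\<^bsub>Comp\<^esub> X m) = cnorm Comp (X m \<ominus>\<^bsub>Comp\<^esub> embed (a m))"
          using a X by (simp add: C.nu_diff_commute)
        ultimately show ?thesis by linarith
      qed
      then show "\<exists>N. \<forall>m\<ge>N. \<forall>n\<ge>N. \<nu> (a m \<ominus> a n) < e" by blast
    qed
    show "\<exists>Y\<in>carrier Comp. (\<lambda>n. cnorm Comp (X n \<ominus>\<^bsub>Comp\<^esub> Y)) \<longlonglongrightarrow> 0"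
    proof (rule bexI[of _ "cls a"])
      have "C.conv X (cls a)"
      proof (rule C.convI_bound)
        fix n
        have "cnorm Comp (X n \<ominus>\<^bsub>Comp\<^esub> cls a)
          \<le> cnorm Comp (X n \<ominus>\<^bsub>Comp\<^esub> embed (a n)) + cnorm Comp (embed (a n) \<ominus>\<^bsub>Comp\<^esub> cls a)"
          using a X \<open>a \<in> CS\<close> by (intro C.nu_diff_triangle) auto
        then show "cnorm Comp (X n \<ominus>\<^bsub>Comp\<^esub> cls a)
          \<le> 1 / real (Suc n) + cnorm Comp (embed (a n) \<ominus>\<^bsub>Comp\<^esub> cls a)"
          using ak[of n] by simp
        have "(\<lambda>n. 1 / real (Suc n)) \<longlonglongrightarrow> 0" by (rule LIMSEQ_Suc[OF lim_1_over_n])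
        then show "(\<lambda>n. 1 / real (Suc n) + cnorm Comp (embed (a n) \<ominus>\<^bsub>Comp\<^esub> cls a)) \<longlonglongrightarrow> 0"
          by (rule tendsto_add_zero) (rule embed_conv[OF \<open>a \<in> CS\<close>])
      qed (use X \<open>a \<in> CS\<close> in auto)
      then show "(\<lambda>n. cnorm Comp (X n \<ominus>\<^bsub>Comp\<^esub> cls a)) \<longlonglongrightarrow> 0" by (simp add: C.conv_def)
    qed (use \<open>a \<in> CS\<close> in simp)
  qed
qed

end

section \<open>Bounded operators on \<open>\<ell>\<^sup>2(X)\<close>\<close>

lemma ell2_zero_outside: "f \<in> ell2 X \<Longrightarrow> x \<notin> X \<Longrightarrow> f x = 0"
  by (simp add: ell2_def)

lemma ell2_summable: "f \<in> ell2 X \<Longrightarrow> (\<lambda>x. (cmod (f x))\<^sup>2) summable_on X"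
  by (simp add: ell2_def)

lemma ell2_norm_nonneg [simp]: "0 \<le> ell2_norm X f"
  by (simp add: ell2_norm_def infsum_nonneg)

lemma ell2_norm_square: "(ell2_norm X f)\<^sup>2 = infsum (\<lambda>x. (cmod (f x))\<^sup>2) X"
  by (simp add: ell2_norm_def infsum_nonneg)

text \<open>Since the squared moduli are nonnegative, uniform bounds on finite sets give summability
  and the norm bound together. This lets the finite-dimensional inequalities for
  \<open>L2_set\<close> carry over.\<close>

lemma ell2I:
  assumes "\<And>x. x \<notin> X \<Longrightarrow> f x = 0" "C \<ge> 0"
    and bd: "\<And>F. \<lbrakk>finite F; F \<subseteq> X\<rbrakk> \<Longrightarrow> L2_set (\<lambda>x. cmod (f x)) F \<le> C"
  shows "f \<in> ell2 X" "ell2_norm X f \<le> C"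
proof -
  have bd': "(\<Sum>x\<in>F. (cmod (f x))\<^sup>2) \<le> C\<^sup>2" if "finite F" "F \<subseteq> X" for F
    using power_mono[OF bd[OF that], of 2] by (simp add: L2_set_def sum_nonneg)
  have summable: "(\<lambda>x. (cmod (f x))\<^sup>2) summable_on X"
    by (rule nonneg_bdd_above_summable_on) (auto intro!: bdd_aboveI2[where M = "C\<^sup>2"] bd')
  then show "f \<in> ell2 X" using assms by (simp add: ell2_def)
  have "(ell2_norm X f)\<^sup>2 \<le> C\<^sup>2"
    unfolding ell2_norm_square using summable bd' by (rule infsum_le_finite_sums)
  then show "ell2_norm X f \<le> C"
    using \<open>C \<ge> 0\<close> by (simp add: power2_le_iff_abs_le)
qed

lemma L2_set_le_ell2_norm:
  assumes "f \<in> ell2 X" "finite F" "F \<subseteq> X"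
  shows "L2_set (\<lambda>x. cmod (f x)) F \<le> ell2_norm X f"
  unfolding L2_set_def ell2_norm_def
  by (intro real_sqrt_le_mono finite_sum_le_infsum) (use assms ell2_summable in auto)

lemma ell2_add:
  assumes "f \<in> ell2 X" "g \<in> ell2 X"
  shows "(\<lambda>x. f x + g x) \<in> ell2 X"
    and "ell2_norm X (\<lambda>x. f x + g x) \<le> ell2_norm X f + ell2_norm X g"
proof -
  have bd: "L2_set (\<lambda>x. cmod (f x + g x)) F \<le> ell2_norm X f + ell2_norm X g"
    if "finite F" "F \<subseteq> X" for F
  proof -
    have "L2_set (\<lambda>x. cmod (f x + g x)) F \<le> L2_set (\<lambda>x. cmod (f x) + cmod (g x)) F"
      by (rule L2_set_mono) (auto intro: norm_triangle_ineq)
    also have "\<dots> \<le> L2_set (\<lambda>x. cmod (f x)) F + L2_set (\<lambda>x. cmod (g x)) F"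
      by (rule L2_set_triangle_ineq)
    also have "\<dots> \<le> ell2_norm X f + ell2_norm X g"
      using assms that by (intro add_mono L2_set_le_ell2_norm)
    finally show ?thesis .
  qed
  show "(\<lambda>x. f x + g x) \<in> ell2 X" "ell2_norm X (\<lambda>x. f x + g x) \<le> ell2_norm X f + ell2_norm X g"
    by (rule ell2I; use assms bd in \<open>auto simp: ell2_zero_outside\<close>)+
qed

lemma ell2_zero [simp]: "(\<lambda>x. 0) \<in> ell2 X" "ell2_norm X (\<lambda>x. 0) = 0"
  by (simp_all add: ell2_def ell2_norm_def)

lemma ell2_scale:
  assumes "f \<in> ell2 X"
  shows "(\<lambda>x. c * f x) \<in> ell2 X" "ell2_norm X (\<lambda>x. c * f x) = cmod c * ell2_norm X f"
proof -
  show "(\<lambda>x. c * f x) \<in> ell2 X"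
    using assms by (auto simp: ell2_def norm_mult power_mult_distrib intro: summable_on_cmult_right)
  show "ell2_norm X (\<lambda>x. c * f x) = cmod c * ell2_norm X f"
    by (simp add: ell2_norm_def norm_mult power_mult_distrib infsum_cmult_right' real_sqrt_mult)
qed

lemma ell2_diff:
  assumes "f \<in> ell2 X" "g \<in> ell2 X" shows "(\<lambda>x. f x - g x) \<in> ell2 X"
  using ell2_add(1)[OF assms(1) ell2_scale(1)[OF assms(2), of "- 1"]] by simp

lemma ell2_norm_eq_zero:
  assumes "f \<in> ell2 X" "ell2_norm X f = 0" shows "f = (\<lambda>x. 0)"
proof
  fix x
  show "f x = 0"
  proof (cases "x \<in> X")
    case True
    then show ?thesis using L2_set_le_ell2_norm[OF assms(1), of "{x}"] assms(2) by simp
  qed (use ell2_zero_outside[OF assms(1)] in simp)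
qed

lemma ell2_inner_abs_summable:
  assumes "f \<in> ell2 X" "g \<in> ell2 X"
  shows "(\<lambda>x. norm (f x * cnj (g x))) summable_on X"
    "infsum (\<lambda>x. norm (f x * cnj (g x))) X \<le> ell2_norm X f * ell2_norm X g"
proof -
  have bd: "(\<Sum>x\<in>F. norm (f x * cnj (g x))) \<le> ell2_norm X f * ell2_norm X g"
    if "finite F" "F \<subseteq> X" for F
  proof -
    have "(\<Sum>x\<in>F. norm (f x * cnj (g x))) = (\<Sum>x\<in>F. \<bar>cmod (f x)\<bar> * \<bar>cmod (g x)\<bar>)"
      by (simp add: norm_mult)
    also have "\<dots> \<le> L2_set (\<lambda>x. cmod (f x)) F * L2_set (\<lambda>x. cmod (g x)) F"
      by (rule L2_set_mult_ineq)
    also have "\<dots> \<le> ell2_norm X f * ell2_norm X g"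
      using assms that by (intro mult_mono L2_set_le_ell2_norm) auto
    finally show ?thesis .
  qed
  show s: "(\<lambda>x. norm (f x * cnj (g x))) summable_on X"
    by (rule nonneg_bdd_above_summable_on)
      (auto intro!: bdd_aboveI2[where M = "ell2_norm X f * ell2_norm X g"] bd)
  show "infsum (\<lambda>x. norm (f x * cnj (g x))) X \<le> ell2_norm X f * ell2_norm X g"
    using s bd by (rule infsum_le_finite_sums)
qed

lemma ell2_inner_summable:
  "\<lbrakk>f \<in> ell2 X; g \<in> ell2 X\<rbrakk> \<Longrightarrow> (\<lambda>x. f x * cnj (g x)) summable_on X"
  by (rule abs_summable_summable) (rule ell2_inner_abs_summable(1))

lemma ell2_Cauchy_Schwarz:
  assumes "f \<in> ell2 X" "g \<in> ell2 X"
  shows "cmod (ell2_inner X f g) \<le> ell2_norm X f * ell2_norm X g"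
  unfolding ell2_inner_def
  using norm_infsum_bound[of "\<lambda>x. f x * cnj (g x)" X] ell2_inner_abs_summable[OF assms]
  by (meson order_trans)

lemma ell2_inner_commute: "cnj (ell2_inner X f g) = ell2_inner X g f"
  unfolding ell2_inner_def by (simp add: infsum_cnj[symmetric] mult.commute del: infsum_cnj)

lemma ell2_inner_self:
  assumes "f \<in> ell2 X" shows "ell2_inner X f f = complex_of_real ((ell2_norm X f)\<^sup>2)"
proof -
  have "infsum (\<lambda>x. complex_of_real ((cmod (f x))\<^sup>2)) X = complex_of_real (infsum (\<lambda>x. (cmod (f x))\<^sup>2) X)"
    by (rule infsumI, rule has_sum_bounded_linear[OF bounded_linear_of_real])
      (rule has_sum_infsum[OF ell2_summable[OF assms]])
  then show ?thesis
    unfolding ell2_inner_def ell2_norm_square by (simp only: complex_norm_square)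
qed

lemma ell2_inner_add_left:
  "\<lbrakk>f \<in> ell2 X; f' \<in> ell2 X; g \<in> ell2 X\<rbrakk>
    \<Longrightarrow> ell2_inner X (\<lambda>x. f x + f' x) g = ell2_inner X f g + ell2_inner X f' g"
  by (simp add: ell2_inner_def distrib_right infsum_add ell2_inner_summable)

lemma ell2_inner_scale_left: "ell2_inner X (\<lambda>x. c * f x) g = c * ell2_inner X f g"
  by (simp add: ell2_inner_def mult.assoc infsum_cmult_right')

lemma ell2_inner_add_right:
  "\<lbrakk>f \<in> ell2 X; f' \<in> ell2 X; g \<in> ell2 X\<rbrakk>
    \<Longrightarrow> ell2_inner X g (\<lambda>x. f x + f' x) = ell2_inner X g f + ell2_inner X g f'"
  using arg_cong[OF ell2_inner_add_left[of f X f' g], of cnj] by (simp add: ell2_inner_commute)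

lemma ell2_inner_scale_right: "ell2_inner X g (\<lambda>x. c * f x) = cnj c * ell2_inner X g f"
  using arg_cong[OF ell2_inner_scale_left[of X c f g], of cnj] by (simp add: ell2_inner_commute)

lemma ell2_inner_diff_left:
  "\<lbrakk>f \<in> ell2 X; f' \<in> ell2 X; g \<in> ell2 X\<rbrakk>
    \<Longrightarrow> ell2_inner X (\<lambda>x. f x - f' x) g = ell2_inner X f g - ell2_inner X f' g"
  using ell2_inner_add_left[of f X "\<lambda>x. (- 1) * f' x" g] ell2_scale[of f' X "- 1"]
    ell2_inner_scale_left[of X "- 1" f' g] by simp

lemma delta_ell2 [simp]: "x \<in> X \<Longrightarrow> delta x \<in> ell2 X"
  unfolding ell2_def delta_def
  by (auto intro!: finite_nonzero_values_imp_summable_on finite_subset[of _ "{x}"] split: if_splits)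

lemma ell2_inner_delta_right: assumes "x \<in> X" shows "ell2_inner X f (delta x) = f x"
proof -
  have "ell2_inner X f (delta x) = infsum (\<lambda>y. f y * cnj (delta x y)) {x}"
    unfolding ell2_inner_def
    by (rule infsum_cong_neutral) (use assms in \<open>auto simp: delta_def\<close>)
  then show ?thesis by (simp add: delta_def)
qed

lemma ell2_inner_delta_left: "x \<in> X \<Longrightarrow> ell2_inner X (delta x) f = cnj (f x)"
  using arg_cong[OF ell2_inner_delta_right[of x X f], of cnj] by (simp add: ell2_inner_commute)

lemma ell2_norm_delta: assumes "x \<in> X" shows "ell2_norm X (delta x) = 1"
proof -
  have "complex_of_real ((ell2_norm X (delta x))\<^sup>2) = delta x x"
    unfolding ell2_inner_self[OF delta_ell2[OF assms], symmetric] by (rule ell2_inner_delta_right[OF assms])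
  also have "\<dots> = 1" by (simp add: delta_def)
  finally have "(ell2_norm X (delta x))\<^sup>2 = 1" by (simp only: of_real_eq_1_iff)
  then show ?thesis using ell2_norm_nonneg[of X "delta x"] unfolding power2_eq_1_iff by linarith
qed

lemma ell2_truncate:
  assumes f: "f \<in> ell2 X" and "e > 0"
  obtains F where "finite F" "F \<subseteq> X" "(\<lambda>x. if x \<in> F then f x else 0) \<in> ell2 X"
    "ell2_norm X (\<lambda>x. f x - (if x \<in> F then f x else 0)) \<le> e"
proof -
  obtain F where F: "finite F" "F \<subseteq> X"
      "dist (\<Sum>x\<in>F. (cmod (f x))\<^sup>2) (infsum (\<lambda>x. (cmod (f x))\<^sup>2) X) \<le> e\<^sup>2"
    using infsum_finite_approximation[OF ell2_summable[OF f], of "e\<^sup>2"] \<open>e > 0\<close> by auto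
  define g where "g = (\<lambda>x. if x \<in> F then f x else 0)"
  have bd: "L2_set (\<lambda>x. cmod (f x - g x)) F' \<le> e" if F': "finite F'" "F' \<subseteq> X" for F'
  proof -
    have "(\<Sum>x\<in>F'. (cmod (f x - g x))\<^sup>2) = (\<Sum>x\<in>F' - F. (cmod (f x))\<^sup>2)"
      by (rule sum.mono_neutral_cong_right) (use F' in \<open>auto simp: g_def\<close>)
    also have "\<dots> = (\<Sum>x\<in>F' \<union> F. (cmod (f x))\<^sup>2) - (\<Sum>x\<in>F. (cmod (f x))\<^sup>2)"
      using F F' sum_diff[of "F' \<union> F" F "\<lambda>x. (cmod (f x))\<^sup>2"] by (simp add: Un_Diff)
    also have "(\<Sum>x\<in>F' \<union> F. (cmod (f x))\<^sup>2) \<le> infsum (\<lambda>x. (cmod (f x))\<^sup>2) X"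
      using F F' by (intro finite_sum_le_infsum ell2_summable f) auto
    finally have "(\<Sum>x\<in>F'. (cmod (f x - g x))\<^sup>2) \<le> e\<^sup>2"
      using F(3) by (simp add: dist_real_def)
    then show ?thesis
      using \<open>e > 0\<close> real_sqrt_le_mono[of _ "e\<^sup>2"] unfolding L2_set_def by fastforce
  qed
  have "(\<lambda>x. f x - g x) \<in> ell2 X" "ell2_norm X (\<lambda>x. f x - g x) \<le> e"
    by (rule ell2I; use bd \<open>e > 0\<close> F(2) in \<open>auto simp: g_def ell2_zero_outside[OF f]\<close>)+
  moreover have "g \<in> ell2 X"
    using ell2_diff[OF f \<open>(\<lambda>x. f x - g x) \<in> ell2 X\<close>] by simp
  ultimately show thesis using that[of F] F by (simp add: g_def)
qed

section \<open>The C*-algebra of bounded operators: norm, adjoint, completeness\<close>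

context
  fixes X :: "'x set"
begin

abbreviation "BO \<equiv> bounded_ops X"
abbreviation "BB \<equiv> B_ell2 X"
abbreviation "NN \<equiv> ell2_norm X"

lemma bo_ell2 [simp]: "T \<in> BO \<Longrightarrow> f \<in> ell2 X \<Longrightarrow> T f \<in> ell2 X"
  and bo_outside: "T \<in> BO \<Longrightarrow> f \<notin> ell2 X \<Longrightarrow> T f = (\<lambda>x. 0)"
  and bo_add: "T \<in> BO \<Longrightarrow> f \<in> ell2 X \<Longrightarrow> g \<in> ell2 X \<Longrightarrow> T (\<lambda>x. f x + g x) = (\<lambda>x. T f x + T g x)"
  and bo_scale: "T \<in> BO \<Longrightarrow> f \<in> ell2 X \<Longrightarrow> T (\<lambda>x. c * f x) = (\<lambda>x. c * T f x)"
  and bo_bound: "T \<in> BO \<Longrightarrow> \<exists>C. \<forall>f\<in>ell2 X. NN (T f) \<le> C * NN f"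
  unfolding bounded_ops_def by blast+

lemma boI:
  assumes "\<And>f. f \<in> ell2 X \<Longrightarrow> T f \<in> ell2 X" "\<And>f. f \<notin> ell2 X \<Longrightarrow> T f = (\<lambda>x. 0)"
    "\<And>f g. f \<in> ell2 X \<Longrightarrow> g \<in> ell2 X \<Longrightarrow> T (\<lambda>x. f x + g x) = (\<lambda>x. T f x + T g x)"
    "\<And>c f. f \<in> ell2 X \<Longrightarrow> T (\<lambda>x. c * f x) = (\<lambda>x. c * T f x)"
    "\<And>f. f \<in> ell2 X \<Longrightarrow> NN (T f) \<le> C * NN f"
  shows "T \<in> BO"
  unfolding bounded_ops_def using assms by blast

lemma bo_zero_vec [simp]: "T \<in> BO \<Longrightarrow> T (\<lambda>x. 0) = (\<lambda>x. 0)"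
  using bo_scale[of T "\<lambda>x. 0" 0] by simp

lemma bo_diff:
  "T \<in> BO \<Longrightarrow> f \<in> ell2 X \<Longrightarrow> g \<in> ell2 X \<Longrightarrow> T (\<lambda>x. f x - g x) = (\<lambda>x. T f x - T g x)"
  using bo_add[of T f "\<lambda>x. (- 1) * g x"] bo_scale[of T g "- 1"] ell2_scale(1)[of g X "- 1"] by simp

lemma bo_eqI:
  assumes "S \<in> BO" "T \<in> BO" "\<And>f. f \<in> ell2 X \<Longrightarrow> S f = T f" shows "S = T"
proof
  fix f show "S f = T f"
    using assms bo_outside[of S f] bo_outside[of T f] by (cases "f \<in> ell2 X") auto
qed

lemma bo_range: "T \<in> BO \<Longrightarrow> T f \<in> ell2 X"
  using bo_outside[of T f] by (cases "f \<in> ell2 X") auto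

lemma B_simps: "carrier BB = BO" "mult BB S T = S \<circ> T" "\<one>\<^bsub>BB\<^esub> = (\<lambda>f. if f \<in> ell2 X then f else (\<lambda>x. 0))"
  "\<zero>\<^bsub>BB\<^esub> = (\<lambda>f x. 0)" "add BB S T = (\<lambda>f x. S f x + T f x)" "smult BB c T = (\<lambda>f x. c * T f x)"
  "adj BB T = (THE S. S \<in> BO \<and> (\<forall>f\<in>ell2 X. \<forall>g\<in>ell2 X. ell2_inner X (T f) g = ell2_inner X f (S g)))"
  "cnorm BB T = Sup {NN (T f) | f. f \<in> ell2 X \<and> NN f \<le> 1}"
  by (simp_all add: B_ell2_def)

lemma op_norm_bdd:
  assumes "T \<in> BO" shows "bdd_above {NN (T f) | f. f \<in> ell2 X \<and> NN f \<le> 1}"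
proof -
  obtain C where C: "\<And>f. f \<in> ell2 X \<Longrightarrow> NN (T f) \<le> C * NN f" using bo_bound[OF assms] by blast
  have "NN (T f) \<le> \<bar>C\<bar>" if "f \<in> ell2 X" "NN f \<le> 1" for f
  proof -
    have "C * NN f \<le> \<bar>C\<bar> * NN f" by (intro mult_right_mono) auto
    also have "\<dots> \<le> \<bar>C\<bar> * 1" using that by (intro mult_left_mono) auto
    finally show ?thesis using C[OF that(1)] by simp
  qed
  then show ?thesis by (auto intro!: bdd_aboveI[where M = "\<bar>C\<bar>"])
qed

lemma op_norm_le_one: "\<lbrakk>T \<in> BO; f \<in> ell2 X; NN f \<le> 1\<rbrakk> \<Longrightarrow> NN (T f) \<le> cnorm BB T"
  unfolding B_simps by (rule cSup_upper[OF _ op_norm_bdd]) auto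

lemma op_norm_nonneg: "T \<in> BO \<Longrightarrow> 0 \<le> cnorm BB T"
  using op_norm_le_one[of T "\<lambda>x. 0"] by simp

lemma op_norm_apply:
  assumes "T \<in> BO" "f \<in> ell2 X" shows "NN (T f) \<le> cnorm BB T * NN f"
proof (cases "NN f = 0")
  case True
  then have "f = (\<lambda>x. 0)" using assms ell2_norm_eq_zero by blast
  then show ?thesis using assms by simp
next
  case False
  then have pos: "0 < NN f" using ell2_norm_nonneg[of X f] by linarith
  define c where "c = complex_of_real (1 / NN f)"
  have nc: "cmod c = 1 / NN f" using pos by (simp add: c_def norm_divide)
  have "NN (T (\<lambda>x. c * f x)) \<le> cnorm BB T"
    using assms pos by (intro op_norm_le_one ell2_scale) (auto simp: ell2_scale nc)
  then have "(1 / NN f) * NN (T f) \<le> cnorm BB T"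
    using assms pos by (simp add: bo_scale ell2_scale nc)
  then show ?thesis using pos by (simp add: field_simps)
qed

lemma op_norm_leI:
  assumes "C \<ge> 0" "\<And>f. f \<in> ell2 X \<Longrightarrow> NN (T f) \<le> C * NN f"
  shows "cnorm BB T \<le> C"
  unfolding B_simps
proof (rule cSup_least)
  show "{NN (T f) |f. f \<in> ell2 X \<and> NN f \<le> 1} \<noteq> {}"
  proof -
    have "(\<lambda>x. 0) \<in> ell2 X \<and> NN (\<lambda>x. 0) \<le> 1" by simp
    then show ?thesis by blast
  qed
  fix r assume "r \<in> {NN (T f) |f. f \<in> ell2 X \<and> NN f \<le> 1}"
  then obtain f where f: "r = NN (T f)" "f \<in> ell2 X" "NN f \<le> 1" by blast
  then show "r \<le> C" using assms(2)[of f] mult_left_mono[of "NN f" 1 C] assms(1) by simp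
qed

lemma bo_zero: "(\<lambda>f x. 0) \<in> BO"
  by (rule boI[where C = 0]) auto

lemma bo_one: "(\<lambda>f. if f \<in> ell2 X then f else (\<lambda>x. 0)) \<in> BO"
  by (rule boI[where C = 1]) (auto simp: ell2_add ell2_scale)

lemma bo_comp: assumes "S \<in> BO" "T \<in> BO" shows "S \<circ> T \<in> BO"
proof (rule boI)
  fix f assume f: "f \<in> ell2 X"
  have "NN (S (T f)) \<le> cnorm BB S * NN (T f)" using assms f by (simp add: op_norm_apply)
  also have "\<dots> \<le> cnorm BB S * (cnorm BB T * NN f)"
    using assms f by (intro mult_left_mono op_norm_apply op_norm_nonneg)
  finally show "NN ((S \<circ> T) f) \<le> (cnorm BB S * cnorm BB T) * NN f" by (simp add: mult.assoc)
qed (use assms in \<open>auto simp: bo_add bo_scale bo_outside\<close>)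

lemma bo_plus: assumes "S \<in> BO" "T \<in> BO" shows "(\<lambda>f x. S f x + T f x) \<in> BO"
proof (rule boI)
  fix f assume f: "f \<in> ell2 X"
  have "NN (\<lambda>x. S f x + T f x) \<le> NN (S f) + NN (T f)" using assms f by (simp add: ell2_add)
  also have "\<dots> \<le> cnorm BB S * NN f + cnorm BB T * NN f"
    using assms f by (intro add_mono op_norm_apply)
  finally show "NN (\<lambda>x. S f x + T f x) \<le> (cnorm BB S + cnorm BB T) * NN f" by (simp add: distrib_right)
qed (use assms in \<open>auto simp: bo_add bo_scale bo_outside ell2_add algebra_simps\<close>)

lemma bo_smult: assumes "T \<in> BO" shows "(\<lambda>f x. c * T f x) \<in> BO"
proof (rule boI)
  fix f assume f: "f \<in> ell2 X"
  show "NN (\<lambda>x. c * T f x) \<le> (cmod c * cnorm BB T) * NN f"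
    using assms f op_norm_apply[OF assms f] by (simp add: ell2_scale mult.assoc mult_left_mono)
qed (use assms in \<open>auto simp: bo_add bo_scale bo_outside ell2_scale algebra_simps\<close>)

lemma bo_sum_delta:
  assumes "T \<in> BO" "finite F" "F \<subseteq> X" "g \<in> ell2 X"
  shows "(\<lambda>x. if x \<in> F then a x else 0) \<in> ell2 X"
    "ell2_inner X (T (\<lambda>x. if x \<in> F then a x else 0)) g = (\<Sum>x\<in>F. a x * ell2_inner X (T (delta x)) g)"
  using assms(2,3)
proof (induction F rule: finite_induct)
  case empty
  { case 1 show ?case by simp next case 2 show ?case using assms by (simp add: ell2_inner_def) }
next
  case (insert y F)
  have eq: "(\<lambda>x. if x \<in> insert y F then a x else 0)
     = (\<lambda>x. (if x \<in> F then a x else 0) + a y * delta y x)"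
    using insert(2) by (auto simp: delta_def)
  have e: "(\<lambda>x. if x \<in> F then a x else 0) \<in> ell2 X" if "insert y F \<subseteq> X" using insert that by simp
  { case 1 then show ?case unfolding eq using e by (intro ell2_add ell2_scale) auto
  next
    case 2
    then have y: "y \<in> X" by simp
    note d = ell2_scale(1)[OF delta_ell2[OF y], of "a y"]
    show ?case unfolding eq bo_add[OF assms(1) e[OF 2] d] bo_scale[OF assms(1) delta_ell2[OF y]]
      using assms insert e[OF 2] 2 y
      by (simp add: ell2_scale ell2_inner_add_left ell2_inner_scale_left) }
qed

text \<open>The adjoint is given by its coordinates, the inner products of g with the images of the
  basis vectors. The norm bound is kept in the statement because the C*-identity for operators needs
  it.\<close>

lemma adjoint_exists:
  assumes T: "T \<in> BO"
  shows "\<exists>S\<in>BO. (\<forall>f\<in>ell2 X. \<forall>g\<in>ell2 X. ell2_inner X (T f) g = ell2_inner X f (S g))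
    \<and> (\<forall>f\<in>ell2 X. NN (S f) \<le> cnorm BB T * NN f)"
proof -
  define S where "S g = (\<lambda>x. if g \<in> ell2 X \<and> x \<in> X then ell2_inner X g (T (delta x)) else 0)" for g
  \<comment> \<open>Test T on the finite vector f that agrees with \<open>S g\<close> on F: the
    squared norm of f is the inner product of \<open>T f\<close> with g, hence at most the product
    of the norms of T, f and g. Cancelling the norm of f gives the bound.\<close>
  have Sbd: "L2_set (\<lambda>x. cmod (S g x)) F \<le> cnorm BB T * NN g"
    if g: "g \<in> ell2 X" and F: "finite F" "F \<subseteq> X" for g F
  proof -
    define f where "f = (\<lambda>x. if x \<in> F then S g x else 0)"
    have f: "f \<in> ell2 X" unfolding f_def by (rule bo_sum_delta[OF T F g])
    have S_eq: "S g x = cnj (ell2_inner X (T (delta x)) g)" if "x \<in> F" for x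
      using that F g by (auto simp: S_def ell2_inner_commute)
    have "ell2_inner X (T f) g = (\<Sum>x\<in>F. S g x * ell2_inner X (T (delta x)) g)"
      unfolding f_def by (rule bo_sum_delta[OF T F g])
    also have "\<dots> = (\<Sum>x\<in>F. S g x * cnj (S g x))"
      by (intro sum.cong) (auto simp: S_eq)
    also have "\<dots> = complex_of_real (\<Sum>x\<in>F. (cmod (S g x))\<^sup>2)"
      by (simp only: of_real_sum complex_norm_square)
    finally have "(\<Sum>x\<in>F. (cmod (S g x))\<^sup>2) = cmod (ell2_inner X (T f) g)"
      by (simp add: sum_nonneg del: of_real_sum)
    also have "\<dots> \<le> NN (T f) * NN g" using T f g by (simp add: ell2_Cauchy_Schwarz)
    also have "\<dots> \<le> (cnorm BB T * NN f) * NN g" using T f by (intro mult_right_mono op_norm_apply) auto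
    also have "NN f = L2_set (\<lambda>x. cmod (S g x)) F"
    proof -
      have "infsum (\<lambda>x. (cmod (f x))\<^sup>2) X = infsum (\<lambda>x. (cmod (S g x))\<^sup>2) F"
        by (rule infsum_cong_neutral) (use F in \<open>auto simp: f_def\<close>)
      then show ?thesis using F by (simp add: ell2_norm_def L2_set_def)
    qed
    also have "(\<Sum>x\<in>F. (cmod (S g x))\<^sup>2) = (L2_set (\<lambda>x. cmod (S g x)) F)\<^sup>2"
      by (simp add: L2_set_def sum_nonneg)
    finally have "L2_set (\<lambda>x. cmod (S g x)) F * L2_set (\<lambda>x. cmod (S g x)) F
      \<le> (cnorm BB T * NN g) * L2_set (\<lambda>x. cmod (S g x)) F"
      by (simp add: power2_eq_square algebra_simps)
    then show ?thesis
      using L2_set_nonneg[of "\<lambda>x. cmod (S g x)" F] op_norm_nonneg[OF T]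
      by (cases "L2_set (\<lambda>x. cmod (S g x)) F = 0") auto
  qed
  have S_ell2: "S g \<in> ell2 X" and S_norm: "NN (S g) \<le> cnorm BB T * NN g" if "g \<in> ell2 X" for g
    by (rule ell2I[where C = "cnorm BB T * NN g"]; use that Sbd op_norm_nonneg[OF T] in \<open>auto simp: S_def\<close>)+
  have S_bo: "S \<in> BO"
  proof (rule boI)
    show "S (\<lambda>x. f x + g x) = (\<lambda>x. S f x + S g x)" if "f \<in> ell2 X" "g \<in> ell2 X" for f g
      using that T by (auto simp: S_def ell2_add ell2_inner_add_left)
    show "S (\<lambda>x. c * f x) = (\<lambda>x. c * S f x)" if "f \<in> ell2 X" for c f
      using that T by (auto simp: S_def ell2_scale ell2_inner_scale_left)
  qed (use S_ell2 S_norm in \<open>auto simp: S_def\<close>)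
  have "ell2_inner X (T f) g = ell2_inner X f (S g)" if f: "f \<in> ell2 X" and g: "g \<in> ell2 X" for f g
  proof -
    \<comment> \<open>Both sides depend continuously on f and agree on finitely supported vectors. C
      is the sum of the two Lipschitz constants, so truncating f up to e costs at most C times
      e.\<close>
    define C where "C = cnorm BB T * NN g + NN (S g)"
    have C: "C \<ge> 0" using op_norm_nonneg[OF T] by (simp add: C_def)
    have "cmod (ell2_inner X (T f) g - ell2_inner X f (S g)) \<le> C * e" if e: "e > 0" for e
    proof -
      obtain F where F: "finite F" "F \<subseteq> X" "(\<lambda>x. if x \<in> F then f x else 0) \<in> ell2 X"
        "NN (\<lambda>x. f x - (if x \<in> F then f x else 0)) \<le> e"
        by (rule ell2_truncate[OF f e])
      define f' where "f' = (\<lambda>x. if x \<in> F then f x else 0)"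
      define d where "d = (\<lambda>x. f x - f' x)"
      have f': "f' \<in> ell2 X" and d: "d \<in> ell2 X" and nd: "NN d \<le> e"
        using F f by (auto simp: f'_def d_def intro: ell2_diff)
      have id_bo: "(\<lambda>f. if f \<in> ell2 X then f else (\<lambda>x. 0)) \<in> BO" by (rule bo_one)
      have "ell2_inner X (T f') g = (\<Sum>x\<in>F. f x * ell2_inner X (T (delta x)) g)"
        unfolding f'_def by (rule bo_sum_delta[OF T F(1,2) g])
      also have "\<dots> = (\<Sum>x\<in>F. f x * cnj (S g x))"
        using F g by (intro sum.cong) (auto simp: S_def ell2_inner_commute)
      also have "\<dots> = ell2_inner X f' (S g)"
        using bo_sum_delta(2)[OF id_bo F(1,2) S_ell2[OF g], of f] F
        by (simp add: f'_def subset_iff ell2_inner_delta_left cong: sum.cong)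
      finally have eq: "ell2_inner X (T f') g = ell2_inner X f' (S g)" .
      have "ell2_inner X (T f) g - ell2_inner X f (S g) = ell2_inner X (T d) g - ell2_inner X d (S g)"
        using eq f f' g T S_ell2[OF g] by (simp add: d_def bo_diff ell2_inner_diff_left)
      also have "cmod \<dots> \<le> cmod (ell2_inner X (T d) g) + cmod (ell2_inner X d (S g))"
        by (rule norm_triangle_ineq4)
      also have "\<dots> \<le> NN (T d) * NN g + NN d * NN (S g)"
        using T d g S_ell2[OF g] by (intro add_mono ell2_Cauchy_Schwarz) auto
      also have "\<dots> \<le> (cnorm BB T * NN d) * NN g + NN d * NN (S g)"
        using T d by (intro add_mono mult_right_mono op_norm_apply) auto
      also have "\<dots> = C * NN d" by (simp add: C_def algebra_simps)
      also have "\<dots> \<le> C * e" using C nd by (rule mult_left_mono[rotated])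
      finally show ?thesis .
    qed
    then have "cmod (ell2_inner X (T f) g - ell2_inner X f (S g)) \<le> 0 + e" if "e > 0" for e
      using that C by (cases "C = 0") (force, metis add_0 divide_pos_pos less_eq_real_def nonzero_mult_div_cancel_left times_divide_eq_right)
    then have "cmod (ell2_inner X (T f) g - ell2_inner X f (S g)) \<le> 0" by (rule field_le_epsilon)
    then show ?thesis by simp
  qed
  then show ?thesis using S_bo S_norm by blast
qed

lemma adjoint_unique:
  assumes "S \<in> BO" "S' \<in> BO"
    "\<And>f g. f \<in> ell2 X \<Longrightarrow> g \<in> ell2 X \<Longrightarrow> ell2_inner X f (S g) = ell2_inner X f (S' g)"
  shows "S = S'"
proof (rule bo_eqI[OF assms(1,2)], rule ext)
  fix g x assume g: "g \<in> ell2 X"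
  show "S g x = S' g x"
  proof (cases "x \<in> X")
    case True
    then show ?thesis using assms(3)[of "delta x" g] g by (simp add: ell2_inner_delta_left)
  next
    case False
    then show ?thesis using assms g by (metis bo_ell2 ell2_zero_outside)
  qed
qed

lemma B_adj:
  assumes T: "T \<in> BO"
  shows "adj BB T \<in> BO"
    and "\<And>f g. f \<in> ell2 X \<Longrightarrow> g \<in> ell2 X \<Longrightarrow> ell2_inner X (T f) g = ell2_inner X f (adj BB T g)"
proof -
  have "\<exists>!S. S \<in> BO \<and> (\<forall>f\<in>ell2 X. \<forall>g\<in>ell2 X. ell2_inner X (T f) g = ell2_inner X f (S g))"
    using adjoint_exists[OF T] adjoint_unique by (metis (no_types, lifting))
  from theI'[OF this, folded B_simps(7)]
  show "adj BB T \<in> BO" "\<And>f g. f \<in> ell2 X \<Longrightarrow> g \<in> ell2 X \<Longrightarrow> ell2_inner X (T f) g = ell2_inner X f (adj BB T g)"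
    by auto
qed

lemma B_adj_eqI:
  assumes "T \<in> BO" "S \<in> BO"
    "\<And>f g. f \<in> ell2 X \<Longrightarrow> g \<in> ell2 X \<Longrightarrow> ell2_inner X (T f) g = ell2_inner X f (S g)"
  shows "adj BB T = S"
  by (rule adjoint_unique) (use assms B_adj[OF assms(1)] in auto)

lemma B_adj_norm: assumes T: "T \<in> BO" shows "cnorm BB (adj BB T) \<le> cnorm BB T"
proof -
  obtain S where S: "S \<in> BO" "\<forall>f\<in>ell2 X. \<forall>g\<in>ell2 X. ell2_inner X (T f) g = ell2_inner X f (S g)"
     "\<forall>f\<in>ell2 X. NN (S f) \<le> cnorm BB T * NN f"
    using adjoint_exists[OF T] by blast
  then have "adj BB T = S" using T by (intro B_adj_eqI) auto
  then show ?thesis using S op_norm_nonneg[OF T] by (auto intro: op_norm_leI)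
qed

lemma B_adj_inner':
  assumes "T \<in> BO" "f \<in> ell2 X" "g \<in> ell2 X"
  shows "ell2_inner X (adj BB T f) g = ell2_inner X f (T g)"
  using arg_cong[OF B_adj(2)[OF assms(1,3,2)], of cnj] by (simp add: ell2_inner_commute)

lemma B_star_alg: "star_alg BB"
proof -
  have "abelian_group BB"
  proof (rule abelian_groupI, unfold B_simps)
    fix S assume "S \<in> BO"
    then show "\<exists>T\<in>BO. (\<lambda>f x. T f x + S f x) = (\<lambda>f x. 0)"
      using bo_smult[of S "- 1"] by (intro bexI[of _ "\<lambda>f x. (- 1) * S f x"]) auto
  qed (auto simp: bo_plus bo_zero algebra_simps)
  moreover have "monoid BB"
    by (rule monoidI, unfold B_simps) (auto simp: bo_comp bo_one bo_outside bo_range fun_eq_iff)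
  ultimately have "ring BB"
  proof (rule ringI, unfold B_simps)
    fix S T U assume "S \<in> BO" "T \<in> BO" "U \<in> BO"
    then show "U \<circ> (\<lambda>f x. S f x + T f x) = (\<lambda>f x. (U \<circ> S) f x + (U \<circ> T) f x)"
      using bo_plus[OF bo_comp[of U S] bo_comp[of U T]]
      by (intro bo_eqI) (auto simp: bo_comp bo_plus bo_add)
  qed (auto simp: fun_eq_iff)
  moreover have "star_alg_axioms BB"
  proof (unfold_locales, unfold B_simps(1-6))
    fix S T c assume S: "S \<in> BO" and T: "T \<in> BO"
    show "S \<circ> (\<lambda>f x. c * T f x) = (\<lambda>f x. c * (S \<circ> T) f x)"
      using S T bo_smult[OF bo_comp[OF S T]] by (intro bo_eqI) (auto simp: bo_comp bo_smult bo_scale)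
    show "adj BB (\<lambda>f x. S f x + T f x) = (\<lambda>f x. adj BB S f x + adj BB T f x)"
      using S T by (intro B_adj_eqI)
        (auto simp: bo_plus B_adj ell2_inner_add_left ell2_inner_add_right)
    show "adj BB (S \<circ> T) = adj BB T \<circ> adj BB S"
      using S T by (intro B_adj_eqI) (auto simp: bo_comp B_adj)
  next
    fix T c assume T: "T \<in> BO"
    show "adj BB (adj BB T) = T"
      using T by (intro B_adj_eqI) (auto simp: B_adj(1) B_adj_inner')
    show "adj BB (\<lambda>f x. c * T f x) = (\<lambda>f x. cnj c * adj BB T f x)"
      using T by (intro B_adj_eqI)
        (auto simp: bo_smult B_adj ell2_inner_scale_left ell2_inner_scale_right)
  qed (auto simp: bo_smult B_adj algebra_simps)
  ultimately show ?thesis by (simp add: star_alg_def)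
qed

lemma B_cstar_seminorm: "cstar_seminorm BB (cnorm BB)"
proof -
  have scale_le: "cnorm BB (\<lambda>f x. c * T f x) \<le> cmod c * cnorm BB T" if "T \<in> BO" for c T
    using that op_norm_apply[OF that] op_norm_nonneg[OF that]
    by (intro op_norm_leI) (auto simp: ell2_scale mult.assoc mult_left_mono)
  have scale: "cnorm BB (\<lambda>f x. c * T f x) = cmod c * cnorm BB T" if T: "T \<in> BO" for c T
  proof (cases "c = 0")
    case False
    have "cnorm BB T \<le> cmod (1 / c) * cnorm BB (\<lambda>f x. c * T f x)"
      using scale_le[OF bo_smult[OF T, of c], of "1 / c"] False by simp
    then have "cmod c * cnorm BB T \<le> cnorm BB (\<lambda>f x. c * T f x)"
      using False by (simp add: norm_divide field_simps)
    then show ?thesis using scale_le[OF T, of c] by simp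
  qed (use scale_le[OF T, of 0] op_norm_nonneg[OF bo_zero] in simp)
  have tri: "cnorm BB (\<lambda>f x. S f x + T f x) \<le> cnorm BB S + cnorm BB T" if "S \<in> BO" "T \<in> BO" for S T
  proof (rule op_norm_leI)
    fix f assume f: "f \<in> ell2 X"
    show "NN (\<lambda>x. S f x + T f x) \<le> (cnorm BB S + cnorm BB T) * NN f"
      using ell2_add(2)[of "S f" X "T f"] op_norm_apply[OF that(1) f] op_norm_apply[OF that(2) f] that f
      by (simp add: distrib_right)
  qed (use that op_norm_nonneg in auto)
  have mult: "cnorm BB (S \<circ> T) \<le> cnorm BB S * cnorm BB T" if "S \<in> BO" "T \<in> BO" for S T
  proof (rule op_norm_leI)
    fix f assume f: "f \<in> ell2 X"
    show "NN ((S \<circ> T) f) \<le> (cnorm BB S * cnorm BB T) * NN f"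
      using op_norm_apply[OF that(1), of "T f"] op_norm_nonneg[OF that(1)] that f
        mult_left_mono[OF op_norm_apply[OF that(2) f], of "cnorm BB S"] by (simp add: mult.assoc)
  qed (use that op_norm_nonneg in auto)
  have cst: "cnorm BB (adj BB T \<circ> T) = (cnorm BB T)\<^sup>2" if T: "T \<in> BO" for T
  proof (rule antisym)
    have "cnorm BB (adj BB T) * cnorm BB T \<le> cnorm BB T * cnorm BB T"
      using T by (intro mult_right_mono B_adj_norm op_norm_nonneg)
    then show "cnorm BB (adj BB T \<circ> T) \<le> (cnorm BB T)\<^sup>2"
      using mult[OF B_adj(1)[OF T] T] by (simp add: power2_eq_square)
    define D where "D = cnorm BB (adj BB T \<circ> T)"
    have cb: "adj BB T \<circ> T \<in> BO" using T by (intro bo_comp B_adj)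
    have D: "D \<ge> 0" using op_norm_nonneg[OF cb] by (simp add: D_def)
    have "cnorm BB T \<le> sqrt D"
    proof (rule op_norm_leI)
      fix f assume f: "f \<in> ell2 X"
      have "complex_of_real ((NN (T f))\<^sup>2) = ell2_inner X f ((adj BB T \<circ> T) f)"
        unfolding ell2_inner_self[OF bo_ell2[OF T f], symmetric] using T f by (simp add: B_adj)
      then have "(NN (T f))\<^sup>2 = cmod (ell2_inner X f ((adj BB T \<circ> T) f))"
        by (metis abs_of_nonneg norm_of_real zero_le_power2)
      also have "\<dots> \<le> NN f * NN ((adj BB T \<circ> T) f)" using f cb by (intro ell2_Cauchy_Schwarz) (auto simp del: comp_apply)
      also have "\<dots> \<le> NN f * (D * NN f)"
        unfolding D_def by (rule mult_left_mono[OF op_norm_apply[OF cb f]]) simp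
      also have "\<dots> = (sqrt D * NN f)\<^sup>2" using D by (simp add: power_mult_distrib power2_eq_square)
      finally show "NN (T f) \<le> sqrt D * NN f"
        using D by (simp add: power2_le_iff_abs_le)
    qed (use D in simp)
    then have "(cnorm BB T)\<^sup>2 \<le> (sqrt D)\<^sup>2" using op_norm_nonneg[OF T] by (intro power_mono)
    then show "(cnorm BB T)\<^sup>2 \<le> cnorm BB (adj BB T \<circ> T)" using D by (simp add: D_def)
  qed
  show ?thesis
    unfolding cstar_seminorm_def B_simps(1-6)
    using scale tri mult cst op_norm_nonneg by auto
qed

lemma B_cstar_algebra: "cstar_algebra BB"
proof (rule cstar_algebraI[OF B_star_alg B_cstar_seminorm])
  interpret B: cstar_semi BB "cnorm BB"
    by (simp add: cstar_semi_def cstar_semi_axioms_def B_star_alg B_cstar_seminorm)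
  have minus: "S \<ominus>\<^bsub>BB\<^esub> T = (\<lambda>f x. S f x - T f x)" if "T \<in> BO" for S T
    using that B.uminus_conv_scale[of T] by (simp add: B.minus_eq B_simps)
  {
    fix T assume T: "T \<in> carrier BB" "cnorm BB T = 0"
    show "T = \<zero>\<^bsub>BB\<^esub>"
      unfolding B_simps
    proof (rule bo_eqI)
      fix f assume "f \<in> ell2 X"
      then show "T f = (\<lambda>x. 0)"
        using op_norm_apply[of T f] T ell2_norm_nonneg[of X "T f"]
        by (intro ell2_norm_eq_zero[of _ X]) (auto simp: B_simps(1) simp del: ell2_norm_nonneg)
    qed (use T bo_zero in \<open>auto simp: B_simps\<close>)
  }
  fix S :: "nat \<Rightarrow> ('x \<Rightarrow> complex) \<Rightarrow> 'x \<Rightarrow> complex"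
  assume S: "\<And>n. S n \<in> carrier BB"
    and cauchy: "\<forall>\<epsilon>>0. \<exists>N. \<forall>m\<ge>N. \<forall>n\<ge>N. cnorm BB (S m \<ominus>\<^bsub>BB\<^esub> S n) < \<epsilon>"
  have S' [simp]: "S n \<in> BO" for n using S by (simp add: B_simps)
  have diff_bo: "(\<lambda>f x. S m f x - S n f x) \<in> BO" for m n
    using B.minus_closed[OF S S] minus by (simp add: B_simps(1))
  have diff_le: "NN (\<lambda>x. S m f x - S n f x) \<le> cnorm BB (S m \<ominus>\<^bsub>BB\<^esub> S n) * NN f" if "f \<in> ell2 X" for m n f
    using op_norm_apply[OF diff_bo that] by (simp add: minus)
  have pt: "convergent (\<lambda>n. S n f x)" if f: "f \<in> ell2 X" for f x
  proof (cases "x \<in> X")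
    case True
    have "Cauchy (\<lambda>n. S n f x)"
    proof (rule metric_CauchyI)
      fix e :: real assume e: "e > 0"
      then have "0 < e / (1 + NN f)" by (simp add: add_pos_nonneg)
      then obtain N where N: "\<forall>m\<ge>N. \<forall>n\<ge>N. cnorm BB (S m \<ominus>\<^bsub>BB\<^esub> S n) < e / (1 + NN f)"
        using cauchy by blast
      have "dist (S m f x) (S n f x) < e" if "m \<ge> N" "n \<ge> N" for m n
      proof -
        have "cmod (S m f x - S n f x) \<le> NN (\<lambda>x. S m f x - S n f x)"
          using L2_set_le_ell2_norm[OF ell2_diff[of "S m f" X "S n f"], of "{x}"] f True by simp
        also have "\<dots> \<le> cnorm BB (S m \<ominus>\<^bsub>BB\<^esub> S n) * NN f" by (rule diff_le[OF f])
        also have "\<dots> \<le> (e / (1 + NN f)) * NN f"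
          using N that by (intro mult_right_mono) (auto intro: less_imp_le)
        also have "\<dots> < e" using e by (simp add: field_simps add_pos_nonneg)
        finally show ?thesis by (simp add: dist_norm)
      qed
      then show "\<exists>M. \<forall>m\<ge>M. \<forall>n\<ge>M. dist (S m f x) (S n f x) < e" by blast
    qed
    then show ?thesis by (simp add: Cauchy_convergent_iff)
  next
    case False
    then have "S n f x = 0" for n using f ell2_zero_outside[of "S n f" X x] by simp
    then show ?thesis by (simp add: convergent_const)
  qed
  define T where "T = (\<lambda>f x. if f \<in> ell2 X then lim (\<lambda>n. S n f x) else 0)"
  have lim: "(\<lambda>n. S n f x) \<longlonglongrightarrow> T f x" if "f \<in> ell2 X" for f x
    using pt[OF that] that by (simp add: T_def convergent_LIMSEQ_iff)
  have T_out: "T f x = 0" if "f \<in> ell2 X" "x \<notin> X" for f x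
  proof -
    have "S n f x = 0" for n using that ell2_zero_outside[of "S n f" X x] by simp
    then show ?thesis using LIMSEQ_unique[OF lim[OF that(1)], of x 0] by simp
  qed
  \<comment> \<open>The bound is passed to the coordinatewise limit on finite sets of coordinates
    first and only then to the whole norm, so no limit is exchanged with an infinite sum.\<close>
  have close: "(\<lambda>x. S n f x - T f x) \<in> ell2 X \<and> NN (\<lambda>x. S n f x - T f x) \<le> e * NN f"
    if f: "f \<in> ell2 X" and e: "e > 0" and N: "\<forall>m\<ge>N. \<forall>n\<ge>N. cnorm BB (S m \<ominus>\<^bsub>BB\<^esub> S n) < e" and n: "n \<ge> N"
    for f e N n
  proof -
    have bd: "L2_set (\<lambda>x. cmod (S n f x - T f x)) F \<le> e * NN f" if F: "finite F" "F \<subseteq> X" for F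
    proof (rule LIMSEQ_le_const2)
      show "(\<lambda>m. L2_set (\<lambda>x. cmod (S n f x - S m f x)) F) \<longlonglongrightarrow> L2_set (\<lambda>x. cmod (S n f x - T f x)) F"
        unfolding L2_set_def by (intro tendsto_intros lim f)
      have "L2_set (\<lambda>x. cmod (S n f x - S m f x)) F \<le> e * NN f" if "m \<ge> N" for m
      proof -
        have "L2_set (\<lambda>x. cmod (S n f x - S m f x)) F \<le> NN (\<lambda>x. S n f x - S m f x)"
          using f F by (intro L2_set_le_ell2_norm ell2_diff) auto
        also have "\<dots> \<le> cnorm BB (S n \<ominus>\<^bsub>BB\<^esub> S m) * NN f" by (rule diff_le[OF f])
        also have "\<dots> \<le> e * NN f" using N n that by (intro mult_right_mono) (auto intro: less_imp_le)
        finally show ?thesis .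
      qed
      then show "\<exists>N. \<forall>m\<ge>N. L2_set (\<lambda>x. cmod (S n f x - S m f x)) F \<le> e * NN f" by blast
    qed
    have out: "S n f x - T f x = 0" if "x \<notin> X" for x
      using that f T_out[OF f that] ell2_zero_outside[of "S n f" X x] by simp
    show ?thesis
      using ell2I[of X "\<lambda>x. S n f x - T f x" "e * NN f"] out bd e by auto
  qed
  obtain N1 where N1: "\<forall>m\<ge>N1. \<forall>n\<ge>N1. cnorm BB (S m \<ominus>\<^bsub>BB\<^esub> S n) < 1"
    using cauchy zero_less_one by blast
  have T_bo: "T \<in> BO"
  proof (rule boI)
    fix f assume f: "f \<in> ell2 X"
    note c = close[OF f zero_less_one N1 order_refl]
    \<comment> \<open>Boundedness of the limit T is read off from T = S - (S - T) for one late
      member S of the sequence, with the difference bounded by 1.\<close>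
    have eq: "T f = (\<lambda>x. S N1 f x + (- 1) * (S N1 f x - T f x))" by (simp add: fun_eq_iff)
    show "T f \<in> ell2 X" by (subst eq, intro ell2_add ell2_scale) (use c f in auto)
    have "NN (T f) \<le> NN (S N1 f) + NN (\<lambda>x. (- 1) * (S N1 f x - T f x))"
      by (subst eq, intro ell2_add ell2_scale) (use c f in auto)
    also have "\<dots> \<le> cnorm BB (S N1) * NN f + 1 * NN f"
      using ell2_scale(2)[of "\<lambda>x. S N1 f x - T f x" X "- 1"] c op_norm_apply[OF S' f] by (intro add_mono) auto
    finally show "NN (T f) \<le> (cnorm BB (S N1) + 1) * NN f" by (simp add: distrib_right)
  next
    fix f g assume f: "f \<in> ell2 X" and g: "g \<in> ell2 X"
    show "T (\<lambda>x. f x + g x) = (\<lambda>x. T f x + T g x)"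
    proof
      fix x
      have "(\<lambda>n. S n (\<lambda>x. f x + g x) x) \<longlonglongrightarrow> T f x + T g x"
        using tendsto_add[OF lim[OF f] lim[OF g]] f g by (simp add: bo_add)
      then show "T (\<lambda>x. f x + g x) x = T f x + T g x"
        using LIMSEQ_unique lim ell2_add(1)[OF f g] by blast
    qed
  next
    fix c f assume f: "f \<in> ell2 X"
    show "T (\<lambda>x. c * f x) = (\<lambda>x. c * T f x)"
    proof
      fix x
      have "(\<lambda>n. S n (\<lambda>x. c * f x) x) \<longlonglongrightarrow> c * T f x"
        using tendsto_mult_left[OF lim[OF f]] f by (simp add: bo_scale)
      then show "T (\<lambda>x. c * f x) x = c * T f x"
        using LIMSEQ_unique lim ell2_scale(1)[OF f] by blast
    qed
  qed (simp add: T_def)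
  show "\<exists>T\<in>carrier BB. (\<lambda>n. cnorm BB (S n \<ominus>\<^bsub>BB\<^esub> T)) \<longlonglongrightarrow> 0"
  proof (rule bexI[of _ T])
    show "(\<lambda>n. cnorm BB (S n \<ominus>\<^bsub>BB\<^esub> T)) \<longlonglongrightarrow> 0"
    proof (rule LIMSEQ_I)
      fix r :: real assume r: "r > 0"
      then obtain N where N: "\<forall>m\<ge>N. \<forall>n\<ge>N. cnorm BB (S m \<ominus>\<^bsub>BB\<^esub> S n) < r / 2"
        using cauchy half_gt_zero by blast
      have "cnorm BB (S n \<ominus>\<^bsub>BB\<^esub> T) \<le> r / 2" if "n \<ge> N" for n
        using close[OF _ _ N that] r T_bo by (intro op_norm_leI) (auto simp: minus)
      moreover have "0 \<le> cnorm BB (S n \<ominus>\<^bsub>BB\<^esub> T)" for n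
        using S T_bo by (intro B.nu_nonneg B.minus_closed) (auto simp: B_simps(1))
      ultimately show "\<exists>N. \<forall>n\<ge>N. norm (cnorm BB (S n \<ominus>\<^bsub>BB\<^esub> T) - 0) < r"
        using r by (intro exI[of _ N]) fastforce
    qed
  qed (use T_bo in \<open>simp add: B_simps\<close>)
qed

end

section \<open>Words and constructible right ideals\<close>

lemma words_Nil [simp]: "[] \<in> words P"
  and words_Cons [simp]: "p # q # \<alpha> \<in> words P \<longleftrightarrow> p \<in> P \<and> q \<in> P \<and> \<alpha> \<in> words P"
  and words_single [simp]: "[p] \<notin> words P"
  and words_append [simp]: "\<alpha> \<in> words P \<Longrightarrow> \<beta> \<in> words P \<Longrightarrow> \<alpha> @ \<beta> \<in> words P"
  and words_rev [simp]: "rev \<alpha> \<in> words P \<longleftrightarrow> \<alpha> \<in> words P"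
  by (auto simp: words_def)

lemma words_induct [consumes 1, case_names Nil Cons]:
  assumes "\<alpha> \<in> words P" "Q []"
    "\<And>p q \<alpha>. \<lbrakk>p \<in> P; q \<in> P; \<alpha> \<in> words P; Q \<alpha>\<rbrakk> \<Longrightarrow> Q (p # q # \<alpha>)"
  shows "Q \<alpha>"
  using assms(1)
proof (induction "length \<alpha>" arbitrary: \<alpha> rule: less_induct)
  case less
  show ?case
  proof (cases \<alpha>)
    case (Cons p \<alpha>')
    then obtain q \<alpha>'' where "\<alpha> = p # q # \<alpha>''" using less.prems by (cases \<alpha>') auto
    then show ?thesis using less assms(3) by auto
  qed (use assms in simp)
qed

locale submonoid_in_group = group G for G :: "('g, 'm) monoid_scheme" (structure) +
  fixes P :: "'g set"
  assumes submonoid: "submonoid P G"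
begin

abbreviation "K \<equiv> constr G P"
abbreviation "NW \<equiv> neutral_words G P"

lemma P_carrier [simp]: "p \<in> P \<Longrightarrow> p \<in> carrier G"
  and P_one [simp]: "\<one> \<in> P"
  and P_mult [simp]: "p \<in> P \<Longrightarrow> q \<in> P \<Longrightarrow> p \<otimes> q \<in> P"
  using submonoid by (auto simp: submonoid_def)

lemma mem_l_coset: "g \<in> carrier G \<Longrightarrow> x \<in> carrier G \<Longrightarrow> x \<in> g <# P \<longleftrightarrow> inv g \<otimes> x \<in> P"
  unfolding l_coset_def
  by (auto simp flip: m_assoc intro!: bexI[of _ "inv g \<otimes> x"])

lemma dot_closed [simp]: "\<alpha> \<in> words P \<Longrightarrow> dot G \<alpha> \<in> carrier G"
  by (induction rule: words_induct) auto

lemma dot_append: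
  assumes "\<alpha> \<in> words P" "\<beta> \<in> words P" shows "dot G (\<alpha> @ \<beta>) = dot G \<alpha> \<otimes> dot G \<beta>"
  using assms(1) by (induction rule: words_induct) (simp_all add: assms m_assoc)

lemma dot_rev: "\<alpha> \<in> words P \<Longrightarrow> dot G (rev \<alpha>) = inv (dot G \<alpha>)"
  by (induction rule: words_induct) (simp_all add: dot_append inv_mult_group)

lemma constr_Nil [simp]: "K [] = P"
  unfolding constr_def by (auto simp: mem_l_coset l_coset_def)

lemma constr_subset: "K \<alpha> \<subseteq> P"
proof
  fix x assume "x \<in> K \<alpha>"
  then have "x \<in> dot G (take (2 * 0) (rev \<alpha>)) <# P" unfolding constr_def by (rule INT_D) simp
  then show "x \<in> P" by (auto simp: l_coset_def)
qed

lemma constr_in_P: "x \<in> K \<alpha> \<Longrightarrow> x \<in> P"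
  using constr_subset by blast

text \<open>The sets in \<open>constr\<close> come from initial segments of the reversed word, so
  two letters put in front add only the set of the full reversed word. The lemma turns
  \<open>constr\<close> into the domain of a partial map: x is translated letter pair by letter
  pair, from the right, and must stay in P.\<close>

lemma mem_constr_Cons:
  assumes "p \<in> P" "q \<in> P" "\<alpha> \<in> words P"
  shows "x \<in> K (p # q # \<alpha>) \<longleftrightarrow> x \<in> K \<alpha> \<and> inv p \<otimes> q \<otimes> dot G \<alpha> \<otimes> x \<in> P"
proof -
  define n where "n = length \<alpha> div 2"
  have len: "length \<alpha> = 2 * n" using assms by (auto simp: n_def words_def)
  have "K (p # q # \<alpha>) = (\<Inter>j\<in>insert (Suc n) {0..n}. dot G (take (2 * j) (rev (p # q # \<alpha>))) <# P)"
    unfolding constr_def by (simp add: len atLeastAtMostSuc_conv)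
  also have "\<dots> = (dot G (rev (p # q # \<alpha>)) <# P) \<inter> (\<Inter>j\<in>{0..n}. dot G (take (2 * j) (rev (p # q # \<alpha>))) <# P)"
    by (simp add: len)
  also have "(\<Inter>j\<in>{0..n}. dot G (take (2 * j) (rev (p # q # \<alpha>))) <# P) = K \<alpha>"
    unfolding constr_def by (rule INF_cong) (auto simp: len)
  finally have eq: "x \<in> K (p # q # \<alpha>) \<longleftrightarrow> x \<in> dot G (rev (p # q # \<alpha>)) <# P \<and> x \<in> K \<alpha>"
    by blast
  have "dot G (rev (p # q # \<alpha>)) = inv (inv p \<otimes> q \<otimes> dot G \<alpha>)"
    using dot_rev[of "p # q # \<alpha>"] assms by simp
  then have "x \<in> dot G (rev (p # q # \<alpha>)) <# P \<longleftrightarrow> inv p \<otimes> q \<otimes> dot G \<alpha> \<otimes> x \<in> P" if "x \<in> carrier G"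
    using that assms by (simp add: mem_l_coset)
  then show ?thesis using eq constr_in_P by auto
qed

lemma constr_right_ideal: "\<alpha> \<in> words P \<Longrightarrow> x \<in> K \<alpha> \<Longrightarrow> t \<in> P \<Longrightarrow> x \<otimes> t \<in> K \<alpha>"
proof (induction rule: words_induct)
  case (Cons p q \<alpha>)
  have "inv p \<otimes> q \<otimes> dot G \<alpha> \<otimes> (x \<otimes> t) = (inv p \<otimes> q \<otimes> dot G \<alpha> \<otimes> x) \<otimes> t"
    using Cons constr_in_P by (auto simp: mem_constr_Cons m_assoc)
  then show ?case using Cons by (auto simp: mem_constr_Cons)
qed simp

lemma constr_dot: "\<alpha> \<in> words P \<Longrightarrow> x \<in> K \<alpha> \<Longrightarrow> dot G \<alpha> \<otimes> x \<in> P"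
  by (induction rule: words_induct) (auto simp: mem_constr_Cons)

text \<open>\<open>K \<alpha>\<close> is the domain of the partial left translation by
  \<open>dot G \<alpha>\<close> that the word describes, and concatenation of words composes these
  partial maps.\<close>

lemma mem_constr_append:
  assumes "\<alpha> \<in> words P" "\<beta> \<in> words P"
  shows "x \<in> K (\<alpha> @ \<beta>) \<longleftrightarrow> x \<in> K \<beta> \<and> dot G \<beta> \<otimes> x \<in> K \<alpha>"
  using assms(1)
proof (induction rule: words_induct)
  case Nil
  then show ?case using constr_dot[OF assms(2)] by auto
next
  case (Cons p q \<alpha>)
  have "inv p \<otimes> q \<otimes> dot G (\<alpha> @ \<beta>) \<otimes> x = inv p \<otimes> q \<otimes> dot G \<alpha> \<otimes> (dot G \<beta> \<otimes> x)" if "x \<in> carrier G"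
    using that Cons assms by (simp add: dot_append m_assoc)
  then show ?case using Cons assms constr_in_P[of x \<beta>] by (auto simp: mem_constr_Cons)
qed

text \<open>The reversed word runs the same partial translation backwards through the same
  intermediate points.\<close>

lemma constr_rev: "\<alpha> \<in> words P \<Longrightarrow> x \<in> K \<alpha> \<Longrightarrow> dot G \<alpha> \<otimes> x \<in> K (rev \<alpha>)"
proof (induction rule: words_induct)
  case Nil
  then show ?case by simp
next
  case (Cons p q \<alpha>)
  then have x: "x \<in> K \<alpha>" "x \<in> carrier G" and y: "inv p \<otimes> q \<otimes> dot G \<alpha> \<otimes> x \<in> P"
    using constr_in_P by (auto simp: mem_constr_Cons)
  have c: "inv q \<otimes> p \<otimes> (inv p \<otimes> q \<otimes> dot G \<alpha> \<otimes> x) = dot G \<alpha> \<otimes> x"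
    using Cons x by (simp add: m_assoc flip: m_assoc[of p] m_assoc[of "inv q"])
  have "x \<in> K \<alpha>" "dot G \<alpha> \<otimes> x \<in> P" using x Cons by (auto intro: constr_dot)
  then show ?case
    using Cons x y c by (simp add: mem_constr_append mem_constr_Cons)
qed

lemma mem_constr_rev:
  assumes "\<alpha> \<in> words P" "x \<in> carrier G"
  shows "x \<in> K (rev \<alpha>) \<longleftrightarrow> inv (dot G \<alpha>) \<otimes> x \<in> K \<alpha>"
  using constr_rev[of "rev \<alpha>" x] constr_rev[of \<alpha> "inv (dot G \<alpha>) \<otimes> x"] assms
  by (auto simp: dot_rev simp flip: m_assoc)

lemma NW_Nil [simp]: "[] \<in> NW"
  by (simp add: neutral_words_def)

lemma NW_append [simp]: "\<alpha> \<in> NW \<Longrightarrow> \<beta> \<in> NW \<Longrightarrow> \<alpha> @ \<beta> \<in> NW"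
  by (simp add: neutral_words_def dot_append)

lemma NW_rev [simp]: "\<alpha> \<in> NW \<Longrightarrow> rev \<alpha> \<in> NW"
  by (simp add: neutral_words_def dot_rev)

lemma NW_rev_append [simp]: "\<alpha> \<in> words P \<Longrightarrow> rev \<alpha> @ \<alpha> \<in> NW"
  and NW_append_rev [simp]: "\<alpha> \<in> words P \<Longrightarrow> \<alpha> @ rev \<alpha> \<in> NW"
  by (simp_all add: neutral_words_def dot_append dot_rev)

lemma NW_words [simp]: "\<alpha> \<in> NW \<Longrightarrow> \<alpha> \<in> words P"
  and NW_dot [simp]: "\<alpha> \<in> NW \<Longrightarrow> dot G \<alpha> = \<one>"
  by (simp_all add: neutral_words_def)

lemma constr_NW_append: "\<alpha> \<in> words P \<Longrightarrow> \<beta> \<in> NW \<Longrightarrow> K (\<alpha> @ \<beta>) = K \<alpha> \<inter> K \<beta>"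
  using constr_in_P by (auto simp: mem_constr_append)

lemma constr_NW_rev: "\<alpha> \<in> NW \<Longrightarrow> K (rev \<alpha>) = K \<alpha>"
  using constr_rev[of \<alpha>] constr_rev[of "rev \<alpha>"] constr_in_P by (auto simp: dot_rev) 

lemma constr_rev_append: "\<alpha> \<in> words P \<Longrightarrow> K (rev \<alpha> @ \<alpha>) = K \<alpha>"
  using constr_rev by (auto simp: mem_constr_append)

text \<open>\<open>K \<alpha> = K (rev \<alpha> @ \<alpha>)\<close> and the latter word is neutral.
  So every constructible ideal belongs to one of the projections \<open>wdot A w \<alpha>\<close>
  with neutral \<alpha>.\<close>

lemma constructible_NW: "S \<in> constructible G P \<longleftrightarrow> (\<exists>\<alpha>\<in>NW. S = K \<alpha>)"
proof
  assume "S \<in> constructible G P"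
  then obtain \<alpha> where "\<alpha> \<in> words P" "S = K \<alpha>" by (auto simp: constructible_def)
  then show "\<exists>\<alpha>\<in>NW. S = K \<alpha>" using constr_rev_append[of \<alpha>] NW_rev_append[of \<alpha>] by metis
qed (auto simp: constructible_def)

text \<open>The word \<open>shift x \<beta>\<close> represents \<open>t\<^sub>x\<^sup>* t\<^sub>\<beta> t\<^sub>x\<close>, and \<open>principal x\<close> represents \<open>t\<^sub>x t\<^sub>x\<^sup>*\<close>.\<close>

definition shift :: "'g \<Rightarrow> 'g list \<Rightarrow> 'g list" where
  "shift x \<beta> = [x, \<one>] @ \<beta> @ [\<one>, x]"

definition principal :: "'g \<Rightarrow> 'g list" where
  "principal x = [\<one>, x, x, \<one>]"

lemma shift_NW [simp]: "x \<in> P \<Longrightarrow> \<beta> \<in> NW \<Longrightarrow> shift x \<beta> \<in> NW"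
  by (simp add: shift_def neutral_words_def dot_append del: NW_words NW_dot)

lemma constr_shift:
  assumes "x \<in> P" "\<beta> \<in> NW" shows "K (shift x \<beta>) = {t \<in> P. x \<otimes> t \<in> K \<beta>}"
proof -
  have "t \<in> K (shift x \<beta>) \<longleftrightarrow> t \<in> P \<and> x \<otimes> t \<in> K \<beta>" for t
    using assms mem_constr_append[of "[x, \<one>]" "\<beta> @ [\<one>, x]" t] mem_constr_append[of \<beta> "[\<one>, x]" t]
    by (auto simp: shift_def mem_constr_Cons dot_append m_assoc simp flip: m_assoc[of "inv x" x] dest: constr_in_P)
  then show ?thesis by blast
qed

lemma principal_NW [simp]: "x \<in> P \<Longrightarrow> principal x \<in> NW"
  by (simp add: principal_def neutral_words_def del: NW_words NW_dot)

lemma mem_constr_principal: "x \<in> P \<Longrightarrow> y \<in> carrier G \<Longrightarrow> y \<in> K (principal x) \<longleftrightarrow> y \<in> P \<and> inv x \<otimes> y \<in> P"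
  by (auto simp: principal_def mem_constr_Cons simp flip: m_assoc)

lemma constr_principal: "x \<in> P \<Longrightarrow> K (principal x) = x <# P"
proof -
  assume x: "x \<in> P"
  have "y \<in> P" if "y \<in> carrier G" "inv x \<otimes> y \<in> P" for y
    using P_mult[OF x that(2)] that x by (simp flip: m_assoc)
  then have iff: "y \<in> K (principal x) \<longleftrightarrow> y \<in> x <# P" if "y \<in> carrier G" for y
    unfolding mem_constr_principal[OF x that] mem_l_coset[OF P_carrier[OF x] that] using that by blast
  have "y \<in> carrier G" if "y \<in> x <# P" for y using that x by (auto simp: l_coset_def)
  then show ?thesis using iff constr_in_P[of _ "principal x"] P_carrier by blast
qed

lemma eq_l_coset_iff:
  assumes "x \<in> P" "y \<in> P"
  shows "x <# P = y <# P \<longleftrightarrow> x \<in> y <# P \<and> y \<in> x <# P"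
proof -
  have sub: "x <# P \<subseteq> y <# P" if "x \<in> y <# P" "x \<in> P" "y \<in> P" for x y
  proof
    fix z assume "z \<in> x <# P"
    then obtain t where t: "t \<in> P" "z = x \<otimes> t" by (auto simp: l_coset_def)
    have "inv y \<otimes> z = (inv y \<otimes> x) \<otimes> t" using that t by (simp add: m_assoc)
    then show "z \<in> y <# P" using that t by (simp add: mem_l_coset)
  qed
  have self: "z \<in> z <# P" if "z \<in> P" for z using that by (simp add: mem_l_coset)
  show ?thesis using sub self assms by blast
qed

end

section \<open>Toeplitz families\<close>

context star_alg begin

lemma mult_list_Nil [simp]: "mult_list A [] = \<one>"
  and mult_list_Cons [simp]: "mult_list A (x # xs) = x \<otimes> mult_list A xs"
  by (simp_all add: mult_list_def)

lemma mult_list_closed [simp]: "set xs \<subseteq> carrier A \<Longrightarrow> mult_list A xs \<in> carrier A"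
  by (induction xs) auto

lemma mult_list_append:
  "set xs \<subseteq> carrier A \<Longrightarrow> set ys \<subseteq> carrier A \<Longrightarrow> mult_list A (xs @ ys) = mult_list A xs \<otimes> mult_list A ys"
  by (induction xs) (auto simp: m_assoc)

lemma mult_list_commute:
  assumes "set xs \<subseteq> carrier A" "y \<in> carrier A" "\<And>x. x \<in> set xs \<Longrightarrow> x \<otimes> y = y \<otimes> x"
  shows "mult_list A xs \<otimes> y = y \<otimes> mult_list A xs"
  using assms
proof (induction xs)
  case (Cons x xs)
  then have c: "x \<in> carrier A" "mult_list A xs \<in> carrier A" "y \<in> carrier A"
    and IH: "mult_list A xs \<otimes> y = y \<otimes> mult_list A xs" and xy: "x \<otimes> y = y \<otimes> x" by auto
  have "mult_list A (x # xs) \<otimes> y = x \<otimes> (mult_list A xs \<otimes> y)" using c by (simp add: m_assoc)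
  also have "\<dots> = (x \<otimes> y) \<otimes> mult_list A xs" using c by (simp only: IH m_assoc)
  also have "\<dots> = y \<otimes> mult_list A (x # xs)" using c by (simp add: xy m_assoc)
  finally show ?case .
qed simp

lemma mult_list_absorb:
  assumes "set xs \<subseteq> carrier A" "y \<in> set xs" "\<And>x. x \<in> set xs \<Longrightarrow> x \<otimes> y = y \<otimes> x" "y \<otimes> y = y"
  shows "y \<otimes> mult_list A xs = mult_list A xs"
  using assms
proof (induction xs)
  case (Cons x xs)
  from Cons.prems(1,2) have c: "x \<in> carrier A" "mult_list A xs \<in> carrier A" "y \<in> carrier A" by auto
  show ?case
  proof (cases "y = x")
    case True
    have "x \<otimes> (x \<otimes> mult_list A xs) = (x \<otimes> x) \<otimes> mult_list A xs" using c by (simp only: m_assoc)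
    then show ?thesis using True Cons.prems(4) by simp
  next
    case False
    have IH: "y \<otimes> mult_list A xs = mult_list A xs"
      by (rule Cons.IH) (use Cons.prems(1,2,4) False in \<open>auto intro: Cons.prems(3)\<close>)
    have "y \<otimes> (x \<otimes> mult_list A xs) = (y \<otimes> x) \<otimes> mult_list A xs" using c by (simp only: m_assoc)
    also have "y \<otimes> x = x \<otimes> y" by (rule Cons.prems(3)[symmetric]) simp
    also have "(x \<otimes> y) \<otimes> mult_list A xs = x \<otimes> mult_list A xs" using c by (simp only: m_assoc IH)
    finally show ?thesis by simp
  qed
qed simp

text \<open>(T4) and \<open>jointly_proper\<close> speak of lists without repetition, while the
  lists of literals below may repeat words. For commuting idempotents repetitions do not change the
  product.\<close>

lemma mult_list_remdups:
  assumes "set (map f xs) \<subseteq> carrier A" "\<And>x y. x \<in> set xs \<Longrightarrow> y \<in> set xs \<Longrightarrow> f x \<otimes> f y = f y \<otimes> f x"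
    "\<And>x. x \<in> set xs \<Longrightarrow> f x \<otimes> f x = f x"
  shows "mult_list A (map f (remdups xs)) = mult_list A (map f xs)"
  using assms
proof (induction xs)
  case (Cons x xs)
  have IH: "mult_list A (map f (remdups xs)) = mult_list A (map f xs)"
    by (rule Cons.IH) (use Cons.prems(1) in \<open>auto intro: Cons.prems(2,3)\<close>)
  show ?case
  proof (cases "x \<in> set xs")
    case True
    have "f x \<otimes> mult_list A (map f xs) = mult_list A (map f xs)"
    proof (rule mult_list_absorb)
      fix z assume "z \<in> set (map f xs)"
      then obtain u where "u \<in> set xs" "z = f u" by auto
      then show "z \<otimes> f x = f x \<otimes> z" using Cons.prems(2)[of u x] by simp
    next
      show "f x \<otimes> f x = f x" by (rule Cons.prems(3)) simp
    qed (use Cons.prems(1) True in auto)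
    then show ?thesis using True IH by simp
  qed (simp add: IH)
qed simp

text \<open>A list of coefficients and words instead of a function on words: repeated words are
  harmless and every proof is an induction on the list.\<close>

definition lin_comb :: "('g \<Rightarrow> 'a) \<Rightarrow> (complex \<times> 'g list) list \<Rightarrow> 'a" where
  "lin_comb w cs = foldr (\<lambda>(c, \<alpha>) s. c \<odot> wdot A w \<alpha> \<oplus> s) cs \<zero>"

lemma lin_comb_Nil [simp]: "lin_comb w [] = \<zero>"
  and lin_comb_Cons [simp]: "lin_comb w ((c, \<alpha>) # cs) = c \<odot> wdot A w \<alpha> \<oplus> lin_comb w cs"
  by (simp_all add: lin_comb_def)

end

locale toeplitz_fam = G: submonoid_in_group G P + star_alg A
  for G :: "('g, 'k) monoid_scheme" and P and A :: "('a, 'm) star_algebra_scheme" (structure) +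
  fixes w :: "'g \<Rightarrow> 'a"
  assumes family: "toeplitz_family G P A w"
begin

abbreviation "wd \<equiv> wdot A w"

lemma w_closed [simp]: "p \<in> P \<Longrightarrow> w p \<in> carrier A"
  using family by (auto simp: toeplitz_family_def)

lemma wd_closed [simp]: "\<alpha> \<in> words P \<Longrightarrow> wd \<alpha> \<in> carrier A"
  by (induction rule: words_induct) auto

lemma wd_append: "\<alpha> \<in> words P \<Longrightarrow> \<beta> \<in> words P \<Longrightarrow> wd (\<alpha> @ \<beta>) = wd \<alpha> \<otimes> wd \<beta>"
  by (induction rule: words_induct) (simp_all add: m_assoc)

lemma adj_wd: "\<alpha> \<in> words P \<Longrightarrow> adj A (wd \<alpha>) = wd (rev \<alpha>)"
  by (induction rule: words_induct) (simp_all add: adj_mult wd_append m_assoc)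

lemma w_one: "w \<one>\<^bsub>G\<^esub> = \<one>"
proof -
  have "w \<one>\<^bsub>G\<^esub> \<ominus> \<one> = \<zero>"
    using family by (simp add: toeplitz_family_def toeplitz_relators_def)
  then show ?thesis by (simp add: diff_eq_zero_iff)
qed

lemma wd_empty: "\<alpha> \<in> G.NW \<Longrightarrow> G.K \<alpha> = {} \<Longrightarrow> wd \<alpha> = \<zero>"
  using family unfolding toeplitz_family_def toeplitz_relators_def by blast

lemma wd_cong: assumes "\<alpha> \<in> G.NW" "\<beta> \<in> G.NW" "G.K \<alpha> = G.K \<beta>" shows "wd \<alpha> = wd \<beta>"
proof -
  have "wd \<alpha> \<ominus> wd \<beta> = \<zero>"
    using family assms unfolding toeplitz_family_def toeplitz_relators_def by blast
  then show ?thesis using assms by (simp add: diff_eq_zero_iff)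
qed

lemma wd_union:
  assumes "\<alpha> \<in> G.NW" "F \<noteq> []" "distinct F" "set F \<subseteq> G.NW" "G.K \<alpha> = (\<Union>\<beta>\<in>set F. G.K \<beta>)"
  shows "mult_list A (map (\<lambda>\<beta>. wd \<alpha> \<ominus> wd \<beta>) F) = \<zero>"
  using family assms unfolding toeplitz_family_def toeplitz_relators_def by blast

text \<open>On neutral words K turns concatenation into intersection and ignores reversal. So (T3)
  alone makes the elements \<open>wd \<alpha>\<close> commuting projections, in this lemma and the
  next two.\<close>

lemma wd_idem: "\<alpha> \<in> G.NW \<Longrightarrow> wd \<alpha> \<otimes> wd \<alpha> = wd \<alpha>"
  using wd_cong[of "\<alpha> @ \<alpha>" \<alpha>] by (simp add: wd_append G.constr_NW_append)

lemma wd_self_adj: "\<alpha> \<in> G.NW \<Longrightarrow> adj A (wd \<alpha>) = wd \<alpha>"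
  using wd_cong[of "rev \<alpha>" \<alpha>] by (simp add: adj_wd G.constr_NW_rev)

lemma wd_commute: "\<alpha> \<in> G.NW \<Longrightarrow> \<beta> \<in> G.NW \<Longrightarrow> wd \<alpha> \<otimes> wd \<beta> = wd \<beta> \<otimes> wd \<alpha>"
  using wd_cong[of "\<alpha> @ \<beta>" "\<beta> @ \<alpha>"] by (simp add: wd_append G.constr_NW_append Int_commute)

lemma wd_full: "\<alpha> \<in> G.NW \<Longrightarrow> G.K \<alpha> = P \<Longrightarrow> wd \<alpha> = \<one>"
  using wd_cong[of \<alpha> "[]"] by simp

lemma adj_wd_wd: "\<alpha> \<in> words P \<Longrightarrow> adj A (wd \<alpha>) \<otimes> wd \<alpha> = wd (rev \<alpha> @ \<alpha>)"
  by (simp add: adj_wd wd_append)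

lemma isometry: assumes "p \<in> P" shows "adj A (w p) \<otimes> w p = \<one>"
proof -
  have "x \<in> G.K [p, p] \<longleftrightarrow> x \<in> P" for x
    using assms by (auto simp: G.mem_constr_Cons)
  moreover have "[p, p] \<in> G.NW"
    unfolding neutral_words_def using assms by simp
  ultimately have "wd [p, p] = \<one>" by (intro wd_full) auto
  then show ?thesis using assms by simp
qed

lemma wd_principal: "p \<in> P \<Longrightarrow> wd (G.principal p) = w p \<otimes> adj A (w p)"
  by (simp add: G.principal_def w_one)

lemma wd_shift: "p \<in> P \<Longrightarrow> \<beta> \<in> words P \<Longrightarrow> wd (G.shift p \<beta>) = adj A (w p) \<otimes> wd \<beta> \<otimes> w p"
  by (simp add: G.shift_def w_one wd_append m_assoc)

text \<open>A literal is a word with a sign, giving a projection or its complement. A product of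
  literals is the abstract counterpart of the indicator function of the points x with
  \<open>sat x ls\<close>.\<close>

definition lit :: "'g list \<times> bool \<Rightarrow> 'a" where
  "lit l = (if snd l then wd (fst l) else \<one> \<ominus> wd (fst l))"

definition lits :: "('g list \<times> bool) list \<Rightarrow> 'a" where
  "lits ls = mult_list A (map lit ls)"

definition valid :: "('g list \<times> bool) list \<Rightarrow> bool" where
  "valid ls \<longleftrightarrow> fst ` set ls \<subseteq> G.NW"

definition sat :: "'g \<Rightarrow> ('g list \<times> bool) list \<Rightarrow> bool" where
  "sat x ls \<longleftrightarrow> (\<forall>l\<in>set ls. (x \<in> G.K (fst l)) = snd l)"

lemma valid_Nil [simp]: "valid []" and valid_Cons [simp]: "valid (l # ls) \<longleftrightarrow> fst l \<in> G.NW \<and> valid ls"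
  by (auto simp: valid_def)

lemma sat_Nil [simp]: "sat x []" and sat_Cons [simp]: "sat x (l # ls) \<longleftrightarrow> (x \<in> G.K (fst l)) = snd l \<and> sat x ls"
  by (auto simp: sat_def)

lemma lits_Nil [simp]: "lits [] = \<one>" and lits_Cons: "lits (l # ls) = lit l \<otimes> lits ls"
  by (simp_all add: lits_def)

lemma lit_closed [simp]: "fst l \<in> G.NW \<Longrightarrow> lit l \<in> carrier A"
  by (simp add: lit_def)

lemma lits_closed [simp]: "valid ls \<Longrightarrow> lits ls \<in> carrier A"
  by (induction ls) (auto simp: lits_Cons)

lemma lit_idem: "fst l \<in> G.NW \<Longrightarrow> lit l \<otimes> lit l = lit l"
  by (auto simp: lit_def wd_idem minus_eq l_distr r_distr l_minus r_minus l_neg r_neg)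

lemma lit_self_adj: "fst l \<in> G.NW \<Longrightarrow> adj A (lit l) = lit l"
  by (auto simp: lit_def wd_self_adj adj_diff)

lemma lit_commute: "fst l \<in> G.NW \<Longrightarrow> fst l' \<in> G.NW \<Longrightarrow> lit l \<otimes> lit l' = lit l' \<otimes> lit l"
  using wd_commute[of "fst l" "fst l'"]
  by (auto simp: lit_def minus_eq minus_add l_distr r_distr l_minus r_minus a_ac)

lemma lits_lit_commute: "valid ls \<Longrightarrow> fst l \<in> G.NW \<Longrightarrow> lits ls \<otimes> lit l = lit l \<otimes> lits ls"
  unfolding lits_def by (rule mult_list_commute) (auto simp: valid_def image_subset_iff intro: lit_commute)

lemma lits_wd_commute: "valid ls \<Longrightarrow> \<alpha> \<in> G.NW \<Longrightarrow> lits ls \<otimes> wd \<alpha> = wd \<alpha> \<otimes> lits ls"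
  using lits_lit_commute[of ls "(\<alpha>, True)"] by (simp add: lit_def)

lemma lits_self_adj: "valid ls \<Longrightarrow> adj A (lits ls) = lits ls"
  by (induction ls) (simp_all add: lits_Cons adj_mult lit_self_adj lits_lit_commute)

lemma lits_idem: "valid ls \<Longrightarrow> lits ls \<otimes> lits ls = lits ls"
proof (induction ls)
  case (Cons l ls)
  then have c: "lit l \<in> carrier A" "lits ls \<in> carrier A" by auto
  have "(lit l \<otimes> lits ls) \<otimes> (lit l \<otimes> lits ls) = lit l \<otimes> (lits ls \<otimes> lit l) \<otimes> lits ls"
    using c by (simp add: m_assoc)
  also have "lits ls \<otimes> lit l = lit l \<otimes> lits ls" using Cons by (simp add: lits_lit_commute)
  also have "lit l \<otimes> (lit l \<otimes> lits ls) \<otimes> lits ls = (lit l \<otimes> lit l) \<otimes> (lits ls \<otimes> lits ls)"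
    using c by (simp add: m_assoc)
  finally show ?case using Cons by (simp add: lits_Cons lit_idem)
qed simp

lemma lits_absorb: "valid ls \<Longrightarrow> l \<in> set ls \<Longrightarrow> lit l \<otimes> lits ls = lits ls"
  unfolding lits_def
  by (rule mult_list_absorb) (auto simp: valid_def image_subset_iff intro: lit_commute lit_idem)

lemma lits_wd:
  assumes "valid ls" "(\<alpha>, b) \<in> set ls"
  shows "lits ls \<otimes> wd \<alpha> = (if b then \<one> else \<zero>) \<otimes> lits ls"
proof -
  have \<alpha>: "\<alpha> \<in> G.NW" using assms by (auto simp: valid_def)
  have "lits ls \<otimes> wd \<alpha> = wd \<alpha> \<otimes> (lit (\<alpha>, b) \<otimes> lits ls)"
    using assms \<alpha> by (simp add: lits_absorb lits_wd_commute)
  also have "\<dots> = (wd \<alpha> \<otimes> lit (\<alpha>, b)) \<otimes> lits ls" using assms \<alpha> by (simp add: m_assoc)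
  also have "wd \<alpha> \<otimes> lit (\<alpha>, b) = (if b then wd \<alpha> else \<zero>)"
    using \<alpha> by (simp add: lit_def wd_idem minus_eq r_distr r_minus r_neg)
  also have "\<dots> \<otimes> lits ls = (if b then \<one> else \<zero>) \<otimes> lits ls"
    using lits_absorb[OF assms] assms by (cases b) (simp_all add: lit_def)
  finally show ?thesis .
qed

text \<open>Each factor of the (T4) product is \<open>wd \<alpha>\<close> times a complement, and
  the copies of \<open>wd \<alpha>\<close> merge by commutation and idempotence. For empty F the
  left side would be the unit instead of \<open>wd \<alpha>\<close>.\<close>

lemma neg_prod:
  assumes "\<alpha> \<in> G.NW" "F \<noteq> []" "set F \<subseteq> G.NW"
  shows "mult_list A (map (\<lambda>\<beta>. wd \<alpha> \<ominus> wd (\<alpha> @ \<beta>)) F) = wd \<alpha> \<otimes> lits (map (\<lambda>\<beta>. (\<beta>, False)) F)"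
  using assms(2,3)
proof (induction F)
  case (Cons \<beta> F)
  have \<beta>: "\<beta> \<in> G.NW" and F: "set F \<subseteq> G.NW" using Cons by auto
  have vF: "valid (map (\<lambda>\<beta>. (\<beta>, False)) F)" using F by (auto simp: valid_def)
  have eq: "wd \<alpha> \<ominus> wd (\<alpha> @ \<beta>) = wd \<alpha> \<otimes> lit (\<beta>, False)"
    using assms \<beta> by (simp add: wd_append lit_def minus_eq r_distr r_minus)
  show ?case
  proof (cases "F = []")
    case True
    then show ?thesis using assms \<beta> eq by (simp add: lits_Cons)
  next
    case False
    define f where "f = lits (map (\<lambda>\<beta>. (\<beta>, False)) F)"
    have f: "f \<in> carrier A" using vF by (simp add: f_def)
    have b: "lit (\<beta>, False) \<in> carrier A" using \<beta> by simp
    have cm: "lit (\<beta>, False) \<otimes> wd \<alpha> = wd \<alpha> \<otimes> lit (\<beta>, False)"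
      using lit_commute[of "(\<beta>, False)" "(\<alpha>, True)"] assms \<beta> by (simp add: lit_def)
    have "mult_list A (map (\<lambda>\<beta>. wd \<alpha> \<ominus> wd (\<alpha> @ \<beta>)) (\<beta> # F)) = (wd \<alpha> \<otimes> lit (\<beta>, False)) \<otimes> (wd \<alpha> \<otimes> f)"
      using Cons.IH[OF False F] eq by (simp add: f_def)
    also have "\<dots> = wd \<alpha> \<otimes> (lit (\<beta>, False) \<otimes> wd \<alpha>) \<otimes> f"
      using assms f b by (simp add: m_assoc)
    also have "\<dots> = (wd \<alpha> \<otimes> wd \<alpha>) \<otimes> lit (\<beta>, False) \<otimes> f"
      using assms f b by (simp add: m_assoc cm)
    finally show ?thesis using assms f b by (simp add: wd_idem lits_Cons f_def m_assoc)
  qed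
qed simp

text \<open>
  (T2) and (T4) say that a product of projections and complements of projections vanishes if it
  vanishes pointwise on \<open>P\<close>.
\<close>

lemma wd_lits_zero:
  assumes "\<alpha> \<in> G.NW" "set F \<subseteq> G.NW" "valid ls"
    "\<And>x. x \<in> G.K \<alpha> \<Longrightarrow> (\<exists>\<beta>\<in>set F. x \<in> G.K \<beta>) \<or> \<not> sat x ls"
  shows "wd \<alpha> \<otimes> lits (map (\<lambda>\<beta>. (\<beta>, False)) F) \<otimes> lits ls = \<zero>"
  using assms
proof (induction ls arbitrary: \<alpha> F)
  case Nil
  define f where "f = (\<lambda>\<beta>. (\<beta>, False) :: 'g list \<times> bool)"
  have vF: "valid (map f F)" using Nil by (auto simp: valid_def f_def)
  show ?case
  proof (cases "F = []")
    case True
    then have "wd \<alpha> = \<zero>" using Nil by (intro wd_empty) auto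
    then show ?thesis using Nil True by simp
  next
    case False
    \<comment> \<open>The hypothesis only says that the ideals of F cover \<open>K \<alpha>\<close>.
      Prefixing each word with \<alpha> intersects the ideals with \<open>K \<alpha>\<close> and
      gives the exact union that (T4) requires.\<close>
    define F' where "F' = map (\<lambda>\<beta>. \<alpha> @ \<beta>) (remdups F)"
    have "mult_list A (map (\<lambda>\<beta>. wd \<alpha> \<ominus> wd \<beta>) F') = \<zero>"
    proof (rule wd_union[OF Nil(1)])
      show "distinct F'" by (simp add: F'_def distinct_map inj_on_def)
      show "G.K \<alpha> = (\<Union>\<beta>\<in>set F'. G.K \<beta>)"
        using Nil by (auto simp: F'_def G.constr_NW_append subset_iff)
    qed (use Nil False in \<open>auto simp: F'_def\<close>)
    then have "wd \<alpha> \<otimes> lits (map f (remdups F)) = \<zero>"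
      using neg_prod[of \<alpha> "remdups F"] Nil False by (simp add: F'_def comp_def f_def)
    moreover have "lits (map f (remdups F)) = lits (map f F)"
      unfolding lits_def map_map
      by (rule mult_list_remdups) (use Nil(2) in \<open>auto simp: f_def subset_iff intro!: lit_commute lit_idem\<close>)
    ultimately show ?thesis using vF Nil by (simp add: f_def)
  qed
next
  \<comment> \<open>A positive literal is absorbed into \<alpha> by intersection and a negative one
    joins F. When no literal is left, (T2) or (T4) applies according to whether F is empty.\<close>
  case (Cons l ls)
  obtain \<beta> b where l: "l = (\<beta>, b)" by force
  have \<beta>: "\<beta> \<in> G.NW" and ls: "valid ls" using Cons l by auto
  define N where "N = lits (map (\<lambda>\<beta>. (\<beta>, False)) F)"
  have vF: "valid (map (\<lambda>\<beta>. (\<beta>, False)) F)" using Cons by (auto simp: valid_def)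
  then have N: "N \<in> carrier A" by (simp add: N_def)
  show ?case
  proof (cases b)
    case True
    have "wd (\<alpha> @ \<beta>) \<otimes> N \<otimes> lits ls = \<zero>"
      unfolding N_def
      by (rule Cons.IH) (use Cons.prems \<beta> l True in \<open>auto simp: G.constr_NW_append\<close>)
    moreover have "wd \<alpha> \<otimes> N \<otimes> (wd \<beta> \<otimes> lits ls) = wd (\<alpha> @ \<beta>) \<otimes> N \<otimes> lits ls"
    proof -
      have "N \<otimes> wd \<beta> = wd \<beta> \<otimes> N" unfolding N_def using vF \<beta> by (rule lits_wd_commute)
      then have "wd \<alpha> \<otimes> (N \<otimes> wd \<beta>) \<otimes> lits ls = wd \<alpha> \<otimes> (wd \<beta> \<otimes> N) \<otimes> lits ls" by simp
      then show ?thesis using Cons.prems \<beta> ls N by (simp add: wd_append m_assoc)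
    qed
    ultimately show ?thesis using l True by (simp add: lits_Cons lit_def N_def)
  next
    case False
    have "wd \<alpha> \<otimes> lits (map (\<lambda>\<beta>. (\<beta>, False)) (\<beta> # F)) \<otimes> lits ls = \<zero>"
      by (rule Cons.IH) (use Cons.prems \<beta> l False in auto)
    moreover have "N \<otimes> lit (\<beta>, False) = lit (\<beta>, False) \<otimes> N"
      unfolding N_def using vF \<beta> by (simp add: lits_lit_commute)
    then have "wd \<alpha> \<otimes> (N \<otimes> lit (\<beta>, False)) \<otimes> lits ls = wd \<alpha> \<otimes> (lit (\<beta>, False) \<otimes> N) \<otimes> lits ls" by simp
    ultimately show ?thesis
      using l False Cons.prems \<beta> ls N by (simp add: lits_Cons N_def m_assoc)
  qed
qed

lemma lits_nonzero_sat:
  assumes "valid ls" "lits ls \<noteq> \<zero>" obtains x where "x \<in> P" "sat x ls"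
proof (rule ccontr)
  assume "\<not> thesis"
  then have "\<not> sat x ls" if "x \<in> P" for x using that \<open>\<And>x. x \<in> P \<Longrightarrow> sat x ls \<Longrightarrow> thesis\<close> by blast
  then have "wd [] \<otimes> lits (map (\<lambda>\<beta>. (\<beta>, False)) []) \<otimes> lits ls = \<zero>"
    using assms by (intro wd_lits_zero) auto
  then show False using assms by simp
qed

text \<open>The converse of \<open>lits_nonzero_sat\<close>: a nonempty cell carries a nonzero
  projection. This is the form in which faithfulness on the diagonal is used.\<close>

definition nondegenerate :: bool where
  "nondegenerate \<longleftrightarrow> (\<forall>ls x. valid ls \<and> x \<in> P \<and> sat x ls \<longrightarrow> lits ls \<noteq> \<zero>)"

text \<open>Compression by the isometry \<open>w x\<close> is multiplicative on the diagonal: its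
  range projection e commutes with the literals and can be inserted between two factors because
  \<open>e \<otimes> w x = w x\<close>.\<close>

lemma shift_lits:
  assumes "valid ls" "x \<in> P"
  shows "adj A (w x) \<otimes> lits ls \<otimes> w x = lits (map (\<lambda>(\<beta>, b). (G.shift x \<beta>, b)) ls)"
  using assms(1)
proof (induction ls)
  case Nil
  then show ?case using assms by (simp add: isometry)
next
  case (Cons l ls)
  obtain \<beta> b where l: "l = (\<beta>, b)" by force
  have \<beta>: "\<beta> \<in> G.NW" and ls: "valid ls" using Cons l by auto
  define e where "e = w x \<otimes> adj A (w x)"
  have e: "e = wd (G.principal x)" using assms by (simp add: e_def wd_principal)
  have c: "e \<in> carrier A" "w x \<in> carrier A" "adj A (w x) \<in> carrier A" "lit l \<in> carrier A" "lits ls \<in> carrier A"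
    using assms \<beta> ls l by (auto simp: e_def)
  have ew: "e \<otimes> w x = w x" using assms by (simp add: e_def m_assoc isometry)
  have comm: "lits ls \<otimes> e = e \<otimes> lits ls" unfolding e using ls assms by (intro lits_wd_commute) auto
  have "adj A (w x) \<otimes> lits (l # ls) \<otimes> w x = adj A (w x) \<otimes> lit l \<otimes> (lits ls \<otimes> (e \<otimes> w x))"
    using c by (simp add: lits_Cons m_assoc ew)
  also have "\<dots> = adj A (w x) \<otimes> lit l \<otimes> ((lits ls \<otimes> e) \<otimes> w x)"
    using c by (simp add: m_assoc)
  also have "\<dots> = adj A (w x) \<otimes> lit l \<otimes> ((e \<otimes> lits ls) \<otimes> w x)" by (simp only: comm)
  also have "\<dots> = (adj A (w x) \<otimes> lit l \<otimes> w x) \<otimes> (adj A (w x) \<otimes> lits ls \<otimes> w x)"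
    using c unfolding e_def by (simp add: m_assoc)
  also have "adj A (w x) \<otimes> lit l \<otimes> w x = lit (G.shift x \<beta>, b)"
    using assms \<beta> l by (simp add: lit_def wd_shift minus_eq r_distr l_distr r_minus l_minus isometry m_assoc)
  finally show ?case using Cons ls l by (simp add: lits_Cons)
qed

lemma jointly_proper_nondegenerate:
  assumes "jointly_proper G P A w" shows nondegenerate
  unfolding nondegenerate_def
proof (intro allI impI)
  fix ls x assume "valid ls \<and> x \<in> P \<and> sat x ls"
  then have ls: "valid ls" and x: "x \<in> P" and sat: "sat x ls" by auto
  define ls' where "ls' = map (\<lambda>(\<beta>, b). (G.shift x \<beta>, b)) ls"
  define N where "N ls = map fst (filter (\<lambda>l. \<not> snd l) ls)" for ls :: "('g list \<times> bool) list"
  have one_mem: "\<one>\<^bsub>G\<^esub> \<in> G.K (G.shift x \<beta>) \<longleftrightarrow> x \<in> G.K \<beta>" if "\<beta> \<in> G.NW" for \<beta>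
    using that x by (simp add: G.constr_shift)
  have v': "valid ls'" using ls x by (auto simp: valid_def ls'_def)
  have s': "sat \<one>\<^bsub>G\<^esub> ls'"
    unfolding sat_def
  proof
    fix l assume "l \<in> set ls'"
    then obtain \<beta> b where "(\<beta>, b) \<in> set ls" "l = (G.shift x \<beta>, b)" by (auto simp: ls'_def)
    moreover from this have "\<beta> \<in> G.NW" "(x \<in> G.K \<beta>) = b" using ls sat by (auto simp: valid_def sat_def)
    ultimately show "(\<one>\<^bsub>G\<^esub> \<in> G.K (fst l)) = snd l" using one_mem by simp
  qed
  \<comment> \<open>A right ideal containing the identity is all of P. After the shift by x the
    positive literals are therefore the unit, and what remains is a product of complements of proper
    ideals, as in \<open>jointly_proper\<close>.\<close>
  have pos: "lit l = \<one>" if "l \<in> set ls'" "snd l" for l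
  proof -
    have "fst l \<in> G.NW" "\<one>\<^bsub>G\<^esub> \<in> G.K (fst l)" using v' s' that by (auto simp: valid_def sat_def)
    moreover from this have "G.K (fst l) = P"
      using G.constr_right_ideal[of "fst l" "\<one>\<^bsub>G\<^esub>"] G.constr_subset[of "fst l"] by fastforce
    ultimately show ?thesis using that by (simp add: lit_def wd_full)
  qed
  have "lits ms = mult_list A (map (\<lambda>\<alpha>. \<one> \<ominus> wd \<alpha>) (N ms))" if "valid ms" "\<And>l. l \<in> set ms \<Longrightarrow> snd l \<Longrightarrow> lit l = \<one>" for ms
    using that
  proof (induction ms)
    case (Cons l ms)
    then have IH: "lits ms = mult_list A (map (\<lambda>\<alpha>. \<one> \<ominus> wd \<alpha>) (N ms))" by simp
    show ?case
    proof (cases "snd l")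
      case True
      then have "lit l = \<one>" using Cons.prems by simp
      moreover have "lits ms \<in> carrier A" using Cons.prems by simp
      ultimately show ?thesis using True IH by (simp add: lits_Cons N_def)
    next
      case False
      then show ?thesis using IH by (simp add: lits_Cons N_def lit_def)
    qed
  qed (simp add: N_def)
  then have "lits ls' = mult_list A (map (\<lambda>\<alpha>. \<one> \<ominus> wd \<alpha>) (N ls'))" using v' pos by blast
  also have "\<dots> = mult_list A (map (\<lambda>\<alpha>. \<one> \<ominus> wd \<alpha>) (remdups (N ls')))"
  proof (rule mult_list_remdups[symmetric])
    have NW: "\<alpha> \<in> G.NW" if "\<alpha> \<in> set (N ls')" for \<alpha> using that v' by (auto simp: N_def valid_def)
    have lit_eq: "\<one> \<ominus> wd \<alpha> = lit (\<alpha>, False)" for \<alpha> by (simp add: lit_def)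
    show "set (map (\<lambda>\<alpha>. \<one> \<ominus> wd \<alpha>) (N ls')) \<subseteq> carrier A" using NW by auto
    show "(\<one> \<ominus> wd \<alpha>) \<otimes> (\<one> \<ominus> wd \<beta>) = (\<one> \<ominus> wd \<beta>) \<otimes> (\<one> \<ominus> wd \<alpha>)" if "\<alpha> \<in> set (N ls')" "\<beta> \<in> set (N ls')" for \<alpha> \<beta>
      unfolding lit_eq by (rule lit_commute) (use NW that in auto)
    show "(\<one> \<ominus> wd \<alpha>) \<otimes> (\<one> \<ominus> wd \<alpha>) = \<one> \<ominus> wd \<alpha>" if "\<alpha> \<in> set (N ls')" for \<alpha>
      unfolding lit_eq by (rule lit_idem) (use NW that in auto)
  qed
  also have "\<dots> \<noteq> \<zero>"
  proof -
    have "distinct (remdups (N ls'))" "set (remdups (N ls')) \<subseteq> G.NW"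
      "\<forall>\<alpha>\<in>set (remdups (N ls')). G.K \<alpha> \<noteq> P"
      using v' s' by (auto simp: N_def valid_def sat_def)
    then show ?thesis using assms unfolding jointly_proper_def by blast
  qed
  finally have "lits ls' \<noteq> \<zero>" .
  moreover have "lits ls' = adj A (w x) \<otimes> lits ls \<otimes> w x"
    using shift_lits[OF ls x] by (simp add: ls'_def)
  ultimately show "lits ls \<noteq> \<zero>" using x by auto
qed

definition value_at :: "'g \<Rightarrow> (complex \<times> 'g list) list \<Rightarrow> complex" where
  "value_at x cs = (\<Sum>(c, \<alpha>)\<leftarrow>cs. if x \<in> G.K \<alpha> then c else 0)"

lemma value_at_Nil [simp]: "value_at x [] = 0"
  and value_at_Cons [simp]: "value_at x ((c, \<alpha>) # cs) = (if x \<in> G.K \<alpha> then c else 0) + value_at x cs"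
  by (simp_all add: value_at_def)

lemma lin_comb_closed [simp]: "snd ` set cs \<subseteq> words P \<Longrightarrow> lin_comb w cs \<in> carrier A"
  by (induction cs) auto

text \<open>The list \<open>ls\<close> records for every word of \<open>cs\<close> whether x lies in
  its ideal. On this cell the step function given by \<open>cs\<close> is constant, with its value
  at x.\<close>

lemma lits_lin_comb:
  assumes "valid ls" "snd ` set cs \<subseteq> G.NW" "\<And>c \<alpha>. (c, \<alpha>) \<in> set cs \<Longrightarrow> (\<alpha>, x \<in> G.K \<alpha>) \<in> set ls"
  shows "lits ls \<otimes> lin_comb w cs = value_at x cs \<odot> lits ls"
  using assms(2,3)
proof (induction cs)
  case Nil
  then show ?case using assms by simp
next
  case (Cons ca cs)
  obtain c \<alpha> where ca: "ca = (c, \<alpha>)" by force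
  then have \<alpha>: "\<alpha> \<in> G.NW" "(\<alpha>, x \<in> G.K \<alpha>) \<in> set ls" and IH: "lits ls \<otimes> lin_comb w cs = value_at x cs \<odot> lits ls"
    using Cons by auto
  have cl: "lin_comb w cs \<in> carrier A" using Cons by (intro lin_comb_closed) auto
  have "lits ls \<otimes> (c \<odot> wd \<alpha>) = (if x \<in> G.K \<alpha> then c else 0) \<odot> lits ls"
    using lits_wd[OF assms(1) \<alpha>(2)] assms(1) \<alpha>(1) by (simp add: scale_mult_right)
  then show ?case
    using ca IH assms(1) \<alpha> cl by (simp add: r_distr scale_add_left)
qed

end

section \<open>Norms of diagonal elements compared with their values at points of P\<close>

context cstar_algebra begin

lemma proj_complement:
  assumes "e \<in> carrier A" "e \<otimes> e = e" "adj A e = e"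
  shows "(\<one> \<ominus> e) \<otimes> (\<one> \<ominus> e) = \<one> \<ominus> e" "adj A (\<one> \<ominus> e) = \<one> \<ominus> e"
  using assms by (simp_all add: adj_add adj_uminus minus_eq l_distr r_distr l_minus r_minus l_neg r_neg)

lemma proj_norm:
  assumes "e \<in> carrier A" "e \<otimes> e = e" "adj A e = e" "e \<noteq> \<zero>" shows "cnorm A e = 1"
proof -
  have "(cnorm A e)\<^sup>2 = cnorm A e" using nu_cstar[of e] assms by simp
  moreover have "cnorm A e \<noteq> 0" using assms by (simp add: norm_eq_zero)
  ultimately show ?thesis by (simp add: power2_eq_square)
qed

lemma norm_square_iterate:
  assumes "a \<in> carrier A" "adj A a = a"
  shows "((\<lambda>y. y \<otimes> y) ^^ k) a \<in> carrier A" "cnorm A (((\<lambda>y. y \<otimes> y) ^^ k) a) = cnorm A a ^ (2 ^ k)"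
proof -
  have "cstar_hom_pair A A (\<lambda>x. x)"
    by (simp add: cstar_hom_pair_def star_hom_pair_def star_alg cstar_algebra_axioms
        star_hom_pair_axioms_def star_hom_def ring_hom_def)
  from cstar_hom_pair.norm_square_iterate[OF this assms, of k]
  show "((\<lambda>y. y \<otimes> y) ^^ k) a \<in> carrier A" "cnorm A (((\<lambda>y. y \<otimes> y) ^^ k) a) = cnorm A a ^ (2 ^ k)"
    by blast+
qed

text \<open>With f = 1 - e the powers split as y^n = (y e)^n + (y f)^n, so for n = 2^k the n-th
  power of the norm of y is at most twice that of the maximum M. The factor 2 becomes harmless as k
  grows, which rules out a norm above M.\<close>

lemma norm_split_self_adj:
  assumes y: "y \<in> carrier A" "adj A y = y" and e: "e \<in> carrier A" "e \<otimes> e = e" "adj A e = e"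
    and comm: "y \<otimes> e = e \<otimes> y"
  shows "cnorm A y \<le> max (cnorm A (y \<otimes> e)) (cnorm A (y \<otimes> (\<one> \<ominus> e)))"
proof -
  define sq where "sq k y = ((\<lambda>y. y \<otimes> y) ^^ k) y" for k y
  have iter: "sq k a \<in> carrier A" "cnorm A (sq k a) = cnorm A a ^ (2 ^ k)"
    if "a \<in> carrier A" "adj A a = a" for a k
    using norm_square_iterate[OF that, of k] by (simp_all add: sq_def)
  define f where "f = \<one> \<ominus> e"
  have f: "f \<in> carrier A" "f \<otimes> f = f" "adj A f = f"
    using proj_complement[OF e] e by (simp_all add: f_def)
  have yf: "y \<otimes> f = f \<otimes> y"
    using y e comm by (simp add: f_def minus_eq l_distr r_distr l_minus r_minus)
  have sq_mult: "sq k y \<otimes> q = q \<otimes> sq k y \<and> sq k (y \<otimes> q) = sq k y \<otimes> q"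
    if q: "q \<in> carrier A" "q \<otimes> q = q" "y \<otimes> q = q \<otimes> y" for q k
  proof (induction k)
    case (Suc k)
    define Y where "Y = sq k y"
    have Y: "Y \<in> carrier A" using iter y by (simp add: Y_def)
    have Yq: "Y \<otimes> q = q \<otimes> Y" and sk: "sq k (y \<otimes> q) = Y \<otimes> q" using Suc by (simp_all add: Y_def)
    have "(Y \<otimes> Y) \<otimes> q = Y \<otimes> (q \<otimes> Y)" using Y q by (simp add: m_assoc Yq)
    also have "\<dots> = (Y \<otimes> q) \<otimes> Y" using Y q by (simp only: m_assoc)
    also have "\<dots> = q \<otimes> (Y \<otimes> Y)" using Y q by (simp only: Yq m_assoc)
    finally have 1: "(Y \<otimes> Y) \<otimes> q = q \<otimes> (Y \<otimes> Y)" .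
    have "(Y \<otimes> q) \<otimes> (Y \<otimes> q) = Y \<otimes> (q \<otimes> Y) \<otimes> q" using Y q by (simp only: m_assoc m_closed)
    also have "\<dots> = Y \<otimes> Y \<otimes> (q \<otimes> q)" using Y q(1) by (simp only: Yq[symmetric] m_assoc m_closed)
    finally have 2: "(Y \<otimes> q) \<otimes> (Y \<otimes> q) = Y \<otimes> Y \<otimes> q" using q by simp
    show ?case using 1 2 sk by (simp add: sq_def Y_def)
  qed (use q in \<open>simp add: sq_def\<close>)
  define M where "M = max (cnorm A (y \<otimes> e)) (cnorm A (y \<otimes> f))"
  have sa: "adj A (y \<otimes> e) = y \<otimes> e" "adj A (y \<otimes> f) = y \<otimes> f"
    using y e f comm yf by (simp_all add: adj_mult)
  have bound: "cnorm A y ^ (2 ^ k) \<le> 2 * M ^ (2 ^ k)" for k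
  proof -
    have "sq k y = sq k y \<otimes> e \<oplus> sq k y \<otimes> f"
      using iter[OF y, of k] e by (simp add: f_def minus_eq r_distr r_minus) (simp add: a_lcomm r_neg)
    then have "cnorm A (sq k y) \<le> cnorm A (sq k (y \<otimes> e)) + cnorm A (sq k (y \<otimes> f))"
      using nu_triangle[of "sq k y \<otimes> e" "sq k y \<otimes> f"] iter[OF y, of k] e f sq_mult comm yf by simp
    also have "\<dots> = cnorm A (y \<otimes> e) ^ (2 ^ k) + cnorm A (y \<otimes> f) ^ (2 ^ k)"
      using iter(2)[of "y \<otimes> e"] iter(2)[of "y \<otimes> f"] sa y e f by simp
    also have "\<dots> \<le> M ^ (2 ^ k) + M ^ (2 ^ k)"
      unfolding M_def using y e f by (intro add_mono power_mono) auto
    finally show ?thesis using iter(2)[OF y] by simp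
  qed
  have "cnorm A y \<le> M"
  proof (rule ccontr)
    assume "\<not> cnorm A y \<le> M"
    then have less: "M < cnorm A y" by simp
    have M0: "0 \<le> M" unfolding M_def using y e by (simp add: le_max_iff_disj)
    then have pos: "0 < cnorm A y" using less by simp
    have r: "0 \<le> M / cnorm A y" "M / cnorm A y < 1" using M0 less pos by auto
    have "strict_mono (\<lambda>k. 2 ^ k :: nat)" by (simp add: strict_mono_def)
    then have "(\<lambda>k. (M / cnorm A y) ^ (2 ^ k)) \<longlonglongrightarrow> 0"
      using LIMSEQ_subseq_LIMSEQ[OF LIMSEQ_realpow_zero[OF r]] by (simp add: comp_def)
    then have "eventually (\<lambda>k. (M / cnorm A y) ^ (2 ^ k) < 1 / 2) sequentially"
      by (rule order_tendstoD) simp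
    then obtain k where "(M / cnorm A y) ^ (2 ^ k) < 1 / 2"
      by (auto simp: eventually_sequentially)
    then show False using bound[of k] pos by (simp add: power_divide field_simps)
  qed
  then show ?thesis by (simp add: M_def f_def)
qed

text \<open>Pass to y = x*x, which commutes with the two projections q as well; the C*-identity
  gives the norm of y q as the square of the norm of x q.\<close>

lemma norm_split:
  assumes x: "x \<in> carrier A" and e: "e \<in> carrier A" "e \<otimes> e = e" "adj A e = e"
    and comm: "x \<otimes> e = e \<otimes> x"
  shows "cnorm A x \<le> max (cnorm A (x \<otimes> e)) (cnorm A (x \<otimes> (\<one> \<ominus> e)))"
proof -
  define y where "y = adj A x \<otimes> x"
  have y: "y \<in> carrier A" "adj A y = y" using x by (simp_all add: y_def adj_mult)
  define f where "f = \<one> \<ominus> e"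
  have f: "f \<in> carrier A" "f \<otimes> f = f" "adj A f = f"
    using proj_complement[OF e] e by (simp_all add: f_def)
  have xf: "x \<otimes> f = f \<otimes> x"
    using x e comm by (simp add: f_def minus_eq l_distr r_distr l_minus r_minus)
  have yq: "y \<otimes> q = q \<otimes> y \<and> cnorm A (y \<otimes> q) = (cnorm A (x \<otimes> q))\<^sup>2"
    if q: "q \<in> carrier A" "q \<otimes> q = q" "adj A q = q" "x \<otimes> q = q \<otimes> x" for q
  proof -
    have xq: "adj A x \<otimes> q = q \<otimes> adj A x"
      using arg_cong[OF q(4), of "adj A"] q(1,3) x by (simp add: adj_mult)
    have "y \<otimes> q = adj A x \<otimes> (q \<otimes> x)" using x q(1) by (simp only: y_def m_assoc adj_closed q(4))
    also have "\<dots> = (adj A x \<otimes> q) \<otimes> x" using x q(1) by (simp only: m_assoc adj_closed)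
    also have "\<dots> = q \<otimes> y" using x q(1) by (simp only: xq y_def m_assoc adj_closed)
    finally have c: "y \<otimes> q = q \<otimes> y" .
    have "adj A (x \<otimes> q) = q \<otimes> adj A x" using x q(1,3) by (simp add: adj_mult)
    then have "adj A (x \<otimes> q) \<otimes> (x \<otimes> q) = (q \<otimes> adj A x) \<otimes> (x \<otimes> q)" by simp
    also have "\<dots> = q \<otimes> (y \<otimes> q)" using x q(1) by (simp only: y_def m_assoc m_closed adj_closed)
    also have "\<dots> = (q \<otimes> q) \<otimes> y" using y q(1) by (simp only: c m_assoc)
    also have "\<dots> = y \<otimes> q" using c q by simp
    finally show ?thesis using c nu_cstar[of "x \<otimes> q"] x q by simp
  qed
  have "(cnorm A x)\<^sup>2 = cnorm A y" using nu_cstar[OF x] by (simp add: y_def)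
  also have "\<dots> \<le> max (cnorm A (y \<otimes> e)) (cnorm A (y \<otimes> f))"
    unfolding f_def using norm_split_self_adj[OF y e] yq[OF e comm] by simp
  also have "\<dots> = max ((cnorm A (x \<otimes> e))\<^sup>2) ((cnorm A (x \<otimes> f))\<^sup>2)"
    using yq[OF e comm, THEN conjunct2] yq[OF f xf, THEN conjunct2] by simp
  finally have "(cnorm A x)\<^sup>2 \<le> (cnorm A (x \<otimes> e))\<^sup>2 \<or> (cnorm A x)\<^sup>2 \<le> (cnorm A (x \<otimes> f))\<^sup>2"
    by (simp add: le_max_iff_disj)
  then have "cnorm A x \<le> cnorm A (x \<otimes> e) \<or> cnorm A x \<le> cnorm A (x \<otimes> f)"
    using x e f by (auto simp: power2_le_iff_abs_le)
  then show ?thesis by (auto simp: f_def le_max_iff_disj)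
qed

end

locale cstar_toeplitz_fam = toeplitz_fam G P A w + cstar_algebra A
  for G :: "('g, 'k) monoid_scheme" and P and A :: "('a, 'm) cstar_scheme" (structure) and w
begin

lemma norm_lits: "valid ls \<Longrightarrow> lits ls \<noteq> \<zero> \<Longrightarrow> cnorm A (lits ls) = 1"
  by (rule proj_norm) (auto simp: lits_idem lits_self_adj)

text \<open>Each word of \<open>cs\<close> splits the cell in two, and \<open>norm_split\<close>
  says that one half carries the norm. On that half the word is a scalar and moves into c, which
  accumulates the coefficients already decided. At the end a nonzero cell contains a point by
  \<open>lits_nonzero_sat\<close>; a zero cell gives the first alternative.\<close>

lemma norm_lits_lin_comb_le:
  assumes "valid ls" "snd ` set cs \<subseteq> G.NW"
  shows "cnorm A (lits ls \<otimes> (c \<odot> \<one> \<oplus> lin_comb w cs)) = 0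
    \<or> (\<exists>x\<in>P. sat x ls \<and> cnorm A (lits ls \<otimes> (c \<odot> \<one> \<oplus> lin_comb w cs)) \<le> cmod (c + value_at x cs))"
  using assms
proof (induction cs arbitrary: ls c)
  case Nil
  show ?case
  proof (cases "lits ls = \<zero>")
    case False
    obtain x where "x \<in> P" "sat x ls" using lits_nonzero_sat Nil False by blast
    moreover have "cnorm A (lits ls \<otimes> (c \<odot> \<one> \<oplus> lin_comb w [])) = cmod c"
      using Nil False norm_lits by (simp add: scale_mult_right nu_scale)
    ultimately show ?thesis by auto
  qed simp
next
  case (Cons d\<beta> cs)
  obtain d \<beta> where d\<beta>: "d\<beta> = (d, \<beta>)" by force
  have \<beta>: "\<beta> \<in> G.NW" and ls: "valid ls" and cs: "snd ` set cs \<subseteq> G.NW" using Cons.prems d\<beta> by auto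
  define s where "s = lin_comb w cs"
  have s: "s \<in> carrier A" unfolding s_def using cs by (intro lin_comb_closed) auto
  define e where "e = wd \<beta>"
  have e: "e \<in> carrier A" "e \<otimes> e = e" "adj A e = e" using \<beta> by (simp_all add: e_def wd_idem wd_self_adj)
  define X where "X = lits ls \<otimes> (c \<odot> \<one> \<oplus> (d \<odot> e \<oplus> s))"
  have L: "lits ls \<in> carrier A" "lits ls \<otimes> e = e \<otimes> lits ls" using ls \<beta> by (simp_all add: e_def lits_wd_commute)
  have X: "X \<in> carrier A" using L s e by (simp add: X_def)
  have se: "s \<otimes> e = e \<otimes> s"
    unfolding s_def using cs
  proof (induction cs)
    case (Cons c\<alpha> cs)
    obtain c \<alpha> where c\<alpha>: "c\<alpha> = (c, \<alpha>)" by force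
    then have "wd \<alpha> \<otimes> e = e \<otimes> wd \<alpha>" "\<alpha> \<in> G.NW" "lin_comb w cs \<in> carrier A"
      using Cons.prems \<beta> wd_commute by (auto simp: e_def intro!: lin_comb_closed)
    then show ?case using Cons c\<alpha> e by (simp add: l_distr r_distr scale_mult_left scale_mult_right)
  qed (use e in simp)
  have comm: "X \<otimes> e = e \<otimes> X"
  proof -
    have "(c \<odot> \<one> \<oplus> (d \<odot> e \<oplus> s)) \<otimes> e = e \<otimes> (c \<odot> \<one> \<oplus> (d \<odot> e \<oplus> s))"
      using s e se by (simp add: l_distr r_distr scale_mult_left scale_mult_right)
    then have "X \<otimes> e = lits ls \<otimes> (e \<otimes> (c \<odot> \<one> \<oplus> (d \<odot> e \<oplus> s)))" using L s e by (simp add: X_def m_assoc)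
    also have "\<dots> = (lits ls \<otimes> e) \<otimes> (c \<odot> \<one> \<oplus> (d \<odot> e \<oplus> s))" using L(1) s e(1) by (simp add: m_assoc)
    also have "\<dots> = (e \<otimes> lits ls) \<otimes> (c \<odot> \<one> \<oplus> (d \<odot> e \<oplus> s))" by (simp only: L(2))
    also have "\<dots> = e \<otimes> X" using L(1) s e(1) by (simp add: X_def m_assoc)
    finally show ?thesis .
  qed
  have Xe: "X \<otimes> e = lits ((\<beta>, True) # ls) \<otimes> ((c + d) \<odot> \<one> \<oplus> s)"
  proof -
    define Z where "Z = c \<odot> \<one> \<oplus> (d \<odot> e \<oplus> s)"
    define Z' where "Z' = (c + d) \<odot> \<one> \<oplus> s"
    have Z: "Z \<in> carrier A" "Z' \<in> carrier A" using s e by (simp_all add: Z_def Z'_def)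
    have eZ: "e \<otimes> Z = e \<otimes> Z'"
      using s e by (simp add: Z_def Z'_def r_distr scale_mult_right scale_add_left a_assoc)
    have "e \<otimes> X = (e \<otimes> lits ls) \<otimes> Z" using L(1) e(1) Z by (simp add: X_def Z_def[symmetric] m_assoc)
    also have "\<dots> = lits ls \<otimes> (e \<otimes> Z)" using L(1) e(1) Z by (simp only: L(2)[symmetric] m_assoc)
    also have "\<dots> = (lits ls \<otimes> e) \<otimes> Z'" using L(1) e(1) Z by (simp only: eZ m_assoc)
    finally have "e \<otimes> X = (e \<otimes> lits ls) \<otimes> ((c + d) \<odot> \<one> \<oplus> s)" by (simp only: L(2) Z'_def)
    then show ?thesis unfolding comm by (simp add: lits_Cons lit_def e_def)
  qed
  have Xf: "X \<otimes> (\<one> \<ominus> e) = lits ((\<beta>, False) # ls) \<otimes> (c \<odot> \<one> \<oplus> s)"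
  proof -
    define f where "f = \<one> \<ominus> e"
    have f: "f \<in> carrier A" "f \<otimes> e = \<zero>"
      using e by (simp_all add: f_def minus_eq l_distr l_minus r_neg)
    have Lf: "lits ls \<otimes> f = f \<otimes> lits ls"
      using lits_lit_commute[of ls "(\<beta>, False)"] ls \<beta> by (simp add: lit_def e_def f_def)
    have "f \<otimes> (c \<odot> \<one> \<oplus> (d \<odot> e \<oplus> s)) = f \<otimes> (c \<odot> \<one> \<oplus> s)"
      using s e f by (simp add: r_distr scale_mult_right)
    moreover have "f \<otimes> X = lits ls \<otimes> (f \<otimes> (c \<odot> \<one> \<oplus> (d \<odot> e \<oplus> s)))"
      using L(1) s e(1) f(1) Lf by (simp add: X_def flip: m_assoc)
    ultimately have "f \<otimes> X = (f \<otimes> lits ls) \<otimes> (c \<odot> \<one> \<oplus> s)"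
      using L(1) s f(1) by (simp add: Lf flip: m_assoc)
    moreover have "X \<otimes> f = f \<otimes> X"
      using X e comm by (simp add: f_def minus_eq l_distr r_distr l_minus r_minus)
    ultimately show ?thesis by (simp add: lits_Cons lit_def e_def f_def)
  qed
  have le: "cnorm A X \<le> max (cnorm A (X \<otimes> e)) (cnorm A (X \<otimes> (\<one> \<ominus> e)))"
    using X e comm by (rule norm_split)
  have goal: "cnorm A X = 0 \<or> (\<exists>x\<in>P. sat x ls \<and> cnorm A X \<le> cmod (c + value_at x (d\<beta> # cs)))"
  proof (cases "cnorm A X \<le> cnorm A (X \<otimes> e)")
    case True
    then show ?thesis
      using Cons.IH[of "(\<beta>, True) # ls" "c + d"] ls \<beta> cs X nu_nonneg[OF X]
      unfolding Xe s_def d\<beta> by (fastforce simp: algebra_simps)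
  next
    case False
    then have "cnorm A X \<le> cnorm A (X \<otimes> (\<one> \<ominus> e))" using le by linarith
    then show ?thesis
      using Cons.IH[of "(\<beta>, False) # ls" c] ls \<beta> cs X nu_nonneg[OF X]
      unfolding Xf s_def d\<beta> by fastforce
  qed
  then show ?case by (simp add: X_def s_def e_def d\<beta>)
qed

lemma norm_lin_comb_le:
  assumes "snd ` set cs \<subseteq> G.NW"
  shows "cnorm A (lin_comb w cs) = 0 \<or> (\<exists>x\<in>P. cnorm A (lin_comb w cs) \<le> cmod (value_at x cs))"
proof -
  have "lin_comb w cs \<in> carrier A" using assms by (intro lin_comb_closed) auto
  then show ?thesis using norm_lits_lin_comb_le[of "[]" cs 0] assms by auto
qed

text \<open>Compress to the cell of x cut out by the words of \<open>cs\<close>. There the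
  combination is the scalar \<open>value_at x cs\<close>, and nondegeneracy gives the cell
  projection norm 1.\<close>

lemma norm_lin_comb_ge:
  assumes "nondegenerate" "snd ` set cs \<subseteq> G.NW" "x \<in> P"
  shows "cmod (value_at x cs) \<le> cnorm A (lin_comb w cs)"
proof -
  define ls where "ls = map (\<lambda>(c, \<alpha>). (\<alpha>, x \<in> G.K \<alpha>)) cs"
  have ls: "valid ls" "sat x ls" using assms by (auto simp: ls_def valid_def sat_def)
  then have nz: "lits ls \<noteq> \<zero>" using assms by (auto simp: nondegenerate_def)
  have c: "lin_comb w cs \<in> carrier A" using assms by (intro lin_comb_closed) auto
  have "lits ls \<otimes> lin_comb w cs = value_at x cs \<odot> lits ls"
    by (rule lits_lin_comb) (use assms ls in \<open>force simp: ls_def\<close>)+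
  then have "cmod (value_at x cs) = cnorm A (lits ls \<otimes> lin_comb w cs)"
    using ls nz norm_lits by (simp add: nu_scale)
  also have "\<dots> \<le> cnorm A (lits ls) * cnorm A (lin_comb w cs)"
    using ls c by (intro nu_mult) auto
  finally show ?thesis using ls nz norm_lits by simp
qed

end

text \<open>Both norms are compared with the values at points of P. With the universal family as w,
  it shows that a nondegenerate representation does not shrink the diagonal.\<close>

lemma norm_lin_comb_compare:
  assumes "cstar_toeplitz_fam G P A w" "cstar_toeplitz_fam G P B v"
    and nd: "toeplitz_fam.nondegenerate G P B v" and cs: "snd ` set cs \<subseteq> neutral_words G P"
  shows "cnorm A (star_alg.lin_comb A w cs) \<le> cnorm B (star_alg.lin_comb B v cs)"
proof -
  interpret A: cstar_toeplitz_fam G P A w by fact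
  interpret B: cstar_toeplitz_fam G P B v by fact
  have "B.lin_comb v cs \<in> carrier B" using cs by (intro B.lin_comb_closed) auto
  then show ?thesis
    using A.norm_lin_comb_le[OF cs] B.norm_lin_comb_ge[OF nd cs] by (force dest: order_trans)
qed

section \<open>Representations on \<open>\<ell>\<^sup>2\<close>\<close>

text \<open>The isometry that carries the basis vector at x to the one at \<open>\<phi> x\<close>,
  for \<phi> injective on X and into X; \<open>pull\<close> is its adjoint.\<close>

definition push :: "'x set \<Rightarrow> ('x \<Rightarrow> 'x) \<Rightarrow> ('x \<Rightarrow> complex) \<Rightarrow> 'x \<Rightarrow> complex" where
  "push X \<phi> f = (\<lambda>y. if f \<in> ell2 X \<and> y \<in> \<phi> ` X then f (inv_into X \<phi> y) else 0)"

definition pull :: "'x set \<Rightarrow> ('x \<Rightarrow> 'x) \<Rightarrow> ('x \<Rightarrow> complex) \<Rightarrow> 'x \<Rightarrow> complex" where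
  "pull X \<phi> f = (\<lambda>x. if f \<in> ell2 X \<and> x \<in> X then f (\<phi> x) else 0)"

context
  fixes X :: "'x set" and \<phi> :: "'x \<Rightarrow> 'x"
  assumes inj: "inj_on \<phi> X" and into: "\<phi> ` X \<subseteq> X"
begin

lemma push_ell2:
  assumes f: "f \<in> ell2 X" shows "push X \<phi> f \<in> ell2 X" "ell2_norm X (push X \<phi> f) \<le> ell2_norm X f"
proof -
  have bd: "L2_set (\<lambda>y. cmod (push X \<phi> f y)) F \<le> ell2_norm X f" if F: "finite F" "F \<subseteq> X" for F
  proof -
    define F' where "F' = inv_into X \<phi> ` (F \<inter> \<phi> ` X)"
    have F': "finite F'" "F' \<subseteq> X" using F by (auto simp: F'_def inv_into_into)
    have "(\<Sum>y\<in>F. (cmod (push X \<phi> f y))\<^sup>2) = (\<Sum>y\<in>F \<inter> \<phi> ` X. (cmod (f (inv_into X \<phi> y)))\<^sup>2)"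
      by (rule sum.mono_neutral_cong_right) (use F f in \<open>auto simp: push_def\<close>)
    also have "\<dots> = (\<Sum>x\<in>F'. (cmod (f x))\<^sup>2)"
      unfolding F'_def
      by (rule sum.reindex[symmetric, unfolded comp_def])
        (auto intro: inj_on_subset[OF inj_on_inv_into[of "\<phi> ` X" \<phi> X]])
    finally have "L2_set (\<lambda>y. cmod (push X \<phi> f y)) F = L2_set (\<lambda>x. cmod (f x)) F'"
      by (simp add: L2_set_def)
    then show ?thesis using L2_set_le_ell2_norm[OF f F'] by simp
  qed
  show "push X \<phi> f \<in> ell2 X" "ell2_norm X (push X \<phi> f) \<le> ell2_norm X f"
    by (rule ell2I; use bd into in \<open>auto simp: push_def\<close>)+
qed

lemma pull_ell2:
  assumes f: "f \<in> ell2 X" shows "pull X \<phi> f \<in> ell2 X" "ell2_norm X (pull X \<phi> f) \<le> ell2_norm X f"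
proof -
  have bd: "L2_set (\<lambda>x. cmod (pull X \<phi> f x)) F \<le> ell2_norm X f" if F: "finite F" "F \<subseteq> X" for F
  proof -
    have "(\<Sum>x\<in>F. (cmod (pull X \<phi> f x))\<^sup>2) = (\<Sum>x\<in>F. (cmod (f (\<phi> x)))\<^sup>2)"
      by (rule sum.cong) (use F f in \<open>auto simp: pull_def\<close>)
    also have "\<dots> = (\<Sum>y\<in>\<phi> ` F. (cmod (f y))\<^sup>2)"
      by (rule sum.reindex[symmetric, unfolded comp_def]) (rule inj_on_subset[OF inj F(2)])
    finally have "L2_set (\<lambda>x. cmod (pull X \<phi> f x)) F = L2_set (\<lambda>y. cmod (f y)) (\<phi> ` F)"
      by (simp add: L2_set_def)
    then show ?thesis using L2_set_le_ell2_norm[OF f, of "\<phi> ` F"] F into by auto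
  qed
  show "pull X \<phi> f \<in> ell2 X" "ell2_norm X (pull X \<phi> f) \<le> ell2_norm X f"
    by (rule ell2I; use bd in \<open>auto simp: pull_def\<close>)+
qed

lemma push_bounded: "push X \<phi> \<in> bounded_ops X"
  by (rule boI[where C = 1])
    (auto simp: push_ell2, auto simp: push_def ell2_add ell2_scale inv_into_into)

lemma pull_bounded: "pull X \<phi> \<in> bounded_ops X"
  by (rule boI[where C = 1])
    (auto simp: pull_ell2, auto simp: pull_def ell2_add ell2_scale)

lemma adj_push: "adj (B_ell2 X) (push X \<phi>) = pull X \<phi>"
proof (rule B_adj_eqI[OF push_bounded pull_bounded])
  fix f g assume f: "f \<in> ell2 X" and g: "g \<in> ell2 X"
  have "ell2_inner X (push X \<phi> f) g = infsum (\<lambda>y. f (inv_into X \<phi> y) * cnj (g y)) (\<phi> ` X)"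
    unfolding ell2_inner_def
    by (rule infsum_cong_neutral) (use f into in \<open>auto simp: push_def\<close>)
  also have "\<dots> = infsum (\<lambda>x. f (inv_into X \<phi> (\<phi> x)) * cnj (g (\<phi> x))) X"
    by (subst infsum_reindex[OF inj]) (simp add: comp_def)
  also have "\<dots> = ell2_inner X f (pull X \<phi> g)"
    unfolding ell2_inner_def
    by (rule infsum_cong) (use g inj in \<open>auto simp: pull_def\<close>)
  finally show "ell2_inner X (push X \<phi> f) g = ell2_inner X f (pull X \<phi> g)" .
qed

lemma push_delta: assumes x: "x \<in> X" shows "push X \<phi> (delta x) = delta (\<phi> x)"
proof
  fix y
  show "push X \<phi> (delta x) y = delta (\<phi> x) y"
  proof (cases "y \<in> \<phi> ` X")
    case True
    then obtain z where z: "z \<in> X" "y = \<phi> z" by blast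
    have "push X \<phi> (delta x) y = delta x z"
      using z x inj by (simp add: push_def)
    also have "\<dots> = delta (\<phi> x) y"
      unfolding delta_def z(2) inj_on_eq_iff[OF inj z(1) x] ..
    finally show ?thesis .
  next
    case False
    then show ?thesis using x by (auto simp: push_def delta_def)
  qed
qed

lemma pull_delta: assumes x: "x \<in> X" shows "pull X \<phi> (delta (\<phi> x)) = delta x"
proof
  fix z
  have d: "delta (\<phi> x) \<in> ell2 X" using x into by (intro delta_ell2) blast
  show "pull X \<phi> (delta (\<phi> x)) z = delta x z"
  proof (cases "z \<in> X")
    case True
    then have "pull X \<phi> (delta (\<phi> x)) z = delta (\<phi> x) (\<phi> z)" using d by (simp add: pull_def)
    also have "\<dots> = delta x z"
      unfolding delta_def inj_on_eq_iff[OF inj True x] ..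
    finally show ?thesis .
  next
    case False
    then show ?thesis using x by (auto simp: pull_def delta_def)
  qed
qed

lemma pull_delta_zero: "y \<notin> \<phi> ` X \<Longrightarrow> pull X \<phi> (delta y) = (\<lambda>x. 0)"
  by (auto simp: pull_def fun_eq_iff delta_def)

end

lemma B_minus:
  assumes "S \<in> bounded_ops X" "T \<in> bounded_ops X"
  shows "S \<ominus>\<^bsub>B_ell2 X\<^esub> T = (\<lambda>f x. S f x - T f x)"
proof -
  interpret B: cstar_algebra "B_ell2 X" by (rule B_cstar_algebra)
  show ?thesis
    using assms B.uminus_conv_scale[of T] by (simp add: B.minus_eq B_simps)
qed

text \<open>Adjoints replace a density argument: the values on basis vectors determine all
  coordinates of the adjoint, and the adjoint on basis vectors determines all coordinates of the
  operator.\<close>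

lemma bo_delta_eqI:
  assumes "S \<in> bounded_ops X" "T \<in> bounded_ops X" "\<And>x. x \<in> X \<Longrightarrow> S (delta x) = T (delta x)"
  shows "S = T"
proof (rule bo_eqI[OF assms(1,2)])
  fix f assume f: "f \<in> ell2 X"
  have adj_eq: "adj (B_ell2 X) S g = adj (B_ell2 X) T g" if g: "g \<in> ell2 X" for g
  proof
    fix x
    show "adj (B_ell2 X) S g x = adj (B_ell2 X) T g x"
    proof (cases "x \<in> X")
      case True
      have "cnj (adj (B_ell2 X) S g x) = ell2_inner X (S (delta x)) g"
        using B_adj(2)[OF assms(1) delta_ell2[OF True] g] True by (simp add: ell2_inner_delta_left)
      also have "\<dots> = cnj (adj (B_ell2 X) T g x)"
        using B_adj(2)[OF assms(2) delta_ell2[OF True] g] True assms(3)[OF True] by (simp add: ell2_inner_delta_left)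
      finally show ?thesis by simp
    next
      case False
      have "adj (B_ell2 X) S g \<in> ell2 X" "adj (B_ell2 X) T g \<in> ell2 X"
        using assms(1,2) g by (auto intro: bo_ell2 B_adj(1))
      then show ?thesis using False by (simp add: ell2_zero_outside)
    qed
  qed
  show "S f = T f"
  proof
    fix y
    show "S f y = T f y"
    proof (cases "y \<in> X")
      case True
      then show ?thesis
        using B_adj(2)[OF assms(1) f delta_ell2[OF True]] B_adj(2)[OF assms(2) f delta_ell2[OF True]]
          adj_eq[OF delta_ell2[OF True]] by (simp add: ell2_inner_delta_right)
    next
      case False
      then show ?thesis
        using bo_ell2[OF assms(1) f] bo_ell2[OF assms(2) f] by (simp add: ell2_zero_outside)
    qed
  qed
qed

text \<open>
  A quotient \<open>c(P)\<close> of \<open>P\<close> on which \<open>P\<close> still acts by injective maps and which separates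
  principal right ideals. The cases of interest are \<open>c t = t\<close> and \<open>c t = tP\<close>.
\<close>

locale quotient_rep = submonoid_in_group G P for G :: "('g, 'k) monoid_scheme" (structure) and P +
  fixes c :: "'g \<Rightarrow> 'x"
  assumes c_cong: "\<lbrakk>p \<in> P; s \<in> P; t \<in> P\<rbrakk> \<Longrightarrow> c (p \<otimes> s) = c (p \<otimes> t) \<longleftrightarrow> c s = c t"
    and c_coset: "\<lbrakk>s \<in> P; t \<in> P; c s = c t\<rbrakk> \<Longrightarrow> s <# P = t <# P"
begin

text \<open>Translation of classes through an arbitrarily chosen representative;
  \<open>c_cong\<close> makes the choice immaterial.\<close>

definition act :: "'g \<Rightarrow> 'x \<Rightarrow> 'x" where
  "act p x = c (p \<otimes> inv_into P c x)"

lemma act_c: "p \<in> P \<Longrightarrow> t \<in> P \<Longrightarrow> act p (c t) = c (p \<otimes> t)"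
  unfolding act_def
  by (subst c_cong) (auto intro: inv_into_into f_inv_into_f)

lemma act_inj: "p \<in> P \<Longrightarrow> inj_on (act p) (c ` P)"
  by (rule inj_onI) (auto simp: act_c c_cong)

lemma act_into: "p \<in> P \<Longrightarrow> act p ` (c ` P) \<subseteq> c ` P"
  by (auto simp: act_c)

abbreviation "HB \<equiv> B_ell2 (c ` P)"

definition V :: "'g \<Rightarrow> ('x \<Rightarrow> complex) \<Rightarrow> 'x \<Rightarrow> complex" where
  "V p = push (c ` P) (act p)"

lemma V_bounded: "p \<in> P \<Longrightarrow> V p \<in> bounded_ops (c ` P)"
  unfolding V_def by (intro push_bounded act_inj act_into)

lemma V_delta: "p \<in> P \<Longrightarrow> t \<in> P \<Longrightarrow> V p (delta (c t)) = delta (c (p \<otimes> t))"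
  unfolding V_def using push_delta[OF act_inj act_into, of p "c t"] by (simp add: act_c)

lemma adj_V_delta:
  assumes "p \<in> P" "s \<in> P"
  shows "adj HB (V p) (delta (c s)) = (if inv p \<otimes> s \<in> P then delta (c (inv p \<otimes> s)) else (\<lambda>x. 0))"
proof (cases "inv p \<otimes> s \<in> P")
  case True
  have "c s = act p (c (inv p \<otimes> s))" using True assms by (simp add: act_c flip: m_assoc)
  then show ?thesis
    using True assms pull_delta[OF act_inj act_into, of p "c (inv p \<otimes> s)"]
    by (simp add: V_def adj_push[OF act_inj act_into])
next
  case False
  \<comment> \<open>This is where \<open>c_coset\<close> enters: if the class of s were hit by p,
    then sP would be ptP for some t, and s would lie in pP. Without this condition the quotient
    could enlarge the range projection of \<open>V p\<close>.\<close>
  have "c s \<notin> act p ` (c ` P)"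
  proof
    assume "c s \<in> act p ` (c ` P)"
    then obtain t where t: "t \<in> P" "c s = c (p \<otimes> t)" using assms by (auto simp: act_c)
    then have "s <# P = (p \<otimes> t) <# P" using assms by (intro c_coset) auto
    then have "s \<in> (p \<otimes> t) <# P" using eq_l_coset_iff[of s "p \<otimes> t"] assms t by simp
    then obtain u where u: "u \<in> P" "s = p \<otimes> t \<otimes> u" by (auto simp: l_coset_def)
    have "inv p \<otimes> s = t \<otimes> u" using u t assms by (simp add: m_assoc flip: m_assoc[of "inv p" p])
    then show False using False u t by simp
  qed
  then show ?thesis
    using False assms pull_delta_zero[OF act_inj act_into, of p "c s"]
    by (simp add: V_def adj_push[OF act_inj act_into])
qed

interpretation H: cstar_algebra HB by (rule B_cstar_algebra)

lemma wdot_V_bounded: "\<alpha> \<in> words P \<Longrightarrow> wdot HB V \<alpha> \<in> bounded_ops (c ` P)"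
proof (induction rule: words_induct)
  case Nil
  then show ?case using H.one_closed by (simp add: B_simps(1))
next
  case (Cons p q \<alpha>)
  then show ?case
    unfolding wdot.simps B_simps(2) by (intro bo_comp B_adj(1) V_bounded)
qed

lemma wdot_V_delta:
  assumes "\<alpha> \<in> words P" "t \<in> P"
  shows "wdot HB V \<alpha> (delta (c t)) = (if t \<in> K \<alpha> then delta (c (dot G \<alpha> \<otimes> t)) else (\<lambda>x. 0))"
  using assms(1)
proof (induction rule: words_induct)
  case Nil
  then show ?case using assms(2) by (simp add: B_simps(3))
next
  case (Cons p q \<alpha>)
  have step: "wdot HB V (p # q # \<alpha>) (delta (c t)) = adj HB (V p) (V q (wdot HB V \<alpha> (delta (c t))))"
    by (simp add: B_simps(2))
  show ?case
  proof (cases "t \<in> K \<alpha>")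
    case True
    have y: "dot G \<alpha> \<otimes> t \<in> P" using Cons True by (intro constr_dot)
    have eq: "inv p \<otimes> q \<otimes> dot G \<alpha> \<otimes> t = inv p \<otimes> (q \<otimes> (dot G \<alpha> \<otimes> t))"
      using Cons assms(2) by (simp add: m_assoc)
    show ?thesis
      unfolding step Cons.IH using Cons.hyps True y assms(2)
      by (simp add: V_delta adj_V_delta mem_constr_Cons eq)
  next
    case False
    have "V q (\<lambda>x. 0) = (\<lambda>x. 0)" "adj HB (V p) (\<lambda>x. 0) = (\<lambda>x. 0)"
      using V_bounded[of p] V_bounded[of q] Cons by (auto intro!: bo_zero_vec B_adj(1))
    then show ?thesis
      unfolding step Cons.IH using Cons.hyps False by (simp add: mem_constr_Cons)
  qed
qed

lemma wdot_V_neutral_delta: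
  assumes "\<alpha> \<in> NW" "t \<in> P"
  shows "wdot HB V \<alpha> (delta (c t)) = (\<lambda>x. (if t \<in> K \<alpha> then 1 else 0) * delta (c t) x)"
  using wdot_V_delta[of \<alpha> t] assms by auto

lemma mult_list_delta:
  assumes "\<And>x. x \<in> set xs \<Longrightarrow> f x \<in> bounded_ops (c ` P)" "t \<in> P"
    "\<And>x. x \<in> set xs \<Longrightarrow> f x (delta (c t)) = (\<lambda>y. r x * delta (c t) y)"
  shows "mult_list HB (map f xs) (delta (c t)) = (\<lambda>y. prod_list (map r xs) * delta (c t) y)"
  using assms(1,3)
proof (induction xs)
  case Nil
  then show ?case using assms by (simp add: B_simps(3))
next
  case (Cons x xs)
  have "mult_list HB (map f (x # xs)) (delta (c t)) = f x (mult_list HB (map f xs) (delta (c t)))"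
    by (simp add: B_simps(2))
  also have "\<dots> = f x (\<lambda>y. prod_list (map r xs) * delta (c t) y)" using Cons by simp
  also have "\<dots> = (\<lambda>y. prod_list (map r xs) * f x (delta (c t)) y)"
    using Cons.prems assms(2) by (intro bo_scale) auto
  finally show ?case using Cons.prems by (simp add: mult.assoc mult.left_commute)
qed

text \<open>Basis vectors are eigenvectors of every neutral word, with eigenvalue 1 or 0 according
  to membership of t in its ideal. The relations thus become identities between indicator functions
  at t.\<close>

lemma V_toeplitz: "toeplitz_family G P HB V"
proof -
  have bd: "wdot HB V \<alpha> \<in> bounded_ops (c ` P)" if "\<alpha> \<in> NW" for \<alpha>
    using that by (intro wdot_V_bounded) simp
  have z: "(\<lambda>f x. 0) \<in> bounded_ops (c ` P)" by (rule bo_zero)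
  have "V \<one> = \<one>\<^bsub>HB\<^esub>"
    by (rule bo_delta_eqI[of _ "c ` P"])
      (use H.one_closed in \<open>auto simp: V_bounded V_delta B_simps(1,3)\<close>)
  then have 1: "V \<one> \<ominus>\<^bsub>HB\<^esub> \<one>\<^bsub>HB\<^esub> = \<zero>\<^bsub>HB\<^esub>" by (simp add: H.diff_eq_zero_iff)
  have 2: "wdot HB V \<alpha> = \<zero>\<^bsub>HB\<^esub>" if "\<alpha> \<in> NW" "K \<alpha> = {}" for \<alpha>
    unfolding B_simps(4)
    by (rule bo_delta_eqI[of _ "c ` P"]) (use that bd z in \<open>auto simp: wdot_V_neutral_delta\<close>)
  have eq: "wdot HB V \<alpha> = wdot HB V \<beta>" if "\<alpha> \<in> NW" "\<beta> \<in> NW" "K \<alpha> = K \<beta>" for \<alpha> \<beta>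
    by (rule bo_delta_eqI[of _ "c ` P"]) (use that bd in \<open>auto simp: wdot_V_neutral_delta\<close>)
  have 3: "wdot HB V \<alpha> \<ominus>\<^bsub>HB\<^esub> wdot HB V \<beta> = \<zero>\<^bsub>HB\<^esub>"
    if "\<alpha> \<in> NW" "\<beta> \<in> NW" "K \<alpha> = K \<beta>" for \<alpha> \<beta>
    using eq[OF that] bd[OF that(1)] bd[OF that(2)] by (simp add: H.diff_eq_zero_iff B_simps(1))
  have 4: "mult_list HB (map (\<lambda>\<beta>. wdot HB V \<alpha> \<ominus>\<^bsub>HB\<^esub> wdot HB V \<beta>) F) = \<zero>\<^bsub>HB\<^esub>"
    if \<alpha>: "\<alpha> \<in> NW" and F: "F \<noteq> []" "set F \<subseteq> NW" "K \<alpha> = (\<Union>\<beta>\<in>set F. K \<beta>)" for \<alpha> F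
  proof -
    define f where "f = (\<lambda>\<beta>. wdot HB V \<alpha> \<ominus>\<^bsub>HB\<^esub> wdot HB V \<beta>)"
    have fb: "f \<beta> \<in> bounded_ops (c ` P)" if "\<beta> \<in> set F" for \<beta>
      using H.minus_closed[of "wdot HB V \<alpha>" "wdot HB V \<beta>"] that \<alpha> F bd by (auto simp: f_def B_simps(1))
    have "mult_list HB (map f F) \<in> carrier HB"
      using fb by (intro H.mult_list_closed) (auto simp: B_simps(1))
    moreover have "mult_list HB (map f F) (delta (c t)) = (\<lambda>x. 0)" if t: "t \<in> P" for t
    proof -
      define r where "r = (\<lambda>\<beta>. (if t \<in> K \<alpha> then 1 else 0) - (if t \<in> K \<beta> then 1 else 0) :: complex)"
      have "f \<beta> (delta (c t)) = (\<lambda>y. r \<beta> * delta (c t) y)" if "\<beta> \<in> set F" for \<beta>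
      proof -
        have "\<beta> \<in> NW" using that F by auto
        then show ?thesis
          using \<alpha> t bd by (simp add: f_def r_def B_minus wdot_V_neutral_delta left_diff_distrib)
      qed
      then have "mult_list HB (map f F) (delta (c t)) = (\<lambda>y. prod_list (map r F) * delta (c t) y)"
        using fb t by (intro mult_list_delta) auto
      moreover have "\<exists>\<beta>\<in>set F. r \<beta> = 0"
      proof (cases "t \<in> K \<alpha>")
        case True
        then show ?thesis using F by (auto simp: r_def)
      next
        case False
        \<comment> \<open>Outside \<open>K \<alpha>\<close> every factor of the (T4) product
          vanishes, but there has to be at least one factor; this is where
          \<open>F \<noteq> []\<close> is used.\<close>
        then have "r (hd F) = 0" using F by (auto simp: r_def)
        then show ?thesis using F(1) by (intro bexI[of _ "hd F"]) auto
      qed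
      then have "prod_list (map r F) = 0" by (auto simp: prod_list_zero_iff image_iff)
      ultimately show ?thesis by simp
    qed
    ultimately have "mult_list HB (map f F) = (\<lambda>f x. 0)"
      by (intro bo_delta_eqI[of _ "c ` P"]) (auto simp: z B_simps(1))
    then show ?thesis by (simp add: f_def B_simps(4))
  qed
  show ?thesis
    unfolding toeplitz_family_def toeplitz_relators_def
    using V_bounded 1 2 3 4 by (auto simp: B_simps(1))
qed

lemma V_cstar_toeplitz_fam: "cstar_toeplitz_fam G P HB V"
  by (simp add: cstar_toeplitz_fam_def toeplitz_fam_def toeplitz_fam_axioms_def
      submonoid_in_group_axioms H.star_alg H.cstar_algebra_axioms V_toeplitz)

interpretation F: cstar_toeplitz_fam G P HB V by (rule V_cstar_toeplitz_fam)

lemma lits_V_delta: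
  assumes "F.valid ls" "t \<in> P" "F.sat t ls"
  shows "F.lits ls (delta (c t)) = delta (c t)"
  using assms(1,3)
proof (induction ls)
  case Nil
  then show ?case using assms(2) by (simp add: B_simps(3))
next
  case (Cons l ls)
  have "F.lit l (delta (c t)) = delta (c t)"
    using Cons.prems assms(2) wdot_V_bounded[of "fst l"] H.one_closed
    by (auto simp: F.lit_def B_minus wdot_V_neutral_delta B_simps(1) B_simps(3))
  then show ?case using Cons by (simp add: F.lits_Cons B_simps(2))
qed

lemma V_nondegenerate: "F.nondegenerate"
  unfolding F.nondegenerate_def
proof (intro allI impI notI)
  fix ls t assume a: "F.valid ls \<and> t \<in> P \<and> F.sat t ls" and "F.lits ls = \<zero>\<^bsub>HB\<^esub>"
  then have "delta (c t) (c t) = (0 :: complex)"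
    using lits_V_delta[of ls t] by (metis B_simps(4))
  then show False by (simp add: delta_def)
qed

end

context submonoid_in_group begin

lemma quotient_rep_id: "quotient_rep G P (\<lambda>t. t)"
  by unfold_locales auto

lemma quotient_rep_coset: "quotient_rep G P (\<lambda>t. t <# P)"
proof unfold_locales
  fix p s t assume p: "p \<in> P" "s \<in> P" "t \<in> P"
  have "p \<otimes> a \<in> (p \<otimes> b) <# P \<longleftrightarrow> a \<in> b <# P" if "a \<in> P" "b \<in> P" for a b
  proof -
    have "inv (p \<otimes> b) \<otimes> (p \<otimes> a) = inv b \<otimes> a"
      using p that by (simp add: inv_mult_group m_assoc flip: m_assoc[of "inv p" p])
    then show ?thesis using p that by (simp add: mem_l_coset)
  qed
  then show "(p \<otimes> s) <# P = (p \<otimes> t) <# P \<longleftrightarrow> s <# P = t <# P"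
    using p by (simp add: eq_l_coset_iff)
qed

lemma L_op_eq_V: assumes "p \<in> P" shows "L_op G P p = quotient_rep.V G P (\<lambda>t. t) p"
proof -
  interpret Q: quotient_rep G P "\<lambda>t. t" by (rule quotient_rep_id)
  have act: "Q.act p t = p \<otimes> t" if "t \<in> P" for t using Q.act_c[OF assms that] by simp
  have img: "x \<in> p <# P \<longleftrightarrow> x \<in> Q.act p ` P" for x
    using act by (auto simp: l_coset_def image_iff)
  have "f (inv p \<otimes> x) = f (inv_into P (Q.act p) x)" if x: "x \<in> p <# P" for f :: "'g \<Rightarrow> complex" and x
  proof -
    obtain t where t: "t \<in> P" "x = p \<otimes> t" using x by (auto simp: l_coset_def)
    have "inv_into P (Q.act p) (Q.act p t) = t"
      using Q.act_inj[OF assms] t by (intro inv_into_f_f) auto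
    then show ?thesis using t act assms by (simp flip: m_assoc)
  qed
  then show ?thesis
    unfolding L_op_def Q.V_def push_def by (auto simp: fun_eq_iff img)
qed

end

section \<open>Free *-algebras and universal seminorms\<close>

abbreviation "plookup \<equiv> Poly_Mapping.lookup"
abbreviation "psingle \<equiv> Poly_Mapping.single"
abbreviation "pkeys \<equiv> Poly_Mapping.keys"

lemma adj_word_adj_word [simp]: "adj_word (adj_word u) = u"
  by (simp add: adj_word_def rev_map comp_def case_prod_unfold)

lemma adj_word_append: "adj_word (u @ v) = adj_word v @ adj_word u"
  by (simp add: adj_word_def)

lemma set_adj_word: "fst ` set (adj_word u) = fst ` set u"
  by (simp add: adj_word_def image_image case_prod_unfold)

lemma lookup_adj_poly: "plookup (adj_poly f) u = cnj (plookup f (adj_word u))"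
proof -
  have "plookup (adj_poly f) u = (\<Sum>v\<in>pkeys f. if v = adj_word u then cnj (plookup f v) else 0)"
    unfolding adj_poly_def lookup_sum
    by (rule sum.cong) (auto simp: lookup_single when_def)
  also have "\<dots> = (if adj_word u \<in> pkeys f then cnj (plookup f (adj_word u)) else 0)"
    by (rule sum.delta) simp
  finally show ?thesis by (simp add: in_keys_iff)
qed

lemma adj_poly_add: "adj_poly (f + g) = adj_poly f + adj_poly g"
  by (rule poly_mapping_eqI) (simp add: lookup_adj_poly lookup_add)

lemma adj_poly_single: "adj_poly (psingle u c) = psingle (adj_word u) (cnj c)"
  by (rule poly_mapping_eqI) (auto simp: lookup_adj_poly lookup_single when_def)

lemma lookup_scale: "plookup (Poly_Mapping.map ((*) c) f) u = c * plookup f u"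
  for c :: complex
  by (simp add: Poly_Mapping.map.rep_eq when_def)

lemma scale_poly_add: "Poly_Mapping.map ((*) c) (f + g) = Poly_Mapping.map ((*) c) f + Poly_Mapping.map ((*) c) g"
  for c :: complex
  by (rule poly_mapping_eqI) (simp add: lookup_scale lookup_add distrib_left)

lemma scale_poly_zero [simp]: "Poly_Mapping.map ((*) c) 0 = 0" for c :: complex
  by (rule poly_mapping_eqI) (simp add: lookup_scale)

lemma scale_poly_single: "Poly_Mapping.map ((*) c) (psingle u d) = psingle u (c * d)"
  for c :: complex
  by (rule poly_mapping_eqI) (auto simp: lookup_scale lookup_single when_def)

text \<open>The predicate C restricts the words that occur, so that the induction can stay inside
  the polynomials over a given set of generators.\<close>

lemma poly_induct [case_names keys single add zero]:
  fixes f :: "'a \<Rightarrow>\<^sub>0 complex"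
  assumes "\<And>u. u \<in> pkeys f \<Longrightarrow> C u"
    and single: "\<And>u c. C u \<Longrightarrow> Q (psingle u c)"
    and add: "\<And>f g. \<lbrakk>\<And>u. u \<in> pkeys f \<Longrightarrow> C u; \<And>u. u \<in> pkeys g \<Longrightarrow> C u; Q f; Q g\<rbrakk> \<Longrightarrow> Q (f + g)"
    and zero: "Q 0"
  shows "Q f"
proof -
  have "Q (\<Sum>u\<in>S. psingle u (plookup f u)) \<and> pkeys (\<Sum>u\<in>S. psingle u (plookup f u)) \<subseteq> S"
    if "finite S" "\<And>u. u \<in> S \<Longrightarrow> C u" for S
    using that
  proof (induction S rule: finite_induct)
    case (insert u S)
    define g where "g = (\<Sum>u\<in>S. psingle u (plookup f u))"
    have g: "Q g" "pkeys g \<subseteq> S" using insert by (auto simp: g_def)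
    have "Q (psingle u (plookup f u) + g)"
    proof (rule add)
      show "C v" if "v \<in> pkeys (psingle u (plookup f u))" for v
        using that insert.prems by (auto split: if_splits)
      show "C v" if "v \<in> pkeys g" for v using that g insert.prems by blast
    qed (use g single insert.prems in auto)
    moreover have "pkeys (psingle u (plookup f u) + g) \<subseteq> insert u S"
      using keys_add[of "psingle u (plookup f u)" g] g by (auto split: if_splits)
    ultimately show ?case using insert by (simp add: g_def)
  qed (simp add: zero)
  from this[of "pkeys f"] have "Q (\<Sum>u\<in>pkeys f. psingle u (plookup f u))" using assms(1) by simp
  moreover have "(\<Sum>u\<in>pkeys f. psingle u (plookup f u)) = f"
  proof (rule poly_mapping_eqI)
    fix v
    have "plookup (\<Sum>u\<in>pkeys f. psingle u (plookup f u)) v = (\<Sum>u\<in>pkeys f. if u = v then plookup f u else 0)"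
      unfolding lookup_sum by (rule sum.cong) (auto simp: lookup_single when_def)
    also have "\<dots> = (if v \<in> pkeys f then plookup f v else 0)" by (rule sum.delta) simp
    finally show "plookup (\<Sum>u\<in>pkeys f. psingle u (plookup f u)) v = plookup f v" by (simp add: in_keys_iff)
  qed
  ultimately show ?thesis by simp
qed

lemma adj_poly_zero [simp]: "adj_poly 0 = 0"
  by (simp add: adj_poly_def)

lemma adj_poly_mult: "adj_poly (f * g) = adj_poly g * adj_poly f"
proof (induction f rule: poly_induct[where C = "\<lambda>_. True"])
  case (single u c)
  show ?case
  proof (induction g rule: poly_induct[where C = "\<lambda>_. True"])
    case (single v d)
    show ?case by (simp add: mult_single adj_poly_single adj_word_append plus_list_def mult.commute)
  qed (simp_all add: distrib_left distrib_right adj_poly_add)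
qed (simp_all add: distrib_left distrib_right adj_poly_add)

lemma scale_poly_mult_left: "Poly_Mapping.map ((*) c) f * g = Poly_Mapping.map ((*) c) (f * g)"
  for f :: "('x \<times> bool) list \<Rightarrow>\<^sub>0 complex"
proof (induction f rule: poly_induct[where C = "\<lambda>_. True"])
  case (single u d)
  show ?case
  proof (induction g rule: poly_induct[where C = "\<lambda>_. True"])
    case (single v d)
    show ?case by (simp add: mult_single scale_poly_single mult.assoc)
  qed (simp_all add: distrib_left distrib_right scale_poly_add)
qed (simp_all add: distrib_left distrib_right scale_poly_add)

lemma scale_poly_mult_right: "f * Poly_Mapping.map ((*) c) g = Poly_Mapping.map ((*) c) (f * g)"
  for f :: "('x \<times> bool) list \<Rightarrow>\<^sub>0 complex"
proof (induction f rule: poly_induct[where C = "\<lambda>_. True"])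
  case (single u d)
  show ?case
  proof (induction g rule: poly_induct[where C = "\<lambda>_. True"])
    case (single v d)
    show ?case by (simp add: mult_single scale_poly_single mult.left_commute)
  qed (simp_all add: distrib_left distrib_right scale_poly_add)
qed (simp_all add: distrib_left distrib_right scale_poly_add)

abbreviation "FA \<equiv> free_star_algebra"

lemma FA_simps: "f \<in> carrier (FA X) \<longleftrightarrow> (\<forall>u\<in>pkeys f. fst ` set u \<subseteq> X)"
  "mult (FA X) f g = f * g" "\<one>\<^bsub>FA X\<^esub> = 1" "\<zero>\<^bsub>FA X\<^esub> = 0" "add (FA X) f g = f + g"
  "smult (FA X) c f = Poly_Mapping.map ((*) c) f" "adj (FA X) f = adj_poly f"
  by (simp_all add: free_star_algebra_def)

lemma FA_closed:
  "f \<in> carrier (FA X) \<Longrightarrow> g \<in> carrier (FA X) \<Longrightarrow> f * g \<in> carrier (FA X)"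
  "f \<in> carrier (FA X) \<Longrightarrow> g \<in> carrier (FA X) \<Longrightarrow> f + g \<in> carrier (FA X)"
  "f \<in> carrier (FA X) \<Longrightarrow> Poly_Mapping.map ((*) c) f \<in> carrier (FA X)"
  "f \<in> carrier (FA X) \<Longrightarrow> adj_poly f \<in> carrier (FA X)"
  "1 \<in> carrier (FA X)" "0 \<in> carrier (FA X)" 
  "psingle u c \<in> carrier (FA X) \<longleftrightarrow> c = 0 \<or> fst ` set u \<subseteq> X"
proof -
  show "f * g \<in> carrier (FA X)" if f: "f \<in> carrier (FA X)" and g: "g \<in> carrier (FA X)"
    unfolding FA_simps
  proof
    fix u assume "u \<in> pkeys (f * g)"
    then obtain a b where "u = a @ b" "a \<in> pkeys f" "b \<in> pkeys g"
      using keys_mult[of f g] by (auto simp: plus_list_def)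
    then show "fst ` set u \<subseteq> X" using f g by (auto simp: FA_simps)
  qed
  show "f + g \<in> carrier (FA X)" if "f \<in> carrier (FA X)" "g \<in> carrier (FA X)"
    using that keys_add[of f g] by (auto simp: FA_simps)
  show "Poly_Mapping.map ((*) c) f \<in> carrier (FA X)" if "f \<in> carrier (FA X)"
    using that by (auto simp: FA_simps in_keys_iff lookup_scale)
  show "adj_poly f \<in> carrier (FA X)" if f: "f \<in> carrier (FA X)"
    unfolding FA_simps
  proof
    fix u assume "u \<in> pkeys (adj_poly f)"
    then have "adj_word u \<in> pkeys f" by (simp add: in_keys_iff lookup_adj_poly)
    then have "fst ` set (adj_word u) \<subseteq> X" using f by (simp add: FA_simps)
    then show "fst ` set u \<subseteq> X" by (simp only: set_adj_word)
  qed
  show "1 \<in> carrier (FA X)" by (auto simp: FA_simps zero_list_def single_one[symmetric] simp del: single_one)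
  show "0 \<in> carrier (FA X)" "psingle u c \<in> carrier (FA X) \<longleftrightarrow> c = 0 \<or> fst ` set u \<subseteq> X"
    by (auto simp: FA_simps)
qed

lemma FA_induct [consumes 1, case_names single add]:
  assumes "f \<in> carrier (FA X)"
    and "\<And>u c. fst ` set u \<subseteq> X \<Longrightarrow> Q (psingle u c)"
    and "\<And>f g. \<lbrakk>f \<in> carrier (FA X); g \<in> carrier (FA X); Q f; Q g\<rbrakk> \<Longrightarrow> Q (f + g)"
  shows "Q f"
  by (rule poly_induct[where C = "\<lambda>u. fst ` set u \<subseteq> X"])
    (use assms assms(2)[of "[]" 0] in \<open>auto simp: FA_simps\<close>)

lemma FA_star_alg: "star_alg (FA X)"
proof -
  have "abelian_group (FA X)"
  proof (rule abelian_groupI)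
    fix f assume f: "f \<in> carrier (FA X)"
    have "Poly_Mapping.map ((*) (- 1)) f + f = 0"
      by (rule poly_mapping_eqI) (simp add: lookup_scale lookup_add)
    then show "\<exists>g\<in>carrier (FA X). g \<oplus>\<^bsub>FA X\<^esub> f = \<zero>\<^bsub>FA X\<^esub>"
      using FA_closed(3)[OF f, of "- 1"] by (auto simp: FA_simps(4,5))
  qed (auto simp: FA_simps(2-) FA_closed add.assoc add.commute)
  moreover have "monoid (FA X)"
    by (rule monoidI) (auto simp: FA_simps(2-) FA_closed mult.assoc)
  ultimately have "ring (FA X)"
    by (rule ringI) (auto simp: FA_simps(2-) distrib_left distrib_right)
  moreover have "star_alg_axioms (FA X)"
    by unfold_locales
      (auto simp: FA_simps(2-) FA_closed scale_poly_add scale_poly_mult_left scale_poly_mult_right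
        adj_poly_add adj_poly_mult lookup_scale lookup_add lookup_adj_poly algebra_simps
        intro: poly_mapping_eqI)
  ultimately show ?thesis by (simp add: star_alg_def)
qed

section \<open>Evaluation homomorphisms of the free *-algebra\<close>

context star_alg begin

definition eval_word :: "('x \<Rightarrow> 'a) \<Rightarrow> ('x \<times> bool) list \<Rightarrow> 'a" where
  "eval_word v u = mult_list A (map (\<lambda>(x, b). if b then adj A (v x) else v x) u)"

definition eval_poly :: "('x \<Rightarrow> 'a) \<Rightarrow> 'x star_poly \<Rightarrow> 'a" where
  "eval_poly v f = finsum A (\<lambda>u. plookup f u \<odot> eval_word v u) (pkeys f)"

context
  fixes X :: "'x set" and v :: "'x \<Rightarrow> 'a"
  assumes v: "v \<in> X \<rightarrow> carrier A"
begin

lemma eval_word_set: "fst ` set u \<subseteq> X \<Longrightarrow> set (map (\<lambda>(x, b). if b then adj A (v x) else v x) u) \<subseteq> carrier A"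
  using v by (auto simp: Pi_iff)

lemma eval_word_closed: "fst ` set u \<subseteq> X \<Longrightarrow> eval_word v u \<in> carrier A"
  unfolding eval_word_def by (intro mult_list_closed eval_word_set)

lemma eval_word_append:
  "\<lbrakk>fst ` set u \<subseteq> X; fst ` set u' \<subseteq> X\<rbrakk> \<Longrightarrow> eval_word v (u @ u') = eval_word v u \<otimes> eval_word v u'"
  unfolding eval_word_def map_append by (intro mult_list_append eval_word_set)

lemma eval_word_adj: "fst ` set u \<subseteq> X \<Longrightarrow> eval_word v (adj_word u) = adj A (eval_word v u)"
proof (induction u)
  case Nil
  then show ?case by (simp add: eval_word_def adj_word_def)
next
  case (Cons xb u)
  obtain x b where xb: "xb = (x, b)" by force
  have x: "v x \<in> carrier A" "fst ` set u \<subseteq> X" "x \<in> X" using Cons v xb by auto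
  have s: "eval_word v [(x, c)] = (if c then adj A (v x) else v x)" for c
    using x by (simp add: eval_word_def)
  have "adj_word (xb # u) = adj_word u @ [(x, \<not> b)]" by (simp add: adj_word_def xb)
  moreover have "eval_word v (xb # u) = eval_word v [(x, b)] \<otimes> eval_word v u"
    using eval_word_append[of "[(x, b)]" u] x xb by simp
  moreover have "eval_word v (adj_word u @ [(x, \<not> b)]) = eval_word v (adj_word u) \<otimes> eval_word v [(x, \<not> b)]"
    using x by (intro eval_word_append) (simp_all add: set_adj_word)
  ultimately show ?case
    using Cons x s eval_word_closed[of u] by (auto simp: adj_mult)
qed

lemma eval_poly_superset:
  assumes "finite S" "pkeys f \<subseteq> S" "\<And>u. u \<in> S \<Longrightarrow> fst ` set u \<subseteq> X"
  shows "eval_poly v f = finsum A (\<lambda>u. plookup f u \<odot> eval_word v u) S"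
  unfolding eval_poly_def
proof (rule add.finprod_mono_neutral_cong_left)
  show "plookup f u \<odot> eval_word v u = \<zero>" if "u \<in> S - pkeys f" for u
    using that assms eval_word_closed by (simp add: in_keys_iff)
qed (use assms eval_word_closed in auto)

lemma eval_poly_closed: "f \<in> carrier (FA X) \<Longrightarrow> eval_poly v f \<in> carrier A"
  unfolding eval_poly_def by (rule finsum_closed) (auto simp: FA_simps eval_word_closed)

lemma eval_poly_add:
  assumes "f \<in> carrier (FA X)" "g \<in> carrier (FA X)"
  shows "eval_poly v (f + g) = eval_poly v f \<oplus> eval_poly v g"
proof -
  define S where "S = pkeys f \<union> pkeys g"
  have S: "finite S" "\<And>u. u \<in> S \<Longrightarrow> fst ` set u \<subseteq> X" using assms by (auto simp: S_def FA_simps)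
  have "eval_poly v (f + g) = finsum A (\<lambda>u. plookup (f + g) u \<odot> eval_word v u) S"
    by (rule eval_poly_superset) (use S keys_add[of f g] in \<open>auto simp: S_def\<close>)
  also have "\<dots> = finsum A (\<lambda>u. plookup f u \<odot> eval_word v u \<oplus> plookup g u \<odot> eval_word v u) S"
    by (rule finsum_cong') (use S(2) eval_word_closed in \<open>auto simp: lookup_add scale_add_left\<close>)
  also have "\<dots> = finsum A (\<lambda>u. plookup f u \<odot> eval_word v u) S \<oplus> finsum A (\<lambda>u. plookup g u \<odot> eval_word v u) S"
    by (rule finsum_addf) (use S(2) eval_word_closed in auto)
  also have "\<dots> = eval_poly v f \<oplus> eval_poly v g"
    using eval_poly_superset[OF S(1) _ S(2), of f] eval_poly_superset[OF S(1) _ S(2), of g]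
    by (simp add: S_def)
  finally show ?thesis .
qed

lemma eval_poly_single:
  assumes "fst ` set u \<subseteq> X" shows "eval_poly v (psingle u c) = c \<odot> eval_word v u"
proof -
  have "eval_poly v (psingle u c) = finsum A (\<lambda>u'. plookup (psingle u c) u' \<odot> eval_word v u') {u}"
    by (rule eval_poly_superset) (use assms in \<open>auto split: if_splits\<close>)
  then show ?thesis using assms eval_word_closed[of u] finsum_insert[of "{}" u "\<lambda>u'. plookup (psingle u c) u' \<odot> eval_word v u'"]
    by (auto simp: lookup_single)
qed

lemma eval_poly_hom: "eval_poly v \<in> star_hom (FA X) A"
proof -
  have mult: "eval_poly v (f * g) = eval_poly v f \<otimes> eval_poly v g"
    if f: "f \<in> carrier (FA X)" and g: "g \<in> carrier (FA X)" for f g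
    using f
  proof (induction f rule: FA_induct)
    case (single u c)
    from g show ?case
    proof (induction g rule: FA_induct)
      case (single u' c')
      have "fst ` set (u @ u') \<subseteq> X" using single \<open>fst ` set u \<subseteq> X\<close> by auto
      then show ?case
        using single \<open>fst ` set u \<subseteq> X\<close> eval_word_closed[of u] eval_word_closed[of u']
        by (simp add: mult_single plus_list_def eval_poly_single eval_word_append scale_mult_left
            scale_mult_right mult.commute flip: scale_scale)
    next
      case (add g g')
      have "psingle u c \<in> carrier (FA X)" using single by (simp add: FA_closed)
      then show ?case using add by (simp add: distrib_left eval_poly_add FA_closed eval_poly_closed r_distr)
    qed
  next
    case (add f f')
    then show ?case using g by (simp add: distrib_right eval_poly_add FA_closed eval_poly_closed l_distr)
  qed
  have scale: "eval_poly v (Poly_Mapping.map ((*) c) f) = c \<odot> eval_poly v f" if "f \<in> carrier (FA X)" for c f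
    using that
  proof (induction f rule: FA_induct)
    case (single u d)
    then show ?case using eval_word_closed[of u] by (simp add: scale_poly_single eval_poly_single scale_scale)
  next
    case (add f g)
    then show ?case by (simp add: scale_poly_add eval_poly_add FA_closed eval_poly_closed scale_add_right)
  qed
  have adj: "eval_poly v (adj_poly f) = adj A (eval_poly v f)" if "f \<in> carrier (FA X)" for f
    using that
  proof (induction f rule: FA_induct)
    case (single u d)
    have "fst ` set (adj_word u) \<subseteq> X" using single by (simp only: set_adj_word)
    then show ?case using single eval_word_closed[of u]
      by (simp add: adj_poly_single eval_poly_single eval_word_adj adj_scale)
  next
    case (add f g)
    then show ?case by (simp add: adj_poly_add eval_poly_add FA_closed eval_poly_closed adj_add)
  qed
  have one: "eval_poly v 1 = \<one>"
    using eval_poly_single[of "[]" 1] by (simp add: single_one[symmetric] zero_list_def eval_word_def del: single_one)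
  show ?thesis
    unfolding star_hom_def ring_hom_def
    using mult scale adj one eval_poly_add eval_poly_closed by (auto simp: FA_simps(2-))
qed

lemma eval_poly_gen: "x \<in> X \<Longrightarrow> eval_poly v (free_gen x) = v x"
  using v by (auto simp: free_gen_def eval_poly_single eval_word_def Pi_iff)

end

end

text \<open>The axioms pass to a supremum of seminorms; for the C*-identity the lower bound uses
  that each member satisfies it exactly. The zero seminorm makes the family nonempty and
  \<open>bd\<close> makes it bounded, so that the real \<open>Sup\<close> is a true
  supremum.\<close>

lemma universal_seminorm:
  fixes A :: "('a, 'm) star_algebra_scheme" (structure)
  assumes "star_alg A" and R: "R \<subseteq> carrier A"
    and bd: "\<And>x. x \<in> carrier A \<Longrightarrow> \<exists>M. \<forall>\<nu>. cstar_seminorm A \<nu> \<and> (\<forall>r\<in>R. \<nu> r = 0) \<longrightarrow> \<nu> x \<le> M"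
  shows "cstar_seminorm A (universal_seminorm A R)"
    and "\<And>\<nu> x. \<lbrakk>cstar_seminorm A \<nu>; \<forall>r\<in>R. \<nu> r = 0; x \<in> carrier A\<rbrakk> \<Longrightarrow> \<nu> x \<le> universal_seminorm A R x"
    and "\<And>r. r \<in> R \<Longrightarrow> universal_seminorm A R r = 0"
proof -
  interpret star_alg A by fact
  define N where "N = {\<nu>. cstar_seminorm A \<nu> \<and> (\<forall>r\<in>R. \<nu> r = 0)}"
  define U where "U = universal_seminorm A R"
  have U: "U x = (SUP \<nu>\<in>N. \<nu> x)" for x
    unfolding U_def universal_seminorm_def N_def by (rule arg_cong[of _ _ Sup]) auto
  have zero: "(\<lambda>x. 0) \<in> N" by (simp add: N_def cstar_seminorm_def)
  have bdd: "bdd_above ((\<lambda>\<nu>. \<nu> x) ` N)" if x: "x \<in> carrier A" for x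
  proof -
    obtain M where "\<And>\<nu>. \<nu> \<in> N \<Longrightarrow> \<nu> x \<le> M" using bd[OF x] by (auto simp: N_def)
    then show ?thesis by (rule bdd_aboveI2)
  qed
  have upper: "\<nu> x \<le> U x" if "\<nu> \<in> N" "x \<in> carrier A" for \<nu> x
    unfolding U by (rule cSUP_upper[OF that(1) bdd[OF that(2)]])
  have least: "U x \<le> M" if "\<And>\<nu>. \<nu> \<in> N \<Longrightarrow> \<nu> x \<le> M" for x M
    unfolding U using zero that by (intro cSUP_least) auto
  have semi: "cstar_semi A \<nu>" if "\<nu> \<in> N" for \<nu>
    using that \<open>star_alg A\<close> by (simp add: N_def cstar_semi_def cstar_semi_axioms_def)
  have nonneg: "0 \<le> U x" if "x \<in> carrier A" for x using upper[OF zero that] by simp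
  have cst: "U (adj A x \<otimes> x) = (U x)\<^sup>2" if x: "x \<in> carrier A" for x
  proof (rule antisym)
    show "U (adj A x \<otimes> x) \<le> (U x)\<^sup>2"
    proof (rule least)
      fix \<nu> assume \<nu>: "\<nu> \<in> N"
      interpret n: cstar_semi A \<nu> by (rule semi[OF \<nu>])
      show "\<nu> (adj A x \<otimes> x) \<le> (U x)\<^sup>2"
        using n.nu_cstar[OF x] power_mono[OF upper[OF \<nu> x] n.nu_nonneg[OF x], of 2] by simp
    qed
    have "U x \<le> sqrt (U (adj A x \<otimes> x))"
    proof (rule least)
      fix \<nu> assume \<nu>: "\<nu> \<in> N"
      interpret n: cstar_semi A \<nu> by (rule semi[OF \<nu>])
      show "\<nu> x \<le> sqrt (U (adj A x \<otimes> x))"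
        using upper[OF \<nu>, of "adj A x \<otimes> x"] x n.nu_cstar[OF x] by (intro real_le_rsqrt) simp
    qed
    then have "(U x)\<^sup>2 \<le> (sqrt (U (adj A x \<otimes> x)))\<^sup>2" using nonneg[OF x] by (intro power_mono)
    then show "(U x)\<^sup>2 \<le> U (adj A x \<otimes> x)" using nonneg[of "adj A x \<otimes> x"] x by simp
  qed
  have scale_le: "U (c \<odot> x) \<le> cmod c * U x" if x: "x \<in> carrier A" for c x
  proof (rule least)
    fix \<nu> assume \<nu>: "\<nu> \<in> N"
    interpret n: cstar_semi A \<nu> by (rule semi[OF \<nu>])
    show "\<nu> (c \<odot> x) \<le> cmod c * U x"
      using n.nu_scale[OF x] upper[OF \<nu> x] by (simp add: mult_left_mono)
  qed
  have scale: "U (c \<odot> x) = cmod c * U x" if x: "x \<in> carrier A" for c x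
  proof (cases "c = 0")
    case True
    then show ?thesis using scale_le[OF x, of 0] nonneg[of "c \<odot> x"] x by simp
  next
    case False
    have "U x \<le> cmod (1 / c) * U (c \<odot> x)"
      using scale_le[of "c \<odot> x" "1 / c"] x False by (simp flip: scale_scale)
    then have "cmod c * U x \<le> U (c \<odot> x)" using False by (simp add: norm_divide field_simps)
    then show ?thesis using scale_le[OF x, of c] by simp
  qed
  have tri: "U (x \<oplus> y) \<le> U x + U y" if xy: "x \<in> carrier A" "y \<in> carrier A" for x y
  proof (rule least)
    fix \<nu> assume \<nu>: "\<nu> \<in> N"
    interpret n: cstar_semi A \<nu> by (rule semi[OF \<nu>])
    show "\<nu> (x \<oplus> y) \<le> U x + U y"
      using n.nu_triangle[OF xy] upper[OF \<nu> xy(1)] upper[OF \<nu> xy(2)] by simp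
  qed
  have mult: "U (x \<otimes> y) \<le> U x * U y" if xy: "x \<in> carrier A" "y \<in> carrier A" for x y
  proof (rule least)
    fix \<nu> assume \<nu>: "\<nu> \<in> N"
    interpret n: cstar_semi A \<nu> by (rule semi[OF \<nu>])
    have "\<nu> x * \<nu> y \<le> U x * U y"
      using upper[OF \<nu> xy(1)] upper[OF \<nu> xy(2)] n.nu_nonneg[OF xy(2)] nonneg[OF xy(1)] by (intro mult_mono)
    then show "\<nu> (x \<otimes> y) \<le> U x * U y" using n.nu_mult[OF xy] by simp
  qed
  show "cstar_seminorm A (universal_seminorm A R)"
    unfolding U_def[symmetric] cstar_seminorm_def using nonneg cst scale tri mult by auto
  show "\<nu> x \<le> universal_seminorm A R x" if "cstar_seminorm A \<nu>" "\<forall>r\<in>R. \<nu> r = 0" "x \<in> carrier A" for \<nu> x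
    using upper[of \<nu> x] that by (simp add: N_def U_def)
  show "universal_seminorm A R r = 0" if "r \<in> R" for r
    using least[of r 0] nonneg[of r] R that by (force simp: N_def U_def)
qed

section \<open>The universal Toeplitz algebra\<close>

text \<open>The bound makes h carry Cauchy sequences to Cauchy sequences, whose limits exist because
  B is complete.\<close>

lemma (in cstar_semi) extend_hom:
  assumes "cstar_algebra B" "h \<in> star_hom A B" and bd: "\<And>a. a \<in> carrier A \<Longrightarrow> cnorm B (h a) \<le> \<nu> a"
  shows "\<exists>\<rho>\<in>star_hom Comp B. \<forall>a\<in>carrier A. \<rho> (embed a) = h a"
proof -
  interpret B: cstar_algebra B by fact
  interpret hp: star_hom_pair A B h
    using assms by (simp add: star_hom_pair_def star_hom_pair_axioms_def B.star_alg star_alg_axioms)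
  have ex: "\<exists>b. B.conv (\<lambda>n. h (s n)) b" if s: "s \<in> CS" for s
  proof -
    note sc = cs_closed[OF s]
    have "\<forall>\<epsilon>>0. \<exists>N. \<forall>m\<ge>N. \<forall>n\<ge>N. cnorm B (h (s m) \<ominus>\<^bsub>B\<^esub> h (s n)) < \<epsilon>"
    proof (intro allI impI)
      fix \<epsilon> :: real assume "\<epsilon> > 0"
      then obtain N where "\<forall>m\<ge>N. \<forall>n\<ge>N. \<nu> (s m \<ominus> s n) < \<epsilon>" using csD[OF s] by blast
      moreover have "cnorm B (h (s m) \<ominus>\<^bsub>B\<^esub> h (s n)) \<le> \<nu> (s m \<ominus> s n)" for m n
        using bd[of "s m \<ominus> s n"] sc by (simp add: hp.hom_diff)
      ultimately show "\<exists>N. \<forall>m\<ge>N. \<forall>n\<ge>N. cnorm B (h (s m) \<ominus>\<^bsub>B\<^esub> h (s n)) < \<epsilon>"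
        by (meson order_le_less_trans)
    qed
    then show ?thesis using B.cauchy_conv[of "\<lambda>n. h (s n)"] sc by (metis hp.hom_closed)
  qed
  define L where "L s = (SOME b. B.conv (\<lambda>n. h (s n)) b)" for s
  have L: "B.conv (\<lambda>n. h (s n)) (L s)" if "s \<in> CS" for s
    unfolding L_def using ex[OF that] by (rule someI_ex)
  have L_eq: "L s = b" if "s \<in> CS" "B.conv (\<lambda>n. h (s n)) b" for s b
    using B.conv_unique[OF L[OF that(1)] that(2)] .
  \<comment> \<open>A representative is picked from each class; equivalent sequences have images
    with the same limit, so the value on a class is the limit along any representative.\<close>
  define \<rho> where "\<rho> X = L (SOME s. s \<in> X)" for X
  have \<rho>: "\<rho> (cls s) = L s" if s: "s \<in> CS" for s
  proof -
    define s' where "s' = (SOME s'. s' \<in> cls s)"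
    have "s' \<in> cls s" unfolding s'_def by (rule someI[of _ s]) (simp add: s)
    then have s': "s' \<in> CS" "equiv_seq s' s" using cls_mem by auto
    note c = cs_closed[OF s] cs_closed[OF s'(1)]
    have "B.conv (\<lambda>n. h (s' n)) (L s)"
    proof (rule B.convI_bound)
      fix n
      have Lc: "L s \<in> carrier B" using L[OF s] by (simp add: B.conv_def)
      have "cnorm B (h (s' n) \<ominus>\<^bsub>B\<^esub> L s)
        \<le> cnorm B (h (s' n) \<ominus>\<^bsub>B\<^esub> h (s n)) + cnorm B (h (s n) \<ominus>\<^bsub>B\<^esub> L s)"
        using c Lc by (intro B.nu_diff_triangle) auto
      also have "cnorm B (h (s' n) \<ominus>\<^bsub>B\<^esub> h (s n)) \<le> \<nu> (s' n \<ominus> s n)"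
        using bd[of "s' n \<ominus> s n"] c by (simp add: hp.hom_diff)
      finally show "cnorm B (h (s' n) \<ominus>\<^bsub>B\<^esub> L s) \<le> \<nu> (s' n \<ominus> s n) + cnorm B (h (s n) \<ominus>\<^bsub>B\<^esub> L s)"
        by simp
      show "(\<lambda>n. \<nu> (s' n \<ominus> s n) + cnorm B (h (s n) \<ominus>\<^bsub>B\<^esub> L s)) \<longlonglongrightarrow> 0"
        using L[OF s] s'(2) by (intro tendsto_add_zero) (auto simp: B.conv_def equiv_seq_def)
    qed (use c L[OF s] in \<open>auto simp: B.conv_def\<close>)
    then have "L s' = L s" by (rule L_eq[OF s'(1)])
    then show ?thesis by (simp add: \<rho>_def s'_def)
  qed
  have Lc: "L s \<in> carrier B" if "s \<in> CS" for s using L[OF that] by (simp add: B.conv_def)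
  have Lmult: "L (\<lambda>n. s n \<otimes> s' n) = L s \<otimes>\<^bsub>B\<^esub> L s'" if "s \<in> CS" "s' \<in> CS" for s s'
    by (rule L_eq) (use B.conv_mult[OF L[OF that(1)] L[OF that(2)]] that cs_closed in \<open>auto simp: cs_closed[OF that(1)] cs_closed[OF that(2)]\<close>)
  have Ladd: "L (\<lambda>n. s n \<oplus> s' n) = L s \<oplus>\<^bsub>B\<^esub> L s'" if "s \<in> CS" "s' \<in> CS" for s s'
    by (rule L_eq) (use B.conv_add[OF L[OF that(1)] L[OF that(2)]] that in \<open>auto simp: cs_closed[OF that(1)] cs_closed[OF that(2)]\<close>)
  have Lscale: "L (\<lambda>n. c \<odot> s n) = c \<odot>\<^bsub>B\<^esub> L s" if "s \<in> CS" for c s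
    by (rule L_eq) (use B.conv_scale[OF L[OF that], of c] that in \<open>auto simp: cs_closed[OF that]\<close>)
  have Ladj: "L (\<lambda>n. adj A (s n)) = adj B (L s)" if "s \<in> CS" for s
    by (rule L_eq) (use B.conv_adj[OF L[OF that]] that in \<open>auto simp: cs_closed[OF that]\<close>)
  have Lconst: "L (\<lambda>n. a) = h a" if "a \<in> carrier A" for a
    by (rule L_eq) (use that in \<open>auto intro: B.conv_const\<close>)
  have "\<rho> \<in> star_hom Comp B"
    unfolding star_hom_def ring_hom_def
    using Lc Lmult Ladd Lscale Ladj Lconst[of \<one>]
    by (auto elim!: compE simp: \<rho> comp_one)
  then show ?thesis using \<rho> Lconst by (intro bexI[of _ \<rho>]) (auto simp: embed_def)
qed

lemma (in star_hom_pair) hom_mult_list: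
  "set xs \<subseteq> carrier A \<Longrightarrow> h (mult_list A xs) = mult_list B (map h xs)"
  by (induction xs) auto

section \<open>The Toeplitz relators and the universal property of T_u\<close>

context submonoid_in_group begin

lemma constr_pair: assumes "p \<in> P" shows "[p, p] \<in> NW" "K [p, p] = P"
proof -
  have "x \<in> K [p, p] \<longleftrightarrow> x \<in> P" for x
    using assms by (auto simp: mem_constr_Cons)
  then show "K [p, p] = P" by blast
  show "[p, p] \<in> NW" unfolding neutral_words_def using assms by simp
qed

lemma hom_wdot:
  assumes "star_hom_pair A B h" "w \<in> P \<rightarrow> carrier A" "\<And>p. p \<in> P \<Longrightarrow> h (w p) = v p" "\<alpha> \<in> words P"
  shows "wdot A w \<alpha> \<in> carrier A" "h (wdot A w \<alpha>) = wdot B v \<alpha>"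
proof -
  interpret star_hom_pair A B h by fact
  show "wdot A w \<alpha> \<in> carrier A" "h (wdot A w \<alpha>) = wdot B v \<alpha>"
    using assms(4)
  proof (induction rule: words_induct)
    case (Cons p q \<alpha>)
    have wpq: "w p \<in> carrier A" "w q \<in> carrier A" using Cons assms(2) by auto
    { case 1 show ?case using Cons wpq by simp
    next case 2 show ?case using Cons wpq assms(3) by simp }
  qed simp_all
qed

lemma toeplitz_relators_hom:
  assumes hp: "star_hom_pair A B h" and w: "w \<in> P \<rightarrow> carrier A" and v: "\<And>p. p \<in> P \<Longrightarrow> h (w p) = v p"
  shows "toeplitz_relators G P A w \<subseteq> carrier A"
    and "toeplitz_relators G P B v = h ` toeplitz_relators G P A w"
proof -
  interpret star_hom_pair A B h by fact
  have wc: "wdot A w \<alpha> \<in> carrier A" and hw: "wdot B v \<alpha> = h (wdot A w \<alpha>)" if "\<alpha> \<in> NW" for \<alpha>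
    using hom_wdot[OF hp w v, of \<alpha>] that by simp_all
  have w1: "w \<one> \<in> carrier A" using w by auto
  \<comment> \<open>The (T4) relators are rewritten as the image of one index set, shared by A and
    B. Then all four kinds of relators are images, and the two relator sets can be compared index by
    index.\<close>
  define T where "T = (\<lambda>(\<alpha>, F). \<alpha> \<in> NW \<and> F \<noteq> [] \<and> distinct F \<and> set F \<subseteq> NW \<and> K \<alpha> = (\<Union>\<beta>\<in>set F. K \<beta>))"
  define tA where "tA = (\<lambda>(\<alpha>, F). mult_list A (map (\<lambda>\<beta>. wdot A w \<alpha> \<ominus>\<^bsub>A\<^esub> wdot A w \<beta>) F))"
  define tB where "tB = (\<lambda>(\<alpha>, F). mult_list B (map (\<lambda>\<beta>. wdot B v \<alpha> \<ominus>\<^bsub>B\<^esub> wdot B v \<beta>) F))"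
  have T4: "tA x \<in> carrier A \<and> h (tA x) = tB x" if x: "T x" for x
  proof -
    obtain \<alpha> F where xe: "x = (\<alpha>, F)" by force
    then have \<alpha>: "\<alpha> \<in> NW" "set F \<subseteq> NW" using x by (auto simp: T_def)
    have c: "set (map (\<lambda>\<beta>. wdot A w \<alpha> \<ominus>\<^bsub>A\<^esub> wdot A w \<beta>) F) \<subseteq> carrier A"
      using \<alpha> wc by auto
    have "map h (map (\<lambda>\<beta>. wdot A w \<alpha> \<ominus>\<^bsub>A\<^esub> wdot A w \<beta>) F) = map (\<lambda>\<beta>. wdot B v \<alpha> \<ominus>\<^bsub>B\<^esub> wdot B v \<beta>) F"
      using \<alpha> wc hw by (auto simp: hom_diff subset_iff)
    then show ?thesis using c by (simp add: xe tA_def tB_def hom_mult_list del: map_map)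
  qed
  have RA: "toeplitz_relators G P A w = {w \<one> \<ominus>\<^bsub>A\<^esub> \<one>\<^bsub>A\<^esub>} \<union> wdot A w ` {\<alpha> \<in> NW. K \<alpha> = {}}
     \<union> (\<lambda>(\<alpha>, \<beta>). wdot A w \<alpha> \<ominus>\<^bsub>A\<^esub> wdot A w \<beta>) ` {(\<alpha>, \<beta>). \<alpha> \<in> NW \<and> \<beta> \<in> NW \<and> K \<alpha> = K \<beta>}
     \<union> tA ` {x. T x}"
    unfolding toeplitz_relators_def tA_def T_def by (rule arg_cong2[of _ _ _ _ "(\<union>)"])+ auto
  have RB: "toeplitz_relators G P B v = {v \<one> \<ominus>\<^bsub>B\<^esub> \<one>\<^bsub>B\<^esub>} \<union> wdot B v ` {\<alpha> \<in> NW. K \<alpha> = {}}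
     \<union> (\<lambda>(\<alpha>, \<beta>). wdot B v \<alpha> \<ominus>\<^bsub>B\<^esub> wdot B v \<beta>) ` {(\<alpha>, \<beta>). \<alpha> \<in> NW \<and> \<beta> \<in> NW \<and> K \<alpha> = K \<beta>}
     \<union> tB ` {x. T x}"
    unfolding toeplitz_relators_def tB_def T_def by (rule arg_cong2[of _ _ _ _ "(\<union>)"])+ auto
  show "toeplitz_relators G P A w \<subseteq> carrier A"
    unfolding RA using wc w1 T4 by auto
  show "toeplitz_relators G P B v = h ` toeplitz_relators G P A w"
    unfolding RA RB image_Un image_image
    by (intro arg_cong2[of _ _ _ _ "(\<union>)"] image_cong refl)
      (use wc hw w1 v[of \<one>] T4 in \<open>auto simp: hom_diff\<close>)
qed

abbreviation "FP \<equiv> free_star_algebra P"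
abbreviation "Rel \<equiv> toeplitz_relators G P FP free_gen"

lemma gen_closed: "free_gen \<in> P \<rightarrow> carrier FP"
  by (auto simp: free_gen_def FA_closed)

lemma free_gen_closed [simp]: "p \<in> P \<Longrightarrow> free_gen p \<in> carrier FP"
  using gen_closed by blast

lemma Rel_closed: "Rel \<subseteq> carrier FP"
proof -
  have "star_hom_pair FP FP (\<lambda>x. x)"
    by (simp add: star_hom_pair_def star_hom_pair_axioms_def FA_star_alg star_hom_def ring_hom_def)
  from toeplitz_relators_hom(1)[OF this gen_closed] show ?thesis by blast
qed

text \<open>(T3) for the words \<open>[p, p]\<close> and \<open>[]\<close> makes every generator an
  isometry modulo the seminorm, so generators and their adjoints have seminorm at most 1. This is
  what keeps the universal seminorm finite.\<close>

lemma seminorm_word_le: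
  assumes "cstar_seminorm FP \<nu>" and rel: "\<forall>r\<in>Rel. \<nu> r = 0" and "fst ` set u \<subseteq> P"
  shows "\<nu> (psingle u 1) \<le> 1"
proof -
  interpret cstar_semi FP \<nu>
    using assms by (simp add: cstar_semi_def cstar_semi_axioms_def FA_star_alg)
  have gen: "\<nu> (free_gen p) \<le> 1" if p: "p \<in> P" for p
  proof -
    define g where "g = free_gen p"
    have g: "g \<in> carrier FP" using gen_closed p by (auto simp: g_def)
    have "wdot FP free_gen [p, p] \<ominus>\<^bsub>FP\<^esub> wdot FP free_gen [] \<in> Rel"
    proof -
      have "K [p, p] = K []" using constr_pair[OF p] by simp
      then show ?thesis unfolding toeplitz_relators_def using constr_pair(1)[OF p] NW_Nil by blast
    qed
    then have "\<nu> (adj FP g \<otimes>\<^bsub>FP\<^esub> g \<ominus>\<^bsub>FP\<^esub> \<one>\<^bsub>FP\<^esub>) = 0" using rel g by (simp add: g_def)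
    then have "(\<nu> g)\<^sup>2 \<le> 1"
      using nu_le_diff_add[of "adj FP g \<otimes>\<^bsub>FP\<^esub> g" "\<one>\<^bsub>FP\<^esub>"] nu_cstar[OF g] nu_one_le g by simp
    then show ?thesis using nu_nonneg[OF g] by (simp add: g_def power_le_one_iff)
  qed
  show ?thesis using assms(3)
  proof (induction u)
    case Nil
    then show ?case using nu_one_le by (simp add: FA_simps(3) flip: single_one zero_list_def)
  next
    case (Cons xb u)
    obtain x b where xb: "xb = (x, b)" by force
    have x: "x \<in> P" "free_gen x \<in> carrier FP" using Cons xb gen_closed by auto
    define l where "l = (if b then adj FP (free_gen x) else free_gen x)"
    have l: "l \<in> carrier FP" "\<nu> l \<le> 1" using x gen by (auto simp: l_def)
    have u: "psingle u (1::complex) \<in> carrier FP" using Cons by (simp add: FA_closed)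
    have "psingle (xb # u) 1 = l \<otimes>\<^bsub>FP\<^esub> psingle u 1"
      by (auto simp: xb l_def FA_simps(2,7) free_gen_def adj_poly_single mult_single plus_list_def adj_word_def)
    then have "\<nu> (psingle (xb # u) 1) \<le> \<nu> l * \<nu> (psingle u 1)" using nu_mult[OF l(1) u] by simp
    also have "\<dots> \<le> 1 * 1" using l u Cons by (intro mult_mono) auto
    finally show ?case by simp
  qed
qed

lemma seminorm_bounded:
  assumes "f \<in> carrier FP"
  shows "\<exists>M. \<forall>\<nu>. cstar_seminorm FP \<nu> \<and> (\<forall>r\<in>Rel. \<nu> r = 0) \<longrightarrow> \<nu> f \<le> M"
  using assms
proof (induction f rule: FA_induct)
  case (single u c)
  have "\<nu> (psingle u c) \<le> cmod c" if "cstar_seminorm FP \<nu>" "\<forall>r\<in>Rel. \<nu> r = 0" for \<nu>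
  proof -
    have "psingle u (1::complex) \<in> carrier FP" using single by (simp add: FA_closed)
    then have "\<nu> (c \<odot>\<^bsub>FP\<^esub> psingle u 1) = cmod c * \<nu> (psingle u 1)"
      using that(1) by (auto simp: cstar_seminorm_def)
    moreover have "c \<odot>\<^bsub>FP\<^esub> psingle u 1 = psingle u c" by (simp add: FA_simps(6) scale_poly_single)
    ultimately show ?thesis
      using mult_left_mono[OF seminorm_word_le[OF that single], of "cmod c"] by simp
  qed
  then show ?case by blast
next
  case (add f g)
  then obtain M M' where "\<And>\<nu>. cstar_seminorm FP \<nu> \<and> (\<forall>r\<in>Rel. \<nu> r = 0) \<Longrightarrow> \<nu> f \<le> M"
      "\<And>\<nu>. cstar_seminorm FP \<nu> \<and> (\<forall>r\<in>Rel. \<nu> r = 0) \<Longrightarrow> \<nu> g \<le> M'" by blast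
  moreover have "\<nu> (f + g) \<le> \<nu> f + \<nu> g" if "cstar_seminorm FP \<nu>" for \<nu>
    using that add by (auto simp: cstar_seminorm_def FA_simps(5))
  ultimately show ?case by (intro exI[of _ "M + M'"]) (meson add_mono order_trans)
qed

lemma toeplitz_seminorm_facts:
  shows "cstar_seminorm FP (toeplitz_seminorm G P)"
    and "\<lbrakk>cstar_seminorm FP \<nu>; \<forall>r\<in>Rel. \<nu> r = 0; f \<in> carrier FP\<rbrakk> \<Longrightarrow> \<nu> f \<le> toeplitz_seminorm G P f"
    and "r \<in> Rel \<Longrightarrow> toeplitz_seminorm G P r = 0"
  unfolding toeplitz_seminorm_def
  by (rule universal_seminorm[OF FA_star_alg Rel_closed seminorm_bounded]; assumption)+

abbreviation "TT \<equiv> T_univ G P"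
abbreviation "tt \<equiv> t_gen G P"

sublocale TS: cstar_semi FP "toeplitz_seminorm G P"
  by (simp add: cstar_semi_def cstar_semi_axioms_def FA_star_alg toeplitz_seminorm_facts(1))

lemma TT_Comp: "TT = TS.Comp"
  by (simp add: T_univ_def)

lemma tt_embed: "tt p = TS.embed (free_gen p)"
  by (simp add: t_gen_def TS.embed_def)

lemma TT_cstar_algebra: "cstar_algebra TT"
  unfolding TT_Comp by (rule TS.comp_cstar_algebra)

sublocale TU: cstar_algebra TT
  by (rule TT_cstar_algebra)

lemma embed_pair: "star_hom_pair FP TT TS.embed"
  by (simp add: star_hom_pair_def star_hom_pair_axioms_def FA_star_alg TU.star_alg)
    (simp add: TT_Comp TS.embed_star_hom)

lemma tt_family: "toeplitz_family G P TT tt"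
proof -
  interpret E: star_hom_pair FP TT TS.embed by (rule embed_pair)
  have "r = \<zero>\<^bsub>TT\<^esub>" if r: "r \<in> toeplitz_relators G P TT tt" for r
  proof -
    obtain f where f: "f \<in> Rel" "r = TS.embed f"
      using r toeplitz_relators_hom(2)[OF embed_pair gen_closed, of tt] by (auto simp: tt_embed)
    then have fc: "f \<in> carrier FP" using Rel_closed by blast
    have "cnorm TT r = 0"
      using TS.norm_embed[OF fc] toeplitz_seminorm_facts(3)[OF f(1)] f(2) by (simp add: TT_Comp)
    then show ?thesis using TU.norm_eq_zero[of r] fc f(2) by simp
  qed
  moreover have "tt \<in> P \<rightarrow> carrier TT"
    by (auto simp: tt_embed)
  ultimately show ?thesis by (simp add: toeplitz_family_def)
qed

text \<open>Evaluation at v followed by the norm of B is one of the C*-seminorms that vanish on the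
  relators. The universal seminorm dominates it, so evaluation extends to the completion.\<close>

lemma TT_universal:
  assumes "cstar_algebra B" and fam: "toeplitz_family G P B v"
  obtains \<rho> where "\<rho> \<in> star_hom TT B" "\<And>p. p \<in> P \<Longrightarrow> \<rho> (tt p) = v p"
proof -
  interpret B: cstar_algebra B by fact
  have v: "v \<in> P \<rightarrow> carrier B" using fam by (simp add: toeplitz_family_def)
  define E where "E = B.eval_poly v"
  have E: "E \<in> star_hom FP B" unfolding E_def using v by (rule B.eval_poly_hom)
  have Eg: "E (free_gen p) = v p" if "p \<in> P" for p unfolding E_def using v that by (rule B.eval_poly_gen)
  interpret hp: star_hom_pair FP B E
    by (simp add: star_hom_pair_def star_hom_pair_axioms_def FA_star_alg B.star_alg E)
  have "cstar_seminorm FP (\<lambda>f. cnorm B (E f))"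
    unfolding cstar_seminorm_def
    by (auto simp: B.nu_cstar B.nu_scale B.nu_triangle B.nu_mult)
  moreover have "\<forall>r\<in>Rel. cnorm B (E r) = 0"
  proof
    fix r assume "r \<in> Rel"
    then have "E r \<in> toeplitz_relators G P B v"
      using toeplitz_relators_hom(2)[OF hp.star_hom_pair_axioms gen_closed Eg] by blast
    then have "E r = \<zero>\<^bsub>B\<^esub>" using fam unfolding toeplitz_family_def by blast
    then show "cnorm B (E r) = 0" by simp
  qed
  ultimately have "cnorm B (E f) \<le> toeplitz_seminorm G P f" if "f \<in> carrier FP" for f
    using toeplitz_seminorm_facts(2) that by blast
  from TS.extend_hom[OF assms(1) E this]
  obtain \<rho> where "\<rho> \<in> star_hom TS.Comp B" "\<forall>f\<in>carrier FP. \<rho> (TS.embed f) = E f" by blast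
  then show thesis using that[of \<rho>] gen_closed Eg by (auto simp: TT_Comp tt_embed)
qed

sublocale TF: cstar_toeplitz_fam G P TT tt
  by (simp add: cstar_toeplitz_fam_def toeplitz_fam_def toeplitz_fam_axioms_def
      submonoid_in_group_axioms TU.star_alg TU.cstar_algebra_axioms tt_family)

text \<open>Words of the free algebra are arbitrary sequences of generators and adjoints, while
  \<open>wdot\<close> needs adjoints and generators in alternation. Padding with the identity of P
  creates the alternation and costs nothing, since (T1) sends it to the unit.\<close>

fun to_word :: "('g \<times> bool) list \<Rightarrow> 'g list" where
  "to_word [] = []"
| "to_word ((x, b) # u) = (if b then [x, \<one>] else [\<one>, x]) @ to_word u"

lemma to_word_words: "fst ` set u \<subseteq> P \<Longrightarrow> to_word u \<in> words P"
  by (induction u rule: to_word.induct) auto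

lemma embed_single:
  assumes "fst ` set u \<subseteq> P" shows "TS.embed (psingle u 1) = TF.wd (to_word u)"
  using assms
proof (induction u rule: to_word.induct)
  case 1
  interpret E: star_hom_pair FP TT TS.embed by (rule embed_pair)
  have "psingle [] 1 = \<one>\<^bsub>FP\<^esub>"
    unfolding FA_simps(3) by (simp only: single_one[symmetric] zero_list_def)
  then show ?case using E.hom_one by simp
next
  case (2 x b u)
  interpret E: star_hom_pair FP TT TS.embed by (rule embed_pair)
  have x: "x \<in> P" "free_gen x \<in> carrier FP" using 2 gen_closed by auto
  define l where "l = (if b then adj FP (free_gen x) else free_gen x)"
  have l: "l \<in> carrier FP" using x by (auto simp: l_def)
  have u: "psingle u (1::complex) \<in> carrier FP" using 2 by (simp add: FA_closed)
  have "psingle ((x, b) # u) 1 = l \<otimes>\<^bsub>FP\<^esub> psingle u 1"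
    by (auto simp: l_def FA_simps(2,7) free_gen_def adj_poly_single mult_single plus_list_def adj_word_def)
  then have "TS.embed (psingle ((x, b) # u) 1) = TS.embed l \<otimes>\<^bsub>TT\<^esub> TF.wd (to_word u)"
    using 2 l u by simp
  moreover have "TS.embed l = (if b then adj TT (tt x) else tt x)"
    using x by (auto simp: l_def tt_embed)
  ultimately show ?case
    using x 2 to_word_words[of u] by (auto simp: TF.w_one)
qed

lemma lin_comb_append:
  "snd ` set cs \<subseteq> words P \<Longrightarrow> snd ` set ds \<subseteq> words P \<Longrightarrow>
    TU.lin_comb tt (cs @ ds) = TU.lin_comb tt cs \<oplus>\<^bsub>TT\<^esub> TU.lin_comb tt ds"
  by (induction cs) (auto simp: TU.a_assoc)

lemma embed_lin_comb:
  assumes "f \<in> carrier FP"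
  shows "\<exists>cs. snd ` set cs \<subseteq> words P \<and> TS.embed f = TU.lin_comb tt cs"
  using assms
proof (induction f rule: FA_induct)
  case (single u c)
  interpret E: star_hom_pair FP TT TS.embed by (rule embed_pair)
  have "psingle u (1::complex) \<in> carrier FP" using single by (simp add: FA_closed)
  then have "TS.embed (c \<odot>\<^bsub>FP\<^esub> psingle u 1) = c \<odot>\<^bsub>TT\<^esub> TF.wd (to_word u)"
    using embed_single[OF single] by simp
  then have "TS.embed (psingle u c) = TU.lin_comb tt [(c, to_word u)]"
    using to_word_words[OF single] by (simp add: FA_simps(6) scale_poly_single)
  then show ?case using to_word_words[OF single] by (intro exI[of _ "[(c, to_word u)]"]) simp
next
  case (add f g)
  interpret E: star_hom_pair FP TT TS.embed by (rule embed_pair)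
  obtain cs ds where cs: "snd ` set cs \<subseteq> words P" "TS.embed f = TU.lin_comb tt cs"
    "snd ` set ds \<subseteq> words P" "TS.embed g = TU.lin_comb tt ds" using add by blast
  have "TS.embed (f + g) = TU.lin_comb tt (cs @ ds)"
    using E.hom_add[of f g] add cs by (simp add: FA_simps(5) lin_comb_append)
  then show ?case using cs by (intro exI[of _ "cs @ ds"]) auto
qed

lemma TT_dense:
  assumes "a \<in> carrier TT" "\<epsilon> > 0"
  obtains cs where "snd ` set cs \<subseteq> words P" "cnorm TT (a \<ominus>\<^bsub>TT\<^esub> TU.lin_comb tt cs) < \<epsilon>"
proof -
  obtain s where s: "s \<in> TS.CS" "\<forall>n. s n \<in> carrier FP" "a = TS.cls s"
    using assms(1) unfolding TT_Comp by (elim TS.compE)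
  have "eventually (\<lambda>k. cnorm TT (TS.embed (s k) \<ominus>\<^bsub>TT\<^esub> a) < \<epsilon>) sequentially"
    using order_tendstoD(2)[OF TS.embed_conv[OF s(1)] assms(2)] by (simp add: TT_Comp s(3))
  then obtain k where k: "cnorm TT (TS.embed (s k) \<ominus>\<^bsub>TT\<^esub> a) < \<epsilon>"
    by (auto simp: eventually_sequentially)
  obtain cs where cs: "snd ` set cs \<subseteq> words P" "TS.embed (s k) = TU.lin_comb tt cs"
    using embed_lin_comb s(2) by blast
  then have "cnorm TT (a \<ominus>\<^bsub>TT\<^esub> TU.lin_comb tt cs) < \<epsilon>"
    using k assms(1) TU.nu_diff_commute[of a "TU.lin_comb tt cs"] TF.lin_comb_closed[OF cs(1)] by simp
  then show thesis using that cs(1) by blast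
qed

end

section \<open>The space \<open>\<Omega>\<^sub>P\<close> and topological freeness\<close>

context submonoid_in_group begin

abbreviation "\<J> \<equiv> constructible G P"

lemma constr_in_J [simp]: "\<alpha> \<in> words P \<Longrightarrow> K \<alpha> \<in> \<J>"
  by (simp add: constructible_def)

lemma J_obtain: assumes "S \<in> \<J>" obtains \<alpha> where "\<alpha> \<in> NW" "S = K \<alpha>"
  using assms constructible_NW by blast

lemma P_in_J: "P \<in> \<J>"
  using constr_in_J[of "[]"] by simp

lemma J_subset: "S \<in> \<J> \<Longrightarrow> S \<subseteq> P"
  using J_obtain constr_subset by metis

lemma J_Int: assumes "S \<in> \<J>" "R \<in> \<J>" shows "S \<inter> R \<in> \<J>"
proof -
  obtain \<alpha> \<beta> where "\<alpha> \<in> NW" "S = K \<alpha>" "\<beta> \<in> NW" "R = K \<beta>" using assms J_obtain by metis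
  then have "S \<inter> R = K (\<alpha> @ \<beta>)" "\<alpha> @ \<beta> \<in> words P" by (simp_all add: constr_NW_append)
  then show ?thesis using constr_in_J by metis
qed

lemma J_right_ideal: "S \<in> \<J> \<Longrightarrow> x \<in> S \<Longrightarrow> t \<in> P \<Longrightarrow> x \<otimes> t \<in> S"
  using J_obtain constr_right_ideal NW_words by metis

lemma J_shift:
  assumes "S \<in> \<J>" "x \<in> P" shows "{t \<in> P. x \<otimes> t \<in> S} \<in> \<J>"
proof -
  obtain \<alpha> where "\<alpha> \<in> NW" "S = K \<alpha>" using assms J_obtain by blast
  then have "{t \<in> P. x \<otimes> t \<in> S} = K (shift x \<alpha>)" "shift x \<alpha> \<in> words P"
    using assms shift_NW[of x \<alpha>] by (simp_all add: constr_shift)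
  then show ?thesis using constr_in_J by metis
qed

lemma l_coset_in_J: "x \<in> P \<Longrightarrow> x <# P \<in> \<J>"
  using constr_in_J[of "principal x"] constr_principal[of x] principal_NW[of x] by simp

lemma self_in_coset: "x \<in> P \<Longrightarrow> x \<in> x <# P"
  by (simp add: mem_l_coset)

text \<open>Constructible ideals are right ideals, so membership of a point depends only on the
  principal right ideal that it generates.\<close>

lemma J_mem_cong:
  assumes "S \<in> \<J>" "x \<in> P" "y \<in> P" "x <# P = y <# P" shows "x \<in> S \<longleftrightarrow> y \<in> S"
proof -
  have imp: "b \<in> S" if a: "a \<in> S" and b: "b \<in> a <# P" for a b
  proof -
    obtain t where "t \<in> P" "b = a \<otimes> t" using b by (auto simp: l_coset_def)
    then show ?thesis using J_right_ideal[OF assms(1) a] by simp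
  qed
  show ?thesis
    using imp[of x y] imp[of y x] assms eq_l_coset_iff[of x y] by blast
qed

lemma OmegaD:
  assumes "\<xi> \<in> Omega G P"
  shows "S \<in> \<J> \<Longrightarrow> \<xi> S = 0 \<or> \<xi> S = 1"
    and "\<xi> \<in> extensional \<J>"
    and "R \<in> \<J> \<Longrightarrow> S \<in> \<J> \<Longrightarrow> \<xi> (R \<inter> S) = \<xi> R * \<xi> S"
    and "S \<in> \<J> \<Longrightarrow> finite \<C> \<Longrightarrow> \<C> \<subseteq> \<J> \<Longrightarrow> S = \<Union>\<C> \<Longrightarrow> \<xi> S = 1 \<Longrightarrow> \<exists>R\<in>\<C>. \<xi> R = 1"
proof -
  have e: "\<xi> \<in> \<J> \<rightarrow>\<^sub>E {0, 1}"
    and m: "\<forall>R\<in>\<J>. \<forall>S\<in>\<J>. \<xi> (R \<inter> S) = \<xi> R * \<xi> S"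
    and c: "\<forall>S\<in>\<J>. \<forall>\<C>. finite \<C> \<and> \<C> \<subseteq> \<J> \<and> S = \<Union>\<C> \<and> \<xi> S = 1 \<longrightarrow> (\<exists>R\<in>\<C>. \<xi> R = 1)"
    using assms unfolding Omega_def by blast+
  show "\<xi> S = 0 \<or> \<xi> S = 1" if "S \<in> \<J>" using PiE_mem[OF e that] by simp
  show "\<xi> \<in> extensional \<J>" using e by (simp add: PiE_def)
  show "\<xi> (R \<inter> S) = \<xi> R * \<xi> S" if "R \<in> \<J>" "S \<in> \<J>" using m that by simp
  show "\<exists>R\<in>\<C>. \<xi> R = 1" if "S \<in> \<J>" "finite \<C>" "\<C> \<subseteq> \<J>" "S = \<Union>\<C>" "\<xi> S = 1"
    using c that by blast
qed

lemma Omega_P: assumes \<xi>: "\<xi> \<in> Omega G P" shows "\<xi> P = 1"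
proof -
  have "\<exists>S\<in>\<J>. \<xi> S \<noteq> 0" using \<xi> unfolding Omega_def mem_Collect_eq by (elim conjE)
  then obtain S where S: "S \<in> \<J>" "\<xi> S \<noteq> 0" by blast
  have "S \<inter> P = S" using J_subset[OF S(1)] by blast
  then have "\<xi> S = \<xi> S * \<xi> P" using OmegaD(3)[OF \<xi> S(1) P_in_J] by simp
  then show ?thesis using S by simp
qed

text \<open>Intersecting with P gives the empty family the intended meaning; the intersection alone
  would be the whole type.\<close>

lemma Omega_Inter:
  assumes \<xi>: "\<xi> \<in> Omega G P" and "finite A" "A \<subseteq> \<J>" "\<And>S. S \<in> A \<Longrightarrow> \<xi> S = 1"
  shows "P \<inter> \<Inter>A \<in> \<J> \<and> \<xi> (P \<inter> \<Inter>A) = 1"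
  using assms(2-)
proof (induction A rule: finite_induct)
  case empty
  then show ?case using P_in_J Omega_P[OF \<xi>] by simp
next
  case (insert S A)
  have "P \<inter> \<Inter>(insert S A) = S \<inter> (P \<inter> \<Inter>A)" by auto
  then show ?case using insert J_Int[of S "P \<inter> \<Inter>A"] OmegaD(3)[OF \<xi>, of S "P \<inter> \<Inter>A"] by simp
qed

text \<open>Density of the characters of points. If no p realised \<xi> on I, the intersection of
  the ideals with value 1 would be covered by the ideals with value 0, and the covering condition in
  \<open>Omega\<close> would give one of these the value 1.\<close>

lemma Omega_point:
  assumes \<xi>: "\<xi> \<in> Omega G P" and I: "finite I" "I \<subseteq> \<J>"
  obtains p where "p \<in> P" "\<And>S. S \<in> I \<Longrightarrow> p \<in> S \<longleftrightarrow> \<xi> S = 1"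
proof -
  define A where "A = {S \<in> I. \<xi> S = 1}"
  define N where "N = {S \<in> I. \<xi> S \<noteq> 1}"
  define S0 where "S0 = P \<inter> \<Inter>A"
  have A: "finite A" "A \<subseteq> \<J>" using I by (auto simp: A_def)
  have A1: "\<xi> S = 1" if "S \<in> A" for S using that by (simp add: A_def)
  have S0: "S0 \<in> \<J>" "\<xi> S0 = 1"
    unfolding S0_def using Omega_Inter[OF \<xi> A A1] by blast+
  have "\<not> S0 \<subseteq> \<Union>N"
  proof
    assume "S0 \<subseteq> \<Union>N"
    then have "S0 = \<Union>((\<lambda>R. S0 \<inter> R) ` N)" by blast
    moreover have "(\<lambda>R. S0 \<inter> R) ` N \<subseteq> \<J>" using I S0 J_Int by (auto simp: N_def)
    moreover have "finite ((\<lambda>R. S0 \<inter> R) ` N)" using I by (simp add: N_def)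
    ultimately obtain R where R: "R \<in> N" "\<xi> (S0 \<inter> R) = 1"
      using OmegaD(4)[OF \<xi> S0(1) _ _ _ S0(2), of "(\<lambda>R. S0 \<inter> R) ` N"] by blast
    then have "R \<in> \<J>" using I by (auto simp: N_def)
    then have "\<xi> R = 1" using OmegaD(3)[OF \<xi> S0(1), of R] R S0 by simp
    then show False using R by (simp add: N_def)
  qed
  then obtain p where "p \<in> S0" "p \<notin> \<Union>N" by blast
  then show thesis using that[of p] by (auto simp: S0_def A_def N_def)
qed

text \<open>The restriction to \<J> makes the function extensional, as the members of
  \<open>Omega\<close> are.\<close>

definition point_char :: "'g \<Rightarrow> 'g set \<Rightarrow> nat" where
  "point_char p = (\<lambda>R\<in>\<J>. if p \<in> R then 1 else 0)"

lemma point_char_apply [simp]: "R \<in> \<J> \<Longrightarrow> point_char p R = (if p \<in> R then 1 else 0)"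
  by (simp add: point_char_def)

lemma point_char_Omega: "p \<in> P \<Longrightarrow> point_char p \<in> Omega G P"
  unfolding Omega_def
proof (intro CollectI conjI ballI allI impI)
  assume p: "p \<in> P"
  show "point_char p \<in> \<J> \<rightarrow>\<^sub>E {0, 1}" by (auto simp: point_char_def)
  show "\<exists>S\<in>\<J>. point_char p S \<noteq> 0" using P_in_J p by (intro bexI[of _ P]) auto
  show "point_char p (R \<inter> S) = point_char p R * point_char p S" if "R \<in> \<J>" "S \<in> \<J>" for R S
    using that J_Int[OF that] by simp
  show "\<exists>R\<in>\<C>. point_char p R = 1"
    if "S \<in> \<J>" "finite \<C> \<and> \<C> \<subseteq> \<J> \<and> S = \<Union>\<C> \<and> point_char p S = 1" for S \<C>
  proof -
    have "p \<in> \<Union>\<C>" using that by (auto split: if_splits)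
    then obtain R where "R \<in> \<C>" "p \<in> R" by blast
    then show ?thesis using that by (intro bexI[of _ R]) auto
  qed
qed simp

lemma point_char_eq_imp:
  assumes "p \<in> P" "q \<in> P" "point_char p = point_char q" shows "p <# P = q <# P"
proof -
  have "p \<in> R \<longleftrightarrow> q \<in> R" if "R \<in> \<J>" for R
    using fun_cong[OF assms(3), of R] that by (auto split: if_splits)
  then show ?thesis
    using assms eq_l_coset_iff[of p q] l_coset_in_J self_in_coset by blast
qed

lemma constr_rev_image:
  assumes "\<beta> \<in> words P" shows "dot G \<beta> <# K \<beta> = K (rev \<beta>)"
proof
  show "dot G \<beta> <# K \<beta> \<subseteq> K (rev \<beta>)"
    using constr_rev[OF assms] by (auto simp: l_coset_def)
  show "K (rev \<beta>) \<subseteq> dot G \<beta> <# K \<beta>"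
  proof
    fix x assume x: "x \<in> K (rev \<beta>)"
    then have c: "x \<in> carrier G" using constr_in_P by auto
    then have "inv (dot G \<beta>) \<otimes> x \<in> K \<beta>" using mem_constr_rev[OF assms] x by simp
    moreover have "x = dot G \<beta> \<otimes> (inv (dot G \<beta>) \<otimes> x)" using c assms by (simp flip: m_assoc)
    ultimately show "x \<in> dot G \<beta> <# K \<beta>" unfolding l_coset_def by blast
  qed
qed

text \<open>The partial action prescribes values only on ideals \<open>K \<beta>\<close> with dot
  equal to h. These suffice: intersecting S with one such ideal of value 1 leaves the value of S
  unchanged, and the intersection is again of this kind, for the word \<beta> followed by a neutral
  word for S.\<close>

lemma Omega_dom_unique:
  assumes "\<psi> \<in> Omega_dom G P h" "\<psi>' \<in> Omega_dom G P h"
    and eq: "\<And>\<beta>. \<beta> \<in> words P \<Longrightarrow> dot G \<beta> = h \<Longrightarrow> \<psi> (K \<beta>) = \<psi>' (K \<beta>)"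
  shows "\<psi> = \<psi>'"
proof -
  have O: "\<psi> \<in> Omega G P" "\<psi>' \<in> Omega G P" using assms by (auto simp: Omega_dom_def)
  obtain \<beta> where \<beta>: "\<beta> \<in> words P" "dot G \<beta> = h" "\<psi> (K \<beta>) = 1"
    using assms(1) unfolding Omega_dom_def by blast
  have "\<psi> S = \<psi>' S" if S: "S \<in> \<J>" for S
  proof -
    obtain \<gamma> where \<gamma>: "\<gamma> \<in> NW" "S = K \<gamma>" using S J_obtain by blast
    have "S \<inter> K \<beta> = K (\<beta> @ \<gamma>)" using \<beta> \<gamma> by (auto simp: constr_NW_append)
    moreover have "dot G (\<beta> @ \<gamma>) = h" "\<beta> @ \<gamma> \<in> words P" using \<beta> \<gamma> by (auto simp: dot_append)
    ultimately have "\<psi> (S \<inter> K \<beta>) = \<psi>' (S \<inter> K \<beta>)" using eq by metis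
    moreover have "\<psi>' (K \<beta>) = 1" using eq[OF \<beta>(1,2)] \<beta>(3) by simp
    ultimately show ?thesis
      using OmegaD(3)[OF O(1) S] OmegaD(3)[OF O(2) S] \<beta> by simp
  qed
  then show ?thesis using OmegaD(2)[OF O(1)] OmegaD(2)[OF O(2)] by (rule extensionalityI[rotated 2])
qed

text \<open>\<open>Omega_act\<close> is a definite description in terms of translated ideals.
  Translation by the inverse of g is reversal of the word, and \<open>Omega_dom_unique\<close>
  supplies uniqueness.\<close>

lemma Omega_act_eqI:
  assumes g: "g \<in> carrier G" and \<psi>: "\<psi> \<in> Omega_dom G P (inv g)"
    and eq: "\<And>\<beta>. \<beta> \<in> words P \<Longrightarrow> dot G \<beta> = inv g \<Longrightarrow> \<psi> (K \<beta>) = \<xi> (K (rev \<beta>))"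
  shows "Omega_act G P g \<xi> = \<psi>"
  unfolding Omega_act_def
proof (rule the_equality)
  have im: "inv g <# K \<beta> = K (rev \<beta>)" if "\<beta> \<in> words P" "dot G \<beta> = inv g" for \<beta>
    using constr_rev_image[OF that(1)] that(2) by simp
  show "\<psi> \<in> Omega_dom G P (inv g) \<and> (\<forall>\<beta>\<in>words P. dot G \<beta> = inv g \<longrightarrow> \<psi> (K \<beta>) = \<xi> (inv g <# K \<beta>))"
    using \<psi> eq im by simp
  show "\<psi>' = \<psi>" if "\<psi>' \<in> Omega_dom G P (inv g) \<and> (\<forall>\<beta>\<in>words P. dot G \<beta> = inv g \<longrightarrow> \<psi>' (K \<beta>) = \<xi> (inv g <# K \<beta>))" for \<psi>'
    by (rule Omega_dom_unique[where h = "inv g"]) (use that \<psi> eq im in auto)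
qed

lemma act_point_char:
  assumes "g \<in> carrier G" "q \<in> P" "point_char q \<in> Omega_dom G P g"
  shows "g \<otimes> q \<in> P" "Omega_act G P g (point_char q) = point_char (g \<otimes> q)"
proof -
  obtain \<alpha> where \<alpha>: "\<alpha> \<in> words P" "dot G \<alpha> = g" "q \<in> K \<alpha>"
    using assms(3) by (auto simp: Omega_dom_def split: if_splits)
  show gq: "g \<otimes> q \<in> P" using constr_dot[OF \<alpha>(1,3)] \<alpha>(2) by simp
  show "Omega_act G P g (point_char q) = point_char (g \<otimes> q)"
  proof (rule Omega_act_eqI[OF assms(1)])
    have "g \<otimes> q \<in> K (rev \<alpha>)" using constr_rev[OF \<alpha>(1,3)] \<alpha>(2) by simp
    then show "point_char (g \<otimes> q) \<in> Omega_dom G P (inv g)"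
      using \<alpha> gq point_char_Omega by (auto simp: Omega_dom_def dot_rev intro!: bexI[of _ "rev \<alpha>"])
    fix \<beta> assume \<beta>: "\<beta> \<in> words P" "dot G \<beta> = inv g"
    then show "point_char (g \<otimes> q) (K \<beta>) = point_char q (K (rev \<beta>))"
      using mem_constr_rev[OF \<beta>(1), of q] assms by simp
  qed
qed

lemma Omega_topspace: "topspace (Omega_top G P) = Omega G P"
  unfolding Omega_top_def by (auto simp: Omega_def)

lemma Omega_open_basis:
  assumes "openin (Omega_top G P) U" "\<xi> \<in> U"
  obtains I where "finite I" "I \<subseteq> \<J>" "\<And>\<psi>. \<psi> \<in> Omega G P \<Longrightarrow> (\<And>S. S \<in> I \<Longrightarrow> \<psi> S = \<xi> S) \<Longrightarrow> \<psi> \<in> U"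
proof -
  let ?X = "\<lambda>_ :: 'g set. discrete_topology {0, 1 :: nat}"
  obtain T where T: "openin (product_topology ?X \<J>) T" "U = T \<inter> Omega G P"
    using assms(1) unfolding Omega_top_def openin_subtopology by blast
  then obtain V where V: "finite {i \<in> \<J>. V i \<noteq> topspace (?X i)}" "\<xi> \<in> PiE \<J> V" "PiE \<J> V \<subseteq> T"
    using assms(2) unfolding openin_product_topology_alt by blast
  define I where "I = {i \<in> \<J>. V i \<noteq> {0, 1}}"
  have "\<psi> \<in> U" if \<psi>: "\<psi> \<in> Omega G P" "\<And>S. S \<in> I \<Longrightarrow> \<psi> S = \<xi> S" for \<psi>
  proof -
    have "\<psi> S \<in> V S" if S: "S \<in> \<J>" for S
    proof (cases "S \<in> I")
      case True
      then show ?thesis using \<psi>(2) V(2) S by auto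
    next
      case False
      then show ?thesis using OmegaD(1)[OF \<psi>(1) S] S by (auto simp: I_def)
    qed
    then have "\<psi> \<in> PiE \<J> V" using OmegaD(2)[OF \<psi>(1)] by (auto simp: PiE_def)
    then show ?thesis using V(3) T(2) \<psi>(1) by blast
  qed
  moreover have "finite I" using V(1) by (simp add: I_def)
  moreover have "I \<subseteq> \<J>" by (auto simp: I_def)
  ultimately show thesis using that by blast
qed

lemma Omega_open_zero:
  assumes "finite \<C>" "\<C> \<subseteq> \<J>"
  shows "openin (Omega_top G P) {\<xi> \<in> Omega G P. \<forall>R\<in>\<C>. \<xi> R = 0}"
proof -
  define V where "V = (\<lambda>S. if S \<in> \<C> then {0} else {0, 1 :: nat})"
  have "openin (product_topology (\<lambda>_. discrete_topology {0, 1}) \<J>) (PiE \<J> V)"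
  proof (rule product_topology_basis)
    show "finite {i. V i \<noteq> topspace (discrete_topology {0, 1})}"
      by (rule finite_subset[OF _ assms(1)]) (auto simp: V_def)
  qed (auto simp: V_def)
  moreover have "{\<xi> \<in> Omega G P. \<forall>R\<in>\<C>. \<xi> R = 0} = PiE \<J> V \<inter> Omega G P"
  proof (intro equalityI subsetI)
    fix \<xi> assume \<xi>: "\<xi> \<in> {\<xi> \<in> Omega G P. \<forall>R\<in>\<C>. \<xi> R = 0}"
    then have O: "\<xi> \<in> Omega G P" by simp
    have "\<xi> S \<in> V S" if "S \<in> \<J>" for S using OmegaD(1)[OF O that] \<xi> by (auto simp: V_def)
    then show "\<xi> \<in> PiE \<J> V \<inter> Omega G P" using O OmegaD(2)[OF O] by (auto simp: PiE_def)
  next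
    fix \<xi> assume \<xi>: "\<xi> \<in> PiE \<J> V \<inter> Omega G P"
    have "\<xi> R = 0" if "R \<in> \<C>" for R
      using PiE_mem[of \<xi> \<J> V R] \<xi> that assms(2) by (auto simp: V_def)
    then show "\<xi> \<in> {\<xi> \<in> Omega G P. \<forall>R\<in>\<C>. \<xi> R = 0}" using \<xi> by blast
  qed
  ultimately show ?thesis unfolding Omega_top_def openin_subtopology by blast
qed

section \<open>Fixed points of the partial action and units that move principal ideals\<close>

lemma unit_groupD: "u \<in> unit_group G P \<Longrightarrow> u \<in> P \<and> inv u \<in> P"
  by (simp add: unit_group_def)

lemma coset_mult_cancel:
  "p \<in> P \<Longrightarrow> s \<in> P \<Longrightarrow> t \<in> P \<Longrightarrow> (p \<otimes> s) <# P = (p \<otimes> t) <# P \<longleftrightarrow> s <# P = t <# P"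
  using quotient_rep.c_cong[OF quotient_rep_coset] .

lemma conjugate_unit:
  assumes x: "x \<in> P" and g: "g \<in> carrier G" and "g \<otimes> x \<in> P" and eq: "(g \<otimes> x) <# P = x <# P"
  shows "inv x \<otimes> g \<otimes> x \<in> unit_group G P"
proof -
  have 1: "g \<otimes> x \<in> x <# P" and 2: "x \<in> (g \<otimes> x) <# P"
    using self_in_coset[of x] self_in_coset[of "g \<otimes> x"] assms by simp_all
  have "inv x \<otimes> (g \<otimes> x) \<in> P" "inv (g \<otimes> x) \<otimes> x \<in> P"
    using mem_l_coset[THEN iffD1, OF _ _ 1] mem_l_coset[THEN iffD1, OF _ _ 2] x g by simp_all
  then show ?thesis using x g by (simp add: unit_group_def inv_mult_group m_assoc)
qed

lemma conjugate_ne_one: "\<lbrakk>x \<in> P; g \<in> carrier G; g \<noteq> \<one>\<rbrakk> \<Longrightarrow> inv x \<otimes> g \<otimes> x \<noteq> \<one>"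
proof
  assume a: "x \<in> P" "g \<in> carrier G" "g \<noteq> \<one>" "inv x \<otimes> g \<otimes> x = \<one>"
  have "g = x \<otimes> (inv x \<otimes> g \<otimes> x) \<otimes> inv x" using a(1,2) by (simp add: m_assoc flip: m_assoc[of x "inv x"])
  then show False using a by simp
qed

text \<open>If g fixes the principal ideal of x, then v = x^{-1} g x is a nontrivial unit, and (iii)
  for v yields t whose principal ideal is moved by v; the point is y = x t. Passing from x to x t
  keeps x in every ideal that contains it.\<close>

lemma move_point:
  assumes units: "units_move_ideals G P" and x: "x \<in> P" and g: "g \<in> carrier G" "g \<noteq> \<one>"
    and I: "finite I" "I \<subseteq> \<J>"
  obtains y where "y \<in> P" "\<And>S. S \<in> I \<Longrightarrow> y \<in> S \<longleftrightarrow> x \<in> S" "g \<otimes> y \<notin> P \<or> (g \<otimes> y) <# P \<noteq> y <# P"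
proof (cases "g \<otimes> x \<in> P \<and> (g \<otimes> x) <# P = x <# P")
  case True
  define v where "v = inv x \<otimes> g \<otimes> x"
  have v: "v \<in> unit_group G P - {\<one>}"
    using conjugate_unit[OF x g(1)] conjugate_ne_one[OF x g] True by (simp add: v_def)
  then have vP: "v \<in> P" using unit_groupD by blast
  \<comment> \<open>Pullbacks along x of the ideals of I that miss x. They do not contain the
    identity, hence are proper, and avoiding them keeps x t outside the same ideals.\<close>
  define \<C> where "\<C> = (\<lambda>S. {t \<in> P. x \<otimes> t \<in> S}) ` {S \<in> I. x \<notin> S}"
  have "finite \<C>" using I by (simp add: \<C>_def)
  moreover have "\<C> \<subseteq> \<J> - {P}"
  proof
    fix R assume "R \<in> \<C>"
    then obtain S where S: "S \<in> I" "x \<notin> S" "R = {t \<in> P. x \<otimes> t \<in> S}" by (auto simp: \<C>_def)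
    have "\<one> \<notin> R" using S x by simp
    moreover have "R \<in> \<J>" using S x I by (auto intro: J_shift)
    ultimately show "R \<in> \<J> - {P}" using P_one by blast
  qed
  ultimately obtain t where t: "t \<in> P - \<Union>\<C>" "(v \<otimes> t) <# P \<noteq> t <# P"
    using units v unfolding units_move_ideals_def by blast
  have gx: "g \<otimes> (x \<otimes> t) = x \<otimes> (v \<otimes> t)"
    using x g t by (simp add: v_def m_assoc flip: m_assoc[of x "inv x"])
  show thesis
  proof
    show "x \<otimes> t \<in> P" using x t by simp
    show "x \<otimes> t \<in> S \<longleftrightarrow> x \<in> S" if "S \<in> I" for S
    proof (cases "x \<in> S")
      case True
      then show ?thesis using that I t J_right_ideal[of S x t] by auto
    next
      case False
      then have "{t \<in> P. x \<otimes> t \<in> S} \<in> \<C>" using that by (auto simp: \<C>_def)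
      then show ?thesis using False t by auto
    qed
    show "g \<otimes> (x \<otimes> t) \<notin> P \<or> (g \<otimes> (x \<otimes> t)) <# P \<noteq> (x \<otimes> t) <# P"
      using t x vP by (simp add: gx coset_mult_cancel)
  qed
next
  case False
  then show thesis using that[of x] x by blast
qed

theorem units_move_imp_top_free:
  assumes "units_move_ideals G P" shows "partial_action_top_free G P"
  unfolding partial_action_top_free_def topologically_free_def
proof (intro ballI impI)
  fix g assume g: "g \<in> carrier G" "g \<noteq> \<one>"
  define F where "F = {\<xi> \<in> Omega_dom G P g. Omega_act G P g \<xi> = \<xi>}"
  have "False" if \<xi>: "\<xi> \<in> Omega_top G P interior_of F" for \<xi>
  proof -
    obtain U where U: "openin (Omega_top G P) U" "\<xi> \<in> U" "U \<subseteq> F"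
      using \<xi> unfolding interior_of_def by blast
    obtain I where I: "finite I" "I \<subseteq> \<J>"
      and IU: "\<And>\<psi>. \<psi> \<in> Omega G P \<Longrightarrow> (\<And>S. S \<in> I \<Longrightarrow> \<psi> S = \<xi> S) \<Longrightarrow> \<psi> \<in> U"
      using Omega_open_basis[OF U(1,2)] by metis
    have O: "\<xi> \<in> Omega G P" using U openin_subset[OF U(1)] by (auto simp: Omega_topspace)
    obtain p where p: "p \<in> P" "\<And>S. S \<in> I \<Longrightarrow> p \<in> S \<longleftrightarrow> \<xi> S = 1"
      using Omega_point[OF O I] by metis
    \<comment> \<open>Moving p to y preserves the finitely many coordinates in I, so the character
      of y remains in U, where g was supposed to fix every character.\<close>
    obtain y where y: "y \<in> P" "\<And>S. S \<in> I \<Longrightarrow> y \<in> S \<longleftrightarrow> p \<in> S" "g \<otimes> y \<notin> P \<or> (g \<otimes> y) <# P \<noteq> y <# P"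
      using move_point[OF assms p(1) g I] by metis
    have "point_char y S = \<xi> S" if "S \<in> I" for S
      using OmegaD(1)[OF O, of S] that I p(2)[OF that] y(2)[OF that] by auto
    then have "point_char y \<in> F" using IU point_char_Omega[OF y(1)] U(3) by blast
    then have d: "point_char y \<in> Omega_dom G P g" and fixed: "Omega_act G P g (point_char y) = point_char y"
      by (auto simp: F_def)
    then show False
      using act_point_char[OF g(1) y(1) d] y point_char_eq_imp[of "g \<otimes> y" y] by simp
  qed
  then show "Omega_top G P interior_of F = {}" by blast
qed

theorem unit_top_free_imp_units_move:
  assumes "unit_action_top_free G P" shows "units_move_ideals G P"
  unfolding units_move_ideals_def
proof (intro ballI allI impI, rule ccontr)
  fix u \<C> assume u: "u \<in> unit_group G P - {\<one>}" and \<C>: "finite \<C> \<and> \<C> \<subseteq> \<J> - {P}"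
    and neg: "\<not> (\<exists>t\<in>P - \<Union>\<C>. (u \<otimes> t) <# P \<noteq> t <# P)"
  have uP: "u \<in> P" "inv u \<in> P" using u unit_groupD by auto
  \<comment> \<open>The open set of characters that vanish on \<C>. It contains the character of the
    identity, since no proper right ideal contains it, and it will consist of fixed points of
    u.\<close>
  define V where "V = {\<xi> \<in> Omega G P. \<forall>R\<in>\<C>. \<xi> R = 0}"
  have "V \<subseteq> {\<xi> \<in> Omega_dom G P u. Omega_act G P u \<xi> = \<xi>}"
  proof
    fix \<xi> assume "\<xi> \<in> V"
    then have O: "\<xi> \<in> Omega G P" and z: "\<And>R. R \<in> \<C> \<Longrightarrow> \<xi> R = 0" by (auto simp: V_def)
    have Ku: "K [\<one>, u] = P" "K [u, \<one>] = P"
      using uP by (auto simp: mem_constr_Cons set_eq_iff)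
    have dom: "\<xi> \<in> Omega_dom G P u"
      using O Omega_P[OF O] uP Ku by (auto simp: Omega_dom_def intro!: bexI[of _ "[\<one>, u]"])
    have dom': "\<xi> \<in> Omega_dom G P (inv u)"
      using O Omega_P[OF O] uP Ku by (auto simp: Omega_dom_def intro!: bexI[of _ "[u, \<one>]"])
    have "Omega_act G P u \<xi> = \<xi>"
    proof (rule Omega_act_eqI)
      fix \<beta> assume \<beta>: "\<beta> \<in> words P" "dot G \<beta> = inv u"
      \<comment> \<open>Equality of the two values is tested at one point p that realises \<xi> on
        these ideals. Such a p avoids \<C>, so upP = pP, and the constructible ideals cannot
        distinguish p from up.\<close>
      define I where "I = insert (K \<beta>) (insert (K (rev \<beta>)) \<C>)"
      have I: "finite I" "I \<subseteq> \<J>" using \<C> \<beta> by (auto simp: I_def)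
      obtain p where p: "p \<in> P" "\<And>S. S \<in> I \<Longrightarrow> p \<in> S \<longleftrightarrow> \<xi> S = 1"
        using Omega_point[OF O I] by metis
      have "p \<notin> \<Union>\<C>" using p z by (auto simp: I_def)
      then have "(u \<otimes> p) <# P = p <# P" using neg p by blast
      then have "p \<in> K \<beta> \<longleftrightarrow> u \<otimes> p \<in> K \<beta>" using J_mem_cong[of "K \<beta>" "u \<otimes> p" p] \<beta> uP p by simp
      also have "\<dots> \<longleftrightarrow> p \<in> K (rev \<beta>)" using mem_constr_rev[OF \<beta>(1), of p] \<beta> uP p by simp
      finally have "\<xi> (K \<beta>) = 1 \<longleftrightarrow> \<xi> (K (rev \<beta>)) = 1" using p(2) by (auto simp: I_def)
      then show "\<xi> (K \<beta>) = \<xi> (K (rev \<beta>))"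
        using OmegaD(1)[OF O, of "K \<beta>"] OmegaD(1)[OF O, of "K (rev \<beta>)"] \<beta> by auto
    qed (use uP dom' in auto)
    then show "\<xi> \<in> {\<xi> \<in> Omega_dom G P u. Omega_act G P u \<xi> = \<xi>}" using dom by simp
  qed
  moreover have "openin (Omega_top G P) V" unfolding V_def using \<C> by (intro Omega_open_zero) auto
  ultimately have "V \<subseteq> Omega_top G P interior_of {\<xi> \<in> Omega_dom G P u. Omega_act G P u \<xi> = \<xi>}"
    by (rule interior_of_maximal)
  also have "\<dots> = {}"
    using assms u unfolding unit_action_top_free_def topologically_free_def by blast
  finally have "V = {}" by simp
  moreover have "point_char \<one> \<in> V"
  proof -
    have "\<one> \<notin> R" if "R \<in> \<C>" for R
    proof
      assume "\<one> \<in> R"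
      have R: "R \<in> \<J>" "R \<noteq> P" using that \<C> by auto
      have "t \<in> R" if "t \<in> P" for t using J_right_ideal[OF R(1) \<open>\<one> \<in> R\<close> that] that by simp
      then show False using R J_subset by blast
    qed
    then show ?thesis using \<C> point_char_Omega[OF P_one] by (auto simp: V_def)
  qed
  ultimately show False by blast
qed

theorem top_free_imp_unit_top_free:
  "partial_action_top_free G P \<Longrightarrow> unit_action_top_free G P"
  unfolding partial_action_top_free_def unit_action_top_free_def topologically_free_def
  by (auto simp: unit_group_def)

end

section \<open>The diagonal subalgebra\<close>

lemma cstar_generated_simps [simp]:
  "mult (cstar_generated A S) = mult A" "one (cstar_generated A S) = one A"
  "zero (cstar_generated A S) = zero A" "add (cstar_generated A S) = add A"
  "smult (cstar_generated A S) = smult A" "adj (cstar_generated A S) = adj A"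
  by (simp_all add: cstar_generated_def)

lemma carrier_cstar_generated:
  "carrier (cstar_generated A S) = \<Inter>{C. cstar_subalgebra A C \<and> S \<subseteq> C}"
  by (simp add: cstar_generated_def)

lemma (in cstar_algebra) cstar_subalgebra_carrier: "cstar_subalgebra A (carrier A)"
  by (auto simp: cstar_subalgebra_def linear_subspace_def norm_closure_def)

lemma (in cstar_algebra) cstar_generated_subset: "S \<subseteq> carrier A \<Longrightarrow> carrier (cstar_generated A S) \<subseteq> carrier A"
  using cstar_subalgebra_carrier by (auto simp: carrier_cstar_generated)

lemma star_hom_cong:
  assumes "h \<in> star_hom A B" "star_alg A" "\<And>x. x \<in> carrier A \<Longrightarrow> h' x = h x"
  shows "h' \<in> star_hom A B"
proof -
  interpret star_alg A by fact
  have "h \<in> carrier A \<rightarrow> carrier B" using assms by (simp add: star_hom_def ring_hom_def)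
  then show ?thesis using assms by (auto simp: star_hom_def ring_hom_def)
qed

lemma star_hom_generated:
  assumes "h \<in> star_hom A B" "\<And>x. x \<in> carrier A \<Longrightarrow> h x \<in> carrier (cstar_generated B S)"
  shows "h \<in> star_hom A (cstar_generated B S)"
  using assms by (auto simp: star_hom_def ring_hom_def)

lemma star_hom_from_generated:
  assumes "h \<in> star_hom A (cstar_generated B S)" "carrier (cstar_generated B S) \<subseteq> carrier B"
  shows "h \<in> star_hom A B"
  using assms by (auto simp: star_hom_def ring_hom_def Pi_iff)

section \<open>Representations of T_u: image, kernel and restriction to the diagonal\<close>

locale toeplitz_rep = submonoid_in_group G P + B: cstar_algebra B
  for G :: "('g, 'k) monoid_scheme" (structure) and P and B :: "('b, 'n) cstar_scheme" +
  fixes v :: "'g \<Rightarrow> 'b" and h :: "(nat \<Rightarrow> 'g star_poly) set \<Rightarrow> 'b"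
  assumes hom: "h \<in> star_hom TT B" and gen: "p \<in> P \<Longrightarrow> h (tt p) = v p"
begin

sublocale H: cstar_hom_pair TT B h
  by (simp add: cstar_hom_pair_def star_hom_pair_def star_hom_pair_axioms_def hom
      TU.star_alg B.star_alg TU.cstar_algebra_axioms B.cstar_algebra_axioms)

lemma v_family: "toeplitz_family G P B v"
proof -
  have w: "tt \<in> P \<rightarrow> carrier TT" by auto
  have rel: "toeplitz_relators G P B v = h ` toeplitz_relators G P TT tt"
    by (rule toeplitz_relators_hom(2)[OF H.star_hom_pair_axioms w gen])
  have "r = \<zero>\<^bsub>B\<^esub>" if r: "r \<in> toeplitz_relators G P B v" for r
  proof -
    obtain a where a: "a \<in> toeplitz_relators G P TT tt" "r = h a"
      using r unfolding rel by blast
    then have "a = \<zero>\<^bsub>TT\<^esub>" using tt_family unfolding toeplitz_family_def by blast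
    then show ?thesis using a by simp
  qed
  moreover have "v p \<in> carrier B" if "p \<in> P" for p using gen[OF that] that H.hom_closed[of "tt p"] by simp
  ultimately show ?thesis by (simp add: toeplitz_family_def)
qed

sublocale BF: cstar_toeplitz_fam G P B v
  by (simp add: cstar_toeplitz_fam_def toeplitz_fam_def toeplitz_fam_axioms_def
      submonoid_in_group_axioms B.star_alg B.cstar_algebra_axioms v_family)

lemma hom_wd: "\<alpha> \<in> words P \<Longrightarrow> h (TF.wd \<alpha>) = BF.wd \<alpha>"
  by (rule hom_wdot[OF H.star_hom_pair_axioms]) (use gen in auto)

lemma hom_lits: "TF.valid ls \<Longrightarrow> h (TF.lits ls) = BF.lits ls"
proof (induction ls)
  case (Cons l ls)
  then have "h (TF.lit l) = BF.lit l" by (simp add: TF.lit_def BF.lit_def hom_wd H.hom_diff)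
  then show ?case using Cons by (simp add: TF.lits_Cons BF.lits_Cons)
qed simp

lemma hom_lin_comb: "snd ` set cs \<subseteq> words P \<Longrightarrow> h (TU.lin_comb tt cs) = B.lin_comb v cs"
proof (induction cs)
  case (Cons c\<alpha> cs)
  obtain c \<alpha> where c\<alpha>: "c\<alpha> = (c, \<alpha>)" by force
  then have "\<alpha> \<in> words P" "TU.lin_comb tt cs \<in> carrier TT" using Cons by (auto intro: TF.lin_comb_closed)
  then show ?case using Cons c\<alpha> by (simp add: hom_wd)
qed simp

lemma into_generated:
  assumes a: "a \<in> carrier TT" shows "h a \<in> carrier (cstar_generated B (v ` P))"
  unfolding carrier_cstar_generated
proof (clarify)
  fix C assume C: "cstar_subalgebra B C" "v ` P \<subseteq> C"
  have sub: "C \<subseteq> carrier B" "\<zero>\<^bsub>B\<^esub> \<in> C" "\<And>x y. x \<in> C \<Longrightarrow> y \<in> C \<Longrightarrow> x \<oplus>\<^bsub>B\<^esub> y \<in> C" "\<And>c x. x \<in> C \<Longrightarrow> c \<odot>\<^bsub>B\<^esub> x \<in> C"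
    "\<And>x y. x \<in> C \<Longrightarrow> y \<in> C \<Longrightarrow> x \<otimes>\<^bsub>B\<^esub> y \<in> C" "\<And>x. x \<in> C \<Longrightarrow> adj B x \<in> C" "norm_closure B C \<subseteq> C"
    using C(1) unfolding cstar_subalgebra_def linear_subspace_def by blast+
  \<comment> \<open>\<open>cstar_subalgebra\<close> does not ask for the unit; (T1) puts it into C
    as the value of v at the identity of P.\<close>
  have one: "\<one>\<^bsub>B\<^esub> \<in> C" using C(2) BF.w_one P_one by (metis image_subset_iff)
  have wd: "BF.wd \<alpha> \<in> C" if "\<alpha> \<in> words P" for \<alpha>
    using that
  proof (induction rule: words_induct)
    case (Cons p q \<alpha>)
    then have "v p \<in> C" "v q \<in> C" using C(2) by auto
    then show ?case using Cons sub by simp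
  qed (simp add: one)
  have lc: "B.lin_comb v cs \<in> C" if "snd ` set cs \<subseteq> words P" for cs
    using that by (induction cs) (auto intro!: sub(2) sub(3) sub(4) wd)
  have "\<exists>cs. snd ` set cs \<subseteq> words P \<and> cnorm TT (a \<ominus>\<^bsub>TT\<^esub> TU.lin_comb tt cs) < 1 / real (Suc n)" for n
    by (rule TT_dense[OF a, of "1 / real (Suc n)"]) (simp, blast)
  then obtain f where f: "\<And>n. snd ` set (f n) \<subseteq> words P"
      "\<And>n. cnorm TT (a \<ominus>\<^bsub>TT\<^esub> TU.lin_comb tt (f n)) < 1 / real (Suc n)" by metis
  have fc: "TU.lin_comb tt (f n) \<in> carrier TT" for n using f(1) by (rule TF.lin_comb_closed)
  have "TU.conv (\<lambda>n. TU.lin_comb tt (f n)) a"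
  proof (rule TU.convI_bound)
    show "cnorm TT (TU.lin_comb tt (f n) \<ominus>\<^bsub>TT\<^esub> a) \<le> 1 / real (Suc n)" for n
      using f(2)[of n] TU.nu_diff_commute[OF a fc[of n]] by simp
    show "(\<lambda>n. 1 / real (Suc n)) \<longlonglongrightarrow> 0" by (rule LIMSEQ_Suc[OF lim_1_over_n])
  qed (use fc a in auto)
  from H.conv_hom[OF this] have "B.conv (\<lambda>n. B.lin_comb v (f n)) (h a)"
    using f(1) by (simp add: hom_lin_comb)
  then have "h a \<in> norm_closure B C"
    unfolding norm_closure_def B.conv_def mem_Collect_eq
    using lc[OF f(1)] by (intro conjI exI[of _ "\<lambda>n. B.lin_comb v (f n)"]) simp_all
  then show "h a \<in> C" using sub(7) by blast
qed

lemma v_in_carrier: "v ` P \<subseteq> carrier B"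
  by auto

text \<open>An injective h is isometric, so the image is complete and therefore closed. It is then
  itself a C*-subalgebra containing the generators, hence contains the generated one.\<close>

lemma injective_image:
  assumes inj: "\<And>a. a \<in> carrier TT \<Longrightarrow> h a = \<zero>\<^bsub>B\<^esub> \<Longrightarrow> a = \<zero>\<^bsub>TT\<^esub>"
  shows "h ` carrier TT = carrier (cstar_generated B (v ` P))" "inj_on h (carrier TT)"
proof -
  have iso: "cnorm B (h a) = cnorm TT a" if "a \<in> carrier TT" for a
    by (rule H.injective_isometric[OF _ that]) (rule inj)
  have lin: "linear_subspace B (h ` carrier TT)"
    unfolding linear_subspace_def
  proof (intro conjI ballI allI)
    show "\<zero>\<^bsub>B\<^esub> \<in> h ` carrier TT" using H.hom_zero TU.zero_closed by (metis imageI)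
    fix x assume "x \<in> h ` carrier TT"
    then obtain a where a: "a \<in> carrier TT" "x = h a" by blast
    show "c \<odot>\<^bsub>B\<^esub> x \<in> h ` carrier TT" for c
      using a H.hom_scale[of a c] TU.scale_closed[of a c] by (metis imageI)
    fix y assume "y \<in> h ` carrier TT"
    then obtain b where b: "b \<in> carrier TT" "y = h b" by blast
    show "x \<oplus>\<^bsub>B\<^esub> y \<in> h ` carrier TT"
      using a b H.hom_add[of a b] TU.add.m_closed[of a b] by (metis imageI)
  qed auto
  have closed: "norm_closure B (h ` carrier TT) \<subseteq> h ` carrier TT"
  proof
    fix x assume "x \<in> norm_closure B (h ` carrier TT)"
    then obtain s where x: "x \<in> carrier B" and s: "\<forall>n. s n \<in> h ` carrier TT"
      and lim: "(\<lambda>n. cnorm B (s n \<ominus>\<^bsub>B\<^esub> x)) \<longlonglongrightarrow> 0"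
      unfolding norm_closure_def mem_Collect_eq by (elim conjE exE)
    have "\<exists>a. a \<in> carrier TT \<and> s n = h a" for n using s by blast
    then obtain a where a: "\<And>n. a n \<in> carrier TT" "\<And>n. s n = h (a n)" by metis
    have "\<forall>\<epsilon>>0. \<exists>N. \<forall>m\<ge>N. \<forall>n\<ge>N. cnorm TT (a m \<ominus>\<^bsub>TT\<^esub> a n) < \<epsilon>"
    proof (intro allI impI)
      fix \<epsilon> :: real assume "\<epsilon> > 0"
      then have "eventually (\<lambda>n. cnorm B (s n \<ominus>\<^bsub>B\<^esub> x) < \<epsilon> / 2) sequentially"
        using order_tendstoD(2)[OF lim, of "\<epsilon> / 2"] by simp
      then obtain N where N: "\<And>n. n \<ge> N \<Longrightarrow> cnorm B (s n \<ominus>\<^bsub>B\<^esub> x) < \<epsilon> / 2"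
        by (auto simp: eventually_sequentially)
      have "cnorm TT (a m \<ominus>\<^bsub>TT\<^esub> a n) < \<epsilon>" if "m \<ge> N" "n \<ge> N" for m n
      proof -
        have "cnorm TT (a m \<ominus>\<^bsub>TT\<^esub> a n) = cnorm B (h (a m) \<ominus>\<^bsub>B\<^esub> h (a n))"
          using a(1) iso[of "a m \<ominus>\<^bsub>TT\<^esub> a n"] by (simp add: H.hom_diff)
        also have "\<dots> \<le> cnorm B (h (a m) \<ominus>\<^bsub>B\<^esub> x) + cnorm B (x \<ominus>\<^bsub>B\<^esub> h (a n))"
          using a(1) x by (intro B.nu_diff_triangle) auto
        also have "cnorm B (x \<ominus>\<^bsub>B\<^esub> h (a n)) = cnorm B (h (a n) \<ominus>\<^bsub>B\<^esub> x)"
          using a(1) x by (intro B.nu_diff_commute) auto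
        finally show ?thesis using N[OF that(1)] N[OF that(2)] a(2) by simp
      qed
      then show "\<exists>N. \<forall>m\<ge>N. \<forall>n\<ge>N. cnorm TT (a m \<ominus>\<^bsub>TT\<^esub> a n) < \<epsilon>" by blast
    qed
    then obtain b where b: "TU.conv a b" by (rule TU.cauchy_conv[OF a(1)])
    have "B.conv s x" using lim x a by (simp add: B.conv_def)
    moreover have "s = (\<lambda>n. h (a n))" using a(2) by auto
    then have "B.conv s (h b)" using H.conv_hom[OF b] by simp
    ultimately have "x = h b" by (rule B.conv_unique)
    then show "x \<in> h ` carrier TT" using b by (auto simp: TU.conv_def)
  qed
  have "cstar_subalgebra B (h ` carrier TT)"
    unfolding cstar_subalgebra_def
  proof (intro conjI ballI lin closed)
    fix x assume "x \<in> h ` carrier TT"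
    then obtain a where a: "a \<in> carrier TT" "x = h a" by blast
    show "adj B x \<in> h ` carrier TT"
      using a H.hom_adj[of a] TU.adj_closed[of a] by (metis imageI)
    fix y assume "y \<in> h ` carrier TT"
    then obtain b where b: "b \<in> carrier TT" "y = h b" by blast
    show "x \<otimes>\<^bsub>B\<^esub> y \<in> h ` carrier TT"
      using a b H.hom_mult[of a b] TU.m_closed[of a b] by (metis imageI)
  qed
  moreover have "v ` P \<subseteq> h ` carrier TT"
  proof
    fix y assume "y \<in> v ` P"
    then obtain p where "p \<in> P" "y = h (tt p)" using gen by auto
    then show "y \<in> h ` carrier TT" by simp
  qed
  ultimately have "carrier (cstar_generated B (v ` P)) \<subseteq> h ` carrier TT"
    unfolding carrier_cstar_generated by blast
  then show "h ` carrier TT = carrier (cstar_generated B (v ` P))" using into_generated by blast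
  show "inj_on h (carrier TT)"
  proof (rule inj_onI)
    fix a b assume ab: "a \<in> carrier TT" "b \<in> carrier TT" "h a = h b"
    then have "h (a \<ominus>\<^bsub>TT\<^esub> b) = \<zero>\<^bsub>B\<^esub>" by (simp add: H.hom_diff B.diff_eq_zero_iff)
    then show "a = b" using inj[of "a \<ominus>\<^bsub>TT\<^esub> b"] ab by (simp add: TU.diff_eq_zero_iff)
  qed
qed

end

context submonoid_in_group begin

text \<open>The part of membership in D_u that the norm comparison uses. In this form stability
  under differences follows by joining lists.\<close>

definition diag_approx :: "(nat \<Rightarrow> 'g star_poly) set \<Rightarrow> bool" where
  "diag_approx d \<longleftrightarrow> d \<in> carrier TT \<and>
    (\<forall>\<epsilon>>0. \<exists>cs. snd ` set cs \<subseteq> NW \<and> cnorm TT (d \<ominus>\<^bsub>TT\<^esub> TU.lin_comb tt cs) < \<epsilon>)"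

abbreviation "DD \<equiv> D_univ G P"

lemma NW_subset_words: "S \<subseteq> NW \<Longrightarrow> S \<subseteq> words P"
  by auto

lemma scale_lin_comb:
  "snd ` set cs \<subseteq> words P \<Longrightarrow> TU.lin_comb tt (map (\<lambda>(a, \<alpha>). (c * a, \<alpha>)) cs) = c \<odot>\<^bsub>TT\<^esub> TU.lin_comb tt cs"
proof (induction cs)
  case (Cons a\<alpha> cs)
  obtain a \<alpha> where a\<alpha>: "a\<alpha> = (a, \<alpha>)" by force
  then have "\<alpha> \<in> words P" "TU.lin_comb tt cs \<in> carrier TT" using Cons by (auto intro: TF.lin_comb_closed)
  then show ?case using Cons a\<alpha> by (simp add: TU.scale_add_right TU.scale_scale)
qed simp

lemma span_lin_comb:
  assumes "x \<in> linear_span TT (TF.wd ` NW)"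
  obtains cs where "snd ` set cs \<subseteq> NW" "x = TU.lin_comb tt cs"
proof -
  define V where "V = {TU.lin_comb tt cs | cs. snd ` set cs \<subseteq> NW}"
  have "linear_subspace TT V"
    unfolding linear_subspace_def
  proof (intro conjI ballI allI)
    show "V \<subseteq> carrier TT" by (auto simp: V_def intro!: TF.lin_comb_closed)
    show "\<zero>\<^bsub>TT\<^esub> \<in> V" unfolding V_def by (auto intro!: exI[of _ "[]"])
    fix x assume "x \<in> V"
    then obtain cs where cs: "snd ` set cs \<subseteq> NW" "x = TU.lin_comb tt cs" by (auto simp: V_def)
    show "c \<odot>\<^bsub>TT\<^esub> x \<in> V" for c
    proof -
      have "c \<odot>\<^bsub>TT\<^esub> x = TU.lin_comb tt (map (\<lambda>(a, \<alpha>). (c * a, \<alpha>)) cs)"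
        using cs NW_subset_words by (simp add: scale_lin_comb)
      moreover have "snd ` set (map (\<lambda>(a, \<alpha>). (c * a, \<alpha>)) cs) \<subseteq> NW" using cs(1) by auto
      ultimately show ?thesis unfolding V_def by blast
    qed
    fix y assume "y \<in> V"
    then obtain ds where ds: "snd ` set ds \<subseteq> NW" "y = TU.lin_comb tt ds" by (auto simp: V_def)
    have "x \<oplus>\<^bsub>TT\<^esub> y = TU.lin_comb tt (cs @ ds)"
      using cs ds NW_subset_words by (simp add: lin_comb_append)
    moreover have "snd ` set (cs @ ds) \<subseteq> NW" using cs(1) ds(1) by auto
    ultimately show "x \<oplus>\<^bsub>TT\<^esub> y \<in> V" unfolding V_def by blast
  qed
  moreover have "TF.wd ` NW \<subseteq> V"
  proof
    fix y assume "y \<in> TF.wd ` NW"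
    then obtain \<alpha> where "\<alpha> \<in> NW" "y = TU.lin_comb tt [(1, \<alpha>)]" by auto
    then show "y \<in> V" unfolding V_def by (auto intro!: exI[of _ "[(1, \<alpha>)]"])
  qed
  ultimately have "x \<in> V" using assms unfolding linear_span_def by blast
  then show thesis using that by (auto simp: V_def)
qed

lemma D_approx: assumes "d \<in> DD" shows "diag_approx d"
proof -
  obtain s where d: "d \<in> carrier TT" and s: "\<forall>n. s n \<in> linear_span TT (TF.wd ` NW)"
    and lim: "(\<lambda>n. cnorm TT (s n \<ominus>\<^bsub>TT\<^esub> d)) \<longlonglongrightarrow> 0"
    using assms unfolding D_univ_def norm_closure_def mem_Collect_eq by (elim conjE exE)
  have "\<exists>cs. snd ` set cs \<subseteq> NW \<and> cnorm TT (d \<ominus>\<^bsub>TT\<^esub> TU.lin_comb tt cs) < \<epsilon>" if e: "\<epsilon> > 0" for \<epsilon>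
  proof -
    have "eventually (\<lambda>n. cnorm TT (s n \<ominus>\<^bsub>TT\<^esub> d) < \<epsilon>) sequentially"
      using order_tendstoD(2)[OF lim e] .
    then obtain n where n: "cnorm TT (s n \<ominus>\<^bsub>TT\<^esub> d) < \<epsilon>" by (auto simp: eventually_sequentially)
    obtain cs where cs: "snd ` set cs \<subseteq> NW" "s n = TU.lin_comb tt cs" using span_lin_comb[OF s[rule_format, of n]] .
    have "TU.lin_comb tt cs \<in> carrier TT" using cs by (intro TF.lin_comb_closed NW_subset_words)
    then have "cnorm TT (d \<ominus>\<^bsub>TT\<^esub> TU.lin_comb tt cs) < \<epsilon>" using n cs TU.nu_diff_commute[OF d] by simp
    then show ?thesis using cs(1) by blast
  qed
  then show ?thesis using d by (simp add: diag_approx_def)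
qed

lemma D_carrier: "d \<in> DD \<Longrightarrow> d \<in> carrier TT"
  using D_approx by (simp add: diag_approx_def)

lemma diag_approx_diff:
  assumes "diag_approx d" "diag_approx d'" shows "diag_approx (d \<ominus>\<^bsub>TT\<^esub> d')"
  unfolding diag_approx_def
proof (intro conjI allI impI)
  have d: "d \<in> carrier TT" "d' \<in> carrier TT" using assms by (auto simp: diag_approx_def)
  then show "d \<ominus>\<^bsub>TT\<^esub> d' \<in> carrier TT" by simp
  fix \<epsilon> :: real assume "\<epsilon> > 0"
  then have e: "\<epsilon> / 2 > 0" by simp
  obtain cs where cs: "snd ` set cs \<subseteq> NW" "cnorm TT (d \<ominus>\<^bsub>TT\<^esub> TU.lin_comb tt cs) < \<epsilon> / 2"
    using assms(1) e unfolding diag_approx_def by blast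
  obtain ds where ds: "snd ` set ds \<subseteq> NW" "cnorm TT (d' \<ominus>\<^bsub>TT\<^esub> TU.lin_comb tt ds) < \<epsilon> / 2"
    using assms(2) e unfolding diag_approx_def by blast
  define x where "x = TU.lin_comb tt cs"
  define y where "y = TU.lin_comb tt ds"
  have xy: "x \<in> carrier TT" "y \<in> carrier TT"
    unfolding x_def y_def using cs ds by (auto intro!: TF.lin_comb_closed NW_subset_words)
  define es where "es = cs @ map (\<lambda>(a, \<alpha>). (- 1 * a, \<alpha>)) ds"
  have m: "snd ` set (map (\<lambda>(a, \<alpha>). (- 1 * a, \<alpha>)) ds) \<subseteq> NW" using ds(1) by auto
  have "TU.lin_comb tt es = x \<oplus>\<^bsub>TT\<^esub> (- 1) \<odot>\<^bsub>TT\<^esub> y"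
    unfolding es_def x_def y_def
    using lin_comb_append[OF NW_subset_words[OF cs(1)] NW_subset_words[OF m]]
      scale_lin_comb[OF NW_subset_words[OF ds(1)], of "- 1"] by simp
  then have es: "TU.lin_comb tt es = x \<ominus>\<^bsub>TT\<^esub> y"
    using xy by (simp add: TU.minus_eq TU.uminus_conv_scale)
  have "(d \<ominus>\<^bsub>TT\<^esub> d') \<ominus>\<^bsub>TT\<^esub> (x \<ominus>\<^bsub>TT\<^esub> y) = (d \<ominus>\<^bsub>TT\<^esub> x) \<ominus>\<^bsub>TT\<^esub> (d' \<ominus>\<^bsub>TT\<^esub> y)"
    using d xy by (simp add: TU.minus_eq TU.minus_add TU.a_ac)
  then have "cnorm TT ((d \<ominus>\<^bsub>TT\<^esub> d') \<ominus>\<^bsub>TT\<^esub> TU.lin_comb tt es) \<le> cnorm TT (d \<ominus>\<^bsub>TT\<^esub> x) + cnorm TT (d' \<ominus>\<^bsub>TT\<^esub> y)"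
    using TU.nu_diff_le[of "d \<ominus>\<^bsub>TT\<^esub> x" "d' \<ominus>\<^bsub>TT\<^esub> y"] d xy by (simp add: es)
  then have "cnorm TT ((d \<ominus>\<^bsub>TT\<^esub> d') \<ominus>\<^bsub>TT\<^esub> TU.lin_comb tt es) < \<epsilon>"
    using cs ds by (simp add: x_def y_def)
  moreover have "snd ` set es \<subseteq> NW"
    unfolding es_def set_append image_Un using cs(1) m by blast
  ultimately show "\<exists>cs. snd ` set cs \<subseteq> NW \<and> cnorm TT ((d \<ominus>\<^bsub>TT\<^esub> d') \<ominus>\<^bsub>TT\<^esub> TU.lin_comb tt cs) < \<epsilon>" by blast
qed

lemma norm_closure_superset: "S \<subseteq> carrier TT \<Longrightarrow> S \<subseteq> norm_closure TT S"
proof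
  fix x assume "S \<subseteq> carrier TT" "x \<in> S"
  then show "x \<in> norm_closure TT S"
    using TU.conv_const[of x] unfolding norm_closure_def TU.conv_def by (auto intro!: exI[of _ "\<lambda>_. x"])
qed

lemma span_subset_D: "linear_span TT (TF.wd ` NW) \<subseteq> DD"
  unfolding D_univ_def
proof (rule norm_closure_superset, rule)
  fix x assume "x \<in> linear_span TT (TF.wd ` NW)"
  then obtain cs where "snd ` set cs \<subseteq> NW" "x = TU.lin_comb tt cs" by (rule span_lin_comb)
  then show "x \<in> carrier TT" by (auto intro!: TF.lin_comb_closed)
qed

lemma zero_in_D: "\<zero>\<^bsub>TT\<^esub> \<in> DD"
proof -
  have "\<zero>\<^bsub>TT\<^esub> \<in> linear_span TT (TF.wd ` NW)"
    by (auto simp: linear_span_def linear_subspace_def)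
  then show ?thesis using span_subset_D by blast
qed

text \<open>Expanding the complements one at a time leaves elements of neutral words only. The extra
  factor \<open>TF.wd \<alpha>\<close> in front is the generalisation that lets the induction
  collect the words already chosen.\<close>

lemma lits_in_D: assumes "TF.valid ls" shows "TF.lits ls \<in> DD"
proof -
  have "TF.wd \<alpha> \<otimes>\<^bsub>TT\<^esub> TF.lits ls \<in> V"
    if V: "linear_subspace TT V" "TF.wd ` NW \<subseteq> V" and "\<alpha> \<in> NW" "TF.valid ls" for V \<alpha> ls
    using that(3,4)
  proof (induction ls arbitrary: \<alpha>)
    case Nil
    then show ?case using V(2) by auto
  next
    case (Cons l ls)
    obtain \<beta> b where l: "l = (\<beta>, b)" by force
    have \<beta>: "\<beta> \<in> NW" and ls: "TF.valid ls" using Cons l by auto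
    define q where "q = TF.lits ls"
    have q: "q \<in> carrier TT" using ls by (simp add: q_def)
    have 1: "TF.wd \<alpha> \<otimes>\<^bsub>TT\<^esub> q \<in> V" "TF.wd (\<alpha> @ \<beta>) \<otimes>\<^bsub>TT\<^esub> q \<in> V"
      using Cons.IH[of \<alpha>] Cons.IH[of "\<alpha> @ \<beta>"] Cons.prems \<beta> ls by (auto simp: q_def)
    have ab: "TF.wd (\<alpha> @ \<beta>) \<otimes>\<^bsub>TT\<^esub> q = TF.wd \<alpha> \<otimes>\<^bsub>TT\<^esub> (TF.wd \<beta> \<otimes>\<^bsub>TT\<^esub> q)"
      using Cons.prems \<beta> q by (simp add: TF.wd_append TU.m_assoc)
    show ?case
    proof (cases b)
      case True
      then show ?thesis using 1(2) ab by (simp add: TF.lits_Cons l TF.lit_def q_def)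
    next
      case False
      have "TF.wd \<alpha> \<otimes>\<^bsub>TT\<^esub> TF.lits (l # ls) = TF.wd \<alpha> \<otimes>\<^bsub>TT\<^esub> q \<oplus>\<^bsub>TT\<^esub> (- 1) \<odot>\<^bsub>TT\<^esub> (TF.wd (\<alpha> @ \<beta>) \<otimes>\<^bsub>TT\<^esub> q)"
        using False Cons.prems \<beta> q unfolding ab
        by (simp add: TF.lits_Cons l TF.lit_def q_def[symmetric] TU.minus_eq TU.l_distr TU.r_distr
            TU.l_minus TU.r_minus TU.scale_uminus_left)
      then show ?thesis using 1 V(1) by (simp add: linear_subspace_def)
    qed
  qed
  from this[of _ "[]" ls] have "TF.lits ls \<in> linear_span TT (TF.wd ` NW)"
    using assms by (auto simp: linear_span_def)
  then show ?thesis using span_subset_D by blast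
qed

end

context toeplitz_rep begin

text \<open>\<open>norm_lin_comb_compare\<close> settles the finite combinations; the approximation
  error enters twice, once in T_u and once through the contraction h, hence e/2.\<close>

lemma diag_norm_le:
  assumes nd: "BF.nondegenerate" and d: "diag_approx d" shows "cnorm TT d \<le> cnorm B (h d)"
proof (rule field_le_epsilon)
  fix e :: real assume "e > 0"
  then have "e / 2 > 0" by simp
  then obtain cs where cs: "snd ` set cs \<subseteq> NW" "cnorm TT (d \<ominus>\<^bsub>TT\<^esub> TU.lin_comb tt cs) < e / 2"
    using d unfolding diag_approx_def by blast
  define x where "x = TU.lin_comb tt cs"
  have x: "x \<in> carrier TT" unfolding x_def using cs by (intro TF.lin_comb_closed NW_subset_words)
  have dc: "d \<in> carrier TT" using d by (simp add: diag_approx_def)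
  have "cnorm TT x \<le> cnorm B (h x)"
    unfolding x_def hom_lin_comb[OF NW_subset_words[OF cs(1)]]
    by (rule norm_lin_comb_compare[OF TF.cstar_toeplitz_fam_axioms BF.cstar_toeplitz_fam_axioms nd cs(1)])
  moreover have "cnorm TT d \<le> cnorm TT (d \<ominus>\<^bsub>TT\<^esub> x) + cnorm TT x" using dc x by (rule TU.nu_le_diff_add)
  moreover have "cnorm B (h x) \<le> cnorm B (h x \<ominus>\<^bsub>B\<^esub> h d) + cnorm B (h d)"
    using dc x by (intro B.nu_le_diff_add) auto
  moreover have "cnorm B (h x \<ominus>\<^bsub>B\<^esub> h d) \<le> cnorm TT (d \<ominus>\<^bsub>TT\<^esub> x)"
    using H.contractive[of "x \<ominus>\<^bsub>TT\<^esub> d"] dc x TU.nu_diff_commute[OF dc x] by (simp add: H.hom_diff)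
  ultimately show "cnorm TT d \<le> cnorm B (h d) + e" using cs(2) by (simp add: x_def)
qed

lemma inj_on_D: assumes "BF.nondegenerate" shows "inj_on h DD"
proof (rule inj_onI)
  fix d d' assume d: "d \<in> DD" "d' \<in> DD" "h d = h d'"
  have c: "d \<in> carrier TT" "d' \<in> carrier TT" using d D_carrier by auto
  have "h (d \<ominus>\<^bsub>TT\<^esub> d') = \<zero>\<^bsub>B\<^esub>" using d c by (simp add: H.hom_diff B.diff_eq_zero_iff)
  then have "cnorm TT (d \<ominus>\<^bsub>TT\<^esub> d') \<le> 0"
    using diag_norm_le[OF assms diag_approx_diff[OF D_approx D_approx], of d d'] d by simp
  then have "cnorm TT (d \<ominus>\<^bsub>TT\<^esub> d') = 0" using TU.nu_nonneg[of "d \<ominus>\<^bsub>TT\<^esub> d'"] c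
    by (meson TU.minus_closed antisym)
  then show "d = d'" using TU.norm_eq_zero[of "d \<ominus>\<^bsub>TT\<^esub> d'"] c by (simp add: TU.diff_eq_zero_iff)
qed

definition "ker_h = {a \<in> carrier TT. h a = \<zero>\<^bsub>B\<^esub>}"

lemma ker_closed_ideal: "closed_ideal ker_h TT"
  unfolding closed_ideal_def
proof (rule conjI)
  show "ideal ker_h TT"
    using H.kernel_is_ideal unfolding ker_h_def a_kernel_def' .
  show "norm_closure TT ker_h \<subseteq> ker_h"
  proof
    fix x assume "x \<in> norm_closure TT ker_h"
    then obtain s where x: "x \<in> carrier TT" and s: "\<forall>n. s n \<in> ker_h"
      and lim: "(\<lambda>n. cnorm TT (s n \<ominus>\<^bsub>TT\<^esub> x)) \<longlonglongrightarrow> 0"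
      unfolding norm_closure_def mem_Collect_eq by (elim conjE exE)
    have "TU.conv s x" using x s lim by (auto simp: TU.conv_def ker_h_def)
    from H.conv_hom[OF this] have "B.conv (\<lambda>n. \<zero>\<^bsub>B\<^esub>) (h x)" using s by (simp add: ker_h_def)
    then have "h x = \<zero>\<^bsub>B\<^esub>" using B.conv_unique B.conv_const[OF B.zero_closed] by blast
    then show "x \<in> ker_h" using x by (simp add: ker_h_def)
  qed
qed

lemma ker_Int_D: assumes "BF.nondegenerate" shows "ker_h \<inter> DD = {\<zero>\<^bsub>TT\<^esub>}"
proof -
  have "d = \<zero>\<^bsub>TT\<^esub>" if "d \<in> DD" "h d = \<zero>\<^bsub>B\<^esub>" for d
    using inj_onD[OF inj_on_D[OF assms], of d "\<zero>\<^bsub>TT\<^esub>"] that zero_in_D by simp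
  then show ?thesis unfolding ker_h_def using zero_in_D H.hom_zero TU.zero_closed by blast
qed

end

lemma (in submonoid_in_group) star_hom_unique:
  assumes "cstar_algebra B" "h \<in> star_hom TT B" "h' \<in> star_hom TT B"
    and eq: "\<And>p. p \<in> P \<Longrightarrow> h (tt p) = h' (tt p)" and a: "a \<in> carrier TT"
  shows "h a = h' a"
proof -
  interpret B: cstar_algebra B by fact
  interpret R: toeplitz_rep G P B "\<lambda>p. h (tt p)" h
    by (simp add: toeplitz_rep_def toeplitz_rep_axioms_def submonoid_in_group_axioms assms)
  interpret R': toeplitz_rep G P B "\<lambda>p. h (tt p)" h'
    by (simp add: toeplitz_rep_def toeplitz_rep_axioms_def submonoid_in_group_axioms assms)
  have "cnorm B (h a \<ominus>\<^bsub>B\<^esub> h' a) \<le> 0 + e" if e: "e > 0" for e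
  proof -
    have "e / 2 > 0" using e by simp
    then obtain cs where cs: "snd ` set cs \<subseteq> words P" "cnorm TT (a \<ominus>\<^bsub>TT\<^esub> TU.lin_comb tt cs) < e / 2"
      using TT_dense[OF a] by blast
    define x where "x = TU.lin_comb tt cs"
    have x: "x \<in> carrier TT" unfolding x_def using cs by (intro TF.lin_comb_closed)
    have "h x = h' x" unfolding x_def using R.hom_lin_comb[OF cs(1)] R'.hom_lin_comb[OF cs(1)] by simp
    then have "cnorm B (h a \<ominus>\<^bsub>B\<^esub> h' a) \<le> cnorm B (h a \<ominus>\<^bsub>B\<^esub> h x) + cnorm B (h' x \<ominus>\<^bsub>B\<^esub> h' a)"
      using B.nu_diff_triangle[of "h a" "h x" "h' a"] a x by simp
    also have "cnorm B (h a \<ominus>\<^bsub>B\<^esub> h x) \<le> cnorm TT (a \<ominus>\<^bsub>TT\<^esub> x)"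
      using R.H.contractive[of "a \<ominus>\<^bsub>TT\<^esub> x"] a x by (simp add: R.H.hom_diff)
    also have "cnorm B (h' x \<ominus>\<^bsub>B\<^esub> h' a) \<le> cnorm TT (x \<ominus>\<^bsub>TT\<^esub> a)"
      using R'.H.contractive[of "x \<ominus>\<^bsub>TT\<^esub> a"] a x by (simp add: R'.H.hom_diff)
    also have "cnorm TT (x \<ominus>\<^bsub>TT\<^esub> a) = cnorm TT (a \<ominus>\<^bsub>TT\<^esub> x)" using a x by (intro TU.nu_diff_commute)
    finally show ?thesis using cs(2) by (simp add: x_def)
  qed
  then have "cnorm B (h a \<ominus>\<^bsub>B\<^esub> h' a) \<le> 0" by (rule field_le_epsilon)
  moreover have c: "h a \<in> carrier B" "h' a \<in> carrier B" using a by auto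
  ultimately have "cnorm B (h a \<ominus>\<^bsub>B\<^esub> h' a) = 0" by (meson B.nu_nonneg B.minus_closed antisym)
  then show ?thesis using B.norm_eq_zero[of "h a \<ominus>\<^bsub>B\<^esub> h' a"] c by (simp add: B.diff_eq_zero_iff)
qed

section \<open>Compression away from the diagonal\<close>

context toeplitz_fam begin

lemma lits_absorb_subset:
  assumes "valid ls'" "set ls \<subseteq> set ls'"
  shows "lits ls \<otimes> lits ls' = lits ls'" "lits ls' \<otimes> lits ls = lits ls'"
proof -
  have v: "valid ls" using assms by (auto simp: valid_def)
  show 1: "lits ls \<otimes> lits ls' = lits ls'"
    using v assms(2)
  proof (induction ls)
    case (Cons l ls)
    then have "lits (l # ls) \<otimes> lits ls' = lit l \<otimes> (lits ls \<otimes> lits ls')"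
      using assms(1) by (simp add: lits_Cons m_assoc)
    then show ?case using Cons lits_absorb[OF assms(1), of l] by simp
  qed (use assms in simp)
  have "adj A (lits ls \<otimes> lits ls') = lits ls' \<otimes> lits ls"
    using v assms(1) by (simp add: adj_mult lits_self_adj)
  then show "lits ls' \<otimes> lits ls = lits ls'" using assms(1) by (simp add: 1 lits_self_adj)
qed

text \<open>A word that is compressed to zero stays so on every smaller cell. This allows the words
  to be treated one after another.\<close>

lemma compressed_zero_mono:
  assumes "valid ls'" "set ls \<subseteq> set ls'" "z \<in> carrier A" "lits ls \<otimes> z \<otimes> lits ls = \<zero>"
  shows "lits ls' \<otimes> z \<otimes> lits ls' = \<zero>"
proof -
  have "valid ls" using assms(1,2) unfolding valid_def by blast
  then have c: "lits ls \<in> carrier A" "lits ls' \<in> carrier A" using assms(1) by simp_all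
  have "lits ls' \<otimes> z \<otimes> lits ls' = (lits ls' \<otimes> lits ls) \<otimes> z \<otimes> (lits ls \<otimes> lits ls')"
    by (simp only: lits_absorb_subset[OF assms(1,2)])
  also have "\<dots> = lits ls' \<otimes> (lits ls \<otimes> z \<otimes> lits ls) \<otimes> lits ls'"
    using c assms(3) by (simp add: m_assoc)
  finally show ?thesis using assms(4) c by simp
qed

end

context cstar_toeplitz_fam begin

text \<open>For z = \<open>wd \<omega>\<close> the element z*z is the projection f, so the square of
  the norm of z(1 - f) is the norm of (1 - f) f (1 - f) = 0. The second identity is the adjoint of
  the first for the reversed word.\<close>

lemma partial_isometry:
  assumes "\<omega> \<in> words P"
  shows "wd \<omega> \<otimes> (\<one> \<ominus> wd (rev \<omega> @ \<omega>)) = \<zero>" "(\<one> \<ominus> wd (\<omega> @ rev \<omega>)) \<otimes> wd \<omega> = \<zero>"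
proof -
  have 1: "wd \<omega> \<otimes> (\<one> \<ominus> wd (rev \<omega> @ \<omega>)) = \<zero>" if w: "\<omega> \<in> words P" for \<omega>
  proof -
    define z where "z = wd \<omega>"
    define f where "f = wd (rev \<omega> @ \<omega>)"
    have z: "z \<in> carrier A" using w by (simp add: z_def)
    have n: "rev \<omega> @ \<omega> \<in> G.NW" using w by simp
    have f: "f \<in> carrier A" "f \<otimes> f = f" "adj A f = f"
      unfolding f_def using wd_idem[OF n] wd_self_adj[OF n] w by simp_all
    have zz: "adj A z \<otimes> z = f" using w by (simp add: z_def f_def adj_wd_wd)
    have "adj A (z \<otimes> (\<one> \<ominus> f)) \<otimes> (z \<otimes> (\<one> \<ominus> f)) = (\<one> \<ominus> f) \<otimes> (adj A z \<otimes> z) \<otimes> (\<one> \<ominus> f)"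
      using z f by (simp add: adj_mult adj_diff m_assoc)
    also have "\<dots> = \<zero>"
      using f by (simp add: zz minus_eq l_distr r_distr l_minus r_minus r_neg)
    finally have "(cnorm A (z \<otimes> (\<one> \<ominus> f)))\<^sup>2 = 0"
      using nu_cstar[of "z \<otimes> (\<one> \<ominus> f)"] z f by simp
    then show ?thesis using z f by (simp add: norm_eq_zero z_def f_def)
  qed
  show "wd \<omega> \<otimes> (\<one> \<ominus> wd (rev \<omega> @ \<omega>)) = \<zero>" using 1 assms .
  have n: "\<omega> @ rev \<omega> \<in> G.NW" using assms by simp
  have "wd (rev \<omega>) \<otimes> (\<one> \<ominus> wd (\<omega> @ rev \<omega>)) = \<zero>" using 1[of "rev \<omega>"] assms by simp
  then have "adj A (wd (rev \<omega>) \<otimes> (\<one> \<ominus> wd (\<omega> @ rev \<omega>))) = \<zero>" by simp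
  then show "(\<one> \<ominus> wd (\<omega> @ rev \<omega>)) \<otimes> wd \<omega> = \<zero>"
    using wd_self_adj[OF n] assms n by (simp add: adj_mult adj_diff adj_wd[of "rev \<omega>"])
qed

text \<open>
  With \<open>e\<close> the range projection of \<open>t\<^sub>y\<close>, the element \<open>z = e t\<^sub>\<alpha> e\<close> is a partial isometry. If \<open>y\<close> is
  outside the support of \<open>z\<^sup>*z\<close> or of \<open>z z\<^sup>*\<close>, then compressing by its complement kills \<open>z\<close>.
\<close>

lemma compress_at_point:
  assumes \<alpha>: "\<alpha> \<in> words P" and y: "y \<in> P" and ls: "valid ls" "sat y ls"
    and moved: "dot G \<alpha> \<otimes>\<^bsub>G\<^esub> y \<notin> P \<or> (dot G \<alpha> \<otimes>\<^bsub>G\<^esub> y) <#\<^bsub>G\<^esub> P \<noteq> y <#\<^bsub>G\<^esub> P"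
  obtains ls' where "valid ls'" "sat y ls'" "set ls \<subseteq> set ls'" "lits ls' \<otimes> wd \<alpha> \<otimes> lits ls' = \<zero>"
proof -
  define p where "p = G.principal y"
  have pN: "p \<in> G.NW" unfolding p_def using y by (rule G.principal_NW)
  then have p: "p \<in> G.NW" "p \<in> words P" by simp_all
  have revp: "rev p = p" by (simp add: p_def G.principal_def)
  have Kp: "G.K p = y <#\<^bsub>G\<^esub> P" using y by (simp add: p_def G.constr_principal)
  have yp: "y \<in> G.K p" using y by (simp add: Kp G.self_in_coset)
  define \<omega> where "\<omega> = p @ \<alpha> @ p"
  have \<omega>: "\<omega> \<in> words P" using p \<alpha> by (simp add: \<omega>_def)
  define e where "e = wd p"
  have e: "e \<in> carrier A" using p by (simp add: e_def)
  have w\<omega>: "wd \<omega> = e \<otimes> wd \<alpha> \<otimes> e" using p \<alpha> by (simp add: \<omega>_def e_def wd_append m_assoc)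
  \<comment> \<open>With g the dot of \<alpha>: if y lay in both supports, then gy and g^{-1}y would
    lie in yP, which means gyP = yP, against \<open>moved\<close>.\<close>
  have "y \<notin> G.K \<omega> \<or> y \<notin> G.K (rev \<omega>)"
  proof (rule ccontr)
    assume "\<not> (y \<notin> G.K \<omega> \<or> y \<notin> G.K (rev \<omega>))"
    then have "y \<in> G.K (p @ (\<alpha> @ p))" "y \<in> G.K (p @ (rev \<alpha> @ p))" by (auto simp: \<omega>_def revp)
    then have 1: "dot G \<alpha> \<otimes>\<^bsub>G\<^esub> y \<in> y <#\<^bsub>G\<^esub> P" and 2: "inv\<^bsub>G\<^esub> (dot G \<alpha>) \<otimes>\<^bsub>G\<^esub> y \<in> y <#\<^bsub>G\<^esub> P"
      using p \<alpha> y G.dot_closed[OF \<alpha>]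
      by (simp_all add: G.mem_constr_append G.dot_append G.dot_rev Kp)
    have gP: "dot G \<alpha> \<otimes>\<^bsub>G\<^esub> y \<in> P" using 1 Kp G.constr_in_P by blast
    have "inv\<^bsub>G\<^esub> y \<otimes>\<^bsub>G\<^esub> (inv\<^bsub>G\<^esub> (dot G \<alpha>) \<otimes>\<^bsub>G\<^esub> y) \<in> P"
      using 2 y \<alpha> by (simp add: G.mem_l_coset)
    then have "y \<in> (dot G \<alpha> \<otimes>\<^bsub>G\<^esub> y) <#\<^bsub>G\<^esub> P"
      using y \<alpha> gP by (simp add: G.mem_l_coset G.inv_mult_group G.m_assoc)
    then have "(dot G \<alpha> \<otimes>\<^bsub>G\<^esub> y) <#\<^bsub>G\<^esub> P = y <#\<^bsub>G\<^esub> P"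
      using G.eq_l_coset_iff[OF gP y] 1 by blast
    then show False using moved gP by blast
  qed
  then show thesis
  proof
    assume n: "y \<notin> G.K \<omega>"
    define ls' where "ls' = (p, True) # (rev \<omega> @ \<omega>, False) # ls"
    have v: "valid ls'" using p \<omega> ls by (simp add: ls'_def)
    moreover have "sat y ls'" using yp n ls \<omega> by (simp add: ls'_def G.constr_rev_append)
    moreover have "lits ls' \<otimes> wd \<alpha> \<otimes> lits ls' = \<zero>"
    proof -
      define q where "q = lits ls'"
      define f where "f = \<one> \<ominus> wd (rev \<omega> @ \<omega>)"
      have q: "q \<in> carrier A" and f: "f \<in> carrier A" using v \<omega> by (simp_all add: q_def f_def)
      have "(p, True) \<in> set ls'" by (simp add: ls'_def)
      from lits_wd[OF v this] have qe: "q \<otimes> e = q" using q by (simp add: q_def e_def)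
      have eq: "e \<otimes> q = q" "q \<otimes> e = q"
        using lits_wd_commute[OF v p(1)] qe by (simp_all add: q_def e_def)
      have "(rev \<omega> @ \<omega>, False) \<in> set ls'" by (simp add: ls'_def)
      from lits_absorb[OF v this] have fq: "f \<otimes> q = q"
        unfolding q_def f_def by (simp add: lit_def)
      have "q \<otimes> wd \<alpha> \<otimes> q = (q \<otimes> e) \<otimes> wd \<alpha> \<otimes> (e \<otimes> (f \<otimes> q))"
        by (simp only: eq fq)
      also have "\<dots> = q \<otimes> (wd \<omega> \<otimes> f) \<otimes> q" using q e f \<alpha> by (simp add: w\<omega> m_assoc)
      also have "wd \<omega> \<otimes> f = \<zero>" unfolding f_def by (rule partial_isometry[OF \<omega>])
      finally show ?thesis using q by (simp add: q_def)
    qed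
    ultimately show thesis using that[of ls'] by (auto simp: ls'_def)
  next
    assume n: "y \<notin> G.K (rev \<omega>)"
    define ls' where "ls' = (p, True) # (\<omega> @ rev \<omega>, False) # ls"
    have v: "valid ls'" using p \<omega> ls by (simp add: ls'_def)
    moreover have "sat y ls'"
      using yp n ls \<omega> G.constr_rev_append[of "rev \<omega>"] by (simp add: ls'_def)
    moreover have "lits ls' \<otimes> wd \<alpha> \<otimes> lits ls' = \<zero>"
    proof -
      define q where "q = lits ls'"
      define f where "f = \<one> \<ominus> wd (\<omega> @ rev \<omega>)"
      have q: "q \<in> carrier A" and f: "f \<in> carrier A" using v \<omega> by (simp_all add: q_def f_def)
      have "(p, True) \<in> set ls'" by (simp add: ls'_def)
      from lits_wd[OF v this] have qe: "q \<otimes> e = q" using q by (simp add: q_def e_def)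
      have eq: "e \<otimes> q = q" "q \<otimes> e = q"
        using lits_wd_commute[OF v p(1)] qe by (simp_all add: q_def e_def)
      have qf: "q \<otimes> f = q"
      proof -
        have m: "(\<omega> @ rev \<omega>, False) \<in> set ls'" by (simp add: ls'_def)
        show ?thesis
          using lits_absorb[OF v m] lits_lit_commute[OF v, of "(\<omega> @ rev \<omega>, False)"] \<omega>
          unfolding q_def f_def by (simp add: lit_def)
      qed
      have "q \<otimes> wd \<alpha> \<otimes> q = ((q \<otimes> f) \<otimes> e) \<otimes> wd \<alpha> \<otimes> (e \<otimes> q)"
        by (simp only: eq qf)
      also have "\<dots> = q \<otimes> (f \<otimes> wd \<omega>) \<otimes> q" using q e f \<alpha> by (simp add: w\<omega> m_assoc)
      also have "f \<otimes> wd \<omega> = \<zero>" unfolding f_def by (rule partial_isometry[OF \<omega>])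
      finally show ?thesis using q by (simp add: q_def)
    qed
    ultimately show thesis using that[of ls'] by (auto simp: ls'_def)
  qed
qed

text \<open>Induction over the words. For a new word the point is first moved within the present
  cell by \<open>move_point\<close>, then the cell is refined there; the old words stay compressed
  by \<open>compressed_zero_mono\<close>. The final point y may differ from x.\<close>

lemma compress_words:
  assumes units: "units_move_ideals G P" and "x \<in> P" "valid ls" "sat x ls"
    and "set as \<subseteq> words P" "\<And>\<alpha>. \<alpha> \<in> set as \<Longrightarrow> dot G \<alpha> \<noteq> \<one>\<^bsub>G\<^esub>"
  shows "\<exists>y ls'. y \<in> P \<and> valid ls' \<and> sat y ls' \<and> set ls \<subseteq> set ls'
    \<and> (\<forall>\<alpha>\<in>set as. lits ls' \<otimes> wd \<alpha> \<otimes> lits ls' = \<zero>)"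
  using assms(5,6)
proof (induction as)
  case Nil
  then show ?case using assms(2-4) by auto
next
  case (Cons \<alpha> as)
  then obtain y ls1 where 1: "y \<in> P" "valid ls1" "sat y ls1" "set ls \<subseteq> set ls1"
    "\<forall>\<alpha>\<in>set as. lits ls1 \<otimes> wd \<alpha> \<otimes> lits ls1 = \<zero>" by auto
  have \<alpha>: "\<alpha> \<in> words P" "dot G \<alpha> \<noteq> \<one>\<^bsub>G\<^esub>" using Cons.prems by auto
  have I: "finite (G.K ` fst ` set ls1)" "G.K ` fst ` set ls1 \<subseteq> G.\<J>"
    using 1(2) by (auto simp: valid_def image_subset_iff)
  obtain z where z: "z \<in> P" "\<And>S. S \<in> G.K ` fst ` set ls1 \<Longrightarrow> z \<in> S \<longleftrightarrow> y \<in> S"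
    "dot G \<alpha> \<otimes>\<^bsub>G\<^esub> z \<notin> P \<or> (dot G \<alpha> \<otimes>\<^bsub>G\<^esub> z) <#\<^bsub>G\<^esub> P \<noteq> z <#\<^bsub>G\<^esub> P"
    using G.move_point[OF units 1(1) G.dot_closed[OF \<alpha>(1)] \<alpha>(2) I] by metis
  have "sat z ls1" using 1(3) z(2) by (simp add: sat_def)
  then obtain ls' where ls': "valid ls'" "sat z ls'" "set ls1 \<subseteq> set ls'" "lits ls' \<otimes> wd \<alpha> \<otimes> lits ls' = \<zero>"
    using compress_at_point[OF \<alpha>(1) z(1) 1(2) _ z(3)] by blast
  have "lits ls' \<otimes> wd \<beta> \<otimes> lits ls' = \<zero>" if "\<beta> \<in> set as" for \<beta>
    by (rule compressed_zero_mono[OF ls'(1,3)]) (use that 1(5) Cons.prems in auto)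
  then have "\<forall>\<beta>\<in>set (\<alpha> # as). lits ls' \<otimes> wd \<beta> \<otimes> lits ls' = \<zero>" using ls'(4) by auto
  then show ?case using z(1) ls'(1-3) 1(4) by (intro exI[of _ z] exI[of _ ls']) blast
qed

text \<open>\<open>value_at\<close> with all nonneutral words dropped. For the regular
  representation it is the diagonal matrix entry at x.\<close>

definition diag_coeff :: "'g \<Rightarrow> (complex \<times> 'g list) list \<Rightarrow> complex" where
  "diag_coeff x cs = (\<Sum>(c, \<alpha>)\<leftarrow>cs. if x \<in> G.K \<alpha> \<and> dot G \<alpha> = \<one>\<^bsub>G\<^esub> then c else 0)"

lemma diag_coeff_simps [simp]: "diag_coeff x [] = 0"
  "diag_coeff x ((c, \<alpha>) # cs) = (if x \<in> G.K \<alpha> \<and> dot G \<alpha> = \<one>\<^bsub>G\<^esub> then c else 0) + diag_coeff x cs"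
  by (simp_all add: diag_coeff_def)

text \<open>The neutral words keep their values at the original x even if the cell has been refined
  around another point, because \<open>ls\<close> still contains the literals that record x.\<close>

lemma compress_lin_comb:
  assumes "valid ls" "snd ` set cs \<subseteq> words P"
    "\<And>c \<alpha>. (c, \<alpha>) \<in> set cs \<Longrightarrow> dot G \<alpha> = \<one>\<^bsub>G\<^esub> \<Longrightarrow> (\<alpha>, x \<in> G.K \<alpha>) \<in> set ls"
    "\<And>c \<alpha>. (c, \<alpha>) \<in> set cs \<Longrightarrow> dot G \<alpha> \<noteq> \<one>\<^bsub>G\<^esub> \<Longrightarrow> lits ls \<otimes> wd \<alpha> \<otimes> lits ls = \<zero>"
  shows "lits ls \<otimes> lin_comb w cs \<otimes> lits ls = diag_coeff x cs \<odot> lits ls"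
  using assms(2-)
proof (induction cs)
  case Nil
  then show ?case using assms(1) by simp
next
  case (Cons ca cs)
  obtain c \<alpha> where ca: "ca = (c, \<alpha>)" by force
  have IH: "lits ls \<otimes> lin_comb w cs \<otimes> lits ls = diag_coeff x cs \<odot> lits ls"
    by (rule Cons.IH) (use Cons.prems in auto)
  define q where "q = lits ls"
  have q: "q \<in> carrier A" "q \<otimes> q = q" using assms(1) lits_idem by (auto simp: q_def)
  have \<alpha>: "\<alpha> \<in> words P" using Cons.prems ca by auto
  have s: "lin_comb w cs \<in> carrier A" using Cons.prems by (intro lin_comb_closed) auto
  have "q \<otimes> wd \<alpha> \<otimes> q = (if x \<in> G.K \<alpha> \<and> dot G \<alpha> = \<one>\<^bsub>G\<^esub> then 1 else 0) \<odot> q"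
  proof (cases "dot G \<alpha> = \<one>\<^bsub>G\<^esub>")
    case True
    then have "(\<alpha>, x \<in> G.K \<alpha>) \<in> set ls" using Cons.prems(2)[of c \<alpha>] ca by simp
    then show ?thesis using lits_wd[OF assms(1)] q True by (simp add: q_def)
  next
    case False
    then show ?thesis using Cons.prems(3)[of c \<alpha>] ca q by (simp add: q_def)
  qed
  then have "q \<otimes> (c \<odot> wd \<alpha> \<oplus> lin_comb w cs) \<otimes> q
      = c \<odot> ((if x \<in> G.K \<alpha> \<and> dot G \<alpha> = \<one>\<^bsub>G\<^esub> then 1 else 0) \<odot> q) \<oplus> diag_coeff x cs \<odot> q"
    using IH q(1) \<alpha> s by (simp add: q_def[symmetric] r_distr l_distr scale_mult_left scale_mult_right)
  then show ?case using q(1) by (auto simp: ca q_def[symmetric] scale_add_left)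
qed

end

text \<open>With \<open>d = q - j\<close>, all \<open>q - d\<^sup>n\<close> lie in \<open>J\<close>, and \<open>d\<^sup>n\<close> tends to \<open>0\<close>.\<close>

lemma (in cstar_algebra) proj_in_closed_ideal:
  assumes J: "closed_ideal J A" and q: "q \<in> carrier A" "q \<otimes> q = q" and j: "j \<in> J" "q \<otimes> j = j" "j \<otimes> q = j"
    and close: "cnorm A (q \<ominus> j) < 1"
  shows "q \<in> J"
proof -
  interpret J: ideal J A using J by (simp add: closed_ideal_def)
  have jc: "j \<in> carrier A" using j(1) by (rule J.Icarr)
  define d where "d = q \<ominus> j"
  have d: "d \<in> carrier A" "q \<otimes> d = d"
    using q jc j by (simp_all add: d_def minus_eq r_distr r_minus)
  have "j \<oplus> (q \<ominus> j) = q" using q(1) jc by algebra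
  then have qd: "q = j \<oplus> d" by (simp add: d_def)
  \<comment> \<open>\<open>D n\<close> is the power of d with exponent n + 1, which accounts for
    \<open>Suc n\<close> in the norm bound.\<close>
  define D where "D n = ((\<lambda>y. d \<otimes> y) ^^ n) d" for n
  have D0: "D 0 = d" and DS: "D (Suc n) = d \<otimes> D n" for n by (simp_all add: D_def)
  have Dc: "D n \<in> carrier A" and qD: "q \<otimes> D n = D n" for n
  proof -
    have "D n \<in> carrier A \<and> q \<otimes> D n = D n"
    proof (induction n)
      case (Suc n)
      then have Dn: "D n \<in> carrier A" by simp
      have "q \<otimes> (d \<otimes> D n) = (q \<otimes> d) \<otimes> D n" using m_assoc[OF q(1) d(1) Dn] by simp
      then have "q \<otimes> (d \<otimes> D n) = d \<otimes> D n" by (simp only: d(2))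
      then show ?case using Dn d(1) by (simp add: DS)
    qed (use d in \<open>simp add: D0\<close>)
    then show "D n \<in> carrier A" "q \<otimes> D n = D n" by auto
  qed
  have mem: "q \<ominus> D n \<in> J" for n
  proof (induction n)
    case 0
    have "q \<ominus> (q \<ominus> j) = j" using q(1) jc by algebra
    then have "q \<ominus> d = j" by (simp add: d_def)
    then show ?case using j by (simp add: D0)
  next
    case (Suc n)
    have "(j \<oplus> d) \<otimes> D n = j \<otimes> D n \<oplus> D (Suc n)"
      using Dc[of n] jc d(1) unfolding DS by (simp add: l_distr)
    then have Dn: "D n = j \<otimes> D n \<oplus> D (Suc n)" using qD[of n] qd by simp
    have "q \<ominus> z = (q \<ominus> (y \<oplus> z)) \<oplus> y" if "y \<in> carrier A" "z \<in> carrier A" for y z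
      using q(1) that by algebra
    from this[of "j \<otimes> D n" "D (Suc n)"] have "q \<ominus> D (Suc n) = (q \<ominus> D n) \<oplus> j \<otimes> D n"
      using Dc jc Dn by simp
    then show ?case using Suc J.I_r_closed[OF j(1) Dc[of n]] by simp
  qed
  have nD: "cnorm A (D n) \<le> cnorm A d ^ Suc n" for n
  proof (induction n)
    case (Suc n)
    have "cnorm A (D (Suc n)) \<le> cnorm A d * cnorm A (D n)" unfolding DS using d Dc by (intro nu_mult)
    also have "\<dots> \<le> cnorm A d * cnorm A d ^ Suc n" using Suc d by (intro mult_left_mono) auto
    finally show ?case by simp
  qed (simp add: D0)
  have "conv (\<lambda>n. q \<ominus> D n) q"
  proof (rule convI_bound)
    show "cnorm A ((q \<ominus> D n) \<ominus> q) \<le> cnorm A d ^ Suc n" for n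
    proof -
      have "(q \<ominus> y) \<ominus> q = \<ominus> y" if "y \<in> carrier A" for y using q(1) that by algebra
      then have "(q \<ominus> D n) \<ominus> q = \<ominus> D n" using Dc[of n] by simp
      then show ?thesis using nD[of n] Dc[of n] by (simp add: nu_uminus)
    qed
    show "(\<lambda>n. cnorm A d ^ Suc n) \<longlonglongrightarrow> 0"
      using close d by (intro LIMSEQ_Suc LIMSEQ_realpow_zero) (simp_all add: d_def)
  qed (use q Dc in auto)
  then have "q \<in> norm_closure A J"
    using mem unfolding norm_closure_def conv_def mem_Collect_eq by (intro conjI exI[of _ "\<lambda>n. q \<ominus> D n"]) simp_all
  then show ?thesis using J by (auto simp: closed_ideal_def)
qed

section \<open>Conclusion\<close>

lemma op_entry_le:
  assumes "T \<in> bounded_ops X" "x \<in> X" shows "cmod (T (delta x) x) \<le> cnorm (B_ell2 X) T"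
proof -
  have "T (delta x) \<in> ell2 X" using assms by simp
  then have "cmod (T (delta x) x) \<le> ell2_norm X (T (delta x))"
    using L2_set_le_ell2_norm[of "T (delta x)" X "{x}"] assms(2) by simp
  also have "\<dots> \<le> cnorm (B_ell2 X) T * ell2_norm X (delta x)"
    using assms by (intro op_norm_apply) auto
  finally show ?thesis using assms(2) by (simp add: ell2_norm_delta)
qed

context quotient_rep begin

interpretation F: cstar_toeplitz_fam G P HB V by (rule V_cstar_toeplitz_fam)

lemma lits_V_delta_value:
  assumes "F.valid ls" "t \<in> P"
  shows "F.lits ls (delta (c t)) = (\<lambda>y. (if F.sat t ls then 1 else 0) * delta (c t) y)"
  using assms(1)
proof (induction ls)
  case Nil
  then show ?case using assms(2) by (simp add: B_simps(3))
next
  case (Cons l ls)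
  define s where "s = (if F.sat t ls then 1 else 0 :: complex)"
  define b where "b = (if (t \<in> K (fst l)) = snd l then 1 else 0 :: complex)"
  have bo: "F.lit l \<in> bounded_ops (c ` P)" using Cons.prems F.lit_closed[of l] by (simp add: B_simps(1))
  have one: "\<one>\<^bsub>HB\<^esub> \<in> bounded_ops (c ` P)" using F.one_closed by (simp add: B_simps(1))
  have "F.lit l (delta (c t)) = (\<lambda>y. b * delta (c t) y)"
    using Cons.prems assms(2) wdot_V_bounded[of "fst l"] one
    by (auto simp: F.lit_def B_minus wdot_V_neutral_delta b_def B_simps(3) fun_eq_iff)
  then have "F.lit l (\<lambda>y. s * delta (c t) y) = (\<lambda>y. s * (b * delta (c t) y))"
    using bo_scale[OF bo, of "delta (c t)" s] assms(2) by simp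
  then have "F.lits (l # ls) (delta (c t)) = (\<lambda>y. s * (b * delta (c t) y))"
    using Cons by (simp add: F.lits_Cons B_simps(2) s_def)
  then show ?case by (auto simp: s_def b_def fun_eq_iff)
qed

end

section \<open>The reduced algebra, condition (iv) and the representation of T_lambda\<close>

context submonoid_in_group begin

text \<open>The rewrite replaces the image of P under the identity map by P itself, so that the
  operators live on the same space as those of \<open>T_red\<close>.\<close>

interpretation Q: quotient_rep G P "\<lambda>t. t" rewrites "(\<lambda>t. t) ` P = P"
  by (rule quotient_rep_id) simp

abbreviation "BP \<equiv> B_ell2 P"
abbreviation "lam \<equiv> lambda_plus G P"

lemma T_red_eq: "T_red G P = cstar_generated BP (Q.V ` P)"
proof -
  have "L_op G P ` P = Q.V ` P" by (intro image_cong refl) (rule L_op_eq_V)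
  then show ?thesis by (simp add: T_red_def)
qed

lemma lambda_plus_props:
  shows "lam \<in> star_hom TT (T_red G P)" and "p \<in> P \<Longrightarrow> lam (tt p) = L_op G P p"
proof -
  interpret BC: cstar_algebra BP by (rule B_cstar_algebra)
  obtain h where h: "h \<in> star_hom TT BP" "\<And>p. p \<in> P \<Longrightarrow> h (tt p) = Q.V p"
    using TT_universal[OF B_cstar_algebra Q.V_toeplitz] by blast
  interpret R: toeplitz_rep G P BP Q.V h
    by (simp add: toeplitz_rep_def toeplitz_rep_axioms_def submonoid_in_group_axioms B_cstar_algebra h)
  have sub: "carrier (T_red G P) \<subseteq> carrier BP"
    unfolding T_red_eq by (rule BC.cstar_generated_subset[OF R.v_in_carrier])
  \<comment> \<open>The definite description of \<open>lambda_plus\<close> asks for an extensional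
    function, so the homomorphism is cut down to the carrier; \<open>star_hom_unique\<close> then
    gives uniqueness.\<close>
  define \<Lambda> where "\<Lambda> = restrict h (carrier TT)"
  have \<Lambda>: "\<Lambda> \<in> star_hom TT (T_red G P)"
    unfolding T_red_eq
  proof (rule star_hom_generated)
    show "\<Lambda> \<in> star_hom TT BP" by (rule star_hom_cong[OF h(1) TU.star_alg]) (simp add: \<Lambda>_def)
    show "\<Lambda> a \<in> carrier (cstar_generated BP (Q.V ` P))" if "a \<in> carrier TT" for a
      using R.into_generated[OF that] that by (simp add: \<Lambda>_def)
  qed
  have "lam = \<Lambda>"
    unfolding lambda_plus_def
  proof (rule the_equality)
    show "\<Lambda> \<in> star_hom TT (T_red G P) \<and> \<Lambda> \<in> extensional (carrier TT) \<and> (\<forall>p\<in>P. \<Lambda> (tt p) = L_op G P p)"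
      using \<Lambda> h(2) L_op_eq_V by (simp add: \<Lambda>_def)
    fix h' assume h': "h' \<in> star_hom TT (T_red G P) \<and> h' \<in> extensional (carrier TT) \<and> (\<forall>p\<in>P. h' (tt p) = L_op G P p)"
    have "h' \<in> star_hom TT BP"
      by (rule star_hom_from_generated[OF conjunct1[OF h'[unfolded T_red_def]] sub[unfolded T_red_def]])
    then have eq: "h' a = h a" if "a \<in> carrier TT" for a
      by (rule star_hom_unique[OF B_cstar_algebra _ h(1) _ that]) (use h' h(2) L_op_eq_V in simp)
    show "h' = \<Lambda>"
    proof (rule extensionalityI[of _ "carrier TT"])
      show "h' \<in> extensional (carrier TT)" using h' by blast
    qed (simp_all add: \<Lambda>_def eq)
  qed
  then show "lam \<in> star_hom TT (T_red G P)" "p \<in> P \<Longrightarrow> lam (tt p) = L_op G P p"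
    using \<Lambda> h(2) L_op_eq_V by (simp_all add: \<Lambda>_def)
qed

lemma lambda_rep: "toeplitz_rep G P BP Q.V lam"
proof -
  interpret BC: cstar_algebra BP by (rule B_cstar_algebra)
  have "Q.V ` P \<subseteq> carrier BP" using Q.V_bounded by (auto simp: B_simps(1))
  then have sub: "carrier (T_red G P) \<subseteq> carrier BP"
    unfolding T_red_eq by (rule BC.cstar_generated_subset)
  have "lam \<in> star_hom TT BP"
    by (rule star_hom_from_generated[OF lambda_plus_props(1)[unfolded T_red_def] sub[unfolded T_red_def]])
  then show ?thesis
    using lambda_plus_props(2) L_op_eq_V
    by (simp add: toeplitz_rep_def toeplitz_rep_axioms_def submonoid_in_group_axioms B_cstar_algebra)
qed

interpretation L: toeplitz_rep G P BP Q.V lam by (rule lambda_rep)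

lemma lambda_nondegenerate: "L.BF.nondegenerate"
  by (rule Q.V_nondegenerate)

lemma lambda_bounded: "a \<in> carrier TT \<Longrightarrow> lam a \<in> bounded_ops P"
  using L.H.hom_closed[of a] by (simp add: B_simps(1))

lemma lambda_lits_delta:
  "TF.valid ls \<Longrightarrow> x \<in> P \<Longrightarrow> TF.sat x ls \<Longrightarrow> lam (TF.lits ls) (delta x) = delta x"
  using L.hom_lits[of ls] Q.lits_V_delta[of ls x] by simp

text \<open>A word with dot g carries the basis vector at x to the one at gx or to 0, and gx = x
  only for g the identity. So only neutral words reach the diagonal.\<close>

lemma lambda_lin_comb_entry:
  assumes "snd ` set cs \<subseteq> words P" "x \<in> P"
  shows "lam (TU.lin_comb tt cs) (delta x) x = TF.diag_coeff x cs"
  using assms(1)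
proof (induction cs)
  case Nil
  then show ?case by (simp add: B_simps(4))
next
  case (Cons c\<alpha> cs)
  obtain c \<alpha> where c\<alpha>: "c\<alpha> = (c, \<alpha>)" by force
  have \<alpha>: "\<alpha> \<in> words P" using Cons.prems c\<alpha> by auto
  have s: "TU.lin_comb tt cs \<in> carrier TT" using Cons.prems by (intro TF.lin_comb_closed) auto
  have "lam (TF.wd \<alpha>) (delta x) x = (if x \<in> K \<alpha> \<and> dot G \<alpha> = \<one> then 1 else 0)"
  proof -
    have g: "dot G \<alpha> \<otimes> x = x \<longleftrightarrow> dot G \<alpha> = \<one>"
      using right_cancel[of x "dot G \<alpha>" \<one>] \<alpha> assms(2) by simp
    then show ?thesis
      using L.hom_wd[OF \<alpha>] Q.wdot_V_delta[OF \<alpha> assms(2)] by (auto simp: delta_def)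
  qed
  moreover have "lam (TU.lin_comb tt (c\<alpha> # cs)) = (c \<odot>\<^bsub>BP\<^esub> lam (TF.wd \<alpha>)) \<oplus>\<^bsub>BP\<^esub> lam (TU.lin_comb tt cs)"
    using \<alpha> s by (simp add: c\<alpha>)
  ultimately show ?case using Cons by (simp add: c\<alpha> B_simps(5,6))
qed

lemma lambda_zero: "\<zero>\<^bsub>T_red G P\<^esub> = (\<lambda>f x. 0)"
  by (simp add: T_red_def B_simps(4))

theorem units_move_imp_detects:
  assumes units: "units_move_ideals G P" shows "diagonal_detects_ideals G P"
  unfolding diagonal_detects_ideals_def
proof (intro allI impI subsetI)
  fix J a assume J: "closed_ideal J TT \<and> J \<inter> DD = {\<zero>\<^bsub>TT\<^esub>}" and a: "a \<in> J"
  interpret J: ideal J TT using J by (simp add: closed_ideal_def)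
  have ac: "a \<in> carrier TT" using a by (rule J.Icarr)
  have "lam a = (\<lambda>f x. 0)"
  proof (rule ccontr)
    assume nz: "lam a \<noteq> (\<lambda>f x. 0)"
    have lb: "lam a \<in> bounded_ops P" using ac by (rule lambda_bounded)
    obtain x where x: "x \<in> P" "lam a (delta x) \<noteq> (\<lambda>x. 0)"
      using bo_delta_eqI[OF lb bo_zero] nz by blast
    define b where "b = adj TT a \<otimes>\<^bsub>TT\<^esub> a"
    have bJ: "b \<in> J" unfolding b_def using a ac by (intro J.I_l_closed) auto
    have b: "b \<in> carrier TT" using bJ by (rule J.Icarr)
    define r where "r = (ell2_norm P (lam a (delta x)))\<^sup>2"
    have lx: "lam a (delta x) \<in> ell2 P" using lb x by simp
    have r: "r > 0" using ell2_norm_eq_zero[OF lx] x(2) by (auto simp: r_def)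
    have "lam b (delta x) = adj BP (lam a) (lam a (delta x))"
      using ac by (simp add: b_def B_simps(2))
    then have "lam b (delta x) x = ell2_inner P (adj BP (lam a) (lam a (delta x))) (delta x)"
      using x by (simp add: ell2_inner_delta_right)
    also have "\<dots> = ell2_inner P (lam a (delta x)) (lam a (delta x))"
      using lb lx x by (intro B_adj_inner') auto
    also have "\<dots> = complex_of_real r" using ell2_inner_self[OF lx] by (simp add: r_def)
    finally have entry: "lam b (delta x) x = complex_of_real r" .
    \<comment> \<open>An error below r/4 leaves the diagonal coefficient s with modulus above 3r/4.
      After division by s the compressed element is within 1/3 of the projection q, below the
      threshold 1 of \<open>proj_in_closed_ideal\<close>.\<close>
    obtain cs where cs: "snd ` set cs \<subseteq> words P" "cnorm TT (b \<ominus>\<^bsub>TT\<^esub> TU.lin_comb tt cs) < r / 4"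
      using TT_dense[OF b, of "r / 4"] r by auto
    define y where "y = TU.lin_comb tt cs"
    have y: "y \<in> carrier TT" unfolding y_def using cs by (intro TF.lin_comb_closed)
    define s where "s = TF.diag_coeff x cs"
    have "cmod (complex_of_real r - s) < r / 4"
    proof -
      have "lam (b \<ominus>\<^bsub>TT\<^esub> y) (delta x) x = complex_of_real r - s"
        using b y lambda_bounded lambda_lin_comb_entry[OF cs(1) x(1)] entry
        by (simp add: L.H.hom_diff B_minus y_def s_def)
      then have "cmod (complex_of_real r - s) \<le> cnorm BP (lam (b \<ominus>\<^bsub>TT\<^esub> y))"
        using op_entry_le[OF lambda_bounded x(1), of "b \<ominus>\<^bsub>TT\<^esub> y"] b y by simp
      also have "\<dots> \<le> cnorm TT (b \<ominus>\<^bsub>TT\<^esub> y)" using b y by (intro L.H.contractive) simp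
      finally show ?thesis using cs(2) by (simp add: y_def)
    qed
    then have s: "cmod s > 3 / 4 * r"
      using norm_triangle_ineq2[of "complex_of_real r" s] r by simp
    then have s0: "s \<noteq> 0" using r by auto
    \<comment> \<open>These literals freeze the neutral words of \<open>cs\<close> at their values
      at x. The nonneutral words \<open>as\<close> are left to be compressed to zero.\<close>
    define ls0 where "ls0 = map (\<lambda>(c, \<alpha>). (\<alpha>, x \<in> K \<alpha>)) (filter (\<lambda>(c, \<alpha>). dot G \<alpha> = \<one>) cs)"
    define as where "as = filter (\<lambda>\<alpha>. dot G \<alpha> \<noteq> \<one>) (map snd cs)"
    have "TF.valid ls0"
      using cs(1) by (auto simp: ls0_def TF.valid_def neutral_words_def simp del: NW_words NW_dot)
    moreover have "TF.sat x ls0" by (auto simp: ls0_def TF.sat_def)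
    moreover have "set as \<subseteq> words P" using cs(1) by (auto simp: as_def)
    moreover have "\<And>\<alpha>. \<alpha> \<in> set as \<Longrightarrow> dot G \<alpha> \<noteq> \<one>" by (simp add: as_def)
    ultimately obtain z ls where ls: "z \<in> P" "TF.valid ls" "TF.sat z ls" "set ls0 \<subseteq> set ls"
      "\<forall>\<alpha>\<in>set as. TF.lits ls \<otimes>\<^bsub>TT\<^esub> TF.wd \<alpha> \<otimes>\<^bsub>TT\<^esub> TF.lits ls = \<zero>\<^bsub>TT\<^esub>"
      using TF.compress_words[OF units x(1), of ls0 as] by blast
    define q where "q = TF.lits ls"
    have q: "q \<in> carrier TT" "q \<otimes>\<^bsub>TT\<^esub> q = q" "q \<in> DD"
      using ls(2) TF.lits_idem lits_in_D by (auto simp: q_def)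
    have "q \<noteq> \<zero>\<^bsub>TT\<^esub>"
    proof
      assume "q = \<zero>\<^bsub>TT\<^esub>"
      then have "delta z = (\<lambda>x. 0 :: complex)"
        using lambda_lits_delta[OF ls(2,1,3)] by (simp add: q_def[symmetric] B_simps(4))
      then show False by (metis delta_def zero_neq_one)
    qed
    then have nq: "cnorm TT q = 1" using TF.norm_lits[OF ls(2)] by (simp add: q_def)
    have qyq: "q \<otimes>\<^bsub>TT\<^esub> y \<otimes>\<^bsub>TT\<^esub> q = s \<odot>\<^bsub>TT\<^esub> q"
      unfolding q_def y_def s_def
    proof (rule TF.compress_lin_comb[OF ls(2) cs(1)])
      fix c \<alpha> assume m: "(c, \<alpha>) \<in> set cs"
      show "(\<alpha>, x \<in> K \<alpha>) \<in> set ls" if "dot G \<alpha> = \<one>"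
        using ls(4) m that by (auto simp: ls0_def)
      show "TF.lits ls \<otimes>\<^bsub>TT\<^esub> TF.wd \<alpha> \<otimes>\<^bsub>TT\<^esub> TF.lits ls = \<zero>\<^bsub>TT\<^esub>" if "dot G \<alpha> \<noteq> \<one>"
        using ls(5) m that by (force simp: as_def)
    qed
    define j where "j = (1 / s) \<odot>\<^bsub>TT\<^esub> (q \<otimes>\<^bsub>TT\<^esub> b \<otimes>\<^bsub>TT\<^esub> q)"
    have qbqJ: "q \<otimes>\<^bsub>TT\<^esub> b \<otimes>\<^bsub>TT\<^esub> q \<in> J" using bJ q by (intro J.I_r_closed J.I_l_closed) auto
    have "j = ((1 / s) \<odot>\<^bsub>TT\<^esub> \<one>\<^bsub>TT\<^esub>) \<otimes>\<^bsub>TT\<^esub> (q \<otimes>\<^bsub>TT\<^esub> b \<otimes>\<^bsub>TT\<^esub> q)"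
      using q b by (simp add: j_def TU.scale_mult_left)
    then have jJ: "j \<in> J" using qbqJ by (simp add: J.I_l_closed)
    have qj: "q \<otimes>\<^bsub>TT\<^esub> j = j" "j \<otimes>\<^bsub>TT\<^esub> q = j"
    proof -
      have "q \<otimes>\<^bsub>TT\<^esub> (q \<otimes>\<^bsub>TT\<^esub> b \<otimes>\<^bsub>TT\<^esub> q) = (q \<otimes>\<^bsub>TT\<^esub> q) \<otimes>\<^bsub>TT\<^esub> b \<otimes>\<^bsub>TT\<^esub> q"
        using q(1) b by (simp add: TU.m_assoc)
      then show "q \<otimes>\<^bsub>TT\<^esub> j = j" using q b by (simp add: j_def TU.scale_mult_right)
      have "(q \<otimes>\<^bsub>TT\<^esub> b \<otimes>\<^bsub>TT\<^esub> q) \<otimes>\<^bsub>TT\<^esub> q = q \<otimes>\<^bsub>TT\<^esub> b \<otimes>\<^bsub>TT\<^esub> (q \<otimes>\<^bsub>TT\<^esub> q)"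
        using q(1) b by (simp add: TU.m_assoc)
      then show "j \<otimes>\<^bsub>TT\<^esub> q = j" using q b by (simp add: j_def TU.scale_mult_left)
    qed
    have "cnorm TT (q \<ominus>\<^bsub>TT\<^esub> j) < 1"
    proof -
      have "q \<otimes>\<^bsub>TT\<^esub> (y \<ominus>\<^bsub>TT\<^esub> b) \<otimes>\<^bsub>TT\<^esub> q = s \<odot>\<^bsub>TT\<^esub> q \<ominus>\<^bsub>TT\<^esub> q \<otimes>\<^bsub>TT\<^esub> b \<otimes>\<^bsub>TT\<^esub> q"
        using q(1) b y qyq by (simp add: TU.minus_eq TU.r_distr TU.l_distr TU.r_minus TU.l_minus)
      then have "(1 / s) \<odot>\<^bsub>TT\<^esub> (q \<otimes>\<^bsub>TT\<^esub> (y \<ominus>\<^bsub>TT\<^esub> b) \<otimes>\<^bsub>TT\<^esub> q) = q \<ominus>\<^bsub>TT\<^esub> j"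
        using q(1) b s0 by (simp add: TU.scale_diff_right j_def flip: TU.scale_scale)
      then have "cnorm TT (q \<ominus>\<^bsub>TT\<^esub> j) = cmod (1 / s) * cnorm TT (q \<otimes>\<^bsub>TT\<^esub> (y \<ominus>\<^bsub>TT\<^esub> b) \<otimes>\<^bsub>TT\<^esub> q)"
        using TU.nu_scale[of "q \<otimes>\<^bsub>TT\<^esub> (y \<ominus>\<^bsub>TT\<^esub> b) \<otimes>\<^bsub>TT\<^esub> q" "1 / s"] q(1) b y by simp
      also have "cnorm TT (q \<otimes>\<^bsub>TT\<^esub> (y \<ominus>\<^bsub>TT\<^esub> b) \<otimes>\<^bsub>TT\<^esub> q) \<le> cnorm TT (y \<ominus>\<^bsub>TT\<^esub> b)"
        using TU.nu_mult[of "q \<otimes>\<^bsub>TT\<^esub> (y \<ominus>\<^bsub>TT\<^esub> b)" q] TU.nu_mult[of q "y \<ominus>\<^bsub>TT\<^esub> b"] q(1) b y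
        by (simp add: nq)
      also have "cnorm TT (y \<ominus>\<^bsub>TT\<^esub> b) < r / 4" using cs(2) TU.nu_diff_commute[OF b y] by (simp add: y_def)
      finally have "cnorm TT (q \<ominus>\<^bsub>TT\<^esub> j) < cmod (1 / s) * (r / 4)"
        using s0 by (simp add: mult_left_mono)
      also have "\<dots> \<le> 1" using s r s0 by (simp add: norm_divide field_simps)
      finally show ?thesis .
    qed
    then have "q \<in> J" using TU.proj_in_closed_ideal[OF _ q(1,2) jJ qj] J by blast
    then show False using q(3) J \<open>q \<noteq> \<zero>\<^bsub>TT\<^esub>\<close> by blast
  qed
  then show "a \<in> {a \<in> carrier TT. lam a = \<zero>\<^bsub>T_red G P\<^esub>}" using ac by (simp add: lambda_zero)
qed

theorem detects_imp_units_move: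
  assumes detects: "diagonal_detects_ideals G P" shows "units_move_ideals G P"
  unfolding units_move_ideals_def
proof (intro ballI allI impI, rule ccontr)
  fix u \<C> assume u: "u \<in> unit_group G P - {\<one>}" and \<C>: "finite \<C> \<and> \<C> \<subseteq> \<J> - {P}"
    and neg: "\<not> (\<exists>t\<in>P - \<Union>\<C>. (u \<otimes> t) <# P \<noteq> t <# P)"
  have uP: "u \<in> P" using u unit_groupD by auto
  interpret C: quotient_rep G P "\<lambda>t. t <# P" by (rule quotient_rep_coset)
  obtain h where h: "h \<in> star_hom TT C.HB" "\<And>p. p \<in> P \<Longrightarrow> h (tt p) = C.V p"
    using TT_universal[OF B_cstar_algebra C.V_toeplitz] by blast
  interpret R: toeplitz_rep G P C.HB C.V h
    by (simp add: toeplitz_rep_def toeplitz_rep_axioms_def submonoid_in_group_axioms B_cstar_algebra h)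
  have nd: "R.BF.nondegenerate" by (rule C.V_nondegenerate)
  have "\<forall>S\<in>\<C>. \<exists>\<alpha>. \<alpha> \<in> NW \<and> S = K \<alpha>" using \<C> constructible_NW by blast
  then obtain f where f: "\<And>S. S \<in> \<C> \<Longrightarrow> f S \<in> NW \<and> S = K (f S)" by metis
  obtain F where F: "set F = \<C>" using \<C> finite_list by blast
  define ls where "ls = map (\<lambda>S. (f S, False)) F"
  have valid: "TF.valid ls" using f F by (auto simp: ls_def TF.valid_def)
  have sat: "TF.sat t ls \<longleftrightarrow> t \<notin> \<Union>\<C>" for t
    using f F by (auto simp: ls_def TF.sat_def)
  have sat1: "TF.sat \<one> ls"
  proof -
    have "\<one> \<notin> R" if "R \<in> \<C>" for R
    proof
      assume "\<one> \<in> R"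
      have R: "R \<in> \<J>" "R \<noteq> P" using that \<C> by auto
      have "t \<in> R" if "t \<in> P" for t using J_right_ideal[OF R(1) \<open>\<one> \<in> R\<close> that] that by simp
      then show False using R J_subset by blast
    qed
    then show ?thesis using sat by blast
  qed
  define a where "a = (tt u \<ominus>\<^bsub>TT\<^esub> \<one>\<^bsub>TT\<^esub>) \<otimes>\<^bsub>TT\<^esub> TF.lits ls"
  have a: "a \<in> carrier TT" using uP valid by (simp add: a_def)
  have "h a = (\<lambda>f x. 0)"
  proof (rule bo_delta_eqI)
    show "h a \<in> bounded_ops ((\<lambda>t. t <# P) ` P)" using R.H.hom_closed[OF a] by (simp add: B_simps(1))
    show "(\<lambda>f x. 0) \<in> bounded_ops ((\<lambda>t. t <# P) ` P)" by (rule bo_zero)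
    fix X assume "X \<in> (\<lambda>t. t <# P) ` P"
    then obtain t where t: "t \<in> P" "X = t <# P" by blast
    define D where "D = C.V u \<ominus>\<^bsub>C.HB\<^esub> \<one>\<^bsub>C.HB\<^esub>"
    have one: "\<one>\<^bsub>C.HB\<^esub> \<in> bounded_ops ((\<lambda>t. t <# P) ` P)" using R.B.one_closed by (simp add: B_simps(1))
    have D: "D = (\<lambda>f x. C.V u f x - \<one>\<^bsub>C.HB\<^esub> f x)"
      unfolding D_def by (rule B_minus[OF C.V_bounded[OF uP] one])
    have Db: "D \<in> bounded_ops ((\<lambda>t. t <# P) ` P)"
      using R.B.minus_closed[of "C.V u" "\<one>\<^bsub>C.HB\<^esub>"] C.V_bounded[OF uP] one by (simp add: D_def B_simps(1))
    have "h a = D \<otimes>\<^bsub>C.HB\<^esub> R.BF.lits ls"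
      using uP valid R.hom_lits[OF valid] h(2) by (simp add: a_def D_def R.H.hom_diff)
    then have ha: "h a (delta X) = D (\<lambda>y. (if TF.sat t ls then 1 else 0) * delta X y)"
      using C.lits_V_delta_value[OF valid t(1)] t by (simp add: B_simps(2))
    show "h a (delta X) = (\<lambda>x. 0)"
    \<comment> \<open>For t in the cell, u fixes the principal ideal of t and hence its basis
      vector. For any other t the literals already give 0.\<close>
    proof (cases "TF.sat t ls")
      case True
      then have "(u \<otimes> t) <# P = t <# P" using neg t sat by blast
      then have "C.V u (delta X) = delta X" using C.V_delta[OF uP t(1)] t by simp
      then show ?thesis using True t unfolding ha by (simp add: D B_simps(3))
    next
      case False
      then show ?thesis unfolding ha using bo_zero_vec[OF Db] by simp
    qed
  qed
  then have "a \<in> R.ker_h" using a by (simp add: R.ker_h_def B_simps(4))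
  moreover have "R.ker_h \<subseteq> {a \<in> carrier TT. lam a = \<zero>\<^bsub>T_red G P\<^esub>}"
    using detects R.ker_closed_ideal R.ker_Int_D[OF nd] unfolding diagonal_detects_ideals_def by blast
  ultimately have "lam a = (\<lambda>f x. 0)" by (auto simp: lambda_zero)
  then have "lam a (delta \<one>) \<one> = 0" by simp
  \<comment> \<open>In the regular representation points are not merged: the literals fix the basis
    vector at the identity, and \<open>L_u - 1\<close> sends it to the difference of the vectors at
    u and at the identity, which are distinct since u is nontrivial.\<close>
  moreover have "lam a (delta \<one>) \<one> = - 1"
  proof -
    have one: "\<one>\<^bsub>BP\<^esub> \<in> bounded_ops P" using L.B.one_closed by (simp add: B_simps(1))
    have "lam a = (Q.V u \<ominus>\<^bsub>BP\<^esub> \<one>\<^bsub>BP\<^esub>) \<otimes>\<^bsub>BP\<^esub> lam (TF.lits ls)"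
      using uP valid L.gen by (simp add: a_def L.H.hom_diff)
    then have "lam a (delta \<one>) = (Q.V u \<ominus>\<^bsub>BP\<^esub> \<one>\<^bsub>BP\<^esub>) (delta \<one>)"
      using lambda_lits_delta[OF valid P_one sat1] by (simp add: B_simps(2))
    also have "\<dots> = (\<lambda>x. delta u x - delta \<one> x)"
      unfolding B_minus[OF Q.V_bounded[OF uP] one]
      using Q.V_delta[OF uP P_one] uP by (simp add: B_simps(3))
    finally show ?thesis using u by (auto simp: delta_def)
  qed
  ultimately show False by simp
qed

text \<open>If \<open>lam\<close> kills a, it kills a*a, so the reduced expectation of a*a is 0.
  \<open>lam\<close> is injective on D_u, so \<open>inv_into\<close> returns 0 there, and
  faithfulness of E_u gives a = 0.\<close>

lemma lambda_injective:
  assumes faithful: "E_univ_faithful G P" and a: "a \<in> carrier TT" "lam a = \<zero>\<^bsub>BP\<^esub>"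
  shows "a = \<zero>\<^bsub>TT\<^esub>"
proof -
  define b where "b = adj TT a \<otimes>\<^bsub>TT\<^esub> a"
  have "lam b = \<zero>\<^bsub>BP\<^esub>" using a by (simp add: b_def)
  then have "E_red P (lam b) = (\<lambda>f x. 0)"
    by (simp add: E_red_def B_simps(4) ell2_inner_def fun_eq_iff)
  also have "\<dots> = lam \<zero>\<^bsub>TT\<^esub>" by (simp add: B_simps(4))
  finally have "E_univ G P b = inv_into DD lam (lam \<zero>\<^bsub>TT\<^esub>)" by (simp add: E_univ_def)
  also have "\<dots> = \<zero>\<^bsub>TT\<^esub>"
    by (rule inv_into_f_f[OF L.inj_on_D[OF lambda_nondegenerate] zero_in_D])
  finally show ?thesis using faithful a unfolding E_univ_faithful_def b_def by blast
qed

theorem reduced_representation: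
  fixes B :: "('b, 'n) cstar_scheme"
  assumes detects: "diagonal_detects_ideals G P" and faithful: "E_univ_faithful G P"
    and B: "cstar_algebra B" and W: "toeplitz_family G P B W"
  shows "\<exists>\<pi>\<in>star_hom (T_red G P) (cstar_generated B (W ` P)).
     (\<forall>p\<in>P. \<pi> (L_op G P p) = W p) \<and>
     (bij_betw \<pi> (carrier (T_red G P)) (carrier (cstar_generated B (W ` P))) \<longleftrightarrow> jointly_proper G P B W)"
proof -
  interpret BC: cstar_algebra B by (rule B)
  obtain \<sigma> where \<sigma>: "\<sigma> \<in> star_hom TT B" "\<And>p. p \<in> P \<Longrightarrow> \<sigma> (tt p) = W p"
    using TT_universal[OF B W] by blast
  interpret R: toeplitz_rep G P B W \<sigma>
    by (simp add: toeplitz_rep_def toeplitz_rep_axioms_def submonoid_in_group_axioms B \<sigma>)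
  have linj: "a = \<zero>\<^bsub>TT\<^esub>" if "a \<in> carrier TT" "lam a = \<zero>\<^bsub>BP\<^esub>" for a
    using lambda_injective[OF faithful that] .
  have limg: "lam ` carrier TT = carrier (T_red G P)" and lio: "inj_on lam (carrier TT)"
    using L.injective_image[OF linj] unfolding T_red_eq by blast+
  have lbij: "bij_betw lam (carrier TT) (carrier (T_red G P))"
    using limg lio by (simp add: bij_betw_def)
  define \<pi> where "\<pi> = \<sigma> \<circ> inv_into (carrier TT) lam"
  have \<pi>: "\<pi> (lam a) = \<sigma> a" if "a \<in> carrier TT" for a
    using inv_into_f_f[OF lio that] by (simp add: \<pi>_def)
  have elem: "\<exists>a\<in>carrier TT. y = lam a" if "y \<in> carrier (T_red G P)" for y
    using that limg by blast
  have hom: "\<pi> \<in> star_hom (T_red G P) (cstar_generated B (W ` P))"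
  proof -
    have one: "\<pi> \<one>\<^bsub>T_red G P\<^esub> = \<one>\<^bsub>B\<^esub>"
      using \<pi>[of "\<one>\<^bsub>TT\<^esub>"] L.H.hom_one by (simp add: T_red_def)
    have closed: "\<pi> y \<in> carrier (cstar_generated B (W ` P))" if y: "y \<in> carrier (T_red G P)" for y
      using elem[OF y] R.into_generated \<pi> by auto
    have scale: "\<pi> (c \<odot>\<^bsub>T_red G P\<^esub> y) = c \<odot>\<^bsub>B\<^esub> \<pi> y" if y: "y \<in> carrier (T_red G P)" for c y
    proof -
      obtain a where a: "a \<in> carrier TT" "y = lam a" using elem[OF y] by blast
      show ?thesis using \<pi>[of "c \<odot>\<^bsub>TT\<^esub> a"] \<pi>[OF a(1)] a L.H.hom_scale[OF a(1), of c] by (simp add: T_red_def)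
    qed
    have adj: "\<pi> (adj (T_red G P) y) = adj B (\<pi> y)" if y: "y \<in> carrier (T_red G P)" for y
    proof -
      obtain a where a: "a \<in> carrier TT" "y = lam a" using elem[OF y] by blast
      show ?thesis using \<pi>[of "adj TT a"] \<pi>[OF a(1)] a L.H.hom_adj[OF a(1)] by (simp add: T_red_def)
    qed
    have ring: "\<pi> (y \<otimes>\<^bsub>T_red G P\<^esub> y') = \<pi> y \<otimes>\<^bsub>B\<^esub> \<pi> y' \<and> \<pi> (y \<oplus>\<^bsub>T_red G P\<^esub> y') = \<pi> y \<oplus>\<^bsub>B\<^esub> \<pi> y'"
      if y: "y \<in> carrier (T_red G P)" "y' \<in> carrier (T_red G P)" for y y'
    proof -
      obtain a b where a: "a \<in> carrier TT" "y = lam a" and b: "b \<in> carrier TT" "y' = lam b"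
        using elem[OF y(1)] elem[OF y(2)] by blast
      show ?thesis
        using \<pi>[of "a \<otimes>\<^bsub>TT\<^esub> b"] \<pi>[of "a \<oplus>\<^bsub>TT\<^esub> b"] \<pi>[OF a(1)] \<pi>[OF b(1)] a b
          L.H.hom_mult[OF a(1) b(1)] L.H.hom_add[OF a(1) b(1)] by (simp add: T_red_def)
    qed
    show ?thesis
      unfolding star_hom_def ring_hom_def using one closed scale adj ring by simp
  qed
  have gen: "\<pi> (L_op G P p) = W p" if "p \<in> P" for p
    using \<pi>[of "tt p"] that lambda_plus_props(2) \<sigma>(2) by simp
  have "bij_betw \<pi> (carrier (T_red G P)) (carrier (cstar_generated B (W ` P))) \<longleftrightarrow> jointly_proper G P B W"
  proof
    assume "jointly_proper G P B W"
    then have nd: "R.BF.nondegenerate" by (rule R.BF.jointly_proper_nondegenerate)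
    have "R.ker_h \<subseteq> {a \<in> carrier TT. lam a = \<zero>\<^bsub>T_red G P\<^esub>}"
      using detects R.ker_closed_ideal R.ker_Int_D[OF nd] unfolding diagonal_detects_ideals_def by blast
    then have "a = \<zero>\<^bsub>TT\<^esub>" if "a \<in> carrier TT" "\<sigma> a = \<zero>\<^bsub>B\<^esub>" for a
      using that linj by (auto simp: R.ker_h_def T_red_def)
    then have "bij_betw \<sigma> (carrier TT) (carrier (cstar_generated B (W ` P)))"
      using R.injective_image by (simp add: bij_betw_def)
    then show "bij_betw \<pi> (carrier (T_red G P)) (carrier (cstar_generated B (W ` P)))"
      unfolding \<pi>_def by (rule bij_betw_trans[OF bij_betw_inv_into[OF lbij]])
  next
    assume bij: "bij_betw \<pi> (carrier (T_red G P)) (carrier (cstar_generated B (W ` P)))"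
    show "jointly_proper G P B W"
      unfolding jointly_proper_def
    proof (intro allI impI)
      fix F assume F: "distinct F \<and> set F \<subseteq> NW \<and> (\<forall>\<alpha>\<in>set F. K \<alpha> \<noteq> P)"
      define ls where "ls = map (\<lambda>\<alpha>. (\<alpha>, False)) F"
      have valid: "TF.valid ls" using F by (auto simp: ls_def TF.valid_def)
      have "\<one> \<notin> K \<alpha>" if "\<alpha> \<in> set F" for \<alpha>
      proof
        assume "\<one> \<in> K \<alpha>"
        have \<alpha>: "\<alpha> \<in> words P" "K \<alpha> \<noteq> P" using that F by auto
        have "t \<in> K \<alpha>" if "t \<in> P" for t
          using constr_right_ideal[OF \<alpha>(1) \<open>\<one> \<in> K \<alpha>\<close> that] that by simp
        then show False using \<alpha> constr_subset by blast
      qed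
      \<comment> \<open>The product of the complements survives in the regular representation,
        because the identity lies in none of the proper ideals. Injectivity of \<pi> then carries
        this nonvanishing over to the family W.\<close>
      then have "TF.sat \<one> ls" by (auto simp: ls_def TF.sat_def)
      then have "lam (TF.lits ls) (delta \<one>) = delta \<one>" using lambda_lits_delta[OF valid P_one] by blast
      then have "lam (TF.lits ls) (delta \<one>) \<one> \<noteq> lam \<zero>\<^bsub>TT\<^esub> (delta \<one>) \<one>"
        by (simp add: B_simps(4)) (simp add: delta_def)
      then have lnz: "lam (TF.lits ls) \<noteq> lam \<zero>\<^bsub>TT\<^esub>" by metis
      have q: "TF.lits ls \<in> carrier TT" using valid by simp
      have "\<pi> (lam (TF.lits ls)) \<noteq> \<pi> (lam \<zero>\<^bsub>TT\<^esub>)"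
        using bij lnz q limg unfolding bij_betw_def inj_on_def by blast
      then have "R.BF.lits ls \<noteq> \<zero>\<^bsub>B\<^esub>"
        using \<pi>[OF q] \<pi>[OF TU.zero_closed] R.hom_lits[OF valid] by simp
      moreover have "R.BF.lits ls = mult_list B (map (\<lambda>\<alpha>. \<one>\<^bsub>B\<^esub> \<ominus>\<^bsub>B\<^esub> wdot B W \<alpha>) F)"
        by (simp add: R.BF.lits_def ls_def R.BF.lit_def comp_def)
      ultimately show "mult_list B (map (\<lambda>\<alpha>. \<one>\<^bsub>B\<^esub> \<ominus>\<^bsub>B\<^esub> wdot B W \<alpha>) F) \<noteq> \<zero>\<^bsub>B\<^esub>" by simp
    qed
  qed
  then show ?thesis using hom gen by blast
qed

end

theorem theorem5p11:
  fixes G :: "('g, 'm) monoid_scheme" and P :: "'g set"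
    and B :: "('b, 'n) cstar_scheme" and W :: "'g \<Rightarrow> 'b"
  assumes "group G" and "submonoid P G"
  shows "((partial_action_top_free G P \<longleftrightarrow> unit_action_top_free G P) \<and>
          (unit_action_top_free G P \<longleftrightarrow> units_move_ideals G P) \<and>
          (units_move_ideals G P \<longleftrightarrow> diagonal_detects_ideals G P)) \<and>
         ((partial_action_top_free G P \<or> unit_action_top_free G P \<or>
            units_move_ideals G P \<or> diagonal_detects_ideals G P) \<and>
          E_univ_faithful G P \<and> cstar_algebra B \<and> toeplitz_family G P B W \<longrightarrow>
          (\<exists>\<pi> \<in> star_hom (T_red G P) (cstar_generated B (W ` P)).
             (\<forall>p\<in>P. \<pi> (L_op G P p) = W p) \<and>
             (bij_betw \<pi> (carrier (T_red G P)) (carrier (cstar_generated B (W ` P))) \<longleftrightarrow>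
                jointly_proper G P B W)))"
proof -
  interpret submonoid_in_group G P
    using assms by (simp add: submonoid_in_group_def submonoid_in_group_axioms_def)
  \<comment> \<open>The implications form the cycle (i), (ii), (iii), (i), together with both
    directions between (iii) and (iv).\<close>
  have 1: "partial_action_top_free G P \<longleftrightarrow> unit_action_top_free G P"
    and 2: "unit_action_top_free G P \<longleftrightarrow> units_move_ideals G P"
    and 3: "units_move_ideals G P \<longleftrightarrow> diagonal_detects_ideals G P"
    using units_move_imp_top_free unit_top_free_imp_units_move top_free_imp_unit_top_free
      units_move_imp_detects detects_imp_units_move by blast+
  then show ?thesis using reduced_representation[of B W] by blast
qed

end
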